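(* Let $p$ be a prime, let $F$ be a field with $\operatorname{char}(F)=p>0$, and let $G$ be a group such that $G'$ is a locally finite $p$-group and the Sylow $p$-subgroup $P=\mathrm{Syl}_p(G)$ of $G$ is normal in $G$. Let $V=V(FG)$ be the group of normalized units of the group algebra $FG$. If $V(FG)$ is an Engel group, then the following conditions hold: (i) $V'\leq 1+\mathfrak{I}(G')$ and $1+\mathfrak{I}(P)=\mathrm{Syl}_p(V(FG))$; (ii) for each prime $q\neq p$, the group $\mathrm{Syl}_q(G)$ is central in $G$; (iii) the torsion part $\mathfrak{t}(G)$ is the group $\mathfrak{t}(G)=P\times D$, where $D=\times_{q\neq p}\mathrm{Syl}_q(G)$ (the product over all primes $q\ne p$); (iv) let $M$ be the subgroup of $G/P$ generated by the central subgroup $DP/P$ and by all the elements of infinite order in $G/P$; then $V(FG)/(1+\mathfrak{I}(P))\cong V(FM)$, and $V(FM)/V(FD)$ is a torsion-free group (where $D$ is identified with the subgroup $DP/P\cong D$ of $M$); (v) $G/\mathfrak{t}(G)$ is an abelian torsion-free group and, if $D$ is finite, then $$V(FM)\cong V(FD)\times\big(\underbrace{G/\mathfrak{t}(G)\times\cdots\times G/\mathfrak{t}(G)}_{n}\big),$$ where $n$ is the number of summands in the decomposition of $FD$ into a direct sum of fields.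
   Context: For a group $H$ and a field $F$, $V(FH)$ denotes the group of normalized units of the group algebra $FH$, i.e. the units $\sum_h\alpha_h h$ with augmentation $\sum_h\alpha_h=1$. A prime on a group denotes its commutator subgroup. $\mathfrak{t}(G)$ is the torsion part of $G$, i.e. the set of elements of finite order of $G$ (a priori not necessarily a subgroup). $\mathrm{Syl}_q(X)$ denotes a Sylow $q$-subgroup (maximal $q$-subgroup) of a group $X$. For a normal subgroup $H$ of $G$, $\mathfrak{I}(H)$ is the ideal of $FG$ generated by all elements $h-1$ with $h\in H$. Commutators are $(x_1,x_2)=x_1^{-1}x_2^{-1}x_1x_2$ and $(x_1,\ldots,x_n)=((x_1,\ldots,x_{n-1}),x_n)$. A group $X$ is an Engel group if for any $x,y\in X$ one has $(x,y,y,\ldots,y)=1$, where $y$ is repeated sufficiently many times depending on $x$ and $y$. *)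

theory Defs
  imports "HOL-Algebra.Algebra"
begin

section \<open>Groups\<close>

definition left_comm :: "('g, 'b) monoid_scheme \<Rightarrow> 'g \<Rightarrow> 'g \<Rightarrow> 'g" where
  "left_comm G x y = inv\<^bsub>G\<^esub> x \<otimes>\<^bsub>G\<^esub> inv\<^bsub>G\<^esub> y \<otimes>\<^bsub>G\<^esub> x \<otimes>\<^bsub>G\<^esub> y"

text \<open>The iterate below is the left-normed commutator \<open>(x, y, \<dots>, y)\<close> with \<open>n\<close> copies of \<open>y\<close>.\<close>

definition engel_group :: "('g, 'b) monoid_scheme \<Rightarrow> bool" where
  "engel_group G \<longleftrightarrow> group G \<and>
     (\<forall>x\<in>carrier G. \<forall>y\<in>carrier G. \<exists>n>0. ((\<lambda>z. left_comm G z y) ^^ n) x = \<one>\<^bsub>G\<^esub>)"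

definition locally_finite_group :: "('g, 'b) monoid_scheme \<Rightarrow> bool" where
  "locally_finite_group G \<longleftrightarrow> group G \<and>
     (\<forall>A. finite A \<and> A \<subseteq> carrier G \<longrightarrow> finite (generate G A))"

text \<open>Recall that \<open>group.ord G x = 0\<close> iff \<open>x\<close> has infinite order.\<close>

definition primary_group :: "nat \<Rightarrow> ('g, 'b) monoid_scheme \<Rightarrow> bool" where
  "primary_group q G \<longleftrightarrow> group G \<and> (\<forall>x\<in>carrier G. \<exists>n. group.ord G x = q ^ n)"

definition sylow_subgroup :: "nat \<Rightarrow> ('g, 'b) monoid_scheme \<Rightarrow> 'g set \<Rightarrow> bool" where
  "sylow_subgroup q G S \<longleftrightarrow>
     subgroup S G \<and> primary_group q (G\<lparr>carrier := S\<rparr>) \<and>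
     (\<forall>T. subgroup T G \<and> primary_group q (G\<lparr>carrier := T\<rparr>) \<and> S \<subseteq> T \<longrightarrow> T = S)"

definition torsion_part :: "('g, 'b) monoid_scheme \<Rightarrow> 'g set" where
  "torsion_part G = {x \<in> carrier G. group.ord G x \<noteq> 0}"

definition torsion_free_group :: "('g, 'b) monoid_scheme \<Rightarrow> bool" where
  "torsion_free_group G \<longleftrightarrow> group G \<and> torsion_part G = {\<one>\<^bsub>G\<^esub>}"

definition central_subgroup :: "'g set \<Rightarrow> ('g, 'b) monoid_scheme \<Rightarrow> bool" where
  "central_subgroup H G \<longleftrightarrow> subgroup H G \<and>
     (\<forall>h\<in>H. \<forall>g\<in>carrier G. h \<otimes>\<^bsub>G\<^esub> g = g \<otimes>\<^bsub>G\<^esub> h)"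

text \<open>Internal restricted direct product of a (possibly infinite) family of subgroups.\<close>

definition internal_direct_product ::
    "('g, 'b) monoid_scheme \<Rightarrow> 'i set \<Rightarrow> ('i \<Rightarrow> 'g set) \<Rightarrow> bool" where
  "internal_direct_product G I S \<longleftrightarrow>
     (\<forall>i\<in>I. S i \<lhd> G) \<and>
     carrier G = generate G (\<Union>i\<in>I. S i) \<and>
     (\<forall>i\<in>I. S i \<inter> generate G (\<Union>j\<in>I - {i}. S j) = {\<one>\<^bsub>G\<^esub>})"

section \<open>Rings\<close>

definition ring_char :: "('f, 'a) ring_scheme \<Rightarrow> nat" where
  "ring_char R = group.ord (add_monoid R) \<one>\<^bsub>R\<^esub>"

text \<open>The summands may be taken over the element type of \<open>R\<close>: in any such
  decomposition they are isomorphic to ideals of \<open>R\<close>.\<close>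

definition direct_sum_of_fields :: "('r, 'a) ring_scheme \<Rightarrow> nat \<Rightarrow> bool" where
  "direct_sum_of_fields R n \<longleftrightarrow>
     (\<exists>Ks :: 'r ring list. length Ks = n \<and> (\<forall>K\<in>set Ks. field K) \<and> R \<simeq> RDirProd_list Ks)"

section \<open>Group algebras\<close>

text \<open>An element is its coefficient function, which vanishes off \<open>carrier G\<close>. Hence for a
  subgroup \<open>H\<close> of \<open>G\<close> the group algebra of \<open>H\<close> is literally a subring of that of \<open>G\<close>.\<close>

definition ga_supp :: "('f, 'a) ring_scheme \<Rightarrow> ('g \<Rightarrow> 'f) \<Rightarrow> 'g set" where
  "ga_supp F a = {x. a x \<noteq> \<zero>\<^bsub>F\<^esub>}"

definition ga_basis :: "('f, 'a) ring_scheme \<Rightarrow> 'g \<Rightarrow> 'g \<Rightarrow> 'f" where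
  "ga_basis F g = (\<lambda>x. if x = g then \<one>\<^bsub>F\<^esub> else \<zero>\<^bsub>F\<^esub>)"

definition group_algebra ::
    "('f, 'a) ring_scheme \<Rightarrow> ('g, 'b) monoid_scheme \<Rightarrow> ('g \<Rightarrow> 'f) ring" where
  "group_algebra F G =
     \<lparr>carrier = {a. range a \<subseteq> carrier F \<and> finite (ga_supp F a) \<and> ga_supp F a \<subseteq> carrier G},
      monoid.mult = (\<lambda>a b x.
        finsum F (\<lambda>(y, z). a y \<otimes>\<^bsub>F\<^esub> b z)
          {(y, z) \<in> ga_supp F a \<times> ga_supp F b. y \<otimes>\<^bsub>G\<^esub> z = x}),
      one = ga_basis F \<one>\<^bsub>G\<^esub>,
      ring.zero = (\<lambda>x. \<zero>\<^bsub>F\<^esub>),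
      ring.add = (\<lambda>a b x. a x \<oplus>\<^bsub>F\<^esub> b x)\<rparr>"

definition augmentation :: "('f, 'a) ring_scheme \<Rightarrow> ('g \<Rightarrow> 'f) \<Rightarrow> 'f" where
  "augmentation F a = (\<Oplus>\<^bsub>F\<^esub>x\<in>ga_supp F a. a x)"

definition normalized_units ::
    "('f, 'a) ring_scheme \<Rightarrow> ('g, 'b) monoid_scheme \<Rightarrow> ('g \<Rightarrow> 'f) monoid" where
  "normalized_units F G =
     (units_of (group_algebra F G))
       \<lparr>carrier := {u \<in> Units (group_algebra F G). augmentation F u = \<one>\<^bsub>F\<^esub>}\<rparr>"

definition aug_ideal ::
    "('f, 'a) ring_scheme \<Rightarrow> ('g, 'b) monoid_scheme \<Rightarrow> 'g set \<Rightarrow> ('g \<Rightarrow> 'f) set" where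
  "aug_ideal F G H =
     Idl\<^bsub>group_algebra F G\<^esub>
       ((\<lambda>h. ga_basis F h \<ominus>\<^bsub>group_algebra F G\<^esub> \<one>\<^bsub>group_algebra F G\<^esub>) ` H)"

definition one_plus :: "('r, 'a) ring_scheme \<Rightarrow> 'r set \<Rightarrow> 'r set" where
  "one_plus R I = (\<lambda>x. \<one>\<^bsub>R\<^esub> \<oplus>\<^bsub>R\<^esub> x) ` I"

section \<open>Existence of Sylow subgroups\<close>

lemma (in group) sylow_subgroup_exists: "\<exists>S. sylow_subgroup q G S"
proof -
  let ?A = "{S. subgroup S G \<and> primary_group q (G\<lparr>carrier := S\<rparr>)}"
  have ordS: "group.ord (G\<lparr>carrier := S\<rparr>) x = ord x" if S: "subgroup S G" and x: "x \<in> S" for S x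
  proof -
    interpret H: group "G\<lparr>carrier := S\<rparr>" using S subgroup_imp_group by blast
    have pw: "x [^]\<^bsub>G\<lparr>carrier := S\<rparr>\<^esub> (n::nat) = x [^] n" for n
      by (simp add: nat_pow_def)
    have "H.ord x dvd n \<longleftrightarrow> ord x dvd n" for n
      using H.pow_eq_id[of x n] pow_eq_id[of x n] pw x subgroup.mem_carrier[OF S x] by auto
    from this[of "H.ord x"] this[of "ord x"] show ?thesis
      by (intro dvd_antisym) simp_all
  qed
  have A: "S \<in> ?A \<longleftrightarrow> subgroup S G \<and> (\<forall>x\<in>S. \<exists>n. ord x = q ^ n)" for S
  proof (cases "subgroup S G")
    case True
    then show ?thesis
      using ordS[OF True] subgroup_imp_group[OF True] by (simp add: primary_group_def)
  qed simp
  have one: "{\<one>} \<in> ?A" unfolding A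
    using triv_subgroup ord_eq_1[OF one_closed] by (auto intro!: exI[of _ "0::nat"])
  have "\<exists>M\<in>?A. \<forall>T\<in>?A. M \<subseteq> T \<longrightarrow> T = M"
  proof (rule subset_Zorn_nonempty)
    show "?A \<noteq> {}" using one by blast
  next
    fix C assume C: "C \<noteq> {}" "subset.chain ?A C"
    then have sub: "S \<in> ?A" if "S \<in> C" for S using that by (auto simp: subset.chain_def)
    have "subgroup (\<Union>C) G"
    proof (rule subgroupI)
      show "\<Union>C \<subseteq> carrier G" using sub subgroup.subset by blast
      show "\<Union>C \<noteq> {}" using C(1) sub subgroup.one_closed by fastforce
    next
      fix a assume "a \<in> \<Union>C"
      then obtain S where "S \<in> C" "a \<in> S" by blast
      then show "inv a \<in> \<Union>C" using sub subgroup.m_inv_closed[of S G a] by auto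
    next
      fix a b assume "a \<in> \<Union>C" "b \<in> \<Union>C"
      then obtain S T where ST: "S \<in> C" "T \<in> C" "a \<in> S" "b \<in> T" by blast
      then have "S \<subseteq> T \<or> T \<subseteq> S" using C(2) by (auto simp: subset.chain_def)
      then show "a \<otimes> b \<in> \<Union>C"
      proof
        assume "S \<subseteq> T"
        then have "a \<otimes> b \<in> T" using ST sub[OF ST(2)] by (auto intro: subgroup.m_closed)
        then show ?thesis using ST by blast
      next
        assume "T \<subseteq> S"
        then have "a \<otimes> b \<in> S" using ST sub[OF ST(1)] by (auto intro: subgroup.m_closed)
        then show ?thesis using ST by blast
      qed
    qed
    moreover have "\<forall>x\<in>\<Union>C. \<exists>n. ord x = q ^ n" using sub A by blast
    ultimately show "\<Union>C \<in> ?A" unfolding A by blast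
  qed
  then show ?thesis unfolding sylow_subgroup_def by blast
qed

end

theory Submission
  imports Defs
begin

text \<open>
  Since \<open>G\<close> embeds into \<open>V(FG)\<close>, it is an Engel group itself. The proof compares \<open>FG\<close> with the
  group algebra of the abelian group \<open>A = G/P\<close>, and \<open>FA\<close> with that of its torsion subgroup.

  Structure of \<open>G\<close>. If \<open>y = (z, h)\<close> commutes with \<open>h\<close> and \<open>h\<^sup>m = 1\<close>, then \<open>y h\<^sup>-\<^sup>1\<close> is a conjugate
  of \<open>h\<^sup>-\<^sup>1\<close> and hence \<open>y\<^sup>m = 1\<close>. If \<open>m\<close> is prime to \<open>p\<close>, then \<open>y = 1\<close>, because \<open>y\<close> lies in the
  \<open>p\<close>-group \<open>G'\<close>. Walking down an Engel commutator \<open>(g, h, \<dots>, h) = 1\<close> in this way gives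
  \<open>(g, h) = 1\<close>, so all elements of order prime to \<open>p\<close> are central (\<open>engel_coprime_central\<close>). This
  makes the Sylow \<open>q\<close>-subgroups central and yields \<open>t(G) = P \<times> D\<close>.

  The ideal of \<open>P\<close> is nil. An element \<open>a\<close> of it involves finitely many elements of \<open>G\<close>. By the
  Engel condition and local finiteness of \<open>G'\<close>, any finitely many elements of \<open>P\<close> lie in a finite
  \<open>p\<close>-subgroup \<open>N\<close> that is normalised by the support of \<open>a\<close>
  (\<open>engel_finite_invariant_subgroup\<close>). A finite \<open>p\<close>-group acts unipotently in characteristic \<open>p\<close>
  (\<open>Z_exhausts\<close>), and therefore \<open>a\<close> is nilpotent (\<open>aug_ideal_nil\<close>). Consequently units lift along
  \<open>FG \<rightarrow> FA\<close>, and \<open>1 + I(P)\<close> is the kernel of \<open>V(FG) \<rightarrow> V(FA)\<close> and a \<open>p\<close>-group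
  (\<open>nil_quotient_units\<close>). The algebra \<open>FA\<close> has no nilpotent elements, since \<open>A\<close> has no \<open>p\<close>-torsion
  (\<open>reduced\<close>), so \<open>V(FA)\<close> has no \<open>p\<close>-elements and \<open>1 + I(P)\<close> consists of all \<open>p\<close>-elements of \<open>V(FG)\<close>.

  Units of \<open>FA\<close>. The torsion subgroup of \<open>A\<close> is the image of \<open>D\<close>, and as \<open>M\<close> contains both it and
  all elements of infinite order, \<open>M = A\<close>. The algebra \<open>FA\<close> is graded by the torsion-free abelian
  group \<open>L = G/t(G)\<close> with \<open>FD\<close> in degree \<open>1\<close>. A total order of \<open>L\<close> provides top components, and
  the product of the top components of two elements is, unless it vanishes, the top component of
  their product. As \<open>FA\<close> is reduced, a root of an element of \<open>FD\<close> therefore lies in \<open>FD\<close>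
  (\<open>root_in_kernel\<close>), which makes \<open>V(FA)/V(FD)\<close> torsion-free. If \<open>D\<close>
  is finite, then \<open>FD\<close> is a direct sum of \<open>n\<close> fields. The component of a unit at each of these
  summands is homogeneous (\<open>unit_component_homogeneous\<close>). The \<open>n\<close> degrees give a homomorphism from
  \<open>V(FA)\<close> to \<open>L\<^sup>n\<close> with kernel \<open>V(FD)\<close>; it splits because a finite torsion subgroup of an abelian
  group is a direct factor (\<open>finite_torsion_splits\<close>).
\<close>

section \<open>Group algebras\<close>

definition ga_mon :: "('f, 'a) ring_scheme \<Rightarrow> 'f \<Rightarrow> 'g \<Rightarrow> 'g \<Rightarrow> 'f" where
  "ga_mon F c g = (\<lambda>x. if x = g then c else \<zero>\<^bsub>F\<^esub>)"

lemma ga_basis_mon: "ga_basis F g = ga_mon F \<one>\<^bsub>F\<^esub> g"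
  by (simp add: ga_basis_def ga_mon_def)

text \<open>The linear extension of a map \<open>\<phi>\<close> of bases. It is used for
  homomorphisms and also for mere maps, such as a choice of coset representatives.\<close>

definition ga_map :: "('f, 'a) ring_scheme \<Rightarrow> ('g \<Rightarrow> 'h) \<Rightarrow> ('g \<Rightarrow> 'f) \<Rightarrow> 'h \<Rightarrow> 'f" where
  "ga_map F \<phi> a = (\<lambda>y. finsum F a {x \<in> ga_supp F a. \<phi> x = y})"

locale ga = F: cring F + G: group G
  for F :: "('f, 'a) ring_scheme" and G :: "('g, 'b) monoid_scheme"
begin

abbreviation R where "R \<equiv> group_algebra F G"
abbreviation mon where "mon \<equiv> ga_mon F"
abbreviation supp where "supp \<equiv> ga_supp F"

lemma mem_carrier:
  "a \<in> carrier R \<longleftrightarrow> (\<forall>x. a x \<in> carrier F) \<and> finite (supp a) \<and> supp a \<subseteq> carrier G"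
  by (auto simp: group_algebra_def)

lemma zero_eq: "\<zero>\<^bsub>R\<^esub> = (\<lambda>x. \<zero>\<^bsub>F\<^esub>)"
  by (simp add: group_algebra_def)

lemma add_eq: "a \<oplus>\<^bsub>R\<^esub> b = (\<lambda>x. a x \<oplus>\<^bsub>F\<^esub> b x)"
  by (simp add: group_algebra_def)

lemma one_eq: "\<one>\<^bsub>R\<^esub> = mon \<one>\<^bsub>F\<^esub> \<one>\<^bsub>G\<^esub>"
  by (simp add: group_algebra_def ga_basis_mon)

lemma mult_eq: "(a \<otimes>\<^bsub>R\<^esub> b) x =
    finsum F (\<lambda>(y, z). a y \<otimes>\<^bsub>F\<^esub> b z) {(y, z) \<in> supp a \<times> supp b. y \<otimes>\<^bsub>G\<^esub> z = x}"
  by (simp add: group_algebra_def)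

lemma coeff: "a \<in> carrier R \<Longrightarrow> a x \<in> carrier F"
  using mem_carrier by blast

lemma fin_supp [simp, intro]: "a \<in> carrier R \<Longrightarrow> finite (supp a)"
  using mem_carrier by blast

lemma supp_carrier: "a \<in> carrier R \<Longrightarrow> supp a \<subseteq> carrier G"
  using mem_carrier by blast

lemma carrierI:
  "(\<And>x. a x \<in> carrier F) \<Longrightarrow> finite (supp a) \<Longrightarrow> supp a \<subseteq> carrier G \<Longrightarrow> a \<in> carrier R"
  using mem_carrier by blast

lemma notin_supp: "x \<notin> supp a \<Longrightarrow> a x = \<zero>\<^bsub>F\<^esub>"
  by (simp add: ga_supp_def)

lemma in_supp: "x \<in> supp a \<longleftrightarrow> a x \<noteq> \<zero>\<^bsub>F\<^esub>"
  by (simp add: ga_supp_def)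

lemma zero_closed' [simp, intro]: "\<zero>\<^bsub>R\<^esub> \<in> carrier R"
  by (rule carrierI) (simp_all add: zero_eq ga_supp_def)

lemma mon_closed [simp, intro]: "c \<in> carrier F \<Longrightarrow> g \<in> carrier G \<Longrightarrow> mon c g \<in> carrier R"
  by (rule carrierI) (auto simp: ga_mon_def ga_supp_def)

lemma supp_add: "supp (a \<oplus>\<^bsub>R\<^esub> b) \<subseteq> supp a \<union> supp b"
  by (auto simp: ga_supp_def add_eq)

lemma add_closed' [simp, intro]:
  assumes "a \<in> carrier R" "b \<in> carrier R" shows "a \<oplus>\<^bsub>R\<^esub> b \<in> carrier R"
  by (rule carrierI)
    (use assms assms[THEN coeff] assms[THEN supp_carrier] supp_add[of a b] in \<open>auto simp: add_eq dest: finite_subset\<close>)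

lemma supp_mon: "supp (mon c g) \<subseteq> {g}"
  by (auto simp: ga_supp_def ga_mon_def)

lemma mon_zero: "mon \<zero>\<^bsub>F\<^esub> g = \<zero>\<^bsub>R\<^esub>"
  by (auto simp: ga_mon_def zero_eq)

text \<open>The two induction rules replace sums over supports by monomials and addition.\<close>

lemma supp_induct [consumes 2, case_names mon add zero]:
  assumes a: "a \<in> carrier R" "supp a \<subseteq> S"
    and mon: "\<And>c g. c \<in> carrier F \<Longrightarrow> g \<in> carrier G \<Longrightarrow> g \<in> S \<Longrightarrow> Q (mon c g)"
    and add: "\<And>a b. a \<in> carrier R \<Longrightarrow> b \<in> carrier R \<Longrightarrow> Q a \<Longrightarrow> Q b \<Longrightarrow> Q (a \<oplus>\<^bsub>R\<^esub> b)"
    and zero: "Q \<zero>\<^bsub>R\<^esub>"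
  shows "Q a"
proof -
  have "finite T \<Longrightarrow> a \<in> carrier R \<Longrightarrow> supp a \<subseteq> T \<Longrightarrow> supp a \<subseteq> S \<Longrightarrow> Q a" for T a
  proof (induction T arbitrary: a rule: finite_induct)
    case empty
    then have "a = \<zero>\<^bsub>R\<^esub>" by (auto simp: ga_supp_def zero_eq)
    then show ?case using zero by simp
  next
    case (insert g T)
    show ?case
    proof (cases "g \<in> carrier G \<and> g \<in> S")
      case False
      then have "supp a \<subseteq> T" using insert.prems supp_carrier[OF insert.prems(1)] by blast
      then show ?thesis using insert by blast
    next
      case True
      let ?b = "\<lambda>x. if x = g then \<zero>\<^bsub>F\<^esub> else a x"
      have s: "supp ?b \<subseteq> T" "supp ?b \<subseteq> supp a" using insert.prems by (auto simp: ga_supp_def)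
      have b: "?b \<in> carrier R"
        by (rule carrierI)
          (use insert.prems(1) s(2) supp_carrier[OF insert.prems(1)] coeff[OF insert.prems(1)] in \<open>auto dest: finite_subset\<close>)
      have "a = mon (a g) g \<oplus>\<^bsub>R\<^esub> ?b"
        using coeff[OF insert.prems(1)] by (auto simp: add_eq ga_mon_def)
      moreover have "Q (mon (a g) g \<oplus>\<^bsub>R\<^esub> ?b)"
        by (rule add) (use insert.prems coeff[OF insert.prems(1)] True mon b s insert.IH in auto)
      ultimately show ?thesis by simp
    qed
  qed
  from this[of "supp a" a] a show ?thesis by auto
qed

lemma induct [consumes 1, case_names mon add]:
  assumes a: "a \<in> carrier R"
    and mon: "\<And>c g. c \<in> carrier F \<Longrightarrow> g \<in> carrier G \<Longrightarrow> Q (mon c g)"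
    and add: "\<And>a b. a \<in> carrier R \<Longrightarrow> b \<in> carrier R \<Longrightarrow> Q a \<Longrightarrow> Q b \<Longrightarrow> Q (a \<oplus>\<^bsub>R\<^esub> b)"
  shows "Q a"
  using a supp_carrier[OF a]
  by (rule supp_induct) (use mon add mon[of "\<zero>\<^bsub>F\<^esub>" "\<one>\<^bsub>G\<^esub>"] mon_zero in auto)

text \<open>The defining sum for a product runs over the supports of the factors. Enlarging the
  index sets to common ones makes products with different supports comparable.\<close>

lemma mult_superset:
  assumes a: "\<And>x. a x \<in> carrier F" and b: "\<And>x. b x \<in> carrier F"
    and "finite S" "finite T" "supp a \<subseteq> S" "supp b \<subseteq> T"
  shows "(a \<otimes>\<^bsub>R\<^esub> b) x =
    finsum F (\<lambda>(y, z). a y \<otimes>\<^bsub>F\<^esub> b z) {(y, z) \<in> S \<times> T. y \<otimes>\<^bsub>G\<^esub> z = x}"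
proof -
  have fin: "finite {(y, z) \<in> S \<times> T. y \<otimes>\<^bsub>G\<^esub> z = x}"
    by (rule finite_subset[of _ "S \<times> T"]) (use assms in auto)
  have za: "a y \<otimes>\<^bsub>F\<^esub> b w = \<zero>\<^bsub>F\<^esub>" if "y \<notin> supp a" for y w
    using notin_supp[OF that] b by auto
  have zb: "a y \<otimes>\<^bsub>F\<^esub> b w = \<zero>\<^bsub>F\<^esub>" if "w \<notin> supp b" for y w
    using notin_supp[OF that] a by auto
  show ?thesis
    unfolding mult_eq
    by (rule F.add.finprod_mono_neutral_cong_left[OF fin]) (use assms in \<open>auto simp: in_supp\<close>)
qed

lemma mult_mon_mon:
  assumes "c \<in> carrier F" "d \<in> carrier F" "g \<in> carrier G" "h \<in> carrier G"
  shows "mon c g \<otimes>\<^bsub>R\<^esub> mon d h = mon (c \<otimes>\<^bsub>F\<^esub> d) (g \<otimes>\<^bsub>G\<^esub> h)"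
proof
  fix x
  have "(mon c g \<otimes>\<^bsub>R\<^esub> mon d h) x =
     finsum F (\<lambda>(y, z). mon c g y \<otimes>\<^bsub>F\<^esub> mon d h z) {(y, z) \<in> {g} \<times> {h}. y \<otimes>\<^bsub>G\<^esub> z = x}"
    by (rule mult_superset) (use assms in \<open>auto simp: ga_mon_def ga_supp_def\<close>)
  also have "{(y, z) \<in> {g} \<times> {h}. y \<otimes>\<^bsub>G\<^esub> z = x} = (if x = g \<otimes>\<^bsub>G\<^esub> h then {(g, h)} else {})"
    by auto
  finally show "(mon c g \<otimes>\<^bsub>R\<^esub> mon d h) x = mon (c \<otimes>\<^bsub>F\<^esub> d) (g \<otimes>\<^bsub>G\<^esub> h) x"
    using assms by (auto simp: ga_mon_def)
qed

lemma supp_mult: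
  assumes "a \<in> carrier R" "b \<in> carrier R"
  shows "supp (a \<otimes>\<^bsub>R\<^esub> b) \<subseteq> (\<lambda>(y, z). y \<otimes>\<^bsub>G\<^esub> z) ` (supp a \<times> supp b)"
proof
  fix x assume x: "x \<in> supp (a \<otimes>\<^bsub>R\<^esub> b)"
  show "x \<in> (\<lambda>(y, z). y \<otimes>\<^bsub>G\<^esub> z) ` (supp a \<times> supp b)"
  proof (rule ccontr)
    assume "\<not> ?thesis"
    then have "{(y, z) \<in> supp a \<times> supp b. y \<otimes>\<^bsub>G\<^esub> z = x} = {}" by auto
    then have "(a \<otimes>\<^bsub>R\<^esub> b) x = \<zero>\<^bsub>F\<^esub>" by (simp only: mult_eq F.finsum_empty)
    then show False using x by (simp add: ga_supp_def)
  qed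
qed

lemma mult_closed [simp, intro]:
  assumes "a \<in> carrier R" "b \<in> carrier R" shows "a \<otimes>\<^bsub>R\<^esub> b \<in> carrier R"
proof -
  have "(a \<otimes>\<^bsub>R\<^esub> b) x \<in> carrier F" for x
    using assms assms[THEN coeff] by (subst mult_superset[of _ _ "supp a" "supp b"]) (auto intro!: F.finsum_closed)
  moreover have "finite (supp (a \<otimes>\<^bsub>R\<^esub> b))"
    by (rule finite_subset[OF supp_mult[OF assms]]) (use assms in auto)
  moreover have "supp (a \<otimes>\<^bsub>R\<^esub> b) \<subseteq> carrier G"
    using supp_mult[OF assms] supp_carrier[OF assms(1)] supp_carrier[OF assms(2)] by fastforce
  ultimately show ?thesis by (rule carrierI)
qed

lemma distr_l:
  assumes "a \<in> carrier R" "a' \<in> carrier R" "b \<in> carrier R"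
  shows "(a \<oplus>\<^bsub>R\<^esub> a') \<otimes>\<^bsub>R\<^esub> b = a \<otimes>\<^bsub>R\<^esub> b \<oplus>\<^bsub>R\<^esub> a' \<otimes>\<^bsub>R\<^esub> b"
proof
  fix x
  let ?S = "supp a \<union> supp a'" and ?T = "supp b"
  let ?Z = "{(y, z) \<in> ?S \<times> ?T. y \<otimes>\<^bsub>G\<^esub> z = x}"
  have "((a \<oplus>\<^bsub>R\<^esub> a') \<otimes>\<^bsub>R\<^esub> b) x = finsum F (\<lambda>(y, z). (a \<oplus>\<^bsub>R\<^esub> a') y \<otimes>\<^bsub>F\<^esub> b z) ?Z"
    by (rule mult_superset) (use assms assms[THEN coeff] add_closed'[OF assms(1,2), THEN coeff] supp_add[of a a'] in auto)
  also have "\<dots> = finsum F (\<lambda>w. (\<lambda>(y, z). a y \<otimes>\<^bsub>F\<^esub> b z) w \<oplus>\<^bsub>F\<^esub> (\<lambda>(y, z). a' y \<otimes>\<^bsub>F\<^esub> b z) w) ?Z"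
    by (rule F.finsum_cong') (use assms[THEN coeff] in \<open>auto simp: add_eq F.l_distr\<close>)
  also have "\<dots> = finsum F (\<lambda>(y, z). a y \<otimes>\<^bsub>F\<^esub> b z) ?Z \<oplus>\<^bsub>F\<^esub> finsum F (\<lambda>(y, z). a' y \<otimes>\<^bsub>F\<^esub> b z) ?Z"
    by (rule F.finsum_addf) (use assms[THEN coeff] in auto)
  also have "\<dots> = (a \<otimes>\<^bsub>R\<^esub> b) x \<oplus>\<^bsub>F\<^esub> (a' \<otimes>\<^bsub>R\<^esub> b) x"
    using assms assms[THEN coeff] by (subst (1 2) mult_superset[of _ _ ?S ?T]) auto
  finally show "((a \<oplus>\<^bsub>R\<^esub> a') \<otimes>\<^bsub>R\<^esub> b) x = (a \<otimes>\<^bsub>R\<^esub> b \<oplus>\<^bsub>R\<^esub> a' \<otimes>\<^bsub>R\<^esub> b) x"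
    by (simp add: add_eq)
qed

lemma distr_r:
  assumes "a \<in> carrier R" "a' \<in> carrier R" "b \<in> carrier R"
  shows "b \<otimes>\<^bsub>R\<^esub> (a \<oplus>\<^bsub>R\<^esub> a') = b \<otimes>\<^bsub>R\<^esub> a \<oplus>\<^bsub>R\<^esub> b \<otimes>\<^bsub>R\<^esub> a'"
proof
  fix x
  let ?S = "supp a \<union> supp a'" and ?T = "supp b"
  let ?Z = "{(y, z) \<in> ?T \<times> ?S. y \<otimes>\<^bsub>G\<^esub> z = x}"
  have "(b \<otimes>\<^bsub>R\<^esub> (a \<oplus>\<^bsub>R\<^esub> a')) x = finsum F (\<lambda>(y, z). b y \<otimes>\<^bsub>F\<^esub> (a \<oplus>\<^bsub>R\<^esub> a') z) ?Z"
    by (rule mult_superset) (use assms assms[THEN coeff] add_closed'[OF assms(1,2), THEN coeff] supp_add[of a a'] in auto)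
  also have "\<dots> = finsum F (\<lambda>w. (\<lambda>(y, z). b y \<otimes>\<^bsub>F\<^esub> a z) w \<oplus>\<^bsub>F\<^esub> (\<lambda>(y, z). b y \<otimes>\<^bsub>F\<^esub> a' z) w) ?Z"
    by (rule F.finsum_cong') (use assms[THEN coeff] in \<open>auto simp: add_eq F.r_distr\<close>)
  also have "\<dots> = finsum F (\<lambda>(y, z). b y \<otimes>\<^bsub>F\<^esub> a z) ?Z \<oplus>\<^bsub>F\<^esub> finsum F (\<lambda>(y, z). b y \<otimes>\<^bsub>F\<^esub> a' z) ?Z"
    by (rule F.finsum_addf) (use assms[THEN coeff] in auto)
  also have "\<dots> = (b \<otimes>\<^bsub>R\<^esub> a) x \<oplus>\<^bsub>F\<^esub> (b \<otimes>\<^bsub>R\<^esub> a') x"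
    using assms assms[THEN coeff] by (subst (1 2) mult_superset[of _ _ ?T ?S]) auto
  finally show "(b \<otimes>\<^bsub>R\<^esub> (a \<oplus>\<^bsub>R\<^esub> a')) x = (b \<otimes>\<^bsub>R\<^esub> a \<oplus>\<^bsub>R\<^esub> b \<otimes>\<^bsub>R\<^esub> a') x"
    by (simp add: add_eq)
qed

lemma mult_assoc_ga:
  assumes "a \<in> carrier R" "b \<in> carrier R" "c \<in> carrier R"
  shows "(a \<otimes>\<^bsub>R\<^esub> b) \<otimes>\<^bsub>R\<^esub> c = a \<otimes>\<^bsub>R\<^esub> (b \<otimes>\<^bsub>R\<^esub> c)"
  using assms(1)
proof (induction a rule: induct)
  case (mon r g)
  show ?case using assms(2)
  proof (induction b rule: induct)
    case (mon s h)
    show ?case using assms(3)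
    proof (induction c rule: induct)
      case (mon t k)
      then show ?case
        using \<open>r \<in> carrier F\<close> \<open>s \<in> carrier F\<close> \<open>g \<in> carrier G\<close> \<open>h \<in> carrier G\<close>
        by (simp add: mult_mon_mon F.m_assoc G.m_assoc)
    next
      case (add c c')
      then show ?case
        using \<open>r \<in> carrier F\<close> \<open>s \<in> carrier F\<close> \<open>g \<in> carrier G\<close> \<open>h \<in> carrier G\<close>
        by (simp add: distr_r)
    qed
  next
    case (add b b')
    then show ?case
      using \<open>r \<in> carrier F\<close> \<open>g \<in> carrier G\<close> assms(3) by (simp add: distr_r distr_l)
  qed
next
  case (add a a')
  then show ?case using assms by (simp add: distr_l)
qed

sublocale ring R
proof (rule ringI)
  show "abelian_group R"
  proof (rule abelian_groupI)
    fix a assume a: "a \<in> carrier R"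
    let ?b = "\<lambda>x. \<ominus>\<^bsub>F\<^esub> a x"
    have "supp ?b = supp a" using coeff[OF a] by (auto simp: ga_supp_def)
    then have "?b \<in> carrier R" using a coeff[OF a] supp_carrier[OF a] by (intro carrierI) auto
    moreover have "?b \<oplus>\<^bsub>R\<^esub> a = \<zero>\<^bsub>R\<^esub>" using coeff[OF a] by (auto simp: add_eq zero_eq F.l_neg)
    ultimately show "\<exists>y\<in>carrier R. y \<oplus>\<^bsub>R\<^esub> a = \<zero>\<^bsub>R\<^esub>" by blast
  next
    fix a b assume "a \<in> carrier R" "b \<in> carrier R"
    then show "a \<oplus>\<^bsub>R\<^esub> b = b \<oplus>\<^bsub>R\<^esub> a" by (auto simp: add_eq intro!: F.a_comm coeff)
  next
    fix a b c assume "a \<in> carrier R" "b \<in> carrier R" "c \<in> carrier R"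
    then show "a \<oplus>\<^bsub>R\<^esub> b \<oplus>\<^bsub>R\<^esub> c = a \<oplus>\<^bsub>R\<^esub> (b \<oplus>\<^bsub>R\<^esub> c)"
      by (auto simp: add_eq intro!: F.a_assoc coeff)
  next
    fix a assume "a \<in> carrier R" note coeff[OF this]
    then show "\<zero>\<^bsub>R\<^esub> \<oplus>\<^bsub>R\<^esub> a = a" by (auto simp: add_eq zero_eq)
  qed auto
  show "Group.monoid R"
  proof (rule monoidI)
    fix a assume a: "a \<in> carrier R"
    show "\<one>\<^bsub>R\<^esub> \<otimes>\<^bsub>R\<^esub> a = a" using a
      by (induction a rule: induct) (auto simp: one_eq mult_mon_mon distr_r)
    show "a \<otimes>\<^bsub>R\<^esub> \<one>\<^bsub>R\<^esub> = a" using a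
      by (induction a rule: induct) (auto simp: one_eq mult_mon_mon distr_l)
  qed (auto simp: mult_assoc_ga, auto simp: one_eq)
qed (use distr_l distr_r in auto)

lemma uminus_eq: assumes a: "a \<in> carrier R" shows "\<ominus>\<^bsub>R\<^esub> a = (\<lambda>x. \<ominus>\<^bsub>F\<^esub> a x)"
proof -
  let ?b = "\<lambda>x. \<ominus>\<^bsub>F\<^esub> a x"
  have "supp ?b = supp a" using coeff[OF a] by (auto simp: ga_supp_def)
  then have "?b \<in> carrier R" using a coeff[OF a] supp_carrier[OF a] by (intro carrierI) auto
  moreover have "?b \<oplus>\<^bsub>R\<^esub> a = \<zero>\<^bsub>R\<^esub>" using coeff[OF a] by (auto simp: add_eq zero_eq F.l_neg)
  ultimately show ?thesis using a minus_equality by blast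
qed

lemma mon_mult_apply:
  assumes "c \<in> carrier F" "g \<in> carrier G" "w \<in> carrier R" "x \<in> carrier G"
  shows "(mon c g \<otimes>\<^bsub>R\<^esub> w) x = c \<otimes>\<^bsub>F\<^esub> w (inv\<^bsub>G\<^esub> g \<otimes>\<^bsub>G\<^esub> x)"
  using assms(3)
proof (induction w rule: induct)
  case (mon d h)
  have "x = g \<otimes>\<^bsub>G\<^esub> h \<longleftrightarrow> inv\<^bsub>G\<^esub> g \<otimes>\<^bsub>G\<^esub> x = h"
    using assms mon by (metis G.inv_solve_left)
  then show ?case using assms mon by (simp add: mult_mon_mon) (auto simp: ga_mon_def)
next
  case (add a b)
  then show ?case using assms coeff
    by (simp add: distr_r) (simp add: add_eq F.r_distr)
qed

lemma cring_if_comm: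
  assumes "comm_group G" shows "cring R"
proof -
  interpret CG: comm_group G by fact
  have "a \<otimes>\<^bsub>R\<^esub> b = b \<otimes>\<^bsub>R\<^esub> a" if "a \<in> carrier R" "b \<in> carrier R" for a b
    using that(1)
  proof (induction a rule: induct)
    case (mon c g)
    show ?case using that(2)
      by (induction b rule: induct)
        (use mon in \<open>auto simp: mult_mon_mon F.m_comm CG.m_comm distr_l distr_r\<close>)
  next
    case (add a a') then show ?case using that by (simp add: distr_l distr_r)
  qed
  then show ?thesis by unfold_locales auto
qed

subsection \<open>Push-forward along a map of groups\<close>

lemma ga_map_superset:
  assumes "a \<in> carrier R" "finite S" "supp a \<subseteq> S"
  shows "ga_map F \<phi> a y = finsum F a {x \<in> S. \<phi> x = y}"
  unfolding ga_map_def
  by (rule F.add.finprod_mono_neutral_cong_left)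
    (use assms coeff[OF assms(1)] in \<open>auto simp: notin_supp\<close>)

lemma ga_map_add:
  assumes "a \<in> carrier R" "b \<in> carrier R"
  shows "ga_map F \<phi> (a \<oplus>\<^bsub>R\<^esub> b) = (\<lambda>y. ga_map F \<phi> a y \<oplus>\<^bsub>F\<^esub> ga_map F \<phi> b y)"
proof
  fix y
  let ?S = "supp a \<union> supp b"
  have "ga_map F \<phi> (a \<oplus>\<^bsub>R\<^esub> b) y = finsum F (a \<oplus>\<^bsub>R\<^esub> b) {x \<in> ?S. \<phi> x = y}"
    by (rule ga_map_superset) (use assms supp_add[of a b] in auto)
  also have "\<dots> = finsum F a {x \<in> ?S. \<phi> x = y} \<oplus>\<^bsub>F\<^esub> finsum F b {x \<in> ?S. \<phi> x = y}"
    unfolding add_eq by (rule F.finsum_addf) (use assms[THEN coeff] in auto)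
  also have "\<dots> = ga_map F \<phi> a y \<oplus>\<^bsub>F\<^esub> ga_map F \<phi> b y"
    using assms by (subst (1 2) ga_map_superset[of _ ?S]) auto
  finally show "ga_map F \<phi> (a \<oplus>\<^bsub>R\<^esub> b) y = ga_map F \<phi> a y \<oplus>\<^bsub>F\<^esub> ga_map F \<phi> b y" .
qed

lemma ga_map_mon: "c \<in> carrier F \<Longrightarrow> ga_map F \<phi> (mon c g) = mon c (\<phi> g)"
proof
  fix y assume c: "c \<in> carrier F"
  have "ga_map F \<phi> (mon c g) y = finsum F (mon c g) {x \<in> {g}. \<phi> x = y}"
    unfolding ga_map_def
    by (rule F.add.finprod_mono_neutral_cong_left) (use c in \<open>auto simp: ga_supp_def ga_mon_def\<close>)
  also have "{x \<in> {g}. \<phi> x = y} = (if y = \<phi> g then {g} else {})" by auto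
  finally show "ga_map F \<phi> (mon c g) y = mon c (\<phi> g) y" using c by (auto simp: ga_mon_def)
qed

lemma aug_superset:
  assumes "a \<in> carrier R" "finite S" "supp a \<subseteq> S"
  shows "augmentation F a = finsum F a S"
  unfolding augmentation_def
  by (rule F.add.finprod_mono_neutral_cong_left)
    (use assms coeff[OF assms(1)] in \<open>auto simp: notin_supp\<close>)

lemma aug_closed [simp, intro]: "a \<in> carrier R \<Longrightarrow> augmentation F a \<in> carrier F"
  unfolding augmentation_def by (rule F.finsum_closed) (auto dest: coeff)

lemma aug_add:
  assumes "a \<in> carrier R" "b \<in> carrier R"
  shows "augmentation F (a \<oplus>\<^bsub>R\<^esub> b) = augmentation F a \<oplus>\<^bsub>F\<^esub> augmentation F b"
proof -
  let ?S = "supp a \<union> supp b"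
  have "augmentation F (a \<oplus>\<^bsub>R\<^esub> b) = finsum F (a \<oplus>\<^bsub>R\<^esub> b) ?S"
    by (rule aug_superset) (use assms supp_add[of a b] in auto)
  also have "\<dots> = finsum F a ?S \<oplus>\<^bsub>F\<^esub> finsum F b ?S"
    unfolding add_eq by (rule F.finsum_addf) (use assms[THEN coeff] in auto)
  also have "\<dots> = augmentation F a \<oplus>\<^bsub>F\<^esub> augmentation F b"
    using assms by (subst (1 2) aug_superset[of _ ?S]) auto
  finally show ?thesis .
qed

lemma aug_mon: "c \<in> carrier F \<Longrightarrow> augmentation F (mon c g) = c"
  unfolding augmentation_def
  by (subst F.add.finprod_mono_neutral_cong_left[of "{g}" _ "mon c g"])
    (auto simp: ga_supp_def ga_mon_def)

lemma aug_mult: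
  assumes "a \<in> carrier R" "b \<in> carrier R"
  shows "augmentation F (a \<otimes>\<^bsub>R\<^esub> b) = augmentation F a \<otimes>\<^bsub>F\<^esub> augmentation F b"
  using assms(1)
proof (induction a rule: induct)
  case (mon c g)
  show ?case using assms(2)
    by (induction b rule: induct)
      (use mon in \<open>auto simp: mult_mon_mon distr_r aug_mon aug_add F.r_distr\<close>)
next
  case (add a a')
  then show ?case using assms(2) by (simp add: distr_l aug_add F.l_distr)
qed

lemma aug_one: "augmentation F \<one>\<^bsub>R\<^esub> = \<one>\<^bsub>F\<^esub>"
  by (simp add: one_eq aug_mon)

end

locale ga_pair = ga F G + H: ga F H
  for F :: "('f, 'a) ring_scheme" and G :: "('g, 'b) monoid_scheme" and H :: "('h, 'c) monoid_scheme"
begin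

lemma ga_map_closed [intro]:
  assumes "a \<in> carrier R" "\<phi> \<in> carrier G \<rightarrow> carrier H" shows "ga_map F \<phi> a \<in> carrier H.R"
  using assms(1)
  by (induction a rule: induct)
    (use assms(2) in \<open>auto simp: ga_map_mon ga_map_add H.add_eq[symmetric]\<close>)

lemma ga_map_add':
  assumes "a \<in> carrier R" "b \<in> carrier R"
  shows "ga_map F \<phi> (a \<oplus>\<^bsub>R\<^esub> b) = ga_map F \<phi> a \<oplus>\<^bsub>H.R\<^esub> ga_map F \<phi> b"
  using ga_map_add[OF assms] by (simp add: H.add_eq)

lemma ga_map_hom:
  assumes \<phi>: "\<phi> \<in> hom G H" shows "ga_map F \<phi> \<in> ring_hom R H.R"
proof (rule ring_hom_memI)
  have \<phi>': "\<phi> \<in> carrier G \<rightarrow> carrier H" using \<phi> by (simp add: hom_def)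
  interpret h: group_hom G H \<phi>
    using \<phi> by unfold_locales
  show "ga_map F \<phi> \<one>\<^bsub>R\<^esub> = \<one>\<^bsub>H.R\<^esub>" by (simp add: one_eq H.one_eq ga_map_mon)
  fix a assume a: "a \<in> carrier R"
  show "ga_map F \<phi> a \<in> carrier H.R" using a \<phi>' by (rule ga_map_closed)
  fix b assume b: "b \<in> carrier R"
  show "ga_map F \<phi> (a \<oplus>\<^bsub>R\<^esub> b) = ga_map F \<phi> a \<oplus>\<^bsub>H.R\<^esub> ga_map F \<phi> b" using a b by (rule ga_map_add')
  show "ga_map F \<phi> (a \<otimes>\<^bsub>R\<^esub> b) = ga_map F \<phi> a \<otimes>\<^bsub>H.R\<^esub> ga_map F \<phi> b" using a
  proof (induction a rule: induct)
    case (mon c g)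
    show ?case using b
      by (induction b rule: induct)
       (use mon \<phi>' in \<open>auto simp: mult_mon_mon H.mult_mon_mon ga_map_mon distr_r H.distr_r ga_map_add' ga_map_closed\<close>)
  next
    case (add a a')
    then show ?case using b \<phi>' by (simp add: distr_l H.distr_l ga_map_add' ga_map_closed)
  qed
qed

lemma aug_ga_map:
  assumes "a \<in> carrier R" "\<phi> \<in> carrier G \<rightarrow> carrier H"
  shows "augmentation F (ga_map F \<phi> a) = augmentation F a"
  using assms(1)
  by (induction a rule: induct)
   (use assms(2) in \<open>auto simp: ga_map_mon aug_mon H.aug_mon ga_map_add' aug_add H.aug_add ga_map_closed\<close>)

lemma ga_map_surj:
  assumes "\<phi> ` carrier G = carrier H" shows "ga_map F \<phi> ` carrier R = carrier H.R"
proof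
  show "ga_map F \<phi> ` carrier R \<subseteq> carrier H.R" using assms by (auto intro!: ga_map_closed)
  show "carrier H.R \<subseteq> ga_map F \<phi> ` carrier R"
  proof
    fix b assume "b \<in> carrier H.R"
    then show "b \<in> ga_map F \<phi> ` carrier R"
    proof (induction b rule: H.induct)
      case (mon c h)
      then obtain g where "g \<in> carrier G" "h = \<phi> g" using assms by auto
      then show ?case using mon by (auto intro!: image_eqI[of _ _ "mon c g"] simp: ga_map_mon)
    next
      case (add a b)
      then obtain a' b' where "a' \<in> carrier R" "b' \<in> carrier R" "a = ga_map F \<phi> a'" "b = ga_map F \<phi> b'"
        by auto
      then show ?case by (auto intro!: image_eqI[of _ _ "a' \<oplus>\<^bsub>R\<^esub> b'"] simp: ga_map_add')
    qed
  qed
qed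

end

section \<open>Engel groups with a locally finite p-group as commutator subgroup\<close>

definition conj_by :: "('g, 'b) monoid_scheme \<Rightarrow> 'g \<Rightarrow> 'g \<Rightarrow> 'g" where
  "conj_by G g x = inv\<^bsub>G\<^esub> g \<otimes>\<^bsub>G\<^esub> x \<otimes>\<^bsub>G\<^esub> g"

context group
begin

lemma ord_subgroup:
  assumes S: "subgroup S G" and x: "x \<in> S"
  shows "group.ord (G\<lparr>carrier := S\<rparr>) x = ord x"
proof -
  interpret H: group "G\<lparr>carrier := S\<rparr>" using S subgroup_imp_group by blast
  have pw: "x [^]\<^bsub>G\<lparr>carrier := S\<rparr>\<^esub> (n::nat) = x [^] n" for n
    by (simp add: nat_pow_def)
  have "H.ord x dvd n \<longleftrightarrow> ord x dvd n" for n
    using H.pow_eq_id[of x n] pow_eq_id[of x n] pw x subgroup.mem_carrier[OF S x] by auto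
  from this[of "H.ord x"] this[of "ord x"] show ?thesis
    by (intro dvd_antisym) simp_all
qed

lemma ord_prime_power_iff:
  assumes "Factorial_Ring.prime q" "x \<in> carrier G"
  shows "(\<exists>n. ord x = q ^ n) \<longleftrightarrow> (\<exists>n::nat. x [^] (q ^ n) = \<one>)"
  using assms pow_eq_id[OF assms(2)] divides_primepow_nat[OF assms(1)]
  by (metis dvd_refl)

lemma primary_subgroup_iff:
  assumes "Factorial_Ring.prime q" "subgroup S G"
  shows "primary_group q (G\<lparr>carrier := S\<rparr>) \<longleftrightarrow> (\<forall>x\<in>S. \<exists>n::nat. x [^] (q ^ n) = \<one>)"
  using ord_subgroup[OF assms(2)] subgroup_imp_group[OF assms(2)]
    ord_prime_power_iff[OF assms(1)] subgroup.mem_carrier[OF assms(2)]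
  by (simp add: primary_group_def)

lemma pow_coprime_eq_one:
  assumes "x \<in> carrier G" "x [^] (m::nat) = \<one>" "x [^] (n::nat) = \<one>" "coprime m n"
  shows "x = \<one>"
  using assms pow_eq_id[OF assms(1)] ord_eq_1[OF assms(1)] by (metis coprime_def is_unit_gcd_iff gcd_greatest nat_dvd_1_iff_1)

text \<open>For a \<open>q\<close>-element \<open>x\<close> the preimage of the cyclic group
  generated by the coset \<open>S x\<close> is again a \<open>q\<close>-group, so by maximality it
  is \<open>S\<close>.\<close>

lemma normal_sylow_eq:
  assumes q: "Factorial_Ring.prime q" and S: "sylow_subgroup q G S" "S \<lhd> G"
  shows "S = {x \<in> carrier G. \<exists>n::nat. x [^] (q ^ n) = \<one>}"
proof
  interpret S: normal S G by fact
  interpret Q: group "G Mod S" by (rule S.factorgroup_is_group)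
  have sub: "subgroup S G" by (rule S.subgroup_axioms)
  have el: "\<exists>n::nat. x [^] (q ^ n) = \<one>" if "x \<in> S" for x
    using S(1) primary_subgroup_iff[OF q sub] that by (auto simp: sylow_subgroup_def)
  then show "S \<subseteq> {x \<in> carrier G. \<exists>n::nat. x [^] (q ^ n) = \<one>}"
    using S.subset by auto
  have mem: "S #> y = S \<longleftrightarrow> y \<in> S" if "y \<in> carrier G" for y
    using that coset_join1 coset_join2 S.subset sub by blast
  show "{x \<in> carrier G. \<exists>n::nat. x [^] (q ^ n) = \<one>} \<subseteq> S"
  proof clarify
    fix x and n :: nat assume x: "x \<in> carrier G" "x [^] (q ^ n) = \<one>"
    let ?c = "S #> x"
    have c: "?c \<in> carrier (G Mod S)" using x by (auto simp: carrier_FactGroup)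
    interpret h: group_hom G "G Mod S" "(#>) S"
      by unfold_locales (rule S.r_coset_hom_Mod)
    let ?T = "{y \<in> carrier G. \<exists>i::int. S #> y = ?c [^]\<^bsub>G Mod S\<^esub> i}"
    have T: "subgroup ?T G"
    proof (rule subgroupI)
      show "?T \<noteq> {}" using x(1) c by (auto intro!: exI[of _ x] exI[of _ "1::int"] simp: Q.int_pow_1)
      fix y assume "y \<in> ?T"
      then obtain i :: int where "y \<in> carrier G" "S #> y = ?c [^]\<^bsub>G Mod S\<^esub> i" by blast
      note yi = this
      have "S #> inv y = ?c [^]\<^bsub>G Mod S\<^esub> (- i)"
        using yi c h.hom_inv[OF yi(1)] Q.int_pow_neg[of ?c i] by simp
      then show "inv y \<in> ?T" using yi(1) by blast
      fix z assume "z \<in> ?T"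
      then obtain j :: int where zj: "z \<in> carrier G" "S #> z = ?c [^]\<^bsub>G Mod S\<^esub> j" by blast
      have "S #> (y \<otimes> z) = ?c [^]\<^bsub>G Mod S\<^esub> (i + j)"
        using yi zj c h.hom_mult[OF yi(1) zj(1)] Q.int_pow_mult[of ?c i j] by simp
      then show "y \<otimes> z \<in> ?T" using yi(1) zj(1) by blast
    qed auto
    have "S \<subseteq> ?T"
    proof
      fix y assume y: "y \<in> S"
      then have "S #> y = ?c [^]\<^bsub>G Mod S\<^esub> (0::int)" using mem[of y] S.subset by auto
      then show "y \<in> ?T" using y S.subset by blast
    qed
    moreover have "\<exists>m::nat. y [^] (q ^ m) = \<one>" if y: "y \<in> ?T" for y
    proof -
      obtain i :: int where i: "y \<in> carrier G" "S #> y = ?c [^]\<^bsub>G Mod S\<^esub> i" using y by blast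
      have "?c [^]\<^bsub>G Mod S\<^esub> (q ^ n) = \<one>\<^bsub>G Mod S\<^esub>"
        using x mem[of \<one>] S.FactGroup_pow[OF x(1), of "q ^ n"] by simp
      then have "(S #> y) [^]\<^bsub>G Mod S\<^esub> (q ^ n) = \<one>\<^bsub>G Mod S\<^esub>"
        using c i by (metis int_pow_int Q.int_pow_one Q.int_pow_pow mult.commute)
      then have "S #> (y [^] (q ^ n)) = S" using S.FactGroup_pow[OF i(1)] by simp
      then have "y [^] (q ^ n) \<in> S" using mem i(1) by simp
      then obtain m :: nat where "(y [^] (q ^ n)) [^] (q ^ m) = \<one>" using el by blast
      then show ?thesis using i(1) by (auto simp: nat_pow_pow simp flip: power_add)
    qed
    ultimately have "?T = S"
      using S(1) T primary_subgroup_iff[OF q T] by (auto simp: sylow_subgroup_def)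
    moreover have "x \<in> ?T" using x(1) c by (auto intro!: exI[of _ "1::int"] simp: Q.int_pow_1)
    ultimately show "x \<in> S" by blast
  qed
qed

subsection \<open>Coprime elements are central\<close>

lemma left_comm_closed [intro, simp]:
  "x \<in> carrier G \<Longrightarrow> y \<in> carrier G \<Longrightarrow> left_comm G x y \<in> carrier G"
  by (simp add: left_comm_def)

lemma mult_cancels:
  "x \<in> carrier G \<Longrightarrow> w \<in> carrier G \<Longrightarrow> x \<otimes> (inv x \<otimes> w) = w"
  "x \<in> carrier G \<Longrightarrow> w \<in> carrier G \<Longrightarrow> inv x \<otimes> (x \<otimes> w) = w"
  by (simp_all flip: m_assoc)

lemma left_comm_eq_one_iff:
  assumes "x \<in> carrier G" "y \<in> carrier G"
  shows "left_comm G x y = \<one> \<longleftrightarrow> x \<otimes> y = y \<otimes> x"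
proof -
  have "left_comm G x y = inv (y \<otimes> x) \<otimes> (x \<otimes> y)"
    using assms by (simp add: left_comm_def inv_mult_group m_assoc)
  then show ?thesis using assms inv_solve_left'[of \<one> "y \<otimes> x" "x \<otimes> y"] by simp
qed

lemma iter_comm_closed:
  "x \<in> carrier G \<Longrightarrow> y \<in> carrier G \<Longrightarrow> ((\<lambda>z. left_comm G z y) ^^ n) x \<in> carrier G"
  by (induction n) auto

text \<open>The step \<open>(z, h, h) = 1 \<Longrightarrow> (z, h) = 1\<close> lets the Engel
  commutator \<open>(g, h, \<dots>, h) = 1\<close> collapse. It holds since \<open>y = (z,
  h)\<close> is then both a \<open>p\<close>-element and, as the product of the commuting elements
  \<open>z\<^sup>-\<^sup>1 h\<^sup>-\<^sup>1 z\<close> and \<open>h\<close>, an element of order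
  dividing \<open>m\<close>.\<close>

lemma engel_coprime_central:
  assumes engel: "engel_group G"
    and C: "\<And>g h. g \<in> carrier G \<Longrightarrow> h \<in> carrier G \<Longrightarrow> \<exists>n::nat. left_comm G g h [^] (p ^ n) = \<one>"
    and h: "h \<in> carrier G" "h [^] (m::nat) = \<one>" "coprime m p" and g: "g \<in> carrier G"
  shows "g \<otimes> h = h \<otimes> g"
proof -
  let ?c = "\<lambda>z. left_comm G z h"
  have step: "?c z = \<one>" if z: "z \<in> carrier G" "?c (?c z) = \<one>" for z
  proof -
    let ?y = "?c z"
    have y: "?y \<in> carrier G" using z h by simp
    have comm: "?y \<otimes> inv h = inv h \<otimes> ?y"
    proof -
      have "h \<otimes> (?y \<otimes> inv h) = ?y \<otimes> h \<otimes> inv h"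
        using z(2) h y left_comm_eq_one_iff[OF y h(1)] by (simp flip: m_assoc)
      also have "\<dots> = ?y" using h y by (simp add: m_assoc)
      finally show ?thesis using h y inv_solve_left'[of "?y \<otimes> inv h" h ?y] by simp
    qed
    have eq: "inv z \<otimes> inv h \<otimes> z = ?y \<otimes> inv h"
      using z h by (simp add: left_comm_def m_assoc)
    \<comment> \<open>Powers of a conjugate, by which \<open>y h\<^sup>-\<^sup>1\<close> has the
      order of \<open>h\<^sup>-\<^sup>1\<close>.\<close>
    have pw: "(inv z \<otimes> inv h \<otimes> z) [^] k = inv z \<otimes> inv h [^] k \<otimes> z" for k :: nat
    proof (induction k)
      case (Suc k)
      have "inv z \<otimes> inv h [^] k \<otimes> z \<otimes> (inv z \<otimes> inv h \<otimes> z) = inv z \<otimes> (inv h [^] k \<otimes> inv h) \<otimes> z"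
        using z h by (simp add: m_assoc mult_cancels)
      then show ?case using Suc by simp
    qed (use z in simp)
    have hm: "inv h [^] m = \<one>" using h by (simp add: nat_pow_inv)
    have "(?y \<otimes> inv h) [^] m = \<one>" using pw[of m] hm z unfolding eq by simp
    then have "?y [^] m = \<one>"
      using pow_mult_distrib[OF comm y, of m] hm y h by simp
    moreover obtain n :: nat where "?y [^] (p ^ n) = \<one>" using C[OF z(1) h(1)] by blast
    moreover have "coprime m (p ^ n)" using h(3) by simp
    ultimately show ?thesis using y pow_coprime_eq_one by blast
  qed
  obtain n where n: "n > 0" "(?c ^^ n) g = \<one>"
    using engel g h unfolding engel_group_def by blast
  have "(?c ^^ Suc k) g = \<one> \<Longrightarrow> ?c g = \<one>" for k
  proof (induction k)
    case (Suc k)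
    have "?c (?c ((?c ^^ k) g)) = \<one>" using Suc.prems by simp
    then have "?c ((?c ^^ k) g) = \<one>" by (rule step[rotated]) (use g h iter_comm_closed in auto)
    then show ?case using Suc.IH by simp
  qed auto
  then have "?c g = \<one>" using n by (cases n) auto
  then show ?thesis using left_comm_eq_one_iff g h by blast
qed

subsection \<open>Finite subgroups invariant under finitely many elements\<close>

lemma conj_by_closed [simp, intro]:
  "g \<in> carrier G \<Longrightarrow> x \<in> carrier G \<Longrightarrow> conj_by G g x \<in> carrier G"
  by (simp add: conj_by_def)

lemma conj_by_mult:
  assumes "g \<in> carrier G" "x \<in> carrier G" "y \<in> carrier G"
  shows "conj_by G g (x \<otimes> y) = conj_by G g x \<otimes> conj_by G g y"
proof -
  show ?thesis using assms by (simp add: conj_by_def m_assoc mult_cancels)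
qed

lemma conj_by_inv:
  "g \<in> carrier G \<Longrightarrow> x \<in> carrier G \<Longrightarrow> conj_by G g (inv x) = inv (conj_by G g x)"
  by (simp add: conj_by_def inv_mult_group m_assoc)

lemma conj_by_one [simp]: "g \<in> carrier G \<Longrightarrow> conj_by G g \<one> = \<one>"
  by (simp add: conj_by_def)

lemma conj_by_by_one [simp]: "x \<in> carrier G \<Longrightarrow> conj_by G \<one> x = x"
  by (simp add: conj_by_def)

lemma conj_by_conj_by:
  "g \<in> carrier G \<Longrightarrow> h \<in> carrier G \<Longrightarrow> x \<in> carrier G \<Longrightarrow>
    conj_by G (g \<otimes> h) x = conj_by G h (conj_by G g x)"
  by (simp add: conj_by_def inv_mult_group m_assoc)

lemma conj_by_pow:
  assumes "g \<in> carrier G" "x \<in> carrier G"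
  shows "conj_by G g (x [^] (n::nat)) = conj_by G g x [^] n"
  by (induction n) (use assms in \<open>auto simp: conj_by_mult\<close>)

lemma conj_by_comm:
  assumes "g \<in> carrier G" "x \<in> carrier G"
  shows "conj_by G g x = x \<otimes> left_comm G x g"
proof -
  show ?thesis using assms by (simp add: conj_by_def left_comm_def m_assoc mult_cancels)
qed

lemma conj_by_generate:
  assumes "A \<subseteq> carrier G" "g \<in> carrier G" "\<And>x. x \<in> A \<Longrightarrow> conj_by G g x \<in> generate G A"
    and "y \<in> generate G A"
  shows "conj_by G g y \<in> generate G A"
  using assms(4)
proof (induction y rule: generate.induct)
  case one then show ?case using assms(2) by (simp add: generate.one)
next
  case (incl h) then show ?case using assms(3) by simp
next
  case (inv h)
  then show ?case using assms generate_m_inv_closed[OF assms(1)] by (subst conj_by_inv) auto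
next
  case (eng u v)
  then show ?case using assms generate_in_carrier[OF assms(1)]
    by (subst conj_by_mult) (auto intro: generate.eng)
qed

text \<open>The identity \<open>(ab, s) = (a, s)\<^sup>b (b, s)\<close>.\<close>

lemma left_comm_mult:
  assumes "a \<in> carrier G" "b \<in> carrier G" "s \<in> carrier G"
  shows "left_comm G (a \<otimes> b) s = conj_by G b (left_comm G a s) \<otimes> left_comm G b s"
proof -
  show ?thesis
    using assms by (simp add: conj_by_def left_comm_def m_assoc inv_mult_group mult_cancels)
qed

text \<open>Elements are adjoined to \<open>S\<close> one at a time. Let \<open>N\<^sub>0\<close>
  be finite, invariant under \<open>S\<close>, and let it contain the commutators \<open>(g,
  s)\<close> for \<open>s \<in> S\<close>. The closure of \<open>N\<^sub>0\<close> under
  conjugation by \<open>g\<close> lies in the group generated by the Engel commutators \<open>(x,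
  g, \<dots>, g)\<close> with \<open>x \<in> N\<^sub>0\<close>. These are finitely many elements
  of \<open>C\<close>, hence the closure is finite. It remains invariant under \<open>S\<close>,
  because \<open>g\<^sup>j s = s g\<^sup>j (g\<^sup>j, s)\<close> and \<open>(g\<^sup>j,
  s)\<close> is a product of \<open>g\<close>-conjugates of \<open>(g, s)\<close>.\<close>

lemma engel_finite_invariant_subgroup_derived:
  assumes engel: "engel_group G"
    and C: "subgroup C G" "\<And>x y. x \<in> carrier G \<Longrightarrow> y \<in> carrier G \<Longrightarrow> left_comm G x y \<in> C"
    and lf: "\<And>A. finite A \<Longrightarrow> A \<subseteq> C \<Longrightarrow> finite (generate G A)"
    and S: "finite S" "S \<subseteq> carrier G" and K: "finite K" "K \<subseteq> C"
  shows "\<exists>N. subgroup N G \<and> finite N \<and> K \<subseteq> N \<and> N \<subseteq> C \<and> (\<forall>s\<in>S. \<forall>n\<in>N. conj_by G s n \<in> N)"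
  using S K
proof (induction S arbitrary: K rule: finite_induct)
  case empty
  have "generate G K \<subseteq> C" using empty C(1) generate_subgroup_incl by blast
  moreover have "subgroup (generate G K) G"
    using empty subgroup.subset[OF C(1)] by (intro generate_is_subgroup) auto
  ultimately show ?case
    using empty lf[of K] generate.incl[of _ K G] by (intro exI[of _ "generate G K"]) auto
next
  case (insert g S)
  have gS: "g \<in> carrier G" "S \<subseteq> carrier G" using insert.prems by auto
  have CG: "C \<subseteq> carrier G" by (rule subgroup.subset[OF C(1)])
  let ?K' = "K \<union> (\<lambda>s. left_comm G g s) ` S"
  have "?K' \<subseteq> C" using insert.prems C(2) by auto
  then obtain N0 where N0: "subgroup N0 G" "finite N0" "?K' \<subseteq> N0" "N0 \<subseteq> C"
    "\<And>s n. s \<in> S \<Longrightarrow> n \<in> N0 \<Longrightarrow> conj_by G s n \<in> N0"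
    using insert.IH[OF gS(2), of ?K'] insert.prems insert.hyps by auto
  let ?c = "\<lambda>x i. ((\<lambda>z. left_comm G z g) ^^ i) x"
  have "\<exists>n. ?c x n = \<one>" if "x \<in> N0" for x
    using that N0(4) CG engel gS(1) unfolding engel_group_def by blast
  then obtain n where n: "\<And>x. x \<in> N0 \<Longrightarrow> ?c x (n x) = \<one>" by metis
  let ?Y = "\<Union>x\<in>N0. ?c x ` {..n x}"
  have cC: "?c x i \<in> C" if "x \<in> N0" for x i
  proof (induction i)
    case 0 then show ?case using that N0(4) by auto
  next
    case (Suc i) then show ?case using C(2) gS(1) CG by auto
  qed
  have Y: "finite ?Y" "?Y \<subseteq> C" "?Y \<subseteq> carrier G" using N0(2) cC CG by auto
  let ?E = "generate G ?Y"
  have finE: "finite ?E" by (rule lf[OF Y(1,2)])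
  \<comment> \<open>Conjugation by \<open>g\<close> maps \<open>y\<close> to \<open>y (y,
    g)\<close>, so it moves each Engel commutator by the next one.\<close>
  have gE: "conj_by G g y \<in> ?E" if "y \<in> ?E" for y
  proof (rule conj_by_generate[OF Y(3) gS(1) _ that])
    fix y assume "y \<in> ?Y"
    then obtain x i where xi: "x \<in> N0" "i \<le> n x" "y = ?c x i" by auto
    have yG: "y \<in> carrier G" using xi cC CG by auto
    show "conj_by G g y \<in> ?E"
    proof (cases "i = n x")
      case True
      then have "y = \<one>" using xi n by simp
      then show ?thesis using gS(1) by (simp add: generate.one)
    next
      case False
      then have "Suc i \<le> n x" using xi by simp
      then have "?c x (Suc i) \<in> ?Y" "y \<in> ?Y" using xi by blast+
      then have "y \<otimes> left_comm G y g \<in> ?E" using xi by (auto intro: generate.eng generate.incl)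
      then show ?thesis using conj_by_comm[OF gS(1) yG] by simp
    qed
  qed
  have N0E: "conj_by G (g [^] j) x \<in> ?E" if "x \<in> N0" for x and j :: nat
  proof (induction j)
    case 0
    have "?c x 0 \<in> ?Y" using that by blast
    then have "?c x 0 \<in> ?E" by (rule generate.incl)
    moreover have "x \<in> carrier G" using that N0(4) CG by auto
    ultimately show ?case by simp
  next
    case (Suc j)
    have "x \<in> carrier G" using that N0(4) CG by auto
    then show ?case using gE[OF Suc.IH] gS(1) by (simp add: conj_by_conj_by)
  qed
  \<comment> \<open>Nonnegative powers of \<open>g\<close> suffice, as the closure is contained in
    a finite group.\<close>
  let ?X = "\<Union>j::nat. conj_by G (g [^] j) ` N0"
  let ?N = "generate G ?X"
  have X: "?X \<subseteq> C" "?X \<subseteq> carrier G" "?X \<subseteq> ?E"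
  proof -
    show 1: "?X \<subseteq> ?E" using N0E by auto
    have "?E \<subseteq> C" using Y(2) C(1) generate_subgroup_incl by blast
    with 1 show "?X \<subseteq> C" by blast
    then show "?X \<subseteq> carrier G" using CG by blast
  qed
  have sub: "subgroup ?N G" by (rule generate_is_subgroup[OF X(2)])
  have NE: "?N \<subseteq> ?E" by (rule generate_subgroup_incl[OF X(3) generate_is_subgroup[OF Y(3)]])
  have N0N: "N0 \<subseteq> ?N"
  proof
    fix x assume x: "x \<in> N0"
    then have "conj_by G (g [^] (0::nat)) x \<in> ?X" by blast
    then have "conj_by G (g [^] (0::nat)) x \<in> ?N" by (rule generate.incl)
    moreover have "x \<in> carrier G" using x N0(4) CG by auto
    ultimately show "x \<in> ?N" by simp
  qed
  have gN: "conj_by G g y \<in> ?N" if "y \<in> ?N" for y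
  proof (rule conj_by_generate[OF X(2) gS(1) _ that])
    fix y assume "y \<in> ?X"
    then obtain j :: nat and x where jx: "x \<in> N0" "y = conj_by G (g [^] j) x" by auto
    then have "conj_by G g y = conj_by G (g [^] Suc j) x"
      using gS(1) N0(4) CG by (simp add: conj_by_conj_by subset_eq)
    moreover have "conj_by G (g [^] Suc j) x \<in> ?X" using jx(1) by blast
    ultimately show "conj_by G g y \<in> ?N" by (simp only: generate.incl)
  qed
  have sN: "conj_by G s y \<in> ?N" if s: "s \<in> S" and y: "y \<in> ?N" for s y
  proof (rule conj_by_generate[OF X(2) _ _ y])
    show sG: "s \<in> carrier G" using s gS by auto
    fix y assume "y \<in> ?X"
    then obtain j :: nat and x where jx: "x \<in> N0" "y = conj_by G (g [^] j) x" by auto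
    have xG: "x \<in> carrier G" using jx N0(4) CG by auto
    have c: "left_comm G (g [^] i) s \<in> ?N" for i :: nat
    proof (induction i)
      case 0
      have "left_comm G (g [^] (0::nat)) s = \<one>" using sG by (simp add: left_comm_eq_one_iff)
      then show ?case using generate.one by simp
    next
      case (Suc i)
      have "left_comm G g s \<in> ?N" using s N0(3) N0N by auto
      then show ?case
        using gN[OF Suc.IH] gS sG subgroup.m_closed[OF sub] by (simp add: left_comm_mult)
    qed
    let ?d = "left_comm G (g [^] j) s"
    have dG: "?d \<in> carrier G" using gS sG by auto
    have "g [^] j \<otimes> s = s \<otimes> g [^] j \<otimes> ?d"
      using gS sG by (simp add: left_comm_def m_assoc mult_cancels del: nat_pow_Suc)
    then have "conj_by G s y = conj_by G ?d (conj_by G (g [^] j) (conj_by G s x))"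
      using jx(2) xG gS sG dG by (metis conj_by_conj_by m_closed nat_pow_closed)
    moreover have "conj_by G (g [^] j) (conj_by G s x) \<in> ?N"
      using N0(5)[OF s jx(1)] by (auto intro!: generate.incl)
    ultimately show "conj_by G s y \<in> ?N"
      using c[of j] subgroup.m_closed[OF sub] subgroup.m_inv_closed[OF sub]
      by (simp add: conj_by_def)
  qed
  show ?case
  proof (intro exI conjI)
    show "subgroup ?N G" by fact
    show "finite ?N" using NE finE by (rule finite_subset)
    show "K \<subseteq> ?N" using N0(3) N0N by auto
    show "?N \<subseteq> C" using X(1) C(1) generate_subgroup_incl by blast
    show "\<forall>s\<in>insert g S. \<forall>n\<in>?N. conj_by G s n \<in> ?N" using gN sN by auto
  qed
qed

text \<open>The commutators of \<open>K\<close> with \<open>S \<union> K\<close> lie in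
  \<open>C\<close> and hence in a finite \<open>N\<^sub>0 \<le> C\<close> that is invariant under
  \<open>S \<union> K\<close>. Above \<open>N\<^sub>0\<close> the elements of \<open>K\<close>
  become invariant, so each of them, having finite order, can be adjoined without losing
  finiteness or invariance.\<close>

lemma engel_finite_invariant_subgroup:
  assumes engel: "engel_group G"
    and C: "subgroup C G" "\<And>x y. x \<in> carrier G \<Longrightarrow> y \<in> carrier G \<Longrightarrow> left_comm G x y \<in> C"
    and lf: "\<And>A. finite A \<Longrightarrow> A \<subseteq> C \<Longrightarrow> finite (generate G A)"
    and P: "subgroup P G" "C \<subseteq> P" "\<And>x. x \<in> P \<Longrightarrow> \<exists>r>0. x [^] (r::nat) = \<one>"
    and S: "finite S" "S \<subseteq> carrier G" and K: "finite K" "K \<subseteq> P"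
  shows "\<exists>N. subgroup N G \<and> finite N \<and> K \<subseteq> N \<and> N \<subseteq> P \<and> (\<forall>s\<in>S. \<forall>n\<in>N. conj_by G s n \<in> N)"
proof -
  have PG: "P \<subseteq> carrier G" by (rule subgroup.subset[OF P(1)])
  let ?S = "S \<union> K"
  have S': "finite ?S" "?S \<subseteq> carrier G" using S K PG by auto
  let ?L = "(\<lambda>(k, s). left_comm G k s) ` (K \<times> ?S)"
  have L: "finite ?L" "?L \<subseteq> C" using S' K PG by (auto intro!: C(2))
  obtain N0 where N0: "subgroup N0 G" "finite N0" "?L \<subseteq> N0" "N0 \<subseteq> C"
      "\<And>s n. s \<in> ?S \<Longrightarrow> n \<in> N0 \<Longrightarrow> conj_by G s n \<in> N0"
    using engel_finite_invariant_subgroup_derived[OF engel C lf S' L] by blast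
  have "\<exists>N. subgroup N G \<and> finite N \<and> N0 \<union> K' \<subseteq> N \<and> N \<subseteq> P \<and> (\<forall>s\<in>?S. \<forall>n\<in>N. conj_by G s n \<in> N)"
    if "finite K'" "K' \<subseteq> K" for K'
    using that
  proof (induction K' rule: finite_induct)
    case empty
    then show ?case using N0 P(2) by (intro exI[of _ N0]) auto
  next
    case (insert k K')
    then obtain N where N: "subgroup N G" "finite N" "N0 \<union> K' \<subseteq> N" "N \<subseteq> P"
       "\<And>s n. s \<in> ?S \<Longrightarrow> n \<in> N \<Longrightarrow> conj_by G s n \<in> N" by auto
    have k: "k \<in> K" "k \<in> P" "k \<in> carrier G" using insert.prems K PG by auto
    obtain r :: nat where r: "r > 0" "k [^] r = \<one>" using P(3) k by blast
    have NG: "N \<subseteq> carrier G" using N(4) PG by auto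
    have kN: "conj_by G (k [^] j) n \<in> N" if "n \<in> N" for n and j :: nat
    proof (induction j)
      case (Suc j)
      then show ?case using N(5)[of k] k that NG by (auto simp: conj_by_conj_by)
    qed (use that NG in auto)
    \<comment> \<open>Since \<open>k\<close> has order dividing \<open>r\<close>, its inverse is a
      nonnegative power and \<open>N \<langle>k\<rangle>\<close> is described by natural
      exponents.\<close>
    have inv_pow: "inv (k [^] j) = k [^] (j * (r - 1))" for j :: nat
    proof -
      have "k [^] j \<otimes> k [^] (j * (r - 1)) = k [^] (r * j)"
      proof -
        have "j + j * (r - 1) = r * j" using r(1) by (cases r) auto
        then show ?thesis using k(3) by (simp add: nat_pow_mult)
      qed
      also have "\<dots> = \<one>" using r k(3) by (simp flip: nat_pow_pow)
      finally show ?thesis using k(3) by (simp add: inv_equality inv_comm)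
    qed
    have kN': "k [^] j \<otimes> n \<otimes> inv (k [^] j) \<in> N" if "n \<in> N" for n and j :: nat
      using kN[OF that, of "j * (r - 1)"] k(3) by (simp only: conj_by_def inv_pow[symmetric] inv_inv nat_pow_closed)
    let ?N = "(\<lambda>(n, j). n \<otimes> k [^] (j::nat)) ` (N \<times> UNIV)"
    have memI: "n \<otimes> k [^] j \<in> ?N" if "n \<in> N" for n and j :: nat using that by auto
    have sub: "subgroup ?N G"
    proof (rule subgroupI)
      show "?N \<subseteq> carrier G" using NG k by auto
      show "?N \<noteq> {}" using subgroup.one_closed[OF N(1)] by auto
      fix a assume "a \<in> ?N"
      then obtain n and i :: nat where a: "n \<in> N" "a = n \<otimes> k [^] i" by auto
      have nG: "n \<in> carrier G" using a NG by auto
      define j where "j = i * (r - 1)"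
      have ij: "inv (k [^] i) = k [^] j" unfolding j_def by (rule inv_pow)
      have "inv a = (k [^] j \<otimes> inv n \<otimes> inv (k [^] j)) \<otimes> k [^] j"
        using a nG k ij by (simp add: inv_mult_group m_assoc)
      then show "inv a \<in> ?N"
        using memI[OF kN'[OF subgroup.m_inv_closed[OF N(1) a(1)]]] by simp
      fix b assume "b \<in> ?N"
      then obtain m and l :: nat where b: "m \<in> N" "b = m \<otimes> k [^] l" by auto
      have mG: "m \<in> carrier G" using b NG by auto
      have "a \<otimes> b = (n \<otimes> (k [^] i \<otimes> m \<otimes> inv (k [^] i))) \<otimes> k [^] (i + l)"
        using a b nG mG k by (simp add: m_assoc nat_pow_mult[symmetric] mult_cancels)
      then show "a \<otimes> b \<in> ?N"
        using memI[OF subgroup.m_closed[OF N(1) a(1) kN'[OF b(1)]]] by simp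
    qed
    have incl: "N \<subseteq> ?N"
    proof
      fix n assume n: "n \<in> N"
      then have "n \<otimes> k [^] (0::nat) = n" using NG by auto
      then show "n \<in> ?N" using memI[OF n, of 0] by simp
    qed
    have "\<one> \<otimes> k [^] (1::nat) = k" using k by simp
    then have kin: "k \<in> ?N" using memI[OF subgroup.one_closed[OF N(1)], of 1] by simp
    have pw_in: "x [^] (i::nat) \<in> ?N" if "x \<in> ?N" for x i
      using that subgroup.m_closed[OF sub] subgroup.one_closed[OF sub] by (induction i) auto
    have sN: "conj_by G s a \<in> ?N" if s: "s \<in> ?S" and "a \<in> ?N" for s a
    proof -
      obtain n and i :: nat where a: "n \<in> N" "a = n \<otimes> k [^] i" using \<open>a \<in> ?N\<close> by auto
      have sG: "s \<in> carrier G" using s S' by auto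
      have "left_comm G k s \<in> ?L" using k(1) s by (intro image_eqI[of _ _ "(k, s)"]) auto
      then have "left_comm G k s \<in> ?N" using N0(3) N(3) incl by blast
      then have "conj_by G s k \<in> ?N"
        using kin conj_by_comm[OF sG k(3)] subgroup.m_closed[OF sub] by simp
      then have "conj_by G s k [^] i \<in> ?N" by (rule pw_in)
      moreover have "conj_by G s n \<in> ?N" using N(5)[OF s a(1)] incl by blast
      ultimately have "conj_by G s n \<otimes> conj_by G s k [^] i \<in> ?N" using subgroup.m_closed[OF sub] by blast
      then show ?thesis using a NG sG k(3) by (simp add: conj_by_mult conj_by_pow subset_eq)
    qed
    have fin: "finite ?N"
    proof (rule finite_subset)
      show "?N \<subseteq> (\<lambda>(n, j). n \<otimes> k [^] j) ` (N \<times> {..<r})"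
      proof clarify
        fix n and j :: nat assume n: "n \<in> N"
        have "k [^] j = k [^] (r * (j div r) + j mod r)" by simp
        also have "\<dots> = (k [^] r) [^] (j div r) \<otimes> k [^] (j mod r)"
          using k(3) by (simp only: nat_pow_mult[symmetric] nat_pow_pow)
        also have "\<dots> = k [^] (j mod r)" using r(2) k(3) by simp
        finally show "n \<otimes> k [^] j \<in> (\<lambda>(n, j). n \<otimes> k [^] j) ` (N \<times> {..<r})"
          using n r(1) by (intro image_eqI[of _ _ "(n, j mod r)"]) auto
      qed
    qed (use N(2) in auto)
    have "?N \<subseteq> P"
    proof clarify
      fix n and j :: nat assume "n \<in> N"
      moreover have "k [^] j \<in> P" using k(2) P(1)
        by (induction j) (auto intro: subgroup.m_closed subgroup.one_closed)
      ultimately show "n \<otimes> k [^] j \<in> P" using N(4) subgroup.m_closed[OF P(1)] by blast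
    qed
    then show ?case using sub fin incl kin N(3) sN by (intro exI[of _ ?N]) (auto simp del: image_eqI)
  qed
  from this[OF K(1)] show ?thesis by auto
qed

subsection \<open>Finite p-groups and their fixed points\<close>

text \<open>Cauchy's theorem excludes every other prime divisor of the order.\<close>

lemma card_p_subgroup:
  assumes p: "Factorial_Ring.prime p" and N: "subgroup N G" "finite N"
    and el: "\<And>x. x \<in> N \<Longrightarrow> \<exists>n::nat. x [^] (p ^ n) = \<one>"
  shows "\<exists>k. card N = p ^ k"
proof -
  interpret N: group "G\<lparr>carrier := N\<rparr>" using N subgroup_imp_group by blast
  have pos: "card N > 0" using N subgroup.one_closed by (fastforce simp: card_gt_0_iff)
  have "q = p" if q: "q \<in> prime_factors (card N)" for q
  proof (rule ccontr)
    assume ne: "q \<noteq> p"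
    have pq: "Factorial_Ring.prime q" "q dvd card N" using q by auto
    then obtain m where m: "order (G\<lparr>carrier := N\<rparr>) = q ^ 1 * m"
      by (auto simp: order_def elim: dvdE)
    obtain H where H: "subgroup H (G\<lparr>carrier := N\<rparr>)" "card H = q ^ 1"
      using sylow_thm[OF pq(1) N.is_group m] N(2) by auto
    have "q > 1" using pq(1) prime_gt_1_nat by blast
    then have "H \<noteq> {\<one>}" "H \<noteq> {}" using H(2) by auto
    then obtain x where x: "x \<in> H" "x \<noteq> \<one>" by auto
    interpret HG: group "G\<lparr>carrier := N\<rparr>\<lparr>carrier := H\<rparr>" using H(1) N.subgroup_imp_group by blast
    have xN: "x \<in> N" using x H(1) subgroup.mem_carrier by fastforce
    have "x [^]\<^bsub>G\<lparr>carrier := N\<rparr>\<lparr>carrier := H\<rparr>\<^esub> card H = \<one>"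
      using HG.pow_order_eq_1[of x] x(1) by (simp add: order_def)
    then have "x [^] q = \<one>" using H(2) by (simp add: nat_pow_def)
    moreover obtain n :: nat where "x [^] (p ^ n) = \<one>" using el xN by blast
    moreover have "coprime q (p ^ n)" using ne pq(1) p by (simp add: primes_coprime)
    ultimately have "x = \<one>" using pow_coprime_eq_one xN N(1) subgroup.mem_carrier by metis
    then show False using x by simp
  qed
  then have "prime_factors (card N) \<subseteq> {p}" by blast
  then have "prime_factors (card N) = {} \<or> prime_factors (card N) = {p}" by blast
  then have "card N = p ^ 0 \<or> card N = p ^ multiplicity p (card N)"
    using prime_factorization_nat[OF pos] by auto
  then show ?thesis by blast
qed

end

text \<open>The orbits that are not fixed points have size divisible by \<open>p\<close>, so the
  number of fixed points is divisible by \<open>p\<close>; as there is one, there is another.\<close>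

lemma (in group_action) p_group_fixed_point:
  assumes p: "Factorial_Ring.prime p" and o: "order G = p ^ k"
    and E: "finite E" "p dvd card E" and x0: "x0 \<in> E" "\<And>g. g \<in> carrier G \<Longrightarrow> \<phi> g x0 = x0"
  shows "\<exists>x\<in>E. x \<noteq> x0 \<and> (\<forall>g\<in>carrier G. \<phi> g x = x)"
proof (rule ccontr)
  assume neg: "\<not> ?thesis"
  let ?O = "orbits G E \<phi>"
  have finO: "finite ?O" using E(1) by (simp add: orbits_def)
  have x0O: "orbit G \<phi> x0 = {x0}"
    using x0 orbit_refl[OF x0(1)] by (auto simp: orbit_def)
  have mem0: "{x0} \<in> ?O" using x0O x0(1) by (auto simp: orbits_def)
  have dvd: "p dvd card c" if c: "c \<in> ?O - {{x0}}" for c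
  proof -
    obtain x where x: "x \<in> E" "c = orbit G \<phi> x" using c by (auto simp: orbits_def)
    have "x \<noteq> x0" using c x x0O by auto
    then obtain g where g: "g \<in> carrier G" "\<phi> g x \<noteq> x" using neg x by blast
    have "\<phi> g x \<in> c" "x \<in> c" using g x orbit_refl by (auto simp: orbit_def)
    moreover have "c \<subseteq> E" using c orbits_coverture by blast
    then have "finite c" using E(1) finite_subset by blast
    ultimately have "card c \<noteq> 1" using g(2) by (metis card_1_singletonE singletonD)
    moreover have "card c dvd p ^ k" using orbit_stabilizer_theorem[OF x(1)] x o by (metis dvd_triv_left)
    ultimately show ?thesis using divides_primepow_nat[OF p] by (metis dvd_power not_gr_zero power_0)
  qed
  have "card E = (\<Sum>x\<in>E. 1)" by simp
  also have "\<dots> = (\<Sum>c\<in>?O. \<Sum>x\<in>c. 1)" by (rule disjoint_sum[OF E(1), symmetric])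
  also have "\<dots> = (\<Sum>c\<in>?O. card c)" by simp
  also have "\<dots> = 1 + (\<Sum>c\<in>?O - {{x0}}. card c)"
    using sum.remove[OF finO mem0, of card] by simp
  finally have "p dvd 1"
    using E(2) dvd dvd_sum[of "?O - {{x0}}" p card] by (metis dvd_add_left_iff)
  then show False using p by auto
qed

section \<open>Frobenius in characteristic p\<close>

context ring
begin

lemma binomial_commuting:
  assumes x: "x \<in> carrier R" and y: "y \<in> carrier R" and xy: "x \<otimes> y = y \<otimes> x"
  shows "(x \<oplus> y) [^] (n::nat) = (\<Oplus>k\<in>{..n}. add_pow R (n choose k :: nat) (x [^] k \<otimes> y [^] (n - k)))"
proof (induction n)
  case 0 then show ?case using x y by simp
next
  case (Suc n)
  let ?t = "\<lambda>i j. x [^] (i::nat) \<otimes> y [^] (j::nat)"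
  have t: "?t i j \<in> carrier R" for i j using x y by simp
  have xt: "x \<otimes> ?t i j = ?t (Suc i) j" for i j
    using x y by (simp only: nat_pow_Suc2[OF x] m_assoc nat_pow_closed)
  have yt: "y \<otimes> ?t i j = ?t i (Suc j)" for i j
  proof -
    have "x [^] i \<otimes> y = y \<otimes> x [^] i" using group_commutes_pow[OF xy x y] .
    then have "y \<otimes> ?t i j = x [^] i \<otimes> (y \<otimes> y [^] j)" using x y by (metis m_assoc nat_pow_closed)
    then show ?thesis using nat_pow_Suc2[OF y] by simp
  qed
  let ?A = "\<Oplus>k\<in>{..n}. add_pow R (n choose k :: nat) (?t (Suc k) (n - k))"
  let ?B = "\<Oplus>k\<in>{..n}. add_pow R (n choose k :: nat) (?t k (Suc n - k))"
  have "(x \<oplus> y) [^] Suc n = (x \<oplus> y) \<otimes> (x \<oplus> y) [^] n" using x y by (simp only: nat_pow_Suc2 a_closed)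
  also have "\<dots> = x \<otimes> (\<Oplus>k\<in>{..n}. add_pow R (n choose k :: nat) (?t k (n - k))) \<oplus> y \<otimes> (\<Oplus>k\<in>{..n}. add_pow R (n choose k :: nat) (?t k (n - k)))"
    unfolding Suc using x y t by (simp add: l_distr Pi_def)
  also have "x \<otimes> (\<Oplus>k\<in>{..n}. add_pow R (n choose k :: nat) (?t k (n - k))) = ?A"
    using x t xt by (subst finsum_rdistr) (auto simp: add_pow_rdistr Pi_def)
  also have "y \<otimes> (\<Oplus>k\<in>{..n}. add_pow R (n choose k :: nat) (?t k (n - k))) = ?B"
    using y t yt by (subst finsum_rdistr)
      (auto simp: add_pow_rdistr Pi_def Suc_diff_le intro!: finsum_cong')
  also have "?B = (\<Oplus>k\<in>{..Suc n}. add_pow R (n choose k :: nat) (?t k (Suc n - k)))"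
    using t x y by (subst finsum_Suc) (auto simp: Pi_def binomial_eq_0)
  also have "\<dots> = (\<Oplus>k\<in>{..n}. add_pow R (n choose Suc k :: nat) (?t (Suc k) (n - k))) \<oplus> ?t 0 (Suc n)"
    using t x y by (subst finsum_Suc2) (auto simp: Pi_def simp del: nat_pow_Suc)
  also have "?A \<oplus> ((\<Oplus>k\<in>{..n}. add_pow R (n choose Suc k :: nat) (?t (Suc k) (n - k))) \<oplus> ?t 0 (Suc n))
     = (\<Oplus>k\<in>{..n}. add_pow R (Suc n choose Suc k :: nat) (?t (Suc k) (n - k))) \<oplus> ?t 0 (Suc n)"
  proof -
    have "(\<Oplus>k\<in>{..n}. add_pow R (Suc n choose Suc k :: nat) (?t (Suc k) (n - k)))
      = (\<Oplus>k\<in>{..n}. add_pow R (n choose k) (?t (Suc k) (n - k)) \<oplus> add_pow R (n choose Suc k) (?t (Suc k) (n - k)))"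
      using t x y by (intro finsum_cong') (auto simp: add.nat_pow_mult simp del: nat_pow_Suc)
    also have "\<dots> = ?A \<oplus> (\<Oplus>k\<in>{..n}. add_pow R (n choose Suc k) (?t (Suc k) (n - k)))"
      using t x y by (intro finsum_addf) (auto simp del: nat_pow_Suc)
    finally show ?thesis using t x y by (simp add: a_assoc Pi_def del: nat_pow_Suc binomial_Suc_Suc)
  qed
  also have "\<dots> = (\<Oplus>k\<in>{..Suc n}. add_pow R (Suc n choose k :: nat) (?t k (Suc n - k)))"
    using t x y by (subst finsum_Suc2) (auto simp: Pi_def simp del: nat_pow_Suc)
  finally show ?case .
qed

text \<open>The binomial coefficients strictly between the ends are divisible by \<open>p\<close>.
  Only the two summands have to commute, so this applies to \<open>1 + x\<close> in a
  noncommutative ring.\<close>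

lemma frobenius_add:
  assumes p: "Factorial_Ring.prime (p::nat)" and ch: "\<And>z. z \<in> carrier R \<Longrightarrow> add_pow R p z = \<zero>"
    and x: "x \<in> carrier R" and y: "y \<in> carrier R" and xy: "x \<otimes> y = y \<otimes> x"
  shows "(x \<oplus> y) [^] p = x [^] p \<oplus> y [^] p"
proof -
  have p0: "p > 0" using p prime_gt_0_nat by blast
  let ?f = "\<lambda>k. add_pow R (p choose k :: nat) (x [^] k \<otimes> y [^] (p - k))"
  have f: "?f k \<in> carrier R" for k using x y by simp
  have z: "?f k = \<zero>" if k: "k \<in> {..p} - {0, p}" for k
  proof -
    have "p dvd (p choose k)" using k p by (intro dvd_choose_prime) auto
    then obtain m where "p choose k = p * m" by (elim dvdE)
    then have "?f k = add_pow R m (add_pow R p (x [^] k \<otimes> y [^] (p - k)))"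
      using x y add.nat_pow_pow[of "x [^] k \<otimes> y [^] (p - k)" p m]
        add.nat_pow_pow[of "x [^] k \<otimes> y [^] (p - k)" m p] by (simp add: mult.commute)
    then show ?thesis using ch x y by simp
  qed
  have "(x \<oplus> y) [^] p = (\<Oplus>k\<in>{..p}. ?f k)" using binomial_commuting[OF x y xy] .
  also have "\<dots> = (\<Oplus>k\<in>{0, p}. ?f k)"
    by (rule add.finprod_mono_neutral_cong_right) (use z f in auto)
  also have "\<dots> = x [^] p \<oplus> y [^] p"
    using x y p0 by (subst finsum_insert) (auto simp: a_comm)
  finally show ?thesis .
qed

lemma frobenius_pow_add:
  assumes p: "Factorial_Ring.prime (p::nat)" and ch: "\<And>z. z \<in> carrier R \<Longrightarrow> add_pow R p z = \<zero>"
    and x: "x \<in> carrier R" and y: "y \<in> carrier R" and xy: "x \<otimes> y = y \<otimes> x"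
  shows "(x \<oplus> y) [^] (p ^ k) = x [^] (p ^ k) \<oplus> y [^] (p ^ k)"
proof (induction k)
  case (Suc k)
  have comm: "x [^] (p ^ k) \<otimes> y [^] (p ^ k) = y [^] (p ^ k) \<otimes> x [^] (p ^ k)"
    using group_commutes_pow[OF group_commutes_pow[OF xy x y, symmetric] y] x y by simp
  have "(x \<oplus> y) [^] (p ^ Suc k) = ((x \<oplus> y) [^] (p ^ k)) [^] p"
    using x y by (simp add: nat_pow_pow mult.commute)
  also have "\<dots> = (x [^] (p ^ k)) [^] p \<oplus> (y [^] (p ^ k)) [^] p"
    unfolding Suc by (rule frobenius_add[OF p ch _ _ comm]) (use x y in auto)
  finally show ?case using x y by (simp add: nat_pow_pow mult.commute)
qed (use x y in simp)

lemma one_plus_nilpotent_pow: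
  assumes p: "Factorial_Ring.prime (p::nat)" and ch: "\<And>z. z \<in> carrier R \<Longrightarrow> add_pow R p z = \<zero>"
    and x: "x \<in> carrier R" "x [^] (n::nat) = \<zero>"
  shows "\<exists>k. (\<one> \<oplus> x) [^] (p ^ k) = \<one>"
proof -
  have "n < p ^ n" using p prime_gt_1_nat by (intro power_gt_expt) auto
  then have "x [^] (p ^ n) = x [^] n \<otimes> x [^] (p ^ n - n)" using x(1) by (simp add: nat_pow_mult)
  then have "x [^] (p ^ n) = \<zero>" using x by simp
  then show ?thesis using frobenius_pow_add[OF p ch, of \<one> x n] x by (intro exI[of _ n]) simp
qed

lemma pow_eq_one_unit:
  assumes "u \<in> carrier R" "u [^] (n::nat) = \<one>" "n > 0" shows "u \<in> Units R"
proof -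
  obtain m where m: "n = Suc m" using assms(3) by (cases n) auto
  have "u \<otimes> u [^] m = \<one>"
    using assms(2) unfolding m nat_pow_Suc2[OF assms(1)] .
  moreover have "u [^] m \<otimes> u = \<one>" using assms(2) unfolding m nat_pow_Suc .
  moreover have "u [^] m \<in> carrier R" using assms(1) by simp
  ultimately show ?thesis using assms(1) unfolding Units_def by blast
qed

end

section \<open>The augmentation ideal of a normal subgroup\<close>

context ga
begin

lemma ring_R: "ring R" by unfold_locales

lemma cosets_ga_pair:
  assumes "N \<lhd> G" shows "ga_pair F G (G Mod N)"
proof -
  interpret N: normal N G by fact
  interpret Q: group "G Mod N" by (rule N.factorgroup_is_group)
  show ?thesis by unfold_locales
qed

text \<open>Let \<open>\<sigma>\<close> replace every group element by a fixed representative of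
  its coset. Then \<open>b - \<sigma>(b)\<close> is in the ideal for each monomial
  \<open>b\<close>, hence for all \<open>b\<close>, and \<open>\<sigma>\<close> factors through
  \<open>F(G/N)\<close>.\<close>

lemma aug_ideal_eq_kernel:
  assumes N: "N \<lhd> G"
  shows "aug_ideal F G N = {a \<in> carrier R. ga_map F (r_coset G N) a = \<zero>\<^bsub>group_algebra F (G Mod N)\<^esub>}"
proof -
  interpret N: normal N G by (rule N)
  interpret Q: ga_pair F G "G Mod N" by (rule cosets_ga_pair[OF N])
  interpret Q': ga_pair F "G Mod N" G by unfold_locales
  let ?\<pi> = "ga_map F (r_coset G N)"
  interpret h: ring_hom_ring R Q.H.R ?\<pi>
    by (rule ring_hom_ringI2) (use Q.ga_map_hom[OF N.r_coset_hom_Mod] Q.H.ring_R ring_R in auto)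
  let ?gen = "(\<lambda>h. ga_basis F h \<ominus>\<^bsub>R\<^esub> \<one>\<^bsub>R\<^esub>) ` N"
  have gen: "?gen \<subseteq> carrier R" using N.subset by (auto simp: ga_basis_mon)
  have I: "ideal (aug_ideal F G N) R" unfolding aug_ideal_def by (rule genideal_ideal[OF gen])
  interpret I: ideal "aug_ideal F G N" R by (rule I)
  have incl: "mon \<one>\<^bsub>F\<^esub> h \<ominus>\<^bsub>R\<^esub> \<one>\<^bsub>R\<^esub> \<in> aug_ideal F G N" if "h \<in> N" for h
    using genideal_self[OF gen] that unfolding aug_ideal_def by (auto simp: ga_basis_mon)
  have "aug_ideal F G N \<subseteq> a_kernel R Q.H.R ?\<pi>"
    unfolding aug_ideal_def
  proof (rule genideal_minimal[OF h.kernel_is_ideal])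
    show "?gen \<subseteq> a_kernel R Q.H.R ?\<pi>"
    proof clarify
      fix g assume g: "g \<in> N"
      then have gG: "g \<in> carrier G" using N.subset by auto
      have "?\<pi> (mon \<one>\<^bsub>F\<^esub> g \<ominus>\<^bsub>R\<^esub> \<one>\<^bsub>R\<^esub>) = ga_mon F \<one>\<^bsub>F\<^esub> (N #>\<^bsub>G\<^esub> g) \<ominus>\<^bsub>Q.H.R\<^esub> \<one>\<^bsub>Q.H.R\<^esub>"
        using gG by (simp add: a_minus_def ga_map_mon)
      also have "N #>\<^bsub>G\<^esub> g = N" using g N.rcos_const by blast
      also have "ga_mon F \<one>\<^bsub>F\<^esub> N = \<one>\<^bsub>Q.H.R\<^esub>" by (simp add: Q.H.one_eq)
      also have "\<one>\<^bsub>Q.H.R\<^esub> \<ominus>\<^bsub>Q.H.R\<^esub> \<one>\<^bsub>Q.H.R\<^esub> = \<zero>\<^bsub>Q.H.R\<^esub>"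
        by (simp add: a_minus_def Q.H.r_neg)
      finally have "?\<pi> (mon \<one>\<^bsub>F\<^esub> g \<ominus>\<^bsub>R\<^esub> \<one>\<^bsub>R\<^esub>) = \<zero>\<^bsub>Q.H.R\<^esub>" .
      moreover have "mon \<one>\<^bsub>F\<^esub> g \<ominus>\<^bsub>R\<^esub> \<one>\<^bsub>R\<^esub> \<in> carrier R"
        using mon_closed[OF F.one_closed gG] by (rule minus_closed) (rule one_closed)
      ultimately show "ga_basis F g \<ominus>\<^bsub>R\<^esub> \<one>\<^bsub>R\<^esub> \<in> a_kernel R Q.H.R ?\<pi>"
        unfolding a_kernel_def' ga_basis_mon by blast
    qed
  qed
  moreover have "a \<in> aug_ideal F G N" if a: "a \<in> carrier R" "?\<pi> a = \<zero>\<^bsub>Q.H.R\<^esub>" for a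
  proof -
    define rep where "rep = (\<lambda>C. SOME g. g \<in> carrier G \<and> N #>\<^bsub>G\<^esub> g = C)"
    have rep: "rep C \<in> carrier G \<and> N #>\<^bsub>G\<^esub> rep C = C" if "C \<in> carrier (G Mod N)" for C
      unfolding rep_def by (rule someI_ex) (use that in \<open>auto simp: carrier_FactGroup\<close>)
    then have rep': "rep \<in> carrier (G Mod N) \<rightarrow> carrier G" by blast
    have "b \<ominus>\<^bsub>R\<^esub> ga_map F rep (?\<pi> b) \<in> aug_ideal F G N" if "b \<in> carrier R" for b
      using that
    proof (induction b rule: induct)
      case (mon c g)
      let ?C = "N #>\<^bsub>G\<^esub> g"
      have C: "?C \<in> carrier (G Mod N)" using mon by (auto simp: carrier_FactGroup)
      define r where "r = rep ?C"
      have r: "r \<in> carrier G" "N #>\<^bsub>G\<^esub> r = ?C" using rep[OF C] by (simp_all add: r_def)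
      let ?h = "inv\<^bsub>G\<^esub> r \<otimes>\<^bsub>G\<^esub> g"
      have "g \<in> N #>\<^bsub>G\<^esub> r" using r mon G.rcos_self[OF mon(2) N.subgroup_axioms] by auto
      then obtain n where n: "n \<in> N" "g = n \<otimes>\<^bsub>G\<^esub> r" by (auto simp: r_coset_def)
      have "inv\<^bsub>G\<^esub> r \<otimes>\<^bsub>G\<^esub> n \<otimes>\<^bsub>G\<^esub> r \<in> N" using N.inv_op_closed1[OF r(1) n(1)] .
      then have h: "?h \<in> N" using n(1) r N.subset unfolding n(2) by (simp add: G.m_assoc subset_eq)
      have hG: "?h \<in> carrier G" using h N.subset by auto
      have geq: "g = r \<otimes>\<^bsub>G\<^esub> ?h" using r mon by (simp add: G.mult_cancels)
      have red: "mon c g \<ominus>\<^bsub>R\<^esub> ga_map F rep (?\<pi> (mon c g)) = mon c g \<ominus>\<^bsub>R\<^esub> mon c (r)"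
        using mon by (simp add: ga_map_mon r_def)
      have "mon c g = mon c r \<otimes>\<^bsub>R\<^esub> mon \<one>\<^bsub>F\<^esub> ?h"
        using mon r(1) hG geq by (simp add: mult_mon_mon del: G.m_assoc)
      then have "mon c g \<ominus>\<^bsub>R\<^esub> mon c (r) = mon c (r) \<otimes>\<^bsub>R\<^esub> (mon \<one>\<^bsub>F\<^esub> ?h \<ominus>\<^bsub>R\<^esub> \<one>\<^bsub>R\<^esub>)"
        using mon r(1) hG by (simp add: a_minus_def r_distr r_minus)
      also have "\<dots> \<in> aug_ideal F G N"
        using mon r(1) incl[OF h] by (intro I.I_l_closed) auto
      finally show ?case unfolding red .
    next
      case (add x y)
      let ?\<sigma> = "\<lambda>x. ga_map F rep (?\<pi> x)"
      have cl: "?\<sigma> x \<in> carrier R" "?\<sigma> y \<in> carrier R"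
        using add by (auto intro!: Q'.ga_map_closed rep')
      have "?\<sigma> (x \<oplus>\<^bsub>R\<^esub> y) = ?\<sigma> x \<oplus>\<^bsub>R\<^esub> ?\<sigma> y"
        using add by (simp add: Q'.ga_map_add')
      then have "(x \<oplus>\<^bsub>R\<^esub> y) \<ominus>\<^bsub>R\<^esub> ?\<sigma> (x \<oplus>\<^bsub>R\<^esub> y) = (x \<ominus>\<^bsub>R\<^esub> ?\<sigma> x) \<oplus>\<^bsub>R\<^esub> (y \<ominus>\<^bsub>R\<^esub> ?\<sigma> y)"
        using add cl by (simp add: a_minus_def minus_add a_ac)
      then show ?case using add by (simp add: I.a_closed)
    qed
    from this[OF a(1)] have "a \<ominus>\<^bsub>R\<^esub> ga_map F rep (?\<pi> a) \<in> aug_ideal F G N" .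
    moreover have "ga_map F rep (?\<pi> a) = \<zero>\<^bsub>R\<^esub>"
      using a(2) by (simp add: ga_map_def Q.H.zero_eq zero_eq ga_supp_def)
    ultimately show ?thesis using a(1) by (simp add: a_minus_def)
  qed
  ultimately show ?thesis unfolding a_kernel_def' by blast
qed

end

locale ga_char = ga F G + F: field F
  for F :: "('f, 'a) ring_scheme" and G :: "('g, 'b) monoid_scheme" +
  fixes p :: nat
  assumes prime: "Factorial_Ring.prime p" and char: "ring_char F = p"
begin

lemma F_char: "x \<in> carrier F \<Longrightarrow> add_pow F p x = \<zero>\<^bsub>F\<^esub>"
proof -
  assume x: "x \<in> carrier F"
  have "add_pow F p \<one>\<^bsub>F\<^esub> = \<zero>\<^bsub>F\<^esub>"
    using F.add.pow_ord_eq_1[OF F.one_closed] char unfolding ring_char_def by metis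
  then show ?thesis using F.add_pow_ldistr[of "\<one>\<^bsub>F\<^esub>" x p] x by simp
qed

lemma add_pow_apply: "a \<in> carrier R \<Longrightarrow> (add_pow R (n::nat) a) x = add_pow F n (a x)"
  by (induction n) (simp_all add: zero_eq add_eq)

lemma R_char: "a \<in> carrier R \<Longrightarrow> add_pow R p a = \<zero>\<^bsub>R\<^esub>"
  using F_char[OF coeff] by (simp add: fun_eq_iff add_pow_apply zero_eq)

lemmas frob = frobenius_add[OF prime R_char]
lemmas frob_pow = frobenius_pow_add[OF prime R_char]
lemmas one_plus_nilp = one_plus_nilpotent_pow[OF prime R_char]

end

section \<open>Nilpotence of the augmentation ideal\<close>

text \<open>The ascending chain of \<open>w\<close> that are annihilated by all products
  \<open>(h\<^sub>1 - 1) \<cdots> (h\<^sub>m - 1)\<close> with \<open>h\<^sub>i \<in> N\<close>.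
  It stands for powers of the augmentation ideal of \<open>N\<close> and avoids products of
  ideals.\<close>

primrec ann_chain :: "('f, 'a) ring_scheme \<Rightarrow> ('g, 'b) monoid_scheme \<Rightarrow> 'g set \<Rightarrow> nat \<Rightarrow> ('g \<Rightarrow> 'f) set" where
  "ann_chain F G N 0 = {\<zero>\<^bsub>group_algebra F G\<^esub>}"
| "ann_chain F G N (Suc m) = {w \<in> carrier (group_algebra F G). \<forall>h\<in>N.
     ga_mon F \<one>\<^bsub>F\<^esub> h \<otimes>\<^bsub>group_algebra F G\<^esub> w \<ominus>\<^bsub>group_algebra F G\<^esub> w \<in> ann_chain F G N m}"

lemma group_actionI:
  assumes "group G"
    and closed: "\<And>g x. g \<in> carrier G \<Longrightarrow> x \<in> E \<Longrightarrow> f g x \<in> E"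
    and one: "\<And>x. x \<in> E \<Longrightarrow> f \<one>\<^bsub>G\<^esub> x = x"
    and mult: "\<And>g h x. g \<in> carrier G \<Longrightarrow> h \<in> carrier G \<Longrightarrow> x \<in> E \<Longrightarrow> f (g \<otimes>\<^bsub>G\<^esub> h) x = f g (f h x)"
  shows "group_action G E (\<lambda>g. restrict (f g) E)"
proof -
  interpret group G by fact
  have bij: "restrict (f g) E \<in> Bij E" if g: "g \<in> carrier G" for g
  proof -
    have "f (inv\<^bsub>G\<^esub> g) (f g x) = x" "f g (f (inv\<^bsub>G\<^esub> g) x) = x" if "x \<in> E" for x
      using that g one by (simp_all flip: mult)
    then have "bij_betw (f g) E E"
      using g closed by (intro bij_betw_byWitness[of E "f (inv\<^bsub>G\<^esub> g)"]) auto
    then show ?thesis by (simp add: Bij_def bij_betw_restrict_eq)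
  qed
  have "(\<lambda>g. restrict (f g) E) \<in> hom G (BijGroup E)"
  proof (rule homI)
    show "restrict (f g) E \<in> carrier (BijGroup E)" if "g \<in> carrier G" for g
      using bij[OF that] by (simp add: BijGroup_def)
    show "restrict (f (g \<otimes>\<^bsub>G\<^esub> h)) E = restrict (f g) E \<otimes>\<^bsub>BijGroup E\<^esub> restrict (f h) E"
      if "g \<in> carrier G" "h \<in> carrier G" for g h
      using that bij[OF that(1)] bij[OF that(2)] mult closed
      by (auto simp: BijGroup_def compose_def fun_eq_iff)
  qed
  then show ?thesis
    by (simp add: group_action_def group_hom_def group_hom_axioms_def group_BijGroup is_group)
qed

context ga_char
begin

abbreviation Z where "Z \<equiv> ann_chain F G"

lemma Z_closed: "w \<in> Z N m \<Longrightarrow> w \<in> carrier R"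
  by (cases m) auto

lemma Z_zero: "N \<subseteq> carrier G \<Longrightarrow> \<zero>\<^bsub>R\<^esub> \<in> Z N m"
  by (induction m) (auto simp: a_minus_def subset_eq)

lemma Z_add: "N \<subseteq> carrier G \<Longrightarrow> v \<in> Z N m \<Longrightarrow> w \<in> Z N m \<Longrightarrow> v \<oplus>\<^bsub>R\<^esub> w \<in> Z N m"
proof (induction m arbitrary: v w)
  case (Suc m)
  have vw: "v \<in> carrier R" "w \<in> carrier R" using Suc.prems by auto
  have "mon \<one>\<^bsub>F\<^esub> h \<otimes>\<^bsub>R\<^esub> (v \<oplus>\<^bsub>R\<^esub> w) \<ominus>\<^bsub>R\<^esub> (v \<oplus>\<^bsub>R\<^esub> w) \<in> Z N m" if h: "h \<in> N" for h
  proof -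
    have hc: "mon \<one>\<^bsub>F\<^esub> h \<in> carrier R" using h Suc.prems(1) by auto
    have "mon \<one>\<^bsub>F\<^esub> h \<otimes>\<^bsub>R\<^esub> (v \<oplus>\<^bsub>R\<^esub> w) \<ominus>\<^bsub>R\<^esub> (v \<oplus>\<^bsub>R\<^esub> w)
      = (mon \<one>\<^bsub>F\<^esub> h \<otimes>\<^bsub>R\<^esub> v \<ominus>\<^bsub>R\<^esub> v) \<oplus>\<^bsub>R\<^esub> (mon \<one>\<^bsub>F\<^esub> h \<otimes>\<^bsub>R\<^esub> w \<ominus>\<^bsub>R\<^esub> w)"
      using hc vw by (simp add: r_distr a_minus_def minus_add a_ac)
    then show ?thesis using Suc h by simp
  qed
  then show ?case using vw by simp
qed simp

text \<open>Multiplication by \<open>s\<close> permutes the conditions that define the chain when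
  \<open>s\<close> normalises \<open>N\<close>, by \<open>h s = s h\<^sup>s\<close>.\<close>

lemma Z_mon:
  assumes N: "N \<subseteq> carrier G" and s: "s \<in> carrier G" "\<And>n. n \<in> N \<Longrightarrow> conj_by G s n \<in> N"
    and c: "c \<in> carrier F"
  shows "w \<in> Z N m \<Longrightarrow> mon c s \<otimes>\<^bsub>R\<^esub> w \<in> Z N m"
proof (induction m arbitrary: w)
  case 0 then show ?case using s c by simp
next
  case (Suc m)
  have w: "w \<in> carrier R" using Suc.prems by auto
  have sc: "mon c s \<in> carrier R" using s c by auto
  have "mon \<one>\<^bsub>F\<^esub> h \<otimes>\<^bsub>R\<^esub> (mon c s \<otimes>\<^bsub>R\<^esub> w) \<ominus>\<^bsub>R\<^esub> (mon c s \<otimes>\<^bsub>R\<^esub> w) \<in> Z N m" if h: "h \<in> N" for h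
  proof -
    have hG: "h \<in> carrier G" using h N by auto
    let ?h = "conj_by G s h"
    have h': "?h \<in> carrier G" using hG s by auto
    have "mon \<one>\<^bsub>F\<^esub> h \<otimes>\<^bsub>R\<^esub> mon c s = mon c s \<otimes>\<^bsub>R\<^esub> mon \<one>\<^bsub>F\<^esub> ?h"
      using hG s c by (simp add: mult_mon_mon conj_by_def G.m_assoc G.mult_cancels)
    then have "mon \<one>\<^bsub>F\<^esub> h \<otimes>\<^bsub>R\<^esub> (mon c s \<otimes>\<^bsub>R\<^esub> w) = mon c s \<otimes>\<^bsub>R\<^esub> (mon \<one>\<^bsub>F\<^esub> ?h \<otimes>\<^bsub>R\<^esub> w)"
      using hG h' sc w by (metis F.one_closed m_assoc mon_closed)
    then have "mon \<one>\<^bsub>F\<^esub> h \<otimes>\<^bsub>R\<^esub> (mon c s \<otimes>\<^bsub>R\<^esub> w) \<ominus>\<^bsub>R\<^esub> (mon c s \<otimes>\<^bsub>R\<^esub> w)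
       = mon c s \<otimes>\<^bsub>R\<^esub> (mon \<one>\<^bsub>F\<^esub> ?h \<otimes>\<^bsub>R\<^esub> w \<ominus>\<^bsub>R\<^esub> w)"
      using h' sc w by (simp add: a_minus_def r_distr r_minus)
    moreover have "mon \<one>\<^bsub>F\<^esub> ?h \<otimes>\<^bsub>R\<^esub> w \<ominus>\<^bsub>R\<^esub> w \<in> Z N m" using Suc.prems s(2)[OF h] by simp
    ultimately show ?thesis using Suc.IH by simp
  qed
  then show ?case using sc w by simp
qed

lemma Z_neg:
  assumes N: "subgroup N G" and w: "w \<in> Z N m" shows "\<ominus>\<^bsub>R\<^esub> w \<in> Z N m"
proof -
  have NG: "N \<subseteq> carrier G" by (rule subgroup.subset[OF N])
  have wc: "w \<in> carrier R" using w by (rule Z_closed)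
  have "mon (\<ominus>\<^bsub>F\<^esub> \<one>\<^bsub>F\<^esub>) \<one>\<^bsub>G\<^esub> \<otimes>\<^bsub>R\<^esub> w \<in> Z N m"
    by (rule Z_mon[OF NG _ _ _ w]) (use NG in auto)
  moreover have "mon (\<ominus>\<^bsub>F\<^esub> \<one>\<^bsub>F\<^esub>) \<one>\<^bsub>G\<^esub> = \<ominus>\<^bsub>R\<^esub> \<one>\<^bsub>R\<^esub>"
    unfolding uminus_eq[OF one_closed] by (auto simp: one_eq ga_mon_def)
  ultimately show ?thesis using wc by (simp add: l_minus)
qed

lemma subgroup_conj:
  assumes "subgroup N G" "s \<in> N" "n \<in> N" shows "conj_by G s n \<in> N"
  using assms by (simp add: conj_by_def subgroup.m_closed subgroup.m_inv_closed)

lemma Z_mono: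
  assumes N: "subgroup N G" and w: "w \<in> Z N m" shows "w \<in> Z N (Suc m)"
proof -
  have NG: "N \<subseteq> carrier G" by (rule subgroup.subset[OF N])
  have "mon \<one>\<^bsub>F\<^esub> h \<otimes>\<^bsub>R\<^esub> w \<ominus>\<^bsub>R\<^esub> w \<in> Z N m" if h: "h \<in> N" for h
  proof -
    have "mon \<one>\<^bsub>F\<^esub> h \<otimes>\<^bsub>R\<^esub> w \<in> Z N m"
      by (rule Z_mon[OF NG _ _ _ w]) (use h NG subgroup_conj[OF N h] in auto)
    then show ?thesis unfolding a_minus_def using Z_neg[OF N w] Z_add[OF NG] by blast
  qed
  then show ?thesis using Z_closed[OF w] by simp
qed

lemma Z_subgroup:
  assumes N: "subgroup N G" shows "subgroup (Z N m) (add_monoid R)"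
proof (rule add.subgroupI)
  note NG = subgroup.subset[OF N]
  show "Z N m \<subseteq> carrier R" using Z_closed by blast
  show "Z N m \<noteq> {}" using Z_zero[OF NG] by blast
  fix v assume v: "v \<in> Z N m"
  show "\<ominus>\<^bsub>R\<^esub> v \<in> Z N m" by (rule Z_neg[OF N v])
  fix w assume "w \<in> Z N m" then show "v \<oplus>\<^bsub>R\<^esub> w \<in> Z N m" by (rule Z_add[OF NG v])
qed

text \<open>This is the unipotence of finite \<open>p\<close>-groups in characteristic
  \<open>p\<close>. The group \<open>N\<close> acts on the finite additive group \<open>W\<close>
  of elements of its group algebra over the prime field. As long as the chain does not contain all
  of \<open>W\<close>, the quotient of \<open>W\<close> by the part reached so far has
  \<open>p\<close>-power order, hence a fixed point other than zero, and the chain grows. A finite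
  \<open>W\<close> cannot accommodate this forever.\<close>

lemma Z_exhausts:
  assumes N: "subgroup N G" "finite N" and el: "\<And>x. x \<in> N \<Longrightarrow> \<exists>n::nat. x [^]\<^bsub>G\<^esub> (p ^ n) = \<one>\<^bsub>G\<^esub>"
  shows "\<exists>m. \<one>\<^bsub>R\<^esub> \<in> Z N m"
proof (rule ccontr)
  assume no: "\<nexists>m. \<one>\<^bsub>R\<^esub> \<in> Z N m"
  have NG: "N \<subseteq> carrier G" by (rule subgroup.subset[OF N(1)])
  \<comment> \<open>The prime field, as the additive group generated by \<open>1\<close>.\<close>
  define Zp where "Zp = generate (add_monoid F) {\<one>\<^bsub>F\<^esub>}"
  have Zp: "subgroup Zp (add_monoid F)"
    unfolding Zp_def by (rule F.add.generate_is_subgroup) simp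
  have "card Zp = p"
    using F.add.generate_pow_card[of "\<one>\<^bsub>F\<^esub>"] char unfolding Zp_def ring_char_def by simp
  then have finZp: "finite Zp" using prime prime_gt_0_nat card_gt_0_iff by metis
  have Zp1: "\<one>\<^bsub>F\<^esub> \<in> Zp" unfolding Zp_def by (rule generate.incl) simp
  have Zp_F: "Zp \<subseteq> carrier F" using subgroup.subset[OF Zp] by simp
  have Zp0: "\<zero>\<^bsub>F\<^esub> \<in> Zp" using subgroup.one_closed[OF Zp] by simp
  have Zpadd: "a \<oplus>\<^bsub>F\<^esub> b \<in> Zp" if "a \<in> Zp" "b \<in> Zp" for a b
    using subgroup.m_closed[OF Zp that] by simp
  have Zpneg: "\<ominus>\<^bsub>F\<^esub> a \<in> Zp" if "a \<in> Zp" for a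
    using subgroup.m_inv_closed[OF Zp that] by (simp add: a_inv_def)
  \<comment> \<open>Coefficients in the prime field keep \<open>W\<close> finite when
    \<open>F\<close> is infinite.\<close>
  define W where "W = {w. \<forall>x. (x \<in> N \<longrightarrow> w x \<in> Zp) \<and> (x \<notin> N \<longrightarrow> w x = \<zero>\<^bsub>F\<^esub>)}"
  have finW: "finite W" unfolding W_def by (rule finite_set_of_finite_funs[OF N(2) finZp])
  have suppW: "supp w \<subseteq> N" if "w \<in> W" for w using that by (auto simp: W_def ga_supp_def)
  have valW: "w x \<in> Zp" if "w \<in> W" for w x using that Zp0 by (cases "x \<in> N") (auto simp: W_def)
  have W_R: "w \<in> carrier R" if "w \<in> W" for w
    by (rule carrierI) (use suppW[OF that] valW[OF that] N(2) NG Zp_F in \<open>auto dest: finite_subset\<close>)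
  have WI: "w \<in> W" if "\<And>x. w x \<in> Zp" "supp w \<subseteq> N" for w
    using that by (auto simp: W_def ga_supp_def)
  have Wsub: "subgroup W (add_monoid R)"
  proof (rule add.subgroupI)
    show "W \<subseteq> carrier R" using W_R by blast
    have "(\<lambda>x. \<zero>\<^bsub>F\<^esub>) \<in> W" using Zp0 by (simp add: W_def)
    then show "W \<noteq> {}" by blast
    fix a assume a: "a \<in> W"
    show "\<ominus>\<^bsub>R\<^esub> a \<in> W"
      unfolding uminus_eq[OF W_R[OF a]] using a Zpneg by (simp add: W_def)
    fix b assume b: "b \<in> W"
    then show "a \<oplus>\<^bsub>R\<^esub> b \<in> W" using a Zpadd by (simp add: W_def add_eq)
  qed
  have Wmon: "mon \<one>\<^bsub>F\<^esub> h \<otimes>\<^bsub>R\<^esub> w \<in> W" if h: "h \<in> N" and w: "w \<in> W" for h w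
  proof (rule WI)
    have hG: "h \<in> carrier G" using h NG by auto
    have c: "mon \<one>\<^bsub>F\<^esub> h \<otimes>\<^bsub>R\<^esub> w \<in> carrier R" using hG W_R[OF w] by auto
    show "supp (mon \<one>\<^bsub>F\<^esub> h \<otimes>\<^bsub>R\<^esub> w) \<subseteq> N"
      using supp_mult[of "mon \<one>\<^bsub>F\<^esub> h" w] hG W_R[OF w] supp_mon[of "\<one>\<^bsub>F\<^esub>" h] suppW[OF w] h
        subgroup.m_closed[OF N(1)] by fastforce
    show "(mon \<one>\<^bsub>F\<^esub> h \<otimes>\<^bsub>R\<^esub> w) x \<in> Zp" for x
    proof (cases "x \<in> carrier G")
      case True
      then show ?thesis
        using mon_mult_apply[OF F.one_closed hG W_R[OF w] True] valW[OF w] Zp_F by (simp add: subset_eq)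
    next
      case False
      then have "(mon \<one>\<^bsub>F\<^esub> h \<otimes>\<^bsub>R\<^esub> w) x = \<zero>\<^bsub>F\<^esub>" using supp_carrier[OF c] by (intro notin_supp) blast
      then show ?thesis using Zp0 by simp
    qed
  qed
  have oneW: "\<one>\<^bsub>R\<^esub> \<in> W"
    by (rule WI) (use Zp0 Zp1 supp_mon[of "\<one>\<^bsub>F\<^esub>" "\<one>\<^bsub>G\<^esub>"] subgroup.one_closed[OF N(1)] in \<open>auto simp: one_eq ga_mon_def\<close>)
  have strict: "\<exists>w\<in>W. w \<notin> Z N m \<and> w \<in> Z N (Suc m)" for m
  proof -
    define U where "U = W \<inter> Z N m"
    have Usub: "subgroup U (add_monoid R)"
      unfolding U_def by (rule add.subgroups_Inter_pair[OF Wsub Z_subgroup[OF N(1)]])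
    define A where "A = (add_monoid R)\<lparr>carrier := W\<rparr>"
    interpret A: comm_group A
      unfolding A_def using a_comm W_R
      by (intro group.group_comm_groupI add.subgroup_imp_group[OF Wsub]) auto
    have UA: "subgroup U A"
      unfolding A_def by (rule add.subgroup_incl[OF Usub Wsub]) (simp add: U_def)
    interpret U: normal U A using UA by (rule A.subgroup_imp_normal)
    interpret Q: comm_group "A Mod U" by (rule A.abelian_FactGroup[OF UA])
    have carA: "carrier A = W" "monoid.mult A = add R" "one A = \<zero>\<^bsub>R\<^esub>" by (simp_all add: A_def)
    let ?E = "carrier (A Mod U)"
    have E: "C \<in> ?E \<longleftrightarrow> (\<exists>w\<in>W. C = U #>\<^bsub>A\<^esub> w)" for C
      by (auto simp: carrier_FactGroup carA)
    have finE: "finite ?E" using finW by (simp add: carrier_FactGroup carA)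
    have eqU: "U #>\<^bsub>A\<^esub> w = U \<longleftrightarrow> w \<in> U" if "w \<in> W" for w
      using that A.coset_join1[of U w] A.coset_join2[of w U] UA U.subset carA by blast
    have dvd: "p dvd card ?E"
    proof -
      have "\<one>\<^bsub>R\<^esub> \<notin> U" using no by (simp add: U_def)
      then have ne: "U #>\<^bsub>A\<^esub> \<one>\<^bsub>R\<^esub> \<noteq> U" using eqU oneW by simp
      let ?C = "U #>\<^bsub>A\<^esub> \<one>\<^bsub>R\<^esub>"
      have C: "?C \<in> ?E" using E oneW by blast
      have "\<one>\<^bsub>R\<^esub> [^]\<^bsub>A\<^esub> n = add_pow R n \<one>\<^bsub>R\<^esub>" for n :: nat
        by (simp add: A_def add_pow_def nat_pow_def)
      then have "\<one>\<^bsub>R\<^esub> [^]\<^bsub>A\<^esub> p = \<zero>\<^bsub>R\<^esub>" using R_char by simp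
      then have "?C [^]\<^bsub>A Mod U\<^esub> p = U #>\<^bsub>A\<^esub> \<one>\<^bsub>A\<^esub>"
        using U.FactGroup_pow[of "\<one>\<^bsub>R\<^esub>" p] oneW carA by simp
      then have "?C [^]\<^bsub>A Mod U\<^esub> p = \<one>\<^bsub>A Mod U\<^esub>" using eqU U.one_closed A.one_closed carA by auto
      then have "Q.ord ?C dvd p" using Q.pow_eq_id[OF C] by blast
      moreover have "Q.ord ?C \<noteq> 1" using Q.ord_eq_1[OF C] ne by simp
      ultimately have "Q.ord ?C = p" using prime by (metis prime_nat_iff)
      then show ?thesis using Q.ord_dvd_group_order[OF C] by (simp add: order_def)
    qed
    let ?f = "\<lambda>h C. (\<lambda>w. mon \<one>\<^bsub>F\<^esub> h \<otimes>\<^bsub>R\<^esub> w) ` C"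
    have Umon: "mon \<one>\<^bsub>F\<^esub> h \<otimes>\<^bsub>R\<^esub> w \<in> U" if "h \<in> N" "w \<in> U" for h w
      unfolding U_def
      using that Wmon[OF that(1)] Z_mon[OF NG _ subgroup_conj[OF N(1) that(1)] F.one_closed] NG
      by (auto simp: U_def)
    have monmon: "mon \<one>\<^bsub>F\<^esub> g \<otimes>\<^bsub>R\<^esub> (mon \<one>\<^bsub>F\<^esub> h \<otimes>\<^bsub>R\<^esub> w) = mon \<one>\<^bsub>F\<^esub> (g \<otimes>\<^bsub>G\<^esub> h) \<otimes>\<^bsub>R\<^esub> w"
      if "g \<in> N" "h \<in> N" "w \<in> carrier R" for g h w
      using that NG by (simp add: m_assoc[symmetric] subset_eq mult_mon_mon)
    have mon1: "mon \<one>\<^bsub>F\<^esub> \<one>\<^bsub>G\<^esub> \<otimes>\<^bsub>R\<^esub> w = w" if "w \<in> carrier R" for w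
      using that by (simp flip: one_eq)
    have UR: "u \<in> carrier R" if "u \<in> U" for u using that W_R by (simp add: U_def)
    have fcos: "?f h (U #>\<^bsub>A\<^esub> w) = U #>\<^bsub>A\<^esub> (mon \<one>\<^bsub>F\<^esub> h \<otimes>\<^bsub>R\<^esub> w)" if h: "h \<in> N" and w: "w \<in> W" for h w
    proof -
      have hG: "h \<in> carrier G" "inv\<^bsub>G\<^esub> h \<in> N" using h NG subgroup.m_inv_closed[OF N(1)] by auto
      have d: "mon \<one>\<^bsub>F\<^esub> h \<otimes>\<^bsub>R\<^esub> (u \<oplus>\<^bsub>R\<^esub> w) = mon \<one>\<^bsub>F\<^esub> h \<otimes>\<^bsub>R\<^esub> u \<oplus>\<^bsub>R\<^esub> mon \<one>\<^bsub>F\<^esub> h \<otimes>\<^bsub>R\<^esub> w" if "u \<in> U" for u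
        using that hG W_R[OF w] UR by (simp add: r_distr)
      have img: "?f h U = U"
      proof
        show "?f h U \<subseteq> U" using Umon[OF h] by auto
        show "U \<subseteq> ?f h U"
        proof
          fix u assume u: "u \<in> U"
          have "u = mon \<one>\<^bsub>F\<^esub> h \<otimes>\<^bsub>R\<^esub> (mon \<one>\<^bsub>F\<^esub> (inv\<^bsub>G\<^esub> h) \<otimes>\<^bsub>R\<^esub> u)"
            using monmon[OF h hG(2) UR[OF u]] hG mon1[OF UR[OF u]] by simp
          then show "u \<in> ?f h U" using Umon[OF hG(2) u] by blast
        qed
      qed
      have "?f h (U #>\<^bsub>A\<^esub> w) = (\<lambda>u. u \<oplus>\<^bsub>R\<^esub> mon \<one>\<^bsub>F\<^esub> h \<otimes>\<^bsub>R\<^esub> w) ` ?f h U"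
        using d by (auto simp: r_coset_def carA image_iff)
      also have "\<dots> = U #>\<^bsub>A\<^esub> (mon \<one>\<^bsub>F\<^esub> h \<otimes>\<^bsub>R\<^esub> w)"
        unfolding img by (auto simp: r_coset_def carA)
      finally show ?thesis .
    qed
    interpret NN: group "G\<lparr>carrier := N\<rparr>" using G.subgroup_imp_group[OF N(1)] .
    interpret act: group_action "G\<lparr>carrier := N\<rparr>" ?E "\<lambda>h. restrict (?f h) ?E"
    proof (rule group_actionI)
      show "group (G\<lparr>carrier := N\<rparr>)" by (rule NN.is_group)
      fix g C assume g: "g \<in> carrier (G\<lparr>carrier := N\<rparr>)" and C: "C \<in> ?E"
      obtain w where w: "w \<in> W" "C = U #>\<^bsub>A\<^esub> w" using C E by blast
      show "?f g C \<in> ?E" using fcos[of g w] g w Wmon[of g w] E by auto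
    next
      fix C assume "C \<in> ?E"
      then obtain w where w: "w \<in> W" "C = U #>\<^bsub>A\<^esub> w" using E by blast
      show "?f \<one>\<^bsub>G\<lparr>carrier := N\<rparr>\<^esub> C = C"
        using fcos[OF subgroup.one_closed[OF N(1)] w(1)] w mon1[OF W_R[OF w(1)]] by simp
    next
      fix g h C assume gh: "g \<in> carrier (G\<lparr>carrier := N\<rparr>)" "h \<in> carrier (G\<lparr>carrier := N\<rparr>)" and "C \<in> ?E"
      then obtain w where w: "w \<in> W" "C = U #>\<^bsub>A\<^esub> w" using E by blast
      have "?f (g \<otimes>\<^bsub>G\<^esub> h) C = U #>\<^bsub>A\<^esub> (mon \<one>\<^bsub>F\<^esub> (g \<otimes>\<^bsub>G\<^esub> h) \<otimes>\<^bsub>R\<^esub> w)"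
        using fcos[of "g \<otimes>\<^bsub>G\<^esub> h" w] gh w subgroup.m_closed[OF N(1)] by simp
      moreover have "?f g (?f h C) = U #>\<^bsub>A\<^esub> (mon \<one>\<^bsub>F\<^esub> g \<otimes>\<^bsub>R\<^esub> (mon \<one>\<^bsub>F\<^esub> h \<otimes>\<^bsub>R\<^esub> w))"
        using fcos[of h w] fcos[of g "mon \<one>\<^bsub>F\<^esub> h \<otimes>\<^bsub>R\<^esub> w"] gh w Wmon[of h w] by simp
      ultimately show "?f (g \<otimes>\<^bsub>G\<lparr>carrier := N\<rparr>\<^esub> h) C = ?f g (?f h C)"
        using monmon[of g h w] gh W_R[OF w(1)] by simp
    qed
    obtain k where k: "order (G\<lparr>carrier := N\<rparr>) = p ^ k"
      using G.card_p_subgroup[OF prime N el] by (auto simp: order_def)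
    have U_E: "U \<in> ?E" using Q.one_closed by simp
    have zU: "\<zero>\<^bsub>R\<^esub> \<in> W" using subgroup.one_closed[OF Wsub] by simp
    have "U #>\<^bsub>A\<^esub> \<zero>\<^bsub>R\<^esub> = U" using eqU[OF zU] U.one_closed carA by simp
    then have fixU: "?f h U = U" if "h \<in> N" for h
      using fcos[OF that zU] that NG by (simp add: subset_eq)
    obtain C where C: "C \<in> ?E" "C \<noteq> U" "\<forall>g\<in>N. ?f g C = C"
      using act.p_group_fixed_point[OF prime k finE dvd U_E] fixU U_E by auto
    obtain w where w: "w \<in> W" "C = U #>\<^bsub>A\<^esub> w" using C E by blast
    have "w \<notin> Z N m" using C(2) w eqU by (auto simp: U_def)
    moreover have "w \<in> Z N (Suc m)"
    proof -
      have "mon \<one>\<^bsub>F\<^esub> h \<otimes>\<^bsub>R\<^esub> w \<ominus>\<^bsub>R\<^esub> w \<in> Z N m" if h: "h \<in> N" for h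
      proof -
        have hw: "mon \<one>\<^bsub>F\<^esub> h \<otimes>\<^bsub>R\<^esub> w \<in> W" by (rule Wmon[OF h w(1)])
        have "U #>\<^bsub>A\<^esub> (mon \<one>\<^bsub>F\<^esub> h \<otimes>\<^bsub>R\<^esub> w) = U #>\<^bsub>A\<^esub> w" using C(3) h w fcos[OF h w(1)] by simp
        then have "mon \<one>\<^bsub>F\<^esub> h \<otimes>\<^bsub>R\<^esub> w \<in> U #>\<^bsub>A\<^esub> w"
          using A.rcos_self[OF _ UA, of "mon \<one>\<^bsub>F\<^esub> h \<otimes>\<^bsub>R\<^esub> w"] hw carA by simp
        then obtain u where u: "u \<in> U" "mon \<one>\<^bsub>F\<^esub> h \<otimes>\<^bsub>R\<^esub> w = u \<oplus>\<^bsub>R\<^esub> w" by (auto simp: r_coset_def carA)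
        then have "mon \<one>\<^bsub>F\<^esub> h \<otimes>\<^bsub>R\<^esub> w \<ominus>\<^bsub>R\<^esub> w = u"
          using UR[OF u(1)] W_R[OF w(1)] by (simp add: a_minus_def a_assoc r_neg)
        then show ?thesis using u(1) by (simp add: U_def)
      qed
      then show ?thesis using W_R[OF w(1)] by simp
    qed
    ultimately show ?thesis using w(1) by blast
  qed
  have "card (W \<inter> Z N m) \<ge> m" for m
  proof (induction m)
    case (Suc m)
    obtain w where w: "w \<in> W" "w \<notin> Z N m" "w \<in> Z N (Suc m)" using strict by blast
    have "W \<inter> Z N m \<subset> W \<inter> Z N (Suc m)" using w Z_mono[OF N(1)] by blast
    then have "card (W \<inter> Z N m) < card (W \<inter> Z N (Suc m))" using finW by (intro psubset_card_mono) auto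
    then show ?case using Suc by simp
  qed simp
  from this[of "Suc (card W)"] show False using card_mono[OF finW, of "W \<inter> Z N (Suc (card W))"] by auto
qed

text \<open>Let \<open>N\<close> be a finite subgroup of \<open>P\<close> that is normalised by
  the support of \<open>a\<close> and contains all quotients of support elements in the same coset
  of \<open>P\<close>. Modulo terms \<open>r (h - 1)\<close> with \<open>h \<in> N\<close> and
  \<open>r\<close> normalising \<open>N\<close>, the element \<open>a\<close> only depends on its
  image in \<open>F(G/P)\<close>, which is zero. Therefore multiplication by \<open>a\<close>
  moves the chain of \<open>N\<close> down by one step, and \<open>1\<close> lies in the chain.\<close>

lemma aug_ideal_nil:
  assumes P: "P \<lhd> G" and el: "\<And>x. x \<in> P \<Longrightarrow> \<exists>n::nat. x [^]\<^bsub>G\<^esub> (p ^ n) = \<one>\<^bsub>G\<^esub>"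
    and inv: "\<And>S K. finite S \<Longrightarrow> S \<subseteq> carrier G \<Longrightarrow> finite K \<Longrightarrow> K \<subseteq> P \<Longrightarrow>
      \<exists>N. subgroup N G \<and> finite N \<and> K \<subseteq> N \<and> N \<subseteq> P \<and> (\<forall>s\<in>S. \<forall>n\<in>N. conj_by G s n \<in> N)"
    and a: "a \<in> aug_ideal F G P"
  shows "\<exists>n::nat. a [^]\<^bsub>R\<^esub> n = \<zero>\<^bsub>R\<^esub>"
proof -
  interpret P: normal P G by (rule P)
  interpret Q: ga_pair F G "G Mod P" by (rule cosets_ga_pair[OF P])
  interpret Q': ga_pair F "G Mod P" G by unfold_locales
  let ?\<pi> = "ga_map F (r_coset G P)"
  have ac: "a \<in> carrier R" and a0: "?\<pi> a = \<zero>\<^bsub>Q.H.R\<^esub>" using a unfolding aug_ideal_eq_kernel[OF P] by auto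
  define S where "S = supp a"
  have S: "finite S" "S \<subseteq> carrier G" unfolding S_def using ac supp_carrier by auto
  define K where "K = {k \<in> (\<lambda>(y, z). inv\<^bsub>G\<^esub> y \<otimes>\<^bsub>G\<^esub> z) ` (S \<times> S). k \<in> P}"
  have K: "finite K" "K \<subseteq> P" using S by (auto simp: K_def)
  obtain N where N: "subgroup N G" "finite N" "K \<subseteq> N" "N \<subseteq> P"
     "\<And>s n. s \<in> S \<Longrightarrow> n \<in> N \<Longrightarrow> conj_by G s n \<in> N"
    using inv[OF S K] by (elim exE conjE) simp
  have NG: "N \<subseteq> carrier G" by (rule subgroup.subset[OF N(1)])
  \<comment> \<open>Representatives are chosen inside the support, since only its elements are
    known to normalise \<open>N\<close>; the value \<open>1\<close> elsewhere keeps
    \<open>rep\<close> inside \<open>G\<close>.\<close>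
  define rep where "rep = (\<lambda>C. if \<exists>s\<in>S. P #>\<^bsub>G\<^esub> s = C then SOME s. s \<in> S \<and> P #>\<^bsub>G\<^esub> s = C else \<one>\<^bsub>G\<^esub>)"
  have rep: "rep (P #>\<^bsub>G\<^esub> s) \<in> S" "P #>\<^bsub>G\<^esub> rep (P #>\<^bsub>G\<^esub> s) = P #>\<^bsub>G\<^esub> s" if "s \<in> S" for s
    using that someI_ex[of "\<lambda>t. t \<in> S \<and> P #>\<^bsub>G\<^esub> t = P #>\<^bsub>G\<^esub> s"] unfolding rep_def by auto
  have rep_car: "rep C \<in> carrier G" for C
    using someI_ex[of "\<lambda>t. t \<in> S \<and> P #>\<^bsub>G\<^esub> t = C"] S(2) unfolding rep_def by auto
  have coset: "inv\<^bsub>G\<^esub> y \<otimes>\<^bsub>G\<^esub> z \<in> P" if "y \<in> carrier G" "z \<in> carrier G" "P #>\<^bsub>G\<^esub> y = P #>\<^bsub>G\<^esub> z" for y z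
  proof -
    have "z \<in> P #>\<^bsub>G\<^esub> y" using that G.rcos_self[OF that(2) P.subgroup_axioms] by simp
    then obtain n where n: "n \<in> P" "z = n \<otimes>\<^bsub>G\<^esub> y" by (auto simp: r_coset_def)
    then show ?thesis using P.inv_op_closed1[OF that(1) n(1)] that(1) P.subset by (simp add: G.m_assoc subset_eq)
  qed
  have key: "a \<otimes>\<^bsub>R\<^esub> w \<in> Z N m" if w: "w \<in> Z N (Suc m)" for w m
  proof -
    have wc: "w \<in> carrier R" using w by simp
    have repc: "rep \<in> carrier (G Mod P) \<rightarrow> carrier G" using rep_car by blast
    have "b \<otimes>\<^bsub>R\<^esub> w \<ominus>\<^bsub>R\<^esub> ga_map F rep (?\<pi> b) \<otimes>\<^bsub>R\<^esub> w \<in> Z N m" if "b \<in> carrier R" "supp b \<subseteq> S" for b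
      using that
    proof (induction b rule: supp_induct)
      case (mon c g)
      define r where "r = rep (P #>\<^bsub>G\<^esub> g)"
      have r: "r \<in> S" "r \<in> carrier G" "P #>\<^bsub>G\<^esub> r = P #>\<^bsub>G\<^esub> g" using rep[OF mon(3)] S(2) by (auto simp: r_def)
      let ?h = "inv\<^bsub>G\<^esub> r \<otimes>\<^bsub>G\<^esub> g"
      have hG: "?h \<in> carrier G" using r mon by auto
      have "?h \<in> K" unfolding K_def using coset[OF r(2) mon(2) r(3)] r(1) mon(3) by auto
      then have hN: "?h \<in> N" using N(3) by blast
      have red: "ga_map F rep (?\<pi> (mon c g)) = mon c r" using mon by (simp add: ga_map_mon r_def)
      have g: "mon c g = mon c r \<otimes>\<^bsub>R\<^esub> mon \<one>\<^bsub>F\<^esub> ?h"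
        using mon r hG by (simp add: mult_mon_mon G.mult_cancels)
      have "mon c g \<otimes>\<^bsub>R\<^esub> w \<ominus>\<^bsub>R\<^esub> mon c r \<otimes>\<^bsub>R\<^esub> w
        = mon c r \<otimes>\<^bsub>R\<^esub> (mon \<one>\<^bsub>F\<^esub> ?h \<otimes>\<^bsub>R\<^esub> w \<ominus>\<^bsub>R\<^esub> w)"
        unfolding g using mon r hG wc by (simp add: a_minus_def r_distr r_minus m_assoc)
      moreover have w0: "mon \<one>\<^bsub>F\<^esub> ?h \<otimes>\<^bsub>R\<^esub> w \<ominus>\<^bsub>R\<^esub> w \<in> Z N m" using w hN by simp
      have "mon c r \<otimes>\<^bsub>R\<^esub> (mon \<one>\<^bsub>F\<^esub> ?h \<otimes>\<^bsub>R\<^esub> w \<ominus>\<^bsub>R\<^esub> w) \<in> Z N m"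
        by (rule Z_mon[OF NG r(2) _ mon(1) w0]) (rule N(5)[OF r(1)])
      ultimately show ?case unfolding red by simp
    next
      case (add x y)
      let ?\<sigma> = "\<lambda>x. ga_map F rep (?\<pi> x)"
      have \<pi>c: "?\<pi> x \<in> carrier Q.H.R" "?\<pi> y \<in> carrier Q.H.R"
        using add by (auto intro!: Q.ga_map_closed hom_in_carrier[OF P.r_coset_hom_Mod])
      have cl: "?\<sigma> x \<in> carrier R" "?\<sigma> y \<in> carrier R"
        using \<pi>c by (auto intro!: Q'.ga_map_closed repc)
      have "?\<sigma> (x \<oplus>\<^bsub>R\<^esub> y) = ?\<sigma> x \<oplus>\<^bsub>R\<^esub> ?\<sigma> y"
        using add \<pi>c by (simp add: Q.ga_map_add' Q'.ga_map_add')
      then have "(x \<oplus>\<^bsub>R\<^esub> y) \<otimes>\<^bsub>R\<^esub> w \<ominus>\<^bsub>R\<^esub> ?\<sigma> (x \<oplus>\<^bsub>R\<^esub> y) \<otimes>\<^bsub>R\<^esub> w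
         = (x \<otimes>\<^bsub>R\<^esub> w \<ominus>\<^bsub>R\<^esub> ?\<sigma> x \<otimes>\<^bsub>R\<^esub> w) \<oplus>\<^bsub>R\<^esub> (y \<otimes>\<^bsub>R\<^esub> w \<ominus>\<^bsub>R\<^esub> ?\<sigma> y \<otimes>\<^bsub>R\<^esub> w)"
        using add cl wc by (simp add: l_distr a_minus_def minus_add a_ac)
      then show ?case using add Z_add[OF NG] by simp
    next
      case zero
      have "ga_map F rep (?\<pi> \<zero>\<^bsub>R\<^esub>) = \<zero>\<^bsub>R\<^esub>" by (simp add: ga_map_def zero_eq ga_supp_def)
      then show ?case using wc Z_zero[OF NG] by (simp add: a_minus_def)
    qed
    from this[OF ac] have "a \<otimes>\<^bsub>R\<^esub> w \<ominus>\<^bsub>R\<^esub> ga_map F rep (?\<pi> a) \<otimes>\<^bsub>R\<^esub> w \<in> Z N m" by (simp add: S_def)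
    moreover have "ga_map F rep (?\<pi> a) = \<zero>\<^bsub>R\<^esub>"
      unfolding a0 by (simp add: ga_map_def Q.H.zero_eq zero_eq ga_supp_def)
    ultimately show ?thesis using ac wc by (simp add: a_minus_def)
  qed
  have pw: "w \<in> Z N m \<Longrightarrow> a [^]\<^bsub>R\<^esub> m \<otimes>\<^bsub>R\<^esub> w = \<zero>\<^bsub>R\<^esub>" for w m
  proof (induction m arbitrary: w)
    case 0 then show ?case using ac by simp
  next
    case (Suc m)
    have "a [^]\<^bsub>R\<^esub> Suc m \<otimes>\<^bsub>R\<^esub> w = a [^]\<^bsub>R\<^esub> m \<otimes>\<^bsub>R\<^esub> (a \<otimes>\<^bsub>R\<^esub> w)"
      using ac Z_closed[OF Suc.prems] by (simp add: m_assoc)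
    then show ?case using Suc.IH[OF key[OF Suc.prems]] by simp
  qed
  obtain m where "\<one>\<^bsub>R\<^esub> \<in> Z N m" using Z_exhausts[OF N(1,2)] el N(4) by blast
  then have "a [^]\<^bsub>R\<^esub> m = \<zero>\<^bsub>R\<^esub>" using pw[of "\<one>\<^bsub>R\<^esub>" m] ac by simp
  then show ?thesis by blast
qed

end

section \<open>Normalized units\<close>

lemma (in group) sylow_subgroup_iff_eq:
  assumes q: "Factorial_Ring.prime q" and T: "subgroup T G"
    "T = {x \<in> carrier G. \<exists>n::nat. x [^] (q ^ n) = \<one>}"
  shows "sylow_subgroup q G Q \<longleftrightarrow> Q = T"
proof -
  have pT: "primary_group q (G\<lparr>carrier := T\<rparr>)" using primary_subgroup_iff[OF q T(1)] T(2) by blast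
  have sub: "S \<subseteq> T" if "subgroup S G" "primary_group q (G\<lparr>carrier := S\<rparr>)" for S
    using that primary_subgroup_iff[OF q that(1)] subgroup.subset[OF that(1)] T(2) by blast
  show ?thesis unfolding sylow_subgroup_def using pT sub T(1) by (metis subset_antisym)
qed

lemma engel_group_inj_hom:
  assumes "group_hom G H \<phi>" "inj_on \<phi> (carrier G)" "engel_group H"
  shows "engel_group G"
proof -
  interpret h: group_hom G H \<phi> by fact
  have lc: "\<phi> (left_comm G x y) = left_comm H (\<phi> x) (\<phi> y)" if "x \<in> carrier G" "y \<in> carrier G" for x y
    using that by (simp add: left_comm_def)
  have it: "\<phi> (((\<lambda>z. left_comm G z y) ^^ n) x) = ((\<lambda>z. left_comm H z (\<phi> y)) ^^ n) (\<phi> x)"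
    if "x \<in> carrier G" "y \<in> carrier G" for x y n
    by (induction n) (use that lc h.G.iter_comm_closed in auto)
  have "\<exists>n>0. ((\<lambda>z. left_comm G z y) ^^ n) x = \<one>\<^bsub>G\<^esub>" if x: "x \<in> carrier G" "y \<in> carrier G" for x y
  proof -
    obtain n where n: "n > 0" "((\<lambda>z. left_comm H z (\<phi> y)) ^^ n) (\<phi> x) = \<one>\<^bsub>H\<^esub>"
      using assms(3) x unfolding engel_group_def by (meson h.hom_closed)
    then have "\<phi> (((\<lambda>z. left_comm G z y) ^^ n) x) = \<phi> \<one>\<^bsub>G\<^esub>" using it[OF x] by simp
    then have "((\<lambda>z. left_comm G z y) ^^ n) x = \<one>\<^bsub>G\<^esub>"
      using assms(2) h.G.iter_comm_closed[OF x] by (meson h.G.one_closed inj_onD)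
    then show ?thesis using n by blast
  qed
  then show ?thesis unfolding engel_group_def using h.G.is_group by blast
qed

context ga
begin

abbreviation V where "V \<equiv> normalized_units F G"

lemma V_carrier: "u \<in> carrier V \<longleftrightarrow> u \<in> Units R \<and> augmentation F u = \<one>\<^bsub>F\<^esub>"
  by (simp add: normalized_units_def)

lemma V_mult [simp]: "monoid.mult V = monoid.mult R"
  by (simp add: normalized_units_def units_of_def)

lemma V_one [simp]: "\<one>\<^bsub>V\<^esub> = \<one>\<^bsub>R\<^esub>"
  by (simp add: normalized_units_def units_of_def)

lemma V_R: "u \<in> carrier V \<Longrightarrow> u \<in> carrier R"
  by (simp add: V_carrier Units_closed)

lemma V_I:
  assumes "u \<in> carrier R" "v \<in> carrier R" "u \<otimes>\<^bsub>R\<^esub> v = \<one>\<^bsub>R\<^esub>" "v \<otimes>\<^bsub>R\<^esub> u = \<one>\<^bsub>R\<^esub>"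
    "augmentation F u = \<one>\<^bsub>F\<^esub>"
  shows "u \<in> carrier V"
  unfolding V_carrier Units_def using assms by blast

lemma V_group: "group V"
proof -
  interpret U: group "units_of R" by (rule units_group)
  have "subgroup {u \<in> Units R. augmentation F u = \<one>\<^bsub>F\<^esub>} (units_of R)"
  proof (rule U.subgroupI)
    show "{u \<in> Units R. augmentation F u = \<one>\<^bsub>F\<^esub>} \<noteq> {}" using aug_one by blast
    fix u assume u: "u \<in> {u \<in> Units R. augmentation F u = \<one>\<^bsub>F\<^esub>}"
    then have uc: "u \<in> Units R" "u \<in> carrier R" "inv\<^bsub>R\<^esub> u \<in> carrier R" "augmentation F u = \<one>\<^bsub>F\<^esub>" by auto
    have "augmentation F (u \<otimes>\<^bsub>R\<^esub> inv\<^bsub>R\<^esub> u) = augmentation F (inv\<^bsub>R\<^esub> u)"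
      using uc by (simp only: aug_mult) (simp add: aug_closed)
    then have "augmentation F (inv\<^bsub>R\<^esub> u) = \<one>\<^bsub>F\<^esub>" using uc aug_one by simp
    then show "inv\<^bsub>units_of R\<^esub> u \<in> {u \<in> Units R. augmentation F u = \<one>\<^bsub>F\<^esub>}"
      using uc by (simp add: units_of_inv)
    fix v assume "v \<in> {u \<in> Units R. augmentation F u = \<one>\<^bsub>F\<^esub>}"
    then show "u \<otimes>\<^bsub>units_of R\<^esub> v \<in> {u \<in> Units R. augmentation F u = \<one>\<^bsub>F\<^esub>}"
      using uc by (simp add: units_of_mult aug_mult Units_closed)
  qed (simp add: units_of_carrier)
  then show ?thesis unfolding normalized_units_def by (rule U.subgroup_imp_group)
qed

sublocale V: group V by (rule V_group)

lemma V_pow: "u [^]\<^bsub>V\<^esub> (n::nat) = u [^]\<^bsub>R\<^esub> n"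
  by (induction n) simp_all

lemma V_comm_group:
  assumes "comm_group G" shows "comm_group V"
proof -
  interpret C: cring R using assms by (rule cring_if_comm)
  show ?thesis by (rule V.group_comm_groupI) (use V_R C.m_comm in simp)
qed

lemma basis_V: "g \<in> carrier G \<Longrightarrow> mon \<one>\<^bsub>F\<^esub> g \<in> carrier V"
  by (rule V_I[of _ "mon \<one>\<^bsub>F\<^esub> (inv\<^bsub>G\<^esub> g)"]) (simp_all add: mult_mon_mon one_eq aug_mon)

lemma basis_hom_V: "(\<lambda>g. mon \<one>\<^bsub>F\<^esub> g) \<in> hom G V"
  by (rule homI) (auto simp: basis_V mult_mon_mon)

lemma basis_inj:
  assumes "\<one>\<^bsub>F\<^esub> \<noteq> \<zero>\<^bsub>F\<^esub>" "mon \<one>\<^bsub>F\<^esub> g = mon \<one>\<^bsub>F\<^esub> h" shows "g = h"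
  using fun_cong[OF assms(2), of g] assms(1) by (simp add: ga_mon_def split: if_splits)

lemma engel_units_imp_engel:
  assumes "\<one>\<^bsub>F\<^esub> \<noteq> \<zero>\<^bsub>F\<^esub>" "engel_group V" shows "engel_group G"
proof (rule engel_group_inj_hom[OF _ _ assms(2)])
  show "group_hom G V (\<lambda>g. mon \<one>\<^bsub>F\<^esub> g)" by unfold_locales (rule basis_hom_V)
  show "inj_on (\<lambda>g. mon \<one>\<^bsub>F\<^esub> g) (carrier G)" by (rule inj_onI) (rule basis_inj[OF assms(1)])
qed

lemma aug_ideal_mono:
  assumes "M \<subseteq> N" shows "aug_ideal F G M \<subseteq> aug_ideal F G N"
  unfolding aug_ideal_def genideal_def using assms by blast

end

context ga_pair
begin

lemma ga_map_V_hom: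
  assumes "\<phi> \<in> hom G H" shows "ga_map F \<phi> \<in> hom V H.V"
proof (rule homI)
  interpret h: ring_hom_ring R H.R "ga_map F \<phi>"
    by (rule ring_hom_ringI2) (use ga_map_hom[OF assms] ring_R H.ring_R in auto)
  fix u assume u: "u \<in> carrier V"
  have uR: "u \<in> carrier R" "inv\<^bsub>R\<^esub> u \<in> carrier R" using u by (auto simp: V_carrier)
  have inv: "u \<otimes>\<^bsub>R\<^esub> inv\<^bsub>R\<^esub> u = \<one>\<^bsub>R\<^esub>" "inv\<^bsub>R\<^esub> u \<otimes>\<^bsub>R\<^esub> u = \<one>\<^bsub>R\<^esub>" using u by (auto simp: V_carrier)
  show "ga_map F \<phi> u \<in> carrier H.V"
  proof (rule H.V_I)
    show "ga_map F \<phi> u \<otimes>\<^bsub>H.R\<^esub> ga_map F \<phi> (inv\<^bsub>R\<^esub> u) = \<one>\<^bsub>H.R\<^esub>"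
      using uR inv by (metis h.hom_mult h.hom_one)
    show "ga_map F \<phi> (inv\<^bsub>R\<^esub> u) \<otimes>\<^bsub>H.R\<^esub> ga_map F \<phi> u = \<one>\<^bsub>H.R\<^esub>"
      using uR inv by (metis h.hom_mult h.hom_one)
    show "augmentation F (ga_map F \<phi> u) = \<one>\<^bsub>F\<^esub>"
      using aug_ga_map[OF uR(1)] assms u by (auto simp: hom_def V_carrier)
  qed (use uR in auto)
  fix v assume "v \<in> carrier V"
  then show "ga_map F \<phi> (u \<otimes>\<^bsub>V\<^esub> v) = ga_map F \<phi> u \<otimes>\<^bsub>H.V\<^esub> ga_map F \<phi> v"
    using uR V_R by simp
qed

end

context ga_char
begin

text \<open>The elements \<open>1 + x\<close> with \<open>x\<close> nilpotent are
  \<open>p\<close>-elements, by the Frobenius map, and hence units. A preimage \<open>a\<close> of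
  a unit has a one-sided inverse modulo such elements on each side, so it is a unit; thus
  normalised units lift.\<close>

lemma nil_quotient_units:
  assumes N: "N \<lhd> G" and nil: "\<And>a. a \<in> aug_ideal F G N \<Longrightarrow> \<exists>n::nat. a [^]\<^bsub>R\<^esub> n = \<zero>\<^bsub>R\<^esub>"
  shows "one_plus R (aug_ideal F G N) = kernel V (normalized_units F (G Mod N)) (ga_map F (r_coset G N))"
    and "ga_map F (r_coset G N) ` carrier V = carrier (normalized_units F (G Mod N))"
    and "\<And>u. u \<in> one_plus R (aug_ideal F G N) \<Longrightarrow> \<exists>k. u [^]\<^bsub>V\<^esub> (p ^ k) = \<one>\<^bsub>V\<^esub>"
proof -
  interpret N: normal N G by (rule N)
  interpret Q: ga_pair F G "G Mod N" by (rule cosets_ga_pair[OF N])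
  let ?\<pi> = "ga_map F (r_coset G N)"
  have \<pi>hom: "r_coset G N \<in> hom G (G Mod N)" by (rule N.r_coset_hom_Mod)
  have \<pi>fun: "r_coset G N \<in> carrier G \<rightarrow> carrier (G Mod N)" using \<pi>hom by (simp add: hom_def)
  interpret h: ring_hom_ring R Q.H.R ?\<pi>
    by (rule ring_hom_ringI2) (use Q.ga_map_hom[OF \<pi>hom] Q.H.ring_R ring_R in auto)
  note ker = aug_ideal_eq_kernel[OF N]
  have pw: "\<exists>k. (\<one>\<^bsub>R\<^esub> \<oplus>\<^bsub>R\<^esub> x) [^]\<^bsub>R\<^esub> (p ^ k) = \<one>\<^bsub>R\<^esub>" if x: "x \<in> aug_ideal F G N" for x
  proof -
    obtain n :: nat where n: "x [^]\<^bsub>R\<^esub> n = \<zero>\<^bsub>R\<^esub>" using nil[OF x] by blast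
    show ?thesis using x n unfolding ker by (intro one_plus_nilp[of x n]) auto
  qed
  have unit: "\<one>\<^bsub>R\<^esub> \<oplus>\<^bsub>R\<^esub> x \<in> Units R" if x: "x \<in> aug_ideal F G N" for x
  proof -
    obtain k where "(\<one>\<^bsub>R\<^esub> \<oplus>\<^bsub>R\<^esub> x) [^]\<^bsub>R\<^esub> (p ^ k) = \<one>\<^bsub>R\<^esub>" using pw[OF x] by blast
    moreover have "x \<in> carrier R" using x ker by auto
    moreover have "p ^ k > 0" using prime prime_gt_0_nat by simp
    ultimately show ?thesis using pow_eq_one_unit[of "\<one>\<^bsub>R\<^esub> \<oplus>\<^bsub>R\<^esub> x" "p ^ k"] by simp
  qed
  have diff: "a \<ominus>\<^bsub>R\<^esub> \<one>\<^bsub>R\<^esub> \<in> aug_ideal F G N" "a = \<one>\<^bsub>R\<^esub> \<oplus>\<^bsub>R\<^esub> (a \<ominus>\<^bsub>R\<^esub> \<one>\<^bsub>R\<^esub>)"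
    if a: "a \<in> carrier R" "?\<pi> a = \<one>\<^bsub>Q.H.R\<^esub>" for a
  proof -
    have "?\<pi> (a \<ominus>\<^bsub>R\<^esub> \<one>\<^bsub>R\<^esub>) = \<zero>\<^bsub>Q.H.R\<^esub>"
      using a by (simp add: a_minus_def Q.H.r_neg)
    then show "a \<ominus>\<^bsub>R\<^esub> \<one>\<^bsub>R\<^esub> \<in> aug_ideal F G N" using a(1) unfolding ker by simp
    show "a = \<one>\<^bsub>R\<^esub> \<oplus>\<^bsub>R\<^esub> (a \<ominus>\<^bsub>R\<^esub> \<one>\<^bsub>R\<^esub>)"
      using a(1) by (simp add: a_minus_def a_lcomm[of "\<one>\<^bsub>R\<^esub>" a] r_neg)
  qed
  have oneV: "\<one>\<^bsub>R\<^esub> \<oplus>\<^bsub>R\<^esub> x \<in> carrier V \<and> ?\<pi> (\<one>\<^bsub>R\<^esub> \<oplus>\<^bsub>R\<^esub> x) = \<one>\<^bsub>Q.H.R\<^esub>"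
    if x: "x \<in> aug_ideal F G N" for x
  proof -
    have xc: "x \<in> carrier R" "?\<pi> x = \<zero>\<^bsub>Q.H.R\<^esub>" using x ker by auto
    then have 1: "?\<pi> (\<one>\<^bsub>R\<^esub> \<oplus>\<^bsub>R\<^esub> x) = \<one>\<^bsub>Q.H.R\<^esub>" by simp
    have "augmentation F (\<one>\<^bsub>R\<^esub> \<oplus>\<^bsub>R\<^esub> x) = augmentation F (?\<pi> (\<one>\<^bsub>R\<^esub> \<oplus>\<^bsub>R\<^esub> x))"
      using xc \<pi>fun by (subst Q.aug_ga_map) auto
    then have "augmentation F (\<one>\<^bsub>R\<^esub> \<oplus>\<^bsub>R\<^esub> x) = \<one>\<^bsub>F\<^esub>" unfolding 1 using Q.H.aug_one by simp
    then show ?thesis using 1 unit[OF x] by (simp add: V_carrier)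
  qed
  show "one_plus R (aug_ideal F G N) = kernel V Q.H.V ?\<pi>"
  proof
    show "one_plus R (aug_ideal F G N) \<subseteq> kernel V Q.H.V ?\<pi>"
      unfolding one_plus_def kernel_def using oneV by auto
    show "kernel V Q.H.V ?\<pi> \<subseteq> one_plus R (aug_ideal F G N)"
    proof
      fix u assume u: "u \<in> kernel V Q.H.V ?\<pi>"
      then have "u \<in> carrier R" "?\<pi> u = \<one>\<^bsub>Q.H.R\<^esub>" by (auto simp: kernel_def V_R)
      then show "u \<in> one_plus R (aug_ideal F G N)"
        unfolding one_plus_def using diff[of u] by blast
    qed
  qed
  show "\<exists>k. u [^]\<^bsub>V\<^esub> (p ^ k) = \<one>\<^bsub>V\<^esub>" if "u \<in> one_plus R (aug_ideal F G N)" for u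
    using that pw by (auto simp: one_plus_def V_pow)
  show "?\<pi> ` carrier V = carrier Q.H.V"
  proof
    show "?\<pi> ` carrier V \<subseteq> carrier Q.H.V"
      using Q.ga_map_V_hom[OF \<pi>hom] by (auto simp: hom_def)
    show "carrier Q.H.V \<subseteq> ?\<pi> ` carrier V"
    proof
      fix w assume w: "w \<in> carrier Q.H.V"
      then have wU: "w \<in> Units Q.H.R" by (simp add: Q.H.V_carrier)
      have surj: "?\<pi> ` carrier R = carrier Q.H.R"
        by (rule Q.ga_map_surj) (simp add: carrier_FactGroup)
      obtain a where a: "a \<in> carrier R" "w = ?\<pi> a" using surj wU Q.H.Units_closed by blast
      obtain b where b: "b \<in> carrier R" "inv\<^bsub>Q.H.R\<^esub> w = ?\<pi> b" using surj Q.H.Units_inv_closed[OF wU] by blast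
      have "?\<pi> (a \<otimes>\<^bsub>R\<^esub> b) = \<one>\<^bsub>Q.H.R\<^esub>" "?\<pi> (b \<otimes>\<^bsub>R\<^esub> a) = \<one>\<^bsub>Q.H.R\<^esub>"
        using a b wU by (simp_all flip: a(2) b(2))
      then have "a \<otimes>\<^bsub>R\<^esub> b \<in> Units R" "b \<otimes>\<^bsub>R\<^esub> a \<in> Units R"
        using unit diff[of "a \<otimes>\<^bsub>R\<^esub> b"] diff[of "b \<otimes>\<^bsub>R\<^esub> a"] a b by (metis mult_closed)+
      then have aU: "a \<in> Units R"
      proof -
        let ?c = "inv\<^bsub>R\<^esub> (a \<otimes>\<^bsub>R\<^esub> b)" and ?d = "inv\<^bsub>R\<^esub> (b \<otimes>\<^bsub>R\<^esub> a)"
        assume U: "a \<otimes>\<^bsub>R\<^esub> b \<in> Units R" "b \<otimes>\<^bsub>R\<^esub> a \<in> Units R"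
        have c: "?c \<in> carrier R" "?d \<in> carrier R" using U by auto
        have r: "a \<otimes>\<^bsub>R\<^esub> (b \<otimes>\<^bsub>R\<^esub> ?c) = \<one>\<^bsub>R\<^esub>" using U a b c by (simp flip: m_assoc)
        have l: "(?d \<otimes>\<^bsub>R\<^esub> b) \<otimes>\<^bsub>R\<^esub> a = \<one>\<^bsub>R\<^esub>" using U a b c by (simp add: m_assoc)
        have "?d \<otimes>\<^bsub>R\<^esub> b = (?d \<otimes>\<^bsub>R\<^esub> b) \<otimes>\<^bsub>R\<^esub> (a \<otimes>\<^bsub>R\<^esub> (b \<otimes>\<^bsub>R\<^esub> ?c))" using r b c by simp
        also have "\<dots> = ((?d \<otimes>\<^bsub>R\<^esub> b) \<otimes>\<^bsub>R\<^esub> a) \<otimes>\<^bsub>R\<^esub> (b \<otimes>\<^bsub>R\<^esub> ?c)" using a b c by (simp only: m_assoc mult_closed)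
        also have "\<dots> = b \<otimes>\<^bsub>R\<^esub> ?c" using l b c by simp
        finally have "?d \<otimes>\<^bsub>R\<^esub> b = b \<otimes>\<^bsub>R\<^esub> ?c" .
        then show ?thesis unfolding Units_def using r l a b c by force
      qed
      have "augmentation F a = augmentation F w" using a Q.aug_ga_map[OF a(1) \<pi>fun] by simp
      then have "a \<in> carrier V" using aU w by (simp add: V_carrier Q.H.V_carrier)
      then show "w \<in> ?\<pi> ` carrier V" using a(2) by blast
    qed
  qed
qed

subsection \<open>Commutative group algebras without p-torsion are reduced\<close>

text \<open>In a commutative group algebra \<open>(\<Sum> c\<^sub>x x)\<^sup>p = \<Sum>
  c\<^sub>x\<^sup>p x\<^sup>p\<close>, and the powers \<open>x\<^sup>p\<close> stay distinct.\<close>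

lemma frobenius_coeff:
  assumes comm: "comm_group G" and nop: "\<And>x. x \<in> carrier G \<Longrightarrow> x [^]\<^bsub>G\<^esub> p = \<one>\<^bsub>G\<^esub> \<Longrightarrow> x = \<one>\<^bsub>G\<^esub>"
    and a: "a \<in> carrier R" and x: "x \<in> carrier G"
  shows "(a [^]\<^bsub>R\<^esub> p) (x [^]\<^bsub>G\<^esub> p) = a x [^]\<^bsub>F\<^esub> p"
  using a
proof (induction a rule: induct)
  interpret C: comm_group G by (rule comm)
  case (mon c g)
  have pw: "mon c g [^]\<^bsub>R\<^esub> n = mon (c [^]\<^bsub>F\<^esub> n) (g [^]\<^bsub>G\<^esub> n)" for n :: nat
    by (induction n) (use mon in \<open>simp_all add: one_eq mult_mon_mon\<close>)
  have "x [^]\<^bsub>G\<^esub> p = g [^]\<^bsub>G\<^esub> p \<longleftrightarrow> x = g"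
  proof
    assume eq: "x [^]\<^bsub>G\<^esub> p = g [^]\<^bsub>G\<^esub> p"
    have "(x \<otimes>\<^bsub>G\<^esub> inv\<^bsub>G\<^esub> g) [^]\<^bsub>G\<^esub> p = x [^]\<^bsub>G\<^esub> p \<otimes>\<^bsub>G\<^esub> inv\<^bsub>G\<^esub> (g [^]\<^bsub>G\<^esub> p)"
      using x mon by (simp add: C.nat_pow_distrib G.nat_pow_inv)
    also have "\<dots> = \<one>\<^bsub>G\<^esub>" using eq mon by simp
    finally have "x \<otimes>\<^bsub>G\<^esub> inv\<^bsub>G\<^esub> g = \<one>\<^bsub>G\<^esub>" using nop x mon by simp
    then show "x = g" using x mon by (metis G.inv_inv G.inv_equality G.inv_closed)
  qed simp
  moreover have "\<zero>\<^bsub>F\<^esub> [^]\<^bsub>F\<^esub> p = \<zero>\<^bsub>F\<^esub>" using prime prime_gt_0_nat by (simp add: F.nat_pow_zero)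
  ultimately show ?case using mon by (simp add: pw) (simp add: ga_mon_def)
next
  interpret CR: cring R by (rule cring_if_comm[OF comm])
  case (add a b)
  have "(a \<oplus>\<^bsub>R\<^esub> b) [^]\<^bsub>R\<^esub> p = a [^]\<^bsub>R\<^esub> p \<oplus>\<^bsub>R\<^esub> b [^]\<^bsub>R\<^esub> p"
    by (rule frob) (use add CR.m_comm in auto)
  moreover have "(a x \<oplus>\<^bsub>F\<^esub> b x) [^]\<^bsub>F\<^esub> p = a x [^]\<^bsub>F\<^esub> p \<oplus>\<^bsub>F\<^esub> b x [^]\<^bsub>F\<^esub> p"
    by (rule F.frobenius_add[OF prime F_char]) (use coeff[OF add(1)] coeff[OF add(2)] F.m_comm in auto)
  ultimately show ?case using add by (simp add: add_eq)
qed

lemma F_pow_zero: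
  assumes "c \<in> carrier F" shows "c [^]\<^bsub>F\<^esub> (n::nat) = \<zero>\<^bsub>F\<^esub> \<Longrightarrow> c = \<zero>\<^bsub>F\<^esub>"
  by (induction n) (use assms F.integral_iff in auto)

lemma reduced:
  assumes comm: "comm_group G" and nop: "\<And>x. x \<in> carrier G \<Longrightarrow> x [^]\<^bsub>G\<^esub> p = \<one>\<^bsub>G\<^esub> \<Longrightarrow> x = \<one>\<^bsub>G\<^esub>"
    and a: "a \<in> carrier R" "a [^]\<^bsub>R\<^esub> (n::nat) = \<zero>\<^bsub>R\<^esub>"
  shows "a = \<zero>\<^bsub>R\<^esub>"
proof -
  have step: "b = \<zero>\<^bsub>R\<^esub>" if b: "b \<in> carrier R" "b [^]\<^bsub>R\<^esub> p = \<zero>\<^bsub>R\<^esub>" for b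
  proof
    fix x
    show "b x = \<zero>\<^bsub>R\<^esub> x"
    proof (cases "x \<in> carrier G")
      case True
      have "b x [^]\<^bsub>F\<^esub> p = \<zero>\<^bsub>F\<^esub>"
        using frobenius_coeff[OF comm nop b(1) True] unfolding b(2) by (simp add: zero_eq)
      then have "b x = \<zero>\<^bsub>F\<^esub>" by (rule F_pow_zero[OF coeff[OF b(1)]])
      then show ?thesis by (simp add: zero_eq)
    next
      case False
      then have "b x = \<zero>\<^bsub>F\<^esub>" using supp_carrier[OF b(1)] by (intro notin_supp) blast
      then show ?thesis by (simp add: zero_eq)
    qed
  qed
  have "b [^]\<^bsub>R\<^esub> (p ^ k) = \<zero>\<^bsub>R\<^esub> \<Longrightarrow> b = \<zero>\<^bsub>R\<^esub>" if "b \<in> carrier R" for b k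
    using that
  proof (induction k arbitrary: b)
    case (Suc k)
    have "(b [^]\<^bsub>R\<^esub> (p ^ k)) [^]\<^bsub>R\<^esub> p = \<zero>\<^bsub>R\<^esub>" using Suc.prems by (simp add: nat_pow_pow mult.commute)
    then have "b [^]\<^bsub>R\<^esub> (p ^ k) = \<zero>\<^bsub>R\<^esub>" using step Suc.prems by simp
    then show ?case using Suc by simp
  qed simp
  moreover have "a [^]\<^bsub>R\<^esub> (p ^ n) = \<zero>\<^bsub>R\<^esub>"
  proof -
    have "n < p ^ n" using prime prime_gt_1_nat by (intro power_gt_expt) auto
    then have "a [^]\<^bsub>R\<^esub> (p ^ n) = a [^]\<^bsub>R\<^esub> n \<otimes>\<^bsub>R\<^esub> a [^]\<^bsub>R\<^esub> (p ^ n - n)" using a(1) by (simp add: nat_pow_mult)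
    then show ?thesis using a by simp
  qed
  ultimately show ?thesis using a(1) by blast
qed

lemma p_unit_trivial:
  assumes comm: "comm_group G" and nop: "\<And>x. x \<in> carrier G \<Longrightarrow> x [^]\<^bsub>G\<^esub> p = \<one>\<^bsub>G\<^esub> \<Longrightarrow> x = \<one>\<^bsub>G\<^esub>"
    and u: "u \<in> carrier V" "u [^]\<^bsub>V\<^esub> (p ^ n) = \<one>\<^bsub>V\<^esub>"
  shows "u = \<one>\<^bsub>V\<^esub>"
proof -
  interpret CR: cring R by (rule cring_if_comm[OF comm])
  have uR: "u \<in> carrier R" by (rule V_R[OF u(1)])
  let ?x = "u \<ominus>\<^bsub>R\<^esub> \<one>\<^bsub>R\<^esub>"
  have u_eq: "u = \<one>\<^bsub>R\<^esub> \<oplus>\<^bsub>R\<^esub> ?x"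
    using uR by (simp add: a_minus_def a_lcomm[of "\<one>\<^bsub>R\<^esub>" u] r_neg)
  have "u [^]\<^bsub>R\<^esub> (p ^ n) = \<one>\<^bsub>R\<^esub> [^]\<^bsub>R\<^esub> (p ^ n) \<oplus>\<^bsub>R\<^esub> ?x [^]\<^bsub>R\<^esub> (p ^ n)"
    by (subst u_eq, rule frob_pow) (use uR in auto)
  then have "\<one>\<^bsub>R\<^esub> = \<one>\<^bsub>R\<^esub> \<oplus>\<^bsub>R\<^esub> ?x [^]\<^bsub>R\<^esub> (p ^ n)" using u(2) by (simp add: V_pow)
  then have "?x [^]\<^bsub>R\<^esub> (p ^ n) = \<zero>\<^bsub>R\<^esub>" using uR
    by (metis add.l_cancel_one' minus_closed nat_pow_closed one_closed)
  then have "?x = \<zero>\<^bsub>R\<^esub>" using reduced[OF comm nop] uR by blast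
  then show ?thesis using u_eq uR by simp
qed

end

section \<open>Units of group algebras graded by a torsion-free abelian group\<close>

text \<open>The elements above \<open>1\<close> in a total order of the abelian group
  \<open>L\<close>.\<close>

definition positive_cone :: "('g, 'b) monoid_scheme \<Rightarrow> 'g set \<Rightarrow> bool" where
  "positive_cone L Q \<longleftrightarrow> Q \<subseteq> carrier L \<and> \<one>\<^bsub>L\<^esub> \<notin> Q \<and> (\<forall>x\<in>Q. \<forall>y\<in>Q. x \<otimes>\<^bsub>L\<^esub> y \<in> Q) \<and>
     (\<forall>x\<in>carrier L. x = \<one>\<^bsub>L\<^esub> \<or> x \<in> Q \<or> inv\<^bsub>L\<^esub> x \<in> Q)"

context comm_group
begin

text \<open>A maximal subsemigroup \<open>M\<close> without \<open>1\<close> works. If \<open>x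
  \<notin> M\<close>, then adjoining \<open>x\<close> produces \<open>1\<close>, which means that
  a positive power of \<open>x\<^sup>-\<^sup>1\<close> is in \<open>M\<close>; if this held for
  \<open>x\<close> and for \<open>x\<^sup>-\<^sup>1\<close>, then \<open>1\<close> would be in
  \<open>M\<close>.\<close>

lemma positive_cone_exists:
  assumes tf: "\<And>x n. x \<in> carrier G \<Longrightarrow> (n::nat) > 0 \<Longrightarrow> x [^] n = \<one> \<Longrightarrow> x = \<one>"
  shows "\<exists>Q. positive_cone G Q"
proof -
  let ?A = "{Q. Q \<subseteq> carrier G \<and> \<one> \<notin> Q \<and> (\<forall>x\<in>Q. \<forall>y\<in>Q. x \<otimes> y \<in> Q)}"
  have "\<exists>M\<in>?A. \<forall>T\<in>?A. M \<subseteq> T \<longrightarrow> T = M"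
  proof (rule subset_Zorn_nonempty)
    show "?A \<noteq> {}" by blast
    fix C assume C: "C \<noteq> {}" "subset.chain ?A C"
    have CA: "C \<subseteq> ?A" and ch: "\<And>S T. S \<in> C \<Longrightarrow> T \<in> C \<Longrightarrow> S \<subseteq> T \<or> T \<subseteq> S"
      using C(2) by (auto simp: subset.chain_def)
    have "x \<otimes> y \<in> \<Union>C" if "x \<in> \<Union>C" "y \<in> \<Union>C" for x y
    proof -
      obtain S T where ST: "S \<in> C" "T \<in> C" "x \<in> S" "y \<in> T" using \<open>x \<in> \<Union>C\<close> \<open>y \<in> \<Union>C\<close> by blast
      then obtain U where "U \<in> C" "x \<in> U" "y \<in> U" using ch by blast
      then show ?thesis using CA by blast
    qed
    then show "\<Union>C \<in> ?A" using CA by blast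
  qed
  then obtain M where MA: "M \<in> ?A" and max: "\<And>T. T \<in> ?A \<Longrightarrow> M \<subseteq> T \<Longrightarrow> T = M" by (elim bexE) simp
  have M: "M \<subseteq> carrier G" "\<one> \<notin> M" "\<And>x y. x \<in> M \<Longrightarrow> y \<in> M \<Longrightarrow> x \<otimes> y \<in> M"
    using MA by simp_all
  have pw: "x [^] n \<in> M" if "x \<in> M" "n > 0" for x and n :: nat
    using that(2)
  proof (induction n)
    case (Suc n)
    then show ?case using M that by (cases "n = 0") auto
  qed simp
  have ext: "\<exists>n>0. inv x [^] (n::nat) \<in> M" if x: "x \<in> carrier G" "x \<noteq> \<one>" "x \<notin> M" for x
  proof (rule ccontr)
    assume no: "\<not> ?thesis"
    let ?T = "{y. \<exists>n::nat. n > 0 \<and> y = x [^] n} \<union> {y. \<exists>q\<in>M. \<exists>n::nat. y = q \<otimes> x [^] n}"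
    have "?T \<subseteq> carrier G" using x M by auto
    moreover have "\<one> \<notin> ?T"
    proof
      assume "\<one> \<in> ?T"
      then consider (a) n :: nat where "n > 0" "\<one> = x [^] n" | (b) q and n :: nat where "q \<in> M" "\<one> = q \<otimes> x [^] n" by blast
      then show False
      proof cases
        case a then show False using tf x by metis
      next
        case b
        have qG: "q \<in> carrier G" using b(1) M(1) by blast
        have "n \<noteq> 0"
        proof
          assume "n = 0" then have "q = \<one>" using b(2) qG by simp
          then show False using b(1) M(2) by simp
        qed
        moreover have "inv x [^] n = q" using b(2) qG x(1) inv_equality[of q "x [^] n"] by (simp add: nat_pow_inv)
        ultimately show False using no b(1) by blast
      qed
    qed
    moreover have clo: "y \<otimes> z \<in> ?T" if yz: "y \<in> ?T" "z \<in> ?T" for y z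
    proof -
      have form: "(\<exists>n::nat. n > 0 \<and> w = x [^] n) \<or> (\<exists>q n. q \<in> M \<and> w = q \<otimes> x [^] (n::nat))" if "w \<in> ?T" for w
        using that by blast
      from form[OF yz(1)] form[OF yz(2)] show ?thesis
      proof (elim disjE exE conjE)
        fix n m :: nat assume "n > 0" "y = x [^] n" "z = x [^] m"
        then have "y \<otimes> z = x [^] (n + m)" "n + m > 0" using x(1) by (simp_all add: nat_pow_mult)
        then show ?thesis by blast
      next
        fix n m :: nat and q assume h: "y = x [^] n" "q \<in> M" "z = q \<otimes> x [^] m"
        then have "y \<otimes> z = q \<otimes> x [^] (n + m)" using x(1) M(1)
          by (simp add: nat_pow_mult[symmetric] m_lcomm subset_eq)
        then show ?thesis using h by blast
      next
        fix n m :: nat and q assume h: "y = q \<otimes> x [^] n" "q \<in> M" "z = x [^] m"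
        then have "y \<otimes> z = q \<otimes> x [^] (n + m)" using x(1) M(1)
          by (simp add: nat_pow_mult[symmetric] m_assoc subset_eq)
        then show ?thesis using h by blast
      next
        fix n m :: nat and q r assume h: "y = q \<otimes> x [^] n" "q \<in> M" "z = r \<otimes> x [^] m" "r \<in> M"
        then have "y \<otimes> z = (q \<otimes> r) \<otimes> x [^] (n + m)" using x(1) M(1)
          by (simp add: nat_pow_mult[symmetric] m_ac subset_eq)
        then show ?thesis using M(3)[OF h(2,4)] by blast
      qed
    qed
    ultimately have "?T \<in> ?A" by (intro CollectI conjI ballI) assumption+
    moreover have "M \<subseteq> ?T"
    proof
      fix q assume q: "q \<in> M"
      then have "q = q \<otimes> x [^] (0::nat)" using M(1) by auto
      then show "q \<in> ?T" using q by blast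
    qed
    ultimately have "?T = M" by (rule max)
    moreover have "x = x [^] (1::nat)" using x(1) by simp
    then have "x \<in> ?T" using zero_less_one by blast
    ultimately show False using x(3) by blast
  qed
  have "x = \<one> \<or> x \<in> M \<or> inv x \<in> M" if x: "x \<in> carrier G" for x
  proof (rule ccontr)
    assume no: "\<not> ?thesis"
    obtain n :: nat where n: "n > 0" "inv x [^] n \<in> M" using ext[of x] x no by blast
    have "inv x \<noteq> \<one>" using no x by (metis inv_inv inv_one)
    then obtain m :: nat where m: "m > 0" "x [^] m \<in> M" using ext[of "inv x"] x no by auto
    have "(inv x [^] n) [^] m \<otimes> (x [^] m) [^] n = inv (x [^] (n * m)) \<otimes> x [^] (n * m)"
      using x by (simp add: nat_pow_pow nat_pow_inv mult.commute)
    also have "\<dots> = \<one>" using x by simp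
    finally have "\<one> \<in> M" using M(3)[OF pw[OF n(2) m(1)] pw[OF m(2) n(1)]] by simp
    then show False using M(2) by simp
  qed
  then have "positive_cone G M"
    unfolding positive_cone_def by (intro conjI ballI) (use M in simp_all)
  then show ?thesis by blast
qed

text \<open>The reverse order. With it, statements on top components also yield those on bottom
  components.\<close>

lemma positive_cone_inverse:
  assumes "positive_cone G Q" shows "positive_cone G {x \<in> carrier G. inv x \<in> Q}"
  using assms unfolding positive_cone_def by (auto simp: inv_mult)

lemma positive_cone_antisym:
  assumes "positive_cone G Q" "x \<in> Q" "inv x \<in> Q" shows False
proof -
  have "x \<in> carrier G" using assms by (auto simp: positive_cone_def)
  moreover have "x \<otimes> inv x \<in> Q" using assms by (auto simp: positive_cone_def)
  ultimately show False using assms by (simp add: positive_cone_def)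
qed

end

definition cone_le :: "('g, 'b) monoid_scheme \<Rightarrow> 'g set \<Rightarrow> 'g \<Rightarrow> 'g \<Rightarrow> bool" where
  "cone_le L Q x y \<longleftrightarrow> x = y \<or> y \<otimes>\<^bsub>L\<^esub> inv\<^bsub>L\<^esub> x \<in> Q"

context comm_group
begin

lemma cone_le_max:
  assumes Q: "positive_cone G Q" and S: "finite S" "S \<noteq> {}" "S \<subseteq> carrier G"
  shows "\<exists>m\<in>S. \<forall>s\<in>S. cone_le G Q s m"
  using S
proof (induction S rule: finite_ne_induct)
  case (singleton x) then show ?case by (simp add: cone_le_def)
next
  case (insert x S)
  then obtain m where m: "m \<in> S" "\<And>s. s \<in> S \<Longrightarrow> cone_le G Q s m" by auto
  have G: "x \<in> carrier G" "m \<in> carrier G" "S \<subseteq> carrier G" using insert m by auto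
  have mulQ: "a \<otimes> b \<in> Q" if "a \<in> Q" "b \<in> Q" for a b using Q that by (auto simp: positive_cone_def)
  have "m \<otimes> inv x = \<one> \<or> m \<otimes> inv x \<in> Q \<or> inv (m \<otimes> inv x) \<in> Q"
    using Q G by (auto simp: positive_cone_def)
  then show ?case
  proof (elim disjE)
    assume "m \<otimes> inv x = \<one>"
    then have "m = x" using G inv_solve_right'[of \<one> m x] by simp
    then show ?thesis using m by (auto simp: cone_le_def)
  next
    assume "m \<otimes> inv x \<in> Q" then show ?thesis using m by (auto simp: cone_le_def)
  next
    assume "inv (m \<otimes> inv x) \<in> Q"
    then have xm: "x \<otimes> inv m \<in> Q" using G by (simp add: inv_mult m_comm)
    have "cone_le G Q s x" if s: "s \<in> S" for s
    proof (cases "s = m")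
      case True then show ?thesis using xm by (simp add: cone_le_def)
    next
      case False
      have sG: "s \<in> carrier G" using s G by auto
      have "m \<otimes> inv s \<in> Q" using m(2)[OF s] False by (simp add: cone_le_def)
      then have "(x \<otimes> inv m) \<otimes> (m \<otimes> inv s) \<in> Q" using mulQ[OF xm] by blast
      moreover have "(x \<otimes> inv m) \<otimes> (m \<otimes> inv s) = x \<otimes> inv s"
        using G sG by (simp add: m_assoc mult_cancels)
      ultimately show ?thesis by (simp add: cone_le_def)
    qed
    then show ?thesis by (auto simp: cone_le_def)
  qed
qed

lemma cone_le_mult:
  assumes Q: "positive_cone G Q" and G: "x \<in> carrier G" "y \<in> carrier G" "m \<in> carrier G" "n \<in> carrier G"
    and le: "cone_le G Q x m" "cone_le G Q y n"
  shows "cone_le G Q (x \<otimes> y) (m \<otimes> n)" "x \<otimes> y = m \<otimes> n \<Longrightarrow> x = m \<and> y = n"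
proof -
  have mulQ: "a \<otimes> b \<in> Q" if "a \<in> Q" "b \<in> Q" for a b using Q that by (auto simp: positive_cone_def)
  have eq: "m \<otimes> n \<otimes> inv (x \<otimes> y) = (m \<otimes> inv x) \<otimes> (n \<otimes> inv y)"
    using G by (simp add: inv_mult m_ac)
  have one: "m \<otimes> n \<otimes> inv (x \<otimes> y) = \<one>" if "x \<otimes> y = m \<otimes> n" using that G by simp
  have strict: "m \<otimes> n \<otimes> inv (x \<otimes> y) \<in> Q" if "x \<noteq> m \<or> y \<noteq> n"
    using that le mulQ G unfolding eq cone_le_def by auto
  show "cone_le G Q (x \<otimes> y) (m \<otimes> n)" using strict by (auto simp: cone_le_def)
  show "x \<otimes> y = m \<otimes> n \<Longrightarrow> x = m \<and> y = n"
    using one strict Q by (auto simp: positive_cone_def)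
qed

lemma cone_le_inverse:
  assumes "x \<in> carrier G" "y \<in> carrier G" "cone_le G {z \<in> carrier G. inv z \<in> Q} x y"
  shows "cone_le G Q y x"
  using assms by (auto simp: cone_le_def inv_mult m_comm)

lemma cone_le_antisym:
  assumes "positive_cone G Q" "x \<in> carrier G" "y \<in> carrier G" "cone_le G Q x y" "cone_le G Q y x"
  shows "x = y"
proof (rule ccontr)
  assume "x \<noteq> y"
  then have "y \<otimes> inv x \<in> Q" "inv (y \<otimes> inv x) \<in> Q"
    using assms by (auto simp: cone_le_def inv_mult m_comm)
  then show False using positive_cone_antisym[OF assms(1)] by blast
qed

end

text \<open>The homogeneous component of degree \<open>l\<close> of \<open>a\<close>, in the
  grading defined by \<open>\<rho>\<close>.\<close>

definition ga_comp :: "('f, 'a) ring_scheme \<Rightarrow> ('g \<Rightarrow> 'l) \<Rightarrow> 'l \<Rightarrow> ('g \<Rightarrow> 'f) \<Rightarrow> 'g \<Rightarrow> 'f" where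
  "ga_comp F \<rho> l a = (\<lambda>x. if \<rho> x = l then a x else \<zero>\<^bsub>F\<^esub>)"

text \<open>The group algebra of \<open>A\<close> is graded by \<open>L\<close> via
  \<open>\<rho>\<close>. The last two assumptions give an order of the degrees and the absence of
  nilpotent elements.\<close>

locale ga_graded = ga_char F A p + A: comm_group A + L: comm_group L
  for F :: "('f, 'a) ring_scheme" and A :: "('g, 'b) monoid_scheme" and p
    and L :: "('l, 'c) monoid_scheme" +
  fixes \<rho> :: "'g \<Rightarrow> 'l"
  assumes \<rho>_hom: "\<rho> \<in> hom A L"
    and L_torsion_free: "\<And>x n. x \<in> carrier L \<Longrightarrow> (n::nat) > 0 \<Longrightarrow> x [^]\<^bsub>L\<^esub> n = \<one>\<^bsub>L\<^esub> \<Longrightarrow> x = \<one>\<^bsub>L\<^esub>"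
    and no_p_torsion: "\<And>x. x \<in> carrier A \<Longrightarrow> x [^]\<^bsub>A\<^esub> p = \<one>\<^bsub>A\<^esub> \<Longrightarrow> x = \<one>\<^bsub>A\<^esub>"
begin

sublocale CR: cring R by (rule cring_if_comm) (rule A.comm_group_axioms)
sublocale \<rho>: group_hom A L \<rho> by unfold_locales (rule \<rho>_hom)

abbreviation comp where "comp \<equiv> ga_comp F \<rho>"
definition T where "T = kernel A L \<rho>"

lemma supp_comp: "supp (comp l a) = {x \<in> supp a. \<rho> x = l}"
  by (auto simp: ga_comp_def ga_supp_def)

lemma comp_coeff: "a \<in> carrier R \<Longrightarrow> comp l a x \<in> carrier F"
  using coeff[of a x] by (simp add: ga_comp_def)

lemma comp_closed [simp]: "a \<in> carrier R \<Longrightarrow> comp l a \<in> carrier R"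
  by (rule carrierI)
    (use supp_carrier[of a] comp_coeff[of a] in \<open>auto simp: supp_comp\<close>)

lemma supp_empty: "supp a = {} \<longleftrightarrow> a = \<zero>\<^bsub>R\<^esub>"
  by (auto simp: ga_supp_def zero_eq)

lemma comp_nonzero: "l \<in> \<rho> ` supp a \<longleftrightarrow> comp l a \<noteq> \<zero>\<^bsub>R\<^esub>"
  unfolding supp_empty[symmetric] supp_comp by auto

definition deg_le where "deg_le Q a m \<longleftrightarrow> (\<forall>x\<in>supp a. cone_le L Q (\<rho> x) m)"

text \<open>In an ordered group \<open>m n\<close> is a product of degrees bounded by
  \<open>m\<close> and \<open>n\<close> in only one way.\<close>

lemma comp_mult_top:
  assumes Q: "positive_cone L Q" and ab: "a \<in> carrier R" "b \<in> carrier R"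
    and mn: "m \<in> carrier L" "n \<in> carrier L" and le: "deg_le Q a m" "deg_le Q b n"
  shows "comp (m \<otimes>\<^bsub>L\<^esub> n) (a \<otimes>\<^bsub>R\<^esub> b) = comp m a \<otimes>\<^bsub>R\<^esub> comp n b"
    and "deg_le Q (a \<otimes>\<^bsub>R\<^esub> b) (m \<otimes>\<^bsub>L\<^esub> n)"
proof -
  have sub: "x \<in> carrier A" if "x \<in> supp a \<or> x \<in> supp b" for x using that ab supp_carrier by blast
  have uniq: "\<rho> y = m \<and> \<rho> z = n" if "y \<in> supp a" "z \<in> supp b" "\<rho> (y \<otimes>\<^bsub>A\<^esub> z) = m \<otimes>\<^bsub>L\<^esub> n" for y z
    using that le sub mn by (intro L.cone_le_mult(2)[OF Q]) (auto simp: deg_le_def)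
  show "comp (m \<otimes>\<^bsub>L\<^esub> n) (a \<otimes>\<^bsub>R\<^esub> b) = comp m a \<otimes>\<^bsub>R\<^esub> comp n b"
  proof
    fix x
    let ?P = "{(y, z) \<in> supp a \<times> supp b. y \<otimes>\<^bsub>A\<^esub> z = x}"
    have r: "(comp m a \<otimes>\<^bsub>R\<^esub> comp n b) x = finsum F (\<lambda>(y, z). comp m a y \<otimes>\<^bsub>F\<^esub> comp n b z) ?P"
      by (rule mult_superset) (use ab comp_coeff[OF ab(1)] comp_coeff[OF ab(2)] in \<open>auto simp: supp_comp\<close>)
    have l: "(a \<otimes>\<^bsub>R\<^esub> b) x = finsum F (\<lambda>(y, z). a y \<otimes>\<^bsub>F\<^esub> b z) ?P" by (rule mult_eq)
    show "comp (m \<otimes>\<^bsub>L\<^esub> n) (a \<otimes>\<^bsub>R\<^esub> b) x = (comp m a \<otimes>\<^bsub>R\<^esub> comp n b) x"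
    proof (cases "\<rho> x = m \<otimes>\<^bsub>L\<^esub> n")
      case True
      have "finsum F (\<lambda>(y, z). a y \<otimes>\<^bsub>F\<^esub> b z) ?P = finsum F (\<lambda>(y, z). comp m a y \<otimes>\<^bsub>F\<^esub> comp n b z) ?P"
        by (rule F.finsum_cong')
          (use uniq True coeff[OF ab(1)] coeff[OF ab(2)] in \<open>auto simp: ga_comp_def\<close>)
      then show ?thesis using True r l by (simp add: ga_comp_def)
    next
      case False
      have "finsum F (\<lambda>(y, z). comp m a y \<otimes>\<^bsub>F\<^esub> comp n b z) ?P = \<zero>\<^bsub>F\<^esub>"
      proof (rule F.add.finprod_one_eqI)
        fix w assume w: "w \<in> ?P"
        obtain y z where yz: "w = (y, z)" "y \<in> supp a" "z \<in> supp b" "x = y \<otimes>\<^bsub>A\<^esub> z" using w by blast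
        have "\<rho> y \<noteq> m \<or> \<rho> z \<noteq> n" using False yz sub by auto
        then show "(case w of (y, z) \<Rightarrow> comp m a y \<otimes>\<^bsub>F\<^esub> comp n b z) = \<zero>\<^bsub>F\<^esub>"
          using yz coeff[OF ab(1)] coeff[OF ab(2)] by (auto simp: ga_comp_def)
      qed
      then show ?thesis using False r by (simp add: ga_comp_def)
    qed
  qed
  show "deg_le Q (a \<otimes>\<^bsub>R\<^esub> b) (m \<otimes>\<^bsub>L\<^esub> n)"
    unfolding deg_le_def
  proof
    fix x assume x: "x \<in> supp (a \<otimes>\<^bsub>R\<^esub> b)"
    obtain y z where yz: "y \<in> supp a" "z \<in> supp b" "x = y \<otimes>\<^bsub>A\<^esub> z"
      using subsetD[OF supp_mult[OF ab] x] by auto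
    have yzA: "y \<in> carrier A" "z \<in> carrier A" using yz sub by simp_all
    have "cone_le L Q (\<rho> y) m" "cone_le L Q (\<rho> z) n" using le yz by (simp_all add: deg_le_def)
    then show "cone_le L Q (\<rho> x) (m \<otimes>\<^bsub>L\<^esub> n)"
      using mn yzA L.cone_le_mult(1)[OF Q, of "\<rho> y" "\<rho> z" m n] by (simp add: yz(3))
  qed
qed

lemma top_exists:
  assumes Q: "positive_cone L Q" and a: "a \<in> carrier R" "a \<noteq> \<zero>\<^bsub>R\<^esub>"
  shows "\<exists>m\<in>carrier L. deg_le Q a m \<and> m \<in> \<rho> ` supp a"
proof -
  have "\<rho> ` supp a \<subseteq> carrier L" using supp_carrier[OF a(1)] by auto
  moreover have "\<rho> ` supp a \<noteq> {}" using a(2) supp_empty by auto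
  ultimately obtain m where "m \<in> \<rho> ` supp a" "\<forall>s\<in>\<rho> ` supp a. cone_le L Q s m"
    using L.cone_le_max[OF Q, of "\<rho> ` supp a"] a(1) by auto
  then show ?thesis using \<open>\<rho> ` supp a \<subseteq> carrier L\<close> by (auto simp: deg_le_def)
qed

lemma cone: "\<exists>Q. positive_cone L Q"
  by (rule L.positive_cone_exists) (rule L_torsion_free)

text \<open>If \<open>m\<close> is the top degree of \<open>u\<close>, then
  \<open>u\<^sup>n\<close> has the component \<open>(u\<^sub>m)\<^sup>n\<close> in degree
  \<open>m\<^sup>n\<close>. It is not zero since the algebra is reduced, so \<open>m\<^sup>n =
  1\<close> and \<open>m = 1\<close>. The same holds for the bottom degree.\<close>

lemma root_in_kernel:
  assumes u: "u \<in> carrier R" and n: "(n::nat) > 0" and un: "supp (u [^]\<^bsub>R\<^esub> n) \<subseteq> T"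
  shows "supp u \<subseteq> T"
proof (cases "u = \<zero>\<^bsub>R\<^esub>")
  case True then show ?thesis using supp_empty by auto
next
  case False
  have le1: "deg_le Q u \<one>\<^bsub>L\<^esub>" if Q: "positive_cone L Q" for Q
  proof -
    obtain m where m: "m \<in> carrier L" "deg_le Q u m" "m \<in> \<rho> ` supp u" using top_exists[OF Q u False] by blast
    have "comp (m [^]\<^bsub>L\<^esub> k) (u [^]\<^bsub>R\<^esub> k) = comp m u [^]\<^bsub>R\<^esub> k \<and> deg_le Q (u [^]\<^bsub>R\<^esub> k) (m [^]\<^bsub>L\<^esub> k)" for k :: nat
    proof (induction k)
      case 0
      have "comp \<one>\<^bsub>L\<^esub> \<one>\<^bsub>R\<^esub> = \<one>\<^bsub>R\<^esub>" by (auto simp: ga_comp_def one_eq ga_mon_def)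
      moreover have "deg_le Q \<one>\<^bsub>R\<^esub> \<one>\<^bsub>L\<^esub>" using supp_mon[of "\<one>\<^bsub>F\<^esub>" "\<one>\<^bsub>A\<^esub>"] by (auto simp: deg_le_def one_eq cone_le_def)
      ultimately show ?case by simp
    next
      case (Suc k)
      then show ?case using comp_mult_top[OF Q _ u _ m(1) _ m(2), of "u [^]\<^bsub>R\<^esub> k" "m [^]\<^bsub>L\<^esub> k"] u m(1) by simp
    qed
    moreover have "comp m u [^]\<^bsub>R\<^esub> n \<noteq> \<zero>\<^bsub>R\<^esub>"
      using reduced[OF A.comm_group_axioms no_p_torsion, of "comp m u" n] u m(3) comp_nonzero by auto
    ultimately have "m [^]\<^bsub>L\<^esub> n \<in> \<rho> ` supp (u [^]\<^bsub>R\<^esub> n)" using comp_nonzero by simp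
    then have "m [^]\<^bsub>L\<^esub> n = \<one>\<^bsub>L\<^esub>" using un by (auto simp: T_def kernel_def)
    then have "m = \<one>\<^bsub>L\<^esub>" using L_torsion_free m(1) n by blast
    then show ?thesis using m(2) by simp
  qed
  obtain Q where Q: "positive_cone L Q" using cone by blast
  note Q' = L.positive_cone_inverse[OF Q]
  show ?thesis
  proof
    fix x assume x: "x \<in> supp u"
    then have xA: "x \<in> carrier A" using supp_carrier[OF u] by blast
    have "cone_le L Q (\<rho> x) \<one>\<^bsub>L\<^esub>" using le1[OF Q] x by (simp add: deg_le_def)
    moreover have "cone_le L Q \<one>\<^bsub>L\<^esub> (\<rho> x)"
      by (rule L.cone_le_inverse) (use le1[OF Q'] x xA in \<open>auto simp: deg_le_def\<close>)
    ultimately have "\<rho> x = \<one>\<^bsub>L\<^esub>"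
      using L.cone_le_antisym[OF Q \<rho>.hom_closed[OF xA] L.one_closed] by simp
    then show "x \<in> T" using xA by (simp add: T_def kernel_def)
  qed
qed

lemma comp_mult_kernel:
  assumes a: "a \<in> carrier R" and e: "e \<in> carrier R" "supp e \<subseteq> T"
  shows "comp l (a \<otimes>\<^bsub>R\<^esub> e) = comp l a \<otimes>\<^bsub>R\<^esub> e"
proof
  fix x
  let ?P = "{(y, z) \<in> supp a \<times> supp e. y \<otimes>\<^bsub>A\<^esub> z = x}"
  have r: "(comp l a \<otimes>\<^bsub>R\<^esub> e) x = finsum F (\<lambda>(y, z). comp l a y \<otimes>\<^bsub>F\<^esub> e z) ?P"
    by (rule mult_superset) (use a e comp_coeff[OF a] coeff[OF e(1)] in \<open>auto simp: supp_comp\<close>)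
  have l: "(a \<otimes>\<^bsub>R\<^esub> e) x = finsum F (\<lambda>(y, z). a y \<otimes>\<^bsub>F\<^esub> e z) ?P" by (rule mult_eq)
  have \<rho>: "\<rho> y = \<rho> x" if "(y, z) \<in> ?P" for y z
  proof -
    have "y \<in> carrier A" "z \<in> carrier A" "\<rho> z = \<one>\<^bsub>L\<^esub>" "x = y \<otimes>\<^bsub>A\<^esub> z"
      using that e(2) supp_carrier[OF a] by (auto simp: T_def kernel_def)
    then show ?thesis by simp
  qed
  show "comp l (a \<otimes>\<^bsub>R\<^esub> e) x = (comp l a \<otimes>\<^bsub>R\<^esub> e) x"
  proof (cases "\<rho> x = l")
    case True
    have "finsum F (\<lambda>(y, z). a y \<otimes>\<^bsub>F\<^esub> e z) ?P = finsum F (\<lambda>(y, z). comp l a y \<otimes>\<^bsub>F\<^esub> e z) ?P"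
      by (rule F.finsum_cong') (use \<rho> True coeff[OF a] coeff[OF e(1)] in \<open>auto simp: ga_comp_def\<close>)
    then show ?thesis using True r l by (simp add: ga_comp_def)
  next
    case False
    have "finsum F (\<lambda>(y, z). comp l a y \<otimes>\<^bsub>F\<^esub> e z) ?P = \<zero>\<^bsub>F\<^esub>"
      by (rule F.add.finprod_one_eqI) (use \<rho> False coeff[OF e(1)] in \<open>auto simp: ga_comp_def\<close>)
    then show ?thesis using False r by (simp add: ga_comp_def)
  qed
qed

lemma T_subgroup: "subgroup T A"
  unfolding T_def by (rule \<rho>.subgroup_kernel)

text \<open>A homogeneous element is a monomial times an element supported on \<open>T\<close>,
  and the latter is invertible in the field that the degree one part has at \<open>e\<close>.\<close>

lemma homogeneous_invertible:
  assumes e: "e \<in> carrier R" "supp e \<subseteq> T" "e \<otimes>\<^bsub>R\<^esub> e = e"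
    and fld: "\<And>c. c \<in> carrier R \<Longrightarrow> supp c \<subseteq> T \<Longrightarrow> c \<otimes>\<^bsub>R\<^esub> e \<noteq> \<zero>\<^bsub>R\<^esub> \<Longrightarrow>
       \<exists>d\<in>carrier R. c \<otimes>\<^bsub>R\<^esub> d \<otimes>\<^bsub>R\<^esub> e = e"
    and a: "a \<in> carrier R" "a \<otimes>\<^bsub>R\<^esub> e = a" "a \<noteq> \<zero>\<^bsub>R\<^esub>" "\<rho> ` supp a \<subseteq> {l}"
  shows "\<exists>d\<in>carrier R. a \<otimes>\<^bsub>R\<^esub> d = e"
proof -
  obtain x where x: "x \<in> supp a" using a(3) supp_empty by blast
  have xA: "x \<in> carrier A" using x supp_carrier[OF a(1)] by blast
  let ?x = "mon \<one>\<^bsub>F\<^esub> x" and ?y = "mon \<one>\<^bsub>F\<^esub> (inv\<^bsub>A\<^esub> x)"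
  have xy: "?x \<in> carrier R" "?y \<in> carrier R" "?y \<otimes>\<^bsub>R\<^esub> ?x = \<one>\<^bsub>R\<^esub>" using xA by (auto simp: mult_mon_mon one_eq)
  let ?c = "a \<otimes>\<^bsub>R\<^esub> ?y"
  have c: "?c \<in> carrier R" using a xy by simp
  have "supp ?c \<subseteq> T"
  proof
    fix z assume z: "z \<in> supp ?c"
    obtain y where y: "y \<in> supp a" "z = y \<otimes>\<^bsub>A\<^esub> inv\<^bsub>A\<^esub> x"
      using subsetD[OF supp_mult[OF a(1) xy(2)] z] supp_mon[of "\<one>\<^bsub>F\<^esub>" "inv\<^bsub>A\<^esub> x"] by auto
    have "y \<in> carrier A" "\<rho> y = \<rho> x" using y x a supp_carrier[OF a(1)] by auto
    then show "z \<in> T" using y xA by (simp add: T_def kernel_def)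
  qed
  moreover have "?c \<otimes>\<^bsub>R\<^esub> e \<noteq> \<zero>\<^bsub>R\<^esub>"
  proof
    assume "?c \<otimes>\<^bsub>R\<^esub> e = \<zero>\<^bsub>R\<^esub>"
    then have "?c \<otimes>\<^bsub>R\<^esub> e \<otimes>\<^bsub>R\<^esub> ?x = \<zero>\<^bsub>R\<^esub>" using xy by simp
    moreover have "?c \<otimes>\<^bsub>R\<^esub> e \<otimes>\<^bsub>R\<^esub> ?x = (a \<otimes>\<^bsub>R\<^esub> e) \<otimes>\<^bsub>R\<^esub> (?y \<otimes>\<^bsub>R\<^esub> ?x)"
      using a(1) e xy(1,2) by (simp only: m_assoc CR.m_comm CR.m_lcomm m_closed)
    ultimately show False using a xy by simp
  qed
  ultimately obtain d where d: "d \<in> carrier R" "?c \<otimes>\<^bsub>R\<^esub> d \<otimes>\<^bsub>R\<^esub> e = e" using fld c by blast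
  have "a \<otimes>\<^bsub>R\<^esub> (?y \<otimes>\<^bsub>R\<^esub> d \<otimes>\<^bsub>R\<^esub> e) = e" using d a(1) e xy by (simp add: m_assoc)
  then show ?thesis using d e xy by blast
qed

text \<open>At \<open>e\<close> homogeneous elements are invertible or zero, so top degrees
  multiply, and so do bottom degrees. The product \<open>(u e)(v e) = e\<close> has top and bottom
  degree \<open>1\<close>. As the bottom degrees \<open>m'\<close>, \<open>n'\<close> lie below
  the top degrees \<open>m\<close>, \<open>n\<close> and \<open>m' n' = m n\<close>, they agree.\<close>

lemma unit_component_homogeneous:
  assumes e: "e \<in> carrier R" "supp e \<subseteq> T" "e \<otimes>\<^bsub>R\<^esub> e = e" "e \<noteq> \<zero>\<^bsub>R\<^esub>"
    and fld: "\<And>c. c \<in> carrier R \<Longrightarrow> supp c \<subseteq> T \<Longrightarrow> c \<otimes>\<^bsub>R\<^esub> e \<noteq> \<zero>\<^bsub>R\<^esub> \<Longrightarrow>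
       \<exists>d\<in>carrier R. c \<otimes>\<^bsub>R\<^esub> d \<otimes>\<^bsub>R\<^esub> e = e"
    and uv: "u \<in> carrier R" "v \<in> carrier R" "u \<otimes>\<^bsub>R\<^esub> v = \<one>\<^bsub>R\<^esub>"
  shows "\<exists>m\<in>carrier L. \<rho> ` supp (u \<otimes>\<^bsub>R\<^esub> e) \<subseteq> {m} \<and> \<rho> ` supp (v \<otimes>\<^bsub>R\<^esub> e) \<subseteq> {inv\<^bsub>L\<^esub> m}"
proof -
  let ?a = "u \<otimes>\<^bsub>R\<^esub> e" and ?b = "v \<otimes>\<^bsub>R\<^esub> e"
  have ab: "?a \<in> carrier R" "?b \<in> carrier R" using uv e by auto
  have abe: "?a \<otimes>\<^bsub>R\<^esub> e = ?a" "?b \<otimes>\<^bsub>R\<^esub> e = ?b" using uv e by (simp_all add: m_assoc)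
  have prod: "?a \<otimes>\<^bsub>R\<^esub> ?b = e"
  proof -
    have "?a \<otimes>\<^bsub>R\<^esub> ?b = (u \<otimes>\<^bsub>R\<^esub> v) \<otimes>\<^bsub>R\<^esub> (e \<otimes>\<^bsub>R\<^esub> e)" using uv(1,2) e(1) by (simp only: m_assoc CR.m_comm CR.m_lcomm m_closed)
    then show ?thesis using uv e by simp
  qed
  have nz: "?a \<noteq> \<zero>\<^bsub>R\<^esub>" "?b \<noteq> \<zero>\<^bsub>R\<^esub>" using prod e(4) ab by auto
  \<comment> \<open>The extreme degrees of \<open>u e\<close> and \<open>v e\<close> are inverse
    to each other in either order.\<close>
  have ext: "m \<otimes>\<^bsub>L\<^esub> n = \<one>\<^bsub>L\<^esub>"
    if Q: "positive_cone L Q" and m: "m \<in> carrier L" "deg_le Q ?a m" "m \<in> \<rho> ` supp ?a"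
      and n: "n \<in> carrier L" "deg_le Q ?b n" "n \<in> \<rho> ` supp ?b" for Q m n
  proof -
    have 1: "comp (m \<otimes>\<^bsub>L\<^esub> n) e = comp m ?a \<otimes>\<^bsub>R\<^esub> comp n ?b"
      using comp_mult_top(1)[OF Q ab m(1) n(1) m(2) n(2)] unfolding prod .
    have "comp m ?a \<otimes>\<^bsub>R\<^esub> e = comp m ?a" using comp_mult_kernel[OF ab(1) e(1,2), of m] abe by simp
    moreover have "comp m ?a \<noteq> \<zero>\<^bsub>R\<^esub>" "comp n ?b \<noteq> \<zero>\<^bsub>R\<^esub>" using m(3) n(3) comp_nonzero by auto
    moreover have "\<rho> ` supp (comp m ?a) \<subseteq> {m}" by (auto simp: supp_comp)
    ultimately obtain d where d: "d \<in> carrier R" "comp m ?a \<otimes>\<^bsub>R\<^esub> d = e"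
      using homogeneous_invertible[OF e(1,2,3) fld, of "comp m ?a" m] ab(1) by auto
    have nb: "comp n ?b \<otimes>\<^bsub>R\<^esub> e = comp n ?b" using comp_mult_kernel[OF ab(2) e(1,2), of n] abe by simp
    have "comp m ?a \<otimes>\<^bsub>R\<^esub> comp n ?b \<noteq> \<zero>\<^bsub>R\<^esub>"
    proof
      assume "comp m ?a \<otimes>\<^bsub>R\<^esub> comp n ?b = \<zero>\<^bsub>R\<^esub>"
      then have "comp m ?a \<otimes>\<^bsub>R\<^esub> comp n ?b \<otimes>\<^bsub>R\<^esub> d = \<zero>\<^bsub>R\<^esub>" using d by simp
      moreover have "comp m ?a \<otimes>\<^bsub>R\<^esub> comp n ?b \<otimes>\<^bsub>R\<^esub> d = comp n ?b \<otimes>\<^bsub>R\<^esub> (comp m ?a \<otimes>\<^bsub>R\<^esub> d)"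
        using d(1) comp_closed[OF ab(1)] comp_closed[OF ab(2)] by (simp only: m_assoc CR.m_comm CR.m_lcomm m_closed)
      ultimately show False using d(2) nb \<open>comp n ?b \<noteq> \<zero>\<^bsub>R\<^esub>\<close> by simp
    qed
    then have "m \<otimes>\<^bsub>L\<^esub> n \<in> \<rho> ` supp e" using 1 comp_nonzero by simp
    then show ?thesis using e(2) by (auto simp: T_def kernel_def)
  qed
  obtain Q where Q: "positive_cone L Q" using cone by blast
  note Q' = L.positive_cone_inverse[OF Q]
  obtain m where m: "m \<in> carrier L" "deg_le Q ?a m" "m \<in> \<rho> ` supp ?a" using top_exists[OF Q ab(1) nz(1)] by blast
  obtain n where n: "n \<in> carrier L" "deg_le Q ?b n" "n \<in> \<rho> ` supp ?b" using top_exists[OF Q ab(2) nz(2)] by blast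
  obtain m' where m': "m' \<in> carrier L" "deg_le {x \<in> carrier L. inv\<^bsub>L\<^esub> x \<in> Q} ?a m'" "m' \<in> \<rho> ` supp ?a"
    using top_exists[OF Q' ab(1) nz(1)] by blast
  obtain n' where n': "n' \<in> carrier L" "deg_le {x \<in> carrier L. inv\<^bsub>L\<^esub> x \<in> Q} ?b n'" "n' \<in> \<rho> ` supp ?b"
    using top_exists[OF Q' ab(2) nz(2)] by blast
  have mn: "m \<otimes>\<^bsub>L\<^esub> n = \<one>\<^bsub>L\<^esub>" "m' \<otimes>\<^bsub>L\<^esub> n' = \<one>\<^bsub>L\<^esub>" using ext[OF Q m n] ext[OF Q' m' n'] .
  have "cone_le L Q m' m" "cone_le L Q n' n" using m m' n n' by (auto simp: deg_le_def)
  then have eq: "m' = m" "n' = n"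
    using L.cone_le_mult(2)[OF Q m'(1) n'(1) m(1) n(1)] mn by auto
  have single: "\<rho> ` supp c \<subseteq> {k}" if "c \<in> carrier R" "k \<in> carrier L" "deg_le Q c k"
    "deg_le {x \<in> carrier L. inv\<^bsub>L\<^esub> x \<in> Q} c k" for c k
  proof clarify
    fix x assume x: "x \<in> supp c"
    have xL: "\<rho> x \<in> carrier L" using x supp_carrier[OF that(1)] by auto
    have "cone_le L Q (\<rho> x) k" "cone_le L Q k (\<rho> x)"
      using that x L.cone_le_inverse[OF xL that(2)] by (auto simp: deg_le_def)
    then show "\<rho> x = k" using L.cone_le_antisym[OF Q xL that(2)] by simp
  qed
  have "n = inv\<^bsub>L\<^esub> m" using mn(1) m(1) n(1) L.m_comm L.inv_equality by metis
  then show ?thesis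
    using single[OF ab(1) m(1,2)] single[OF ab(2) n(1,2)] m'(2) n'(2) eq m(1) by auto
qed

end

section \<open>Decompositions into fields and orthogonal idempotents\<close>

text \<open>An elementwise form of a decomposition of a commutative ring into \<open>n\<close>
  fields \<open>R e\<^sub>i\<close>. Joint faithfulness of the \<open>e\<^sub>i\<close> replaces
  \<open>\<Sum> e\<^sub>i = 1\<close>, which follows from it, and is what a maximal orthogonal
  family satisfies by construction.\<close>

definition field_idempotents :: "('r, 'a) ring_scheme \<Rightarrow> nat \<Rightarrow> (nat \<Rightarrow> 'r) \<Rightarrow> bool" where
  "field_idempotents R n e \<longleftrightarrow>
     (\<forall>i<n. e i \<in> carrier R \<and> e i \<noteq> \<zero>\<^bsub>R\<^esub> \<and> e i \<otimes>\<^bsub>R\<^esub> e i = e i) \<and>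
     (\<forall>i<n. \<forall>j<n. i \<noteq> j \<longrightarrow> e i \<otimes>\<^bsub>R\<^esub> e j = \<zero>\<^bsub>R\<^esub>) \<and>
     (\<forall>x\<in>carrier R. (\<forall>i<n. x \<otimes>\<^bsub>R\<^esub> e i = \<zero>\<^bsub>R\<^esub>) \<longrightarrow> x = \<zero>\<^bsub>R\<^esub>) \<and>
     (\<forall>i<n. \<forall>c\<in>carrier R. c \<otimes>\<^bsub>R\<^esub> e i \<noteq> \<zero>\<^bsub>R\<^esub> \<longrightarrow> (\<exists>d\<in>carrier R. c \<otimes>\<^bsub>R\<^esub> d \<otimes>\<^bsub>R\<^esub> e i = e i))"

lemma RDirProd_list_Cons_ops:
  assumes "x \<in> carrier K" "y \<in> carrier K" "xs \<in> carrier (RDirProd_list Ks)" "ys \<in> carrier (RDirProd_list Ks)"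
  shows "(x # xs) \<otimes>\<^bsub>RDirProd_list (K # Ks)\<^esub> (y # ys) = (x \<otimes>\<^bsub>K\<^esub> y) # (xs \<otimes>\<^bsub>RDirProd_list Ks\<^esub> ys)"
    and "(x # xs) \<oplus>\<^bsub>RDirProd_list (K # Ks)\<^esub> (y # ys) = (x \<oplus>\<^bsub>K\<^esub> y) # (xs \<oplus>\<^bsub>RDirProd_list Ks\<^esub> ys)"
proof -
  let ?f = "\<lambda>(a, as). a # as" and ?D = "RDirProd K (RDirProd_list Ks)"
  have c: "(x, xs) \<in> carrier ?D" "(y, ys) \<in> carrier ?D" using assms by (simp_all add: RDirProd_carrier)
  have h: "?f \<in> ring_hom ?D (RDirProd_list (K # Ks))" by (rule RDirProd_list_hom1)
  show "(x # xs) \<otimes>\<^bsub>RDirProd_list (K # Ks)\<^esub> (y # ys) = (x \<otimes>\<^bsub>K\<^esub> y) # (xs \<otimes>\<^bsub>RDirProd_list Ks\<^esub> ys)"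
    using ring_hom_mult[OF h c] by (simp add: RDirProd_def DirProd_def monoid.defs)
  show "(x # xs) \<oplus>\<^bsub>RDirProd_list (K # Ks)\<^esub> (y # ys) = (x \<oplus>\<^bsub>K\<^esub> y) # (xs \<oplus>\<^bsub>RDirProd_list Ks\<^esub> ys)"
    using ring_hom_add[OF h c] by (simp add: RDirProd_def DirProd_def monoid.defs)
qed

lemma RDirProd_list_ops_nth:
  assumes "xs \<in> carrier (RDirProd_list Ks)" "ys \<in> carrier (RDirProd_list Ks)" "i < length Ks"
  shows "(xs \<otimes>\<^bsub>RDirProd_list Ks\<^esub> ys) ! i = xs ! i \<otimes>\<^bsub>Ks ! i\<^esub> ys ! i"
    and "(xs \<oplus>\<^bsub>RDirProd_list Ks\<^esub> ys) ! i = xs ! i \<oplus>\<^bsub>Ks ! i\<^esub> ys ! i"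
proof -
  have "(xs \<otimes>\<^bsub>RDirProd_list Ks\<^esub> ys) ! i = xs ! i \<otimes>\<^bsub>Ks ! i\<^esub> ys ! i \<and>
        (xs \<oplus>\<^bsub>RDirProd_list Ks\<^esub> ys) ! i = xs ! i \<oplus>\<^bsub>Ks ! i\<^esub> ys ! i"
    using assms
  proof (induction Ks arbitrary: xs ys i)
    case (Cons K Ks)
    obtain x xs' where x: "xs = x # xs'" "x \<in> carrier K" "xs' \<in> carrier (RDirProd_list Ks)"
      using Cons.prems(1) unfolding RDirProd_list_carrier by auto
    obtain y ys' where y: "ys = y # ys'" "y \<in> carrier K" "ys' \<in> carrier (RDirProd_list Ks)"
      using Cons.prems(2) unfolding RDirProd_list_carrier by auto
    show ?case
      unfolding x(1) y(1) RDirProd_list_Cons_ops[OF x(2) y(2) x(3) y(3)]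
      using Cons.IH[OF x(3) y(3)] Cons.prems(3) by (cases i) auto
  qed simp
  then show "(xs \<otimes>\<^bsub>RDirProd_list Ks\<^esub> ys) ! i = xs ! i \<otimes>\<^bsub>Ks ! i\<^esub> ys ! i"
    "(xs \<oplus>\<^bsub>RDirProd_list Ks\<^esub> ys) ! i = xs ! i \<oplus>\<^bsub>Ks ! i\<^esub> ys ! i" by auto
qed

lemma RDirProd_list_zero_map: "\<zero>\<^bsub>RDirProd_list Ks\<^esub> = map ring.zero Ks"
  unfolding RDirProd_list_zero by (induction Ks) auto

lemma RDirProd_list_one_map: "\<one>\<^bsub>RDirProd_list Ks\<^esub> = map one Ks"
  unfolding RDirProd_list_one by (induction Ks) auto

lemma RDirProd_list_eqI:
  assumes "xs \<in> carrier (RDirProd_list Ks)" "ys \<in> carrier (RDirProd_list Ks)"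
    "\<And>i. i < length Ks \<Longrightarrow> xs ! i = ys ! i"
  shows "xs = ys"
  using assms RDirProd_list_carrier_mem(1)[OF assms(1)] RDirProd_list_carrier_mem(1)[OF assms(2)]
  by (intro nth_equalityI) auto

lemma RDirProd_list_closed:
  assumes "\<And>K. K \<in> set Ks \<Longrightarrow> field K"
  shows "ring (RDirProd_list Ks)"
proof (rule RDirProd_list_is_ring)
  fix i assume "i < length Ks"
  then have "field (Ks ! i)" using assms by simp
  then show "ring (Ks ! i)" using field.is_ring by blast
qed

lemma ring_iso_preimage:
  assumes "h \<in> ring_iso R S" "s \<in> carrier S" shows "\<exists>r\<in>carrier R. h r = s"
proof -
  have "s \<in> h ` carrier R" using assms unfolding ring_iso_def bij_betw_def by simp
  then show ?thesis by blast
qed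

lemma field_idempotents_transfer:
  assumes R: "ring R" "ring S" and h: "h \<in> ring_iso S R" and e: "field_idempotents R n e"
    and f: "\<And>i. i < n \<Longrightarrow> f i \<in> carrier S \<and> h (f i) = e i"
  shows "field_idempotents S n f"
proof -
  interpret R: ring R by fact
  interpret S: ring S by fact
  have hh: "h \<in> ring_hom S R" using h by (simp add: ring_iso_def)
  interpret h: ring_hom_ring S R h by (rule ring_hom_ringI2) (use R hh in auto)
  have injh: "inj_on h (carrier S)" using h by (simp add: ring_iso_def bij_betw_def)
  note inj = inj_onD[OF injh]
  have E: "\<And>i. i < n \<Longrightarrow> e i \<in> carrier R \<and> e i \<noteq> \<zero>\<^bsub>R\<^esub> \<and> e i \<otimes>\<^bsub>R\<^esub> e i = e i"
    "\<And>i j. i < n \<Longrightarrow> j < n \<Longrightarrow> i \<noteq> j \<Longrightarrow> e i \<otimes>\<^bsub>R\<^esub> e j = \<zero>\<^bsub>R\<^esub>"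
    "\<And>x. x \<in> carrier R \<Longrightarrow> (\<And>i. i < n \<Longrightarrow> x \<otimes>\<^bsub>R\<^esub> e i = \<zero>\<^bsub>R\<^esub>) \<Longrightarrow> x = \<zero>\<^bsub>R\<^esub>"
    "\<And>i c. i < n \<Longrightarrow> c \<in> carrier R \<Longrightarrow> c \<otimes>\<^bsub>R\<^esub> e i \<noteq> \<zero>\<^bsub>R\<^esub> \<Longrightarrow> \<exists>d\<in>carrier R. c \<otimes>\<^bsub>R\<^esub> d \<otimes>\<^bsub>R\<^esub> e i = e i"
    using e unfolding field_idempotents_def by auto
  have 1: "f i \<in> carrier S \<and> f i \<noteq> \<zero>\<^bsub>S\<^esub> \<and> f i \<otimes>\<^bsub>S\<^esub> f i = f i" if i: "i < n" for i
    using f[OF i] E(1)[OF i] inj[of "f i \<otimes>\<^bsub>S\<^esub> f i" "f i"] by auto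
  have 2: "f i \<otimes>\<^bsub>S\<^esub> f j = \<zero>\<^bsub>S\<^esub>" if i: "i < n" "j < n" "i \<noteq> j" for i j
    using f[OF i(1)] f[OF i(2)] E(2)[OF i] inj[of "f i \<otimes>\<^bsub>S\<^esub> f j" "\<zero>\<^bsub>S\<^esub>"] by auto
  have 3: "x = \<zero>\<^bsub>S\<^esub>" if x: "x \<in> carrier S" "\<And>i. i < n \<Longrightarrow> x \<otimes>\<^bsub>S\<^esub> f i = \<zero>\<^bsub>S\<^esub>" for x
  proof -
    have "h x \<otimes>\<^bsub>R\<^esub> e i = \<zero>\<^bsub>R\<^esub>" if i: "i < n" for i
      using x(2)[OF i] f[OF i] x(1) by (metis h.hom_mult h.hom_zero)
    then have "h x = h \<zero>\<^bsub>S\<^esub>" using E(3)[of "h x"] x(1) by simp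
    then show ?thesis using inj x(1) by blast
  qed
  have 4: "\<exists>d\<in>carrier S. c \<otimes>\<^bsub>S\<^esub> d \<otimes>\<^bsub>S\<^esub> f i = f i"
    if c: "i < n" "c \<in> carrier S" "c \<otimes>\<^bsub>S\<^esub> f i \<noteq> \<zero>\<^bsub>S\<^esub>" for i c
  proof -
    have "h (c \<otimes>\<^bsub>S\<^esub> f i) \<noteq> h \<zero>\<^bsub>S\<^esub>" using inj[of "c \<otimes>\<^bsub>S\<^esub> f i" "\<zero>\<^bsub>S\<^esub>"] c f[OF c(1)] by auto
    then have "h c \<otimes>\<^bsub>R\<^esub> e i \<noteq> \<zero>\<^bsub>R\<^esub>" using c f[OF c(1)] by simp
    then obtain d where d: "d \<in> carrier R" "h c \<otimes>\<^bsub>R\<^esub> d \<otimes>\<^bsub>R\<^esub> e i = e i"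
      using E(4)[OF c(1), of "h c"] c(2) by auto
    obtain d' where d': "d' \<in> carrier S" "h d' = d" using ring_iso_preimage[OF h d(1)] by blast
    have "h (c \<otimes>\<^bsub>S\<^esub> d' \<otimes>\<^bsub>S\<^esub> f i) = h (f i)" using d d' c f[OF c(1)] by simp
    then show ?thesis using inj[of "c \<otimes>\<^bsub>S\<^esub> d' \<otimes>\<^bsub>S\<^esub> f i" "f i"] d' c f[OF c(1)] by auto
  qed
  show ?thesis unfolding field_idempotents_def using 1 2 3 4 by simp
qed

lemma field_idempotents_RDirProd_list:
  assumes "\<And>K. K \<in> set Ks \<Longrightarrow> field K"
  shows "\<exists>e. field_idempotents (RDirProd_list Ks) (length Ks) e"
proof -
  let ?P = "RDirProd_list Ks"
  let ?n = "length Ks"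
  interpret P: ring ?P by (rule RDirProd_list_closed[OF assms])
  have fld: "field (Ks ! i)" if "i < ?n" for i using assms that by simp
  define e where "e i = map (\<lambda>j. if j = i then \<one>\<^bsub>Ks ! j\<^esub> else \<zero>\<^bsub>Ks ! j\<^esub>) [0..<?n]" for i
  have nth: "e i ! j = (if j = i then \<one>\<^bsub>Ks ! j\<^esub> else \<zero>\<^bsub>Ks ! j\<^esub>)" if "j < ?n" for i j
    using that by (simp add: e_def)
  have ec: "e i \<in> carrier ?P" for i
  proof (rule RDirProd_list_carrier_memI)
    fix j assume j: "j < ?n"
    interpret K: field "Ks ! j" by (rule fld[OF j])
    show "e i ! j \<in> carrier (Ks ! j)"
      unfolding nth[OF j] using K.one_closed K.zero_closed by presburger
  qed (simp add: e_def)
  have z: "\<zero>\<^bsub>?P\<^esub> ! j = \<zero>\<^bsub>Ks ! j\<^esub>" if "j < ?n" for j using that by (simp add: RDirProd_list_zero_map)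
  have me: "(x \<otimes>\<^bsub>?P\<^esub> e i) ! j = (if j = i then x ! j else \<zero>\<^bsub>Ks ! j\<^esub>)" if x: "x \<in> carrier ?P" and j: "j < ?n" for x i j
  proof -
    interpret K: field "Ks ! j" by (rule fld[OF j])
    note xj = RDirProd_list_carrier_mem(2)[OF x j]
    show ?thesis unfolding RDirProd_list_ops_nth(1)[OF x ec j] nth[OF j]
      using K.r_one[OF xj] K.r_null[OF xj] by presburger
  qed
  have 1: "e i \<in> carrier ?P \<and> e i \<noteq> \<zero>\<^bsub>?P\<^esub> \<and> e i \<otimes>\<^bsub>?P\<^esub> e i = e i" if i: "i < ?n" for i
  proof (intro conjI)
    interpret K: field "Ks ! i" by (rule fld[OF i])
    show "e i \<noteq> \<zero>\<^bsub>?P\<^esub>" using nth[OF i, of i] z[OF i] K.one_not_zero by auto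
    show "e i \<otimes>\<^bsub>?P\<^esub> e i = e i"
      by (rule RDirProd_list_eqI) (use ec me nth in auto)
  qed (rule ec)
  have 2: "e i \<otimes>\<^bsub>?P\<^esub> e j = \<zero>\<^bsub>?P\<^esub>" if "i \<noteq> j" for i j
    by (rule RDirProd_list_eqI) (use ec me nth z that in auto)
  have 3: "x = \<zero>\<^bsub>?P\<^esub>" if x: "x \<in> carrier ?P" "\<And>i. i < ?n \<Longrightarrow> x \<otimes>\<^bsub>?P\<^esub> e i = \<zero>\<^bsub>?P\<^esub>" for x
  proof (rule RDirProd_list_eqI[OF x(1) P.zero_closed])
    fix i assume i: "i < ?n"
    show "x ! i = \<zero>\<^bsub>?P\<^esub> ! i" using me[OF x(1) i, of i] x(2)[OF i] by simp
  qed
  have 4: "\<exists>d\<in>carrier ?P. c \<otimes>\<^bsub>?P\<^esub> d \<otimes>\<^bsub>?P\<^esub> e i = e i"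
    if c: "i < ?n" "c \<in> carrier ?P" "c \<otimes>\<^bsub>?P\<^esub> e i \<noteq> \<zero>\<^bsub>?P\<^esub>" for i c
  proof -
    interpret K: field "Ks ! i" by (rule fld[OF c(1)])
    have "c ! i \<noteq> \<zero>\<^bsub>Ks ! i\<^esub>"
    proof
      assume "c ! i = \<zero>\<^bsub>Ks ! i\<^esub>"
      then have "c \<otimes>\<^bsub>?P\<^esub> e i = \<zero>\<^bsub>?P\<^esub>"
        by (intro RDirProd_list_eqI) (use ec c me z in auto)
      then show False using c by simp
    qed
    then have U: "c ! i \<in> Units (Ks ! i)" using RDirProd_list_carrier_mem(2)[OF c(2,1)] K.field_Units by auto
    define d where "d = map (\<lambda>j. if j = i then inv\<^bsub>Ks ! i\<^esub> (c ! i) else \<zero>\<^bsub>Ks ! j\<^esub>) [0..<?n]"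
    have dc: "d \<in> carrier ?P"
    proof (rule RDirProd_list_carrier_memI)
      fix j assume j: "j < ?n"
      interpret J: field "Ks ! j" by (rule fld[OF j])
      show "d ! j \<in> carrier (Ks ! j)" using j K.Units_inv_closed[OF U] by (auto simp: d_def)
    qed (simp add: d_def)
    have "c \<otimes>\<^bsub>?P\<^esub> d \<otimes>\<^bsub>?P\<^esub> e i = e i"
    proof (rule RDirProd_list_eqI)
      fix j assume j: "j < ?n"
      show "(c \<otimes>\<^bsub>?P\<^esub> d \<otimes>\<^bsub>?P\<^esub> e i) ! j = e i ! j"
        using me[of "c \<otimes>\<^bsub>?P\<^esub> d" j i] nth[OF j] RDirProd_list_ops_nth(1)[OF c(2) dc j] c dc j U
        by (auto simp: d_def)
    qed (use c dc ec in auto)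
    then show ?thesis using dc by blast
  qed
  show ?thesis unfolding field_idempotents_def using 1 2 3 4 by (intro exI[of _ e]) simp
qed

lemma direct_sum_of_fields_imp_idempotents:
  assumes R: "ring R" and "direct_sum_of_fields R n"
  shows "\<exists>e. field_idempotents R n e"
proof -
  obtain Ks :: "'a ring list" where Ks: "length Ks = n" "\<forall>K\<in>set Ks. field K" "ring_iso R (RDirProd_list Ks) \<noteq> {}"
    using assms(2) unfolding direct_sum_of_fields_def is_ring_iso_def by (elim exE conjE)
  then obtain h where h: "h \<in> ring_iso R (RDirProd_list Ks)" by blast
  note K = Ks(1) bspec[OF Ks(2)] h
  obtain e where e: "field_idempotents (RDirProd_list Ks) n e"
    using field_idempotents_RDirProd_list[of Ks] K(1,2) by auto
  have "\<forall>i<n. \<exists>r\<in>carrier R. h r = e i"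
    using e ring_iso_preimage[OF K(3)] unfolding field_idempotents_def by blast
  then obtain f where "\<And>i. i < n \<Longrightarrow> f i \<in> carrier R \<and> h (f i) = e i" by metis
  then show ?thesis using field_idempotents_transfer[OF RDirProd_list_closed R K(3) e] K(2) by blast
qed

context cring
begin

lemma field_idempotents_sum:
  assumes e: "field_idempotents R n e"
  shows "finsum R e {..<n} = \<one>"
proof -
  have ec: "e \<in> {..<n} \<rightarrow> carrier R" using e by (auto simp: field_idempotents_def)
  let ?s = "finsum R e {..<n}"
  have s: "?s \<in> carrier R" by (rule finsum_closed[OF ec])
  have "(\<one> \<ominus> ?s) \<otimes> e j = \<zero>" if j: "j < n" for j
  proof -
    have ej: "e j \<in> carrier R" using ec j by auto
    have "?s \<otimes> e j = (\<Oplus>i\<in>{..<n}. e i \<otimes> e j)" by (rule finsum_ldistr) (use ec ej in auto)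
    also have "\<dots> = (\<Oplus>i\<in>{..<n}. if j = i then e i else \<zero>)"
      by (rule finsum_cong') (use e j in \<open>auto simp: field_idempotents_def\<close>)
    also have "\<dots> = e j" using add.finprod_singleton[of j "{..<n}" e] j ec by simp
    finally show ?thesis using s ej by (simp add: a_minus_def l_distr l_minus r_neg)
  qed
  moreover have "\<one> \<ominus> ?s \<in> carrier R" using s by simp
  moreover have "\<forall>x\<in>carrier R. (\<forall>i<n. x \<otimes> e i = \<zero>) \<longrightarrow> x = \<zero>"
    using e unfolding field_idempotents_def by (elim conjE)
  ultimately have "\<one> \<ominus> ?s = \<zero>" by blast
  then show ?thesis using s by (simp add: r_right_minus_eq)
qed

text \<open>The map \<open>x \<mapsto> (x e\<^sub>i)\<^sub>i\<close> is an isomorphism onto the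
  product of the fields \<open>R e\<^sub>i\<close>; the inverse is summation.\<close>

lemma idempotents_imp_direct_sum_of_fields:
  assumes e: "field_idempotents R n e"
  shows "direct_sum_of_fields R n"
proof -
  have E: "\<And>i. i < n \<Longrightarrow> e i \<in> carrier R" "\<And>i. i < n \<Longrightarrow> e i \<noteq> \<zero>" "\<And>i. i < n \<Longrightarrow> e i \<otimes> e i = e i"
    "\<And>i j. i < n \<Longrightarrow> j < n \<Longrightarrow> i \<noteq> j \<Longrightarrow> e i \<otimes> e j = \<zero>"
    "\<And>x. x \<in> carrier R \<Longrightarrow> (\<And>i. i < n \<Longrightarrow> x \<otimes> e i = \<zero>) \<Longrightarrow> x = \<zero>"
    "\<And>i c. i < n \<Longrightarrow> c \<in> carrier R \<Longrightarrow> c \<otimes> e i \<noteq> \<zero> \<Longrightarrow> \<exists>d\<in>carrier R. c \<otimes> d \<otimes> e i = e i"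
    using e unfolding field_idempotents_def by auto
  define K :: "nat \<Rightarrow> 'a ring" where
    "K i = \<lparr>carrier = {x \<in> carrier R. x \<otimes> e i = x}, monoid.mult = (\<otimes>), one = e i, ring.zero = \<zero>, ring.add = (\<oplus>)\<rparr>" for i
  have Ksimps: "carrier (K i) = {x \<in> carrier R. x \<otimes> e i = x}" "monoid.mult (K i) = (\<otimes>)"
    "one (K i) = e i" "ring.zero (K i) = \<zero>" "ring.add (K i) = (\<oplus>)" for i
    by (simp_all add: K_def)
  have fieldK: "field (K i)" if i: "i < n" for i
  proof -
    note ei = E(1)[OF i]
    have "cring (K i)"
    proof (rule cringI)
      show "abelian_group (K i)"
      proof (rule abelian_groupI)
        fix x assume x: "x \<in> carrier (K i)"
        then have "\<ominus> x \<in> carrier (K i)" "\<ominus> x \<oplus> x = \<zero>" using ei by (auto simp: Ksimps l_minus l_neg)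
        then show "\<exists>y\<in>carrier (K i). y \<oplus>\<^bsub>K i\<^esub> x = \<zero>\<^bsub>K i\<^esub>" by (auto simp: Ksimps)
      qed (use ei in \<open>auto simp: Ksimps l_distr a_ac\<close>)
      show "Group.comm_monoid (K i)"
      proof (rule Group.comm_monoidI)
        fix x y assume "x \<in> carrier (K i)" "y \<in> carrier (K i)"
        then show "x \<otimes>\<^bsub>K i\<^esub> y \<in> carrier (K i)" "x \<otimes>\<^bsub>K i\<^esub> y = y \<otimes>\<^bsub>K i\<^esub> x"
          using ei by (auto simp: Ksimps m_assoc intro: m_comm)
      next
        fix x assume "x \<in> carrier (K i)"
        then show "\<one>\<^bsub>K i\<^esub> \<otimes>\<^bsub>K i\<^esub> x = x" using ei m_comm[of "e i" x] by (auto simp: Ksimps)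
      qed (use ei E(3)[OF i] in \<open>auto simp: Ksimps m_assoc\<close>)
    qed (auto simp: Ksimps l_distr)
    then interpret K: cring "K i" .
    show ?thesis
    proof (rule K.cring_fieldI2)
      show "\<zero>\<^bsub>K i\<^esub> \<noteq> \<one>\<^bsub>K i\<^esub>" using E(2)[OF i] by (simp add: Ksimps)
      fix c assume c: "c \<in> carrier (K i)" "c \<noteq> \<zero>\<^bsub>K i\<^esub>"
      then have "c \<in> carrier R" "c \<otimes> e i = c" "c \<noteq> \<zero>" by (auto simp: Ksimps)
      then obtain d where d: "d \<in> carrier R" "c \<otimes> d \<otimes> e i = e i" using E(6)[OF i, of c] by auto
      have "d \<otimes> e i \<in> carrier (K i)" using d ei E(3)[OF i] by (simp add: Ksimps m_assoc)
      moreover have "c \<otimes> (d \<otimes> e i) = e i" using d ei \<open>c \<in> carrier R\<close> by (simp add: m_assoc)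
      ultimately show "\<exists>d\<in>carrier (K i). c \<otimes>\<^bsub>K i\<^esub> d = \<one>\<^bsub>K i\<^esub>" by (auto simp: Ksimps)
    qed
  qed
  let ?Ks = "map K [0..<n]"
  let ?P = "RDirProd_list ?Ks"
  define h where "h x = map (\<lambda>i. x \<otimes> e i) [0..<n]" for x
  interpret P: ring ?P by (rule RDirProd_list_closed) (use fieldK in auto)
  have hc: "h x \<in> carrier ?P" if x: "x \<in> carrier R" for x
    by (rule RDirProd_list_carrier_memI) (use x E(1,3) in \<open>auto simp: h_def Ksimps m_assoc\<close>)
  have "h \<in> ring_iso R ?P"
    unfolding ring_iso_def
  proof (intro CollectI conjI)
    show "h \<in> ring_hom R ?P"
    proof (rule ring_hom_memI)
      fix x y assume x: "x \<in> carrier R" and y: "y \<in> carrier R"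
      show "h (x \<otimes> y) = h x \<otimes>\<^bsub>?P\<^esub> h y"
      proof (rule RDirProd_list_eqI)
        fix i assume i': "i < length ?Ks" then have i: "i < n" by simp
        have "x \<otimes> y \<otimes> e i = (x \<otimes> y) \<otimes> (e i \<otimes> e i)" using E(3)[OF i] by simp
        also have "\<dots> = (x \<otimes> e i) \<otimes> (y \<otimes> e i)" using x y E(1)[OF i] by (simp add: m_ac)
        finally show "h (x \<otimes> y) ! i = (h x \<otimes>\<^bsub>?P\<^esub> h y) ! i"
          using RDirProd_list_ops_nth(1)[OF hc[OF x] hc[OF y] i'] i by (simp add: h_def Ksimps)
      qed (use x y hc in auto)
      show "h (x \<oplus> y) = h x \<oplus>\<^bsub>?P\<^esub> h y"
      proof (rule RDirProd_list_eqI)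
        fix i assume i': "i < length ?Ks" then have i: "i < n" by simp
        then show "h (x \<oplus> y) ! i = (h x \<oplus>\<^bsub>?P\<^esub> h y) ! i"
          using RDirProd_list_ops_nth(2)[OF hc[OF x] hc[OF y] i'] x y E(1)[OF i]
          by (simp add: h_def Ksimps l_distr)
      qed (use x y hc in auto)
    next
      show "h \<one> = \<one>\<^bsub>?P\<^esub>" using E(1) by (auto simp: h_def RDirProd_list_one_map Ksimps)
    qed (rule hc)
    show "bij_betw h (carrier R) (carrier ?P)"
      unfolding bij_betw_def
    proof
      show "inj_on h (carrier R)"
      proof (rule inj_onI)
        fix x y assume xy: "x \<in> carrier R" "y \<in> carrier R" "h x = h y"
        have "x \<otimes> e i = y \<otimes> e i" if "i < n" for i
          using arg_cong[OF xy(3), of "\<lambda>l. l ! i"] that by (simp add: h_def)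
        then have "(x \<ominus> y) \<otimes> e i = \<zero>" if "i < n" for i
          using that xy E(1) by (simp add: a_minus_def l_distr l_minus r_neg)
        then have "x \<ominus> y = \<zero>" using xy E(5) by simp
        then show "x = y" using xy by (simp add: r_right_minus_eq)
      qed
      show "h ` carrier R = carrier ?P"
      proof
        show "h ` carrier R \<subseteq> carrier ?P" using hc by auto
        show "carrier ?P \<subseteq> h ` carrier R"
        proof
          fix xs assume xs: "xs \<in> carrier ?P"
          have xi: "xs ! i \<in> carrier R \<and> xs ! i \<otimes> e i = xs ! i" if "i < n" for i
            using RDirProd_list_carrier_mem(2)[OF xs, of i] that by (simp add: Ksimps)
          define x where "x = finsum R (\<lambda>i. xs ! i) {..<n}"
          have x: "x \<in> carrier R" unfolding x_def by (rule finsum_closed) (use xi in auto)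
          have "x \<otimes> e j = xs ! j" if j: "j < n" for j
          proof -
            have "x \<otimes> e j = (\<Oplus>i\<in>{..<n}. xs ! i \<otimes> e j)"
              unfolding x_def by (rule finsum_ldistr) (use xi E(1)[OF j] in auto)
            also have "\<dots> = (\<Oplus>i\<in>{..<n}. if j = i then xs ! i else \<zero>)"
            proof (rule finsum_cong')
              fix i assume "i \<in> {..<n}"
              then have i: "i < n" by simp
              show "xs ! i \<otimes> e j = (if j = i then xs ! i else \<zero>)"
              proof (cases "j = i")
                case False
                have "xs ! i \<otimes> e j = xs ! i \<otimes> (e i \<otimes> e j)"
                  using xi[OF i] E(1)[OF i] E(1)[OF j] by (simp flip: m_assoc)
                then show ?thesis using False E(4)[OF i j] xi[OF i] by simp
              qed (use xi[OF i] in simp)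
            qed (use xi in auto)
            also have "\<dots> = xs ! j" using add.finprod_singleton[of j "{..<n}" "\<lambda>i. xs ! i"] j xi by auto
            finally show ?thesis .
          qed
          then have "h x = xs"
            using RDirProd_list_carrier_mem(1)[OF xs] by (intro nth_equalityI) (auto simp: h_def)
          then show "xs \<in> h ` carrier R" using x by blast
        qed
      qed
    qed
  qed
  then have "R \<simeq> ?P" unfolding is_ring_iso_def by blast
  moreover have "length ?Ks = n" "\<forall>K\<in>set ?Ks. field K" using fieldK by auto
  ultimately show ?thesis unfolding direct_sum_of_fields_def by blast
qed

end

section \<open>Semisimplicity of commutative group algebras of finite p'-groups\<close>

text \<open>Gaussian elimination: more than \<open>card B\<close> vectors with coordinates in
  \<open>B\<close> are linearly dependent.\<close>

lemma (in field) linear_dependence: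
  assumes "finite B" "finite I" "card B < card I"
    "\<And>i x. i \<in> I \<Longrightarrow> x \<in> B \<Longrightarrow> v i x \<in> carrier R"
  shows "\<exists>c. (\<forall>i\<in>I. c i \<in> carrier R) \<and> (\<exists>i\<in>I. c i \<noteq> \<zero>) \<and> (\<forall>x\<in>B. (\<Oplus>i\<in>I. c i \<otimes> v i x) = \<zero>)"
  using assms
proof (induction B arbitrary: I v rule: finite_induct)
  case empty
  then have "I \<noteq> {}" by auto
  then show ?case by (intro exI[of _ "\<lambda>_. \<one>"]) auto
next
  case (insert x B)
  show ?case
  proof (cases "\<forall>i\<in>I. v i x = \<zero>")
    case True
    obtain c where c: "\<forall>i\<in>I. c i \<in> carrier R" "\<exists>i\<in>I. c i \<noteq> \<zero>" "\<forall>x\<in>B. (\<Oplus>i\<in>I. c i \<otimes> v i x) = \<zero>"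
      using insert.IH[of I v] insert.prems insert.hyps by auto
    have "(\<Oplus>i\<in>I. c i \<otimes> v i x) = \<zero>"
      by (rule add.finprod_one_eqI) (use True c in auto)
    then show ?thesis using c by blast
  next
    case False
    then obtain j where j: "j \<in> I" "v j x \<noteq> \<zero>" by blast
    have vc: "v i y \<in> carrier R" if "i \<in> I" "y \<in> insert x B" for i y using insert.prems that by blast
    have U: "v j x \<in> Units R" using j vc[of j x] field_Units by auto
    let ?I = "I - {j}"
    define t where "t i = v i x \<otimes> inv (v j x)" for i
    have t: "t i \<in> carrier R" if "i \<in> I" for i using that vc U by (simp add: t_def)
    \<comment> \<open>Subtracting multiples of the pivot vector \<open>v j\<close> clears the
      coordinate \<open>x\<close>.\<close>
    define w where "w i y = v i y \<oplus> t i \<otimes> (\<ominus> v j y)" for i y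
    have wc: "w i y \<in> carrier R" if "i \<in> I" "y \<in> insert x B" for i y
      using that vc t j(1) by (simp add: w_def)
    have "card B < card ?I" using insert.prems insert.hyps j(1) by (simp add: card_Diff_singleton)
    then obtain c where c: "\<forall>i\<in>?I. c i \<in> carrier R" "\<exists>i\<in>?I. c i \<noteq> \<zero>" "\<forall>y\<in>B. (\<Oplus>i\<in>?I. c i \<otimes> w i y) = \<zero>"
      using insert.IH[of ?I w] insert.prems wc by auto
    have wx: "w i x = \<zero>" if "i \<in> I" for i
    proof -
      have "t i \<otimes> v j x = v i x" using that U vc[of i x] vc[of j x] j(1) by (simp add: t_def m_assoc)
      then show ?thesis using that vc[of i x] vc[of j x] j(1) t by (simp add: w_def r_minus r_neg)
    qed
    have "(\<Oplus>i\<in>?I. c i \<otimes> w i x) = \<zero>"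
      by (rule add.finprod_one_eqI) (use wx c in auto)
    then have cw: "(\<Oplus>i\<in>?I. c i \<otimes> w i y) = \<zero>" if "y \<in> insert x B" for y using that c(3) by auto
    let ?s = "\<Oplus>i\<in>?I. c i \<otimes> t i"
    have s: "?s \<in> carrier R" by (rule finsum_closed) (use c t in auto)
    define c' where "c' = c(j := \<ominus> ?s)"
    have c'c: "\<forall>i\<in>I. c' i \<in> carrier R" using c s by (auto simp: c'_def)
    have nz: "\<exists>i\<in>I. c' i \<noteq> \<zero>" using c(2) by (auto simp: c'_def)
    have "(\<Oplus>i\<in>I. c' i \<otimes> v i y) = \<zero>" if y: "y \<in> insert x B" for y
    proof -
      have vj: "v j y \<in> carrier R" using vc[OF j(1) y] .
      let ?S = "\<Oplus>i\<in>?I. c i \<otimes> v i y"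
      have S: "?S \<in> carrier R" by (rule finsum_closed) (use c vc y in auto)
      have "\<zero> = (\<Oplus>i\<in>?I. c i \<otimes> w i y)" using cw[OF y] by simp
      also have "\<dots> = (\<Oplus>i\<in>?I. c i \<otimes> v i y \<oplus> (c i \<otimes> t i) \<otimes> (\<ominus> v j y))"
        by (rule finsum_cong') (use c vc[OF _ y] t vj in \<open>auto simp: w_def r_distr m_assoc\<close>)
      also have "\<dots> = ?S \<oplus> (\<Oplus>i\<in>?I. (c i \<otimes> t i) \<otimes> (\<ominus> v j y))"
        by (rule finsum_addf) (use c vc[OF _ y] t vj in auto)
      also have "(\<Oplus>i\<in>?I. (c i \<otimes> t i) \<otimes> (\<ominus> v j y)) = ?s \<otimes> (\<ominus> v j y)"
        by (rule finsum_ldistr[symmetric]) (use c t vj insert.prems in auto)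
      finally have eq: "?S \<oplus> ?s \<otimes> (\<ominus> v j y) = \<zero>" by simp
      have "(\<Oplus>i\<in>I. c' i \<otimes> v i y) = (\<Oplus>i\<in>insert j ?I. c' i \<otimes> v i y)" using j(1) by (simp add: insert_absorb)
      also have "\<dots> = c' j \<otimes> v j y \<oplus> (\<Oplus>i\<in>?I. c' i \<otimes> v i y)"
        by (rule finsum_insert) (use insert.prems c'c vc[OF _ y] j(1) in auto)
      also have "(\<Oplus>i\<in>?I. c' i \<otimes> v i y) = ?S"
        by (rule finsum_cong') (use c vc[OF _ y] in \<open>auto simp: c'_def\<close>)
      also have "c' j \<otimes> v j y = ?s \<otimes> (\<ominus> v j y)" using s vj by (simp add: c'_def l_minus r_minus)
      finally show ?thesis using eq S s vj by (simp add: a_comm)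
    qed
    then show ?thesis using c'c nz by blast
  qed
qed

context ga_char
begin

lemma finsum_apply:
  assumes "finite I" "f \<in> I \<rightarrow> carrier R"
  shows "(\<Oplus>\<^bsub>R\<^esub>i\<in>I. f i) x = (\<Oplus>\<^bsub>F\<^esub>i\<in>I. f i x)"
  using assms
proof (induction I rule: finite_induct)
  case (insert i I)
  have "(\<lambda>i. f i x) \<in> I \<rightarrow> carrier F" "f i x \<in> carrier F" using insert coeff by (auto simp: Pi_def)
  then show ?case using insert by (simp add: add_eq Pi_def)
qed (simp add: zero_eq)

lemma dependence_in_group_algebra:
  assumes fin: "finite (carrier G)" and I: "finite I" "card (carrier G) < card I" and f: "f \<in> I \<rightarrow> carrier R"
  shows "\<exists>c. (\<forall>i\<in>I. c i \<in> carrier F) \<and> (\<exists>i\<in>I. c i \<noteq> \<zero>\<^bsub>F\<^esub>) \<and>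
     (\<Oplus>\<^bsub>R\<^esub>i\<in>I. mon (c i) \<one>\<^bsub>G\<^esub> \<otimes>\<^bsub>R\<^esub> f i) = \<zero>\<^bsub>R\<^esub>"
proof -
  have fc: "f i x \<in> carrier F" if "i \<in> I" for i x using f that coeff by blast
  obtain c where c: "\<forall>i\<in>I. c i \<in> carrier F" "\<exists>i\<in>I. c i \<noteq> \<zero>\<^bsub>F\<^esub>"
    "\<forall>x\<in>carrier G. (\<Oplus>\<^bsub>F\<^esub>i\<in>I. c i \<otimes>\<^bsub>F\<^esub> f i x) = \<zero>\<^bsub>F\<^esub>"
    using F.linear_dependence[OF fin I, of f] fc by blast
  have g: "(\<lambda>i. mon (c i) \<one>\<^bsub>G\<^esub> \<otimes>\<^bsub>R\<^esub> f i) \<in> I \<rightarrow> carrier R" using c f by auto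
  let ?s = "\<Oplus>\<^bsub>R\<^esub>i\<in>I. mon (c i) \<one>\<^bsub>G\<^esub> \<otimes>\<^bsub>R\<^esub> f i"
  have sc: "?s \<in> carrier R" using g by simp
  have "?s = \<zero>\<^bsub>R\<^esub>"
  proof
    fix x
    show "?s x = \<zero>\<^bsub>R\<^esub> x"
    proof (cases "x \<in> carrier G")
      case True
      have "?s x = (\<Oplus>\<^bsub>F\<^esub>i\<in>I. (mon (c i) \<one>\<^bsub>G\<^esub> \<otimes>\<^bsub>R\<^esub> f i) x)" by (rule finsum_apply[OF I(1) g])
      also have "\<dots> = (\<Oplus>\<^bsub>F\<^esub>i\<in>I. c i \<otimes>\<^bsub>F\<^esub> f i x)"
      proof (rule F.finsum_cong')
        fix i assume i: "i \<in> I"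
        then have "c i \<in> carrier F" "f i \<in> carrier R" using c f by auto
        then show "(mon (c i) \<one>\<^bsub>G\<^esub> \<otimes>\<^bsub>R\<^esub> f i) x = c i \<otimes>\<^bsub>F\<^esub> f i x"
          using mon_mult_apply[of "c i" "\<one>\<^bsub>G\<^esub>" "f i" x] True by simp
      qed (use c fc in auto)
      finally show ?thesis using c(3) True by (simp add: zero_eq)
    next
      case False
      then have "?s x = \<zero>\<^bsub>F\<^esub>" using supp_carrier[OF sc] by (intro notin_supp) blast
      then show ?thesis by (simp add: zero_eq)
    qed
  qed
  then show ?thesis using c by blast
qed

text \<open>Some polynomial expression \<open>c\<^sub>0 + c\<^sub>1 a + \<dots> + c\<^sub>n
  a\<^sup>n\<close> vanishes, the algebra being finite-dimensional. After multiplication by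
  \<open>a\<close>, leading zeros \<open>c\<^sub>0 = 0\<close> can be cancelled because the
  algebra is reduced: \<open>a\<^sup>2 t = 0\<close> implies \<open>(a t)\<^sup>2 = 0\<close>.
  Once \<open>c\<^sub>0 \<noteq> 0\<close>, the relation \<open>a (c\<^sub>0 + a t) = 0\<close>
  can be solved for \<open>a\<close>.\<close>

lemma von_neumann_regular:
  assumes comm: "comm_group G" and fin: "finite (carrier G)"
    and nop: "\<And>x. x \<in> carrier G \<Longrightarrow> x [^]\<^bsub>G\<^esub> p = \<one>\<^bsub>G\<^esub> \<Longrightarrow> x = \<one>\<^bsub>G\<^esub>"
    and a: "a \<in> carrier R"
  shows "\<exists>y\<in>carrier R. a = a \<otimes>\<^bsub>R\<^esub> a \<otimes>\<^bsub>R\<^esub> y"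
proof -
  interpret CR: cring R by (rule cring_if_comm[OF comm])
  let ?S = "\<lambda>c n. \<Oplus>\<^bsub>R\<^esub>i\<in>{..n}. mon (c i) \<one>\<^bsub>G\<^esub> \<otimes>\<^bsub>R\<^esub> a [^]\<^bsub>R\<^esub> (i::nat)"
  have S: "?S c n \<in> carrier R" if "\<And>i. c i \<in> carrier F" for c n using that a by (intro finsum_closed) auto
  have shift: "?S c (Suc n) = mon (c 0) \<one>\<^bsub>G\<^esub> \<oplus>\<^bsub>R\<^esub> a \<otimes>\<^bsub>R\<^esub> ?S (\<lambda>i. c (Suc i)) n"
    if c: "\<And>i. c i \<in> carrier F" for c n
  proof -
    have "?S c (Suc n) = (\<Oplus>\<^bsub>R\<^esub>i\<in>{..n}. mon (c (Suc i)) \<one>\<^bsub>G\<^esub> \<otimes>\<^bsub>R\<^esub> a [^]\<^bsub>R\<^esub> Suc i) \<oplus>\<^bsub>R\<^esub>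
        mon (c 0) \<one>\<^bsub>G\<^esub> \<otimes>\<^bsub>R\<^esub> a [^]\<^bsub>R\<^esub> (0::nat)"
      by (rule finsum_Suc2) (use c a in auto)
    also have "(\<Oplus>\<^bsub>R\<^esub>i\<in>{..n}. mon (c (Suc i)) \<one>\<^bsub>G\<^esub> \<otimes>\<^bsub>R\<^esub> a [^]\<^bsub>R\<^esub> Suc i)
       = (\<Oplus>\<^bsub>R\<^esub>i\<in>{..n}. a \<otimes>\<^bsub>R\<^esub> (mon (c (Suc i)) \<one>\<^bsub>G\<^esub> \<otimes>\<^bsub>R\<^esub> a [^]\<^bsub>R\<^esub> i))"
    proof (rule finsum_cong')
      fix i :: nat
      have "mon (c (Suc i)) \<one>\<^bsub>G\<^esub> \<in> carrier R" "a [^]\<^bsub>R\<^esub> i \<in> carrier R" using c a by auto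
      then show "mon (c (Suc i)) \<one>\<^bsub>G\<^esub> \<otimes>\<^bsub>R\<^esub> a [^]\<^bsub>R\<^esub> Suc i = a \<otimes>\<^bsub>R\<^esub> (mon (c (Suc i)) \<one>\<^bsub>G\<^esub> \<otimes>\<^bsub>R\<^esub> a [^]\<^bsub>R\<^esub> i)"
        using a by (simp add: CR.m_comm CR.m_lcomm)
    qed (use c a in auto)
    also have "\<dots> = a \<otimes>\<^bsub>R\<^esub> ?S (\<lambda>i. c (Suc i)) n"
      by (rule finsum_rdistr[symmetric]) (use c a in auto)
    finally show ?thesis using S[of "\<lambda>i. c (Suc i)" n] c a by (simp add: a_comm)
  qed
  have key: "\<exists>y\<in>carrier R. a = a \<otimes>\<^bsub>R\<^esub> a \<otimes>\<^bsub>R\<^esub> y"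
    if "\<And>i. c i \<in> carrier F" "\<exists>i\<le>n. c i \<noteq> \<zero>\<^bsub>F\<^esub>" "a \<otimes>\<^bsub>R\<^esub> ?S c n = \<zero>\<^bsub>R\<^esub>" for c :: "nat \<Rightarrow> 'f" and n
    using that
  proof (induction n arbitrary: c)
    case 0
    have d: "c 0 \<in> Units F" using 0 F.field_Units by auto
    have c0: "mon (c 0) \<one>\<^bsub>G\<^esub> \<in> carrier R" "mon (inv\<^bsub>F\<^esub> c 0) \<one>\<^bsub>G\<^esub> \<in> carrier R" using d by auto
    have "a \<otimes>\<^bsub>R\<^esub> mon (c 0) \<one>\<^bsub>G\<^esub> = \<zero>\<^bsub>R\<^esub>" using 0 c0 a by simp
    then have "a \<otimes>\<^bsub>R\<^esub> mon (c 0) \<one>\<^bsub>G\<^esub> \<otimes>\<^bsub>R\<^esub> mon (inv\<^bsub>F\<^esub> c 0) \<one>\<^bsub>G\<^esub> = \<zero>\<^bsub>R\<^esub>" using c0 by simp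
    moreover have "mon (c 0) \<one>\<^bsub>G\<^esub> \<otimes>\<^bsub>R\<^esub> mon (inv\<^bsub>F\<^esub> c 0) \<one>\<^bsub>G\<^esub> = \<one>\<^bsub>R\<^esub>" using d F.Units_closed[OF d] by (simp add: mult_mon_mon one_eq)
    ultimately have "a = \<zero>\<^bsub>R\<^esub>" using a c0 by (simp add: m_assoc)
    then show ?case by auto
  next
    case (Suc n)
    define T where "T = ?S (\<lambda>i. c (Suc i)) n"
    have T: "T \<in> carrier R" unfolding T_def by (rule S) (rule Suc.prems(1))
    have eq: "a \<otimes>\<^bsub>R\<^esub> (mon (c 0) \<one>\<^bsub>G\<^esub> \<oplus>\<^bsub>R\<^esub> a \<otimes>\<^bsub>R\<^esub> T) = \<zero>\<^bsub>R\<^esub>"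
      using Suc.prems(3) unfolding shift[OF Suc.prems(1)] T_def .
    show ?case
    proof (cases "c 0 = \<zero>\<^bsub>F\<^esub>")
      case False
      have d: "c 0 \<in> Units F" using Suc.prems(1)[of 0] False F.field_Units by auto
      \<comment> \<open>The coefficients are continued by zero, as \<open>key\<close> asks for a
        sequence in \<open>F\<close>.\<close>
      let ?c = "mon (c 0) \<one>\<^bsub>G\<^esub>" and ?d = "mon (inv\<^bsub>F\<^esub> c 0) \<one>\<^bsub>G\<^esub>"
      have c0: "?c \<in> carrier R" "?d \<in> carrier R" using d by auto
      have cd: "?c \<otimes>\<^bsub>R\<^esub> ?d = \<one>\<^bsub>R\<^esub>" using d F.Units_closed[OF d] by (simp add: mult_mon_mon one_eq)
      have "a \<otimes>\<^bsub>R\<^esub> ?c \<oplus>\<^bsub>R\<^esub> a \<otimes>\<^bsub>R\<^esub> a \<otimes>\<^bsub>R\<^esub> T = \<zero>\<^bsub>R\<^esub>" using eq a c0 T by (simp add: r_distr m_assoc)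
      then have "a \<otimes>\<^bsub>R\<^esub> ?c = \<ominus>\<^bsub>R\<^esub> (a \<otimes>\<^bsub>R\<^esub> a \<otimes>\<^bsub>R\<^esub> T)" using a c0 T minus_equality[of "a \<otimes>\<^bsub>R\<^esub> ?c" "a \<otimes>\<^bsub>R\<^esub> a \<otimes>\<^bsub>R\<^esub> T"] by simp
      then have "a \<otimes>\<^bsub>R\<^esub> ?c \<otimes>\<^bsub>R\<^esub> ?d = a \<otimes>\<^bsub>R\<^esub> a \<otimes>\<^bsub>R\<^esub> (\<ominus>\<^bsub>R\<^esub> (T \<otimes>\<^bsub>R\<^esub> ?d))"
        using a c0 T by (simp add: l_minus r_minus m_assoc)
      moreover have "a \<otimes>\<^bsub>R\<^esub> ?c \<otimes>\<^bsub>R\<^esub> ?d = a" using a c0 cd by (simp add: m_assoc)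
      ultimately show ?thesis using T c0 by (metis a_inv_closed m_closed)
    next
      case True
      have "a \<otimes>\<^bsub>R\<^esub> (a \<otimes>\<^bsub>R\<^esub> T) = \<zero>\<^bsub>R\<^esub>" using eq True a T by (simp add: mon_zero)
      moreover have "(a \<otimes>\<^bsub>R\<^esub> T) [^]\<^bsub>R\<^esub> (2::nat) = a \<otimes>\<^bsub>R\<^esub> (a \<otimes>\<^bsub>R\<^esub> T) \<otimes>\<^bsub>R\<^esub> T"
        using a T by (simp add: numeral_2_eq_2 CR.m_lcomm m_assoc)
      ultimately have "(a \<otimes>\<^bsub>R\<^esub> T) [^]\<^bsub>R\<^esub> (2::nat) = \<zero>\<^bsub>R\<^esub>" using T by simp
      then have "a \<otimes>\<^bsub>R\<^esub> T = \<zero>\<^bsub>R\<^esub>" using reduced[OF comm nop] a T by (metis m_closed)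
      moreover have "\<exists>i\<le>n. c (Suc i) \<noteq> \<zero>\<^bsub>F\<^esub>"
        using Suc.prems(2) True by (metis Suc_le_mono not0_implies_Suc)
      ultimately show ?thesis unfolding T_def by (intro Suc.IH[of "\<lambda>i. c (Suc i)"] Suc.prems(1))
    qed
  qed
  let ?N = "card (carrier G)"
  obtain c where c: "\<forall>i\<in>{..?N}. c i \<in> carrier F" "\<exists>i\<in>{..?N}. c i \<noteq> \<zero>\<^bsub>F\<^esub>" "?S c ?N = \<zero>\<^bsub>R\<^esub>"
    using dependence_in_group_algebra[OF fin, of "{..?N}" "\<lambda>i. a [^]\<^bsub>R\<^esub> i"] a by auto
  let ?c = "\<lambda>i. if i \<le> ?N then c i else \<zero>\<^bsub>F\<^esub>"
  have "?S ?c ?N = ?S c ?N" by (rule finsum_cong') (use c a in auto)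
  then have "a \<otimes>\<^bsub>R\<^esub> ?S ?c ?N = \<zero>\<^bsub>R\<^esub>" using c(3) a by simp
  then show ?thesis by (rule key[of ?c ?N, rotated 2]) (use c in auto)
qed

text \<open>Take an orthogonal family of idempotents of maximal length; its members are linearly
  independent, so the length is bounded. Regularity provides an idempotent generator for every
  principal ideal. If some \<open>x \<noteq> 0\<close> annihilated the family, or if an idempotent
  split some \<open>e\<^sub>i\<close> properly, the family could be enlarged.\<close>

lemma field_idempotents_exist:
  assumes comm: "comm_group G" and fin: "finite (carrier G)"
    and nop: "\<And>x. x \<in> carrier G \<Longrightarrow> x [^]\<^bsub>G\<^esub> p = \<one>\<^bsub>G\<^esub> \<Longrightarrow> x = \<one>\<^bsub>G\<^esub>"
  shows "\<exists>n e. field_idempotents R n e"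
proof -
  interpret CR: cring R by (rule cring_if_comm[OF comm])
  define orth where "orth k e \<longleftrightarrow>
     (\<forall>i<k. e i \<in> carrier R \<and> e i \<noteq> \<zero>\<^bsub>R\<^esub> \<and> e i \<otimes>\<^bsub>R\<^esub> e i = e i) \<and>
     (\<forall>i<k. \<forall>j<k. i \<noteq> j \<longrightarrow> e i \<otimes>\<^bsub>R\<^esub> e j = \<zero>\<^bsub>R\<^esub>)" for k :: nat and e
  have bound: "k \<le> card (carrier G)" if o: "orth k e" for k e
  proof (rule ccontr)
    assume "\<not> ?thesis"
    then have lt: "card (carrier G) < card {..<k}" by simp
    have ec: "e \<in> {..<k} \<rightarrow> carrier R" using o by (auto simp: orth_def)
    obtain c where c: "\<forall>i\<in>{..<k}. c i \<in> carrier F" "\<exists>i\<in>{..<k}. c i \<noteq> \<zero>\<^bsub>F\<^esub>"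
      "(\<Oplus>\<^bsub>R\<^esub>i\<in>{..<k}. mon (c i) \<one>\<^bsub>G\<^esub> \<otimes>\<^bsub>R\<^esub> e i) = \<zero>\<^bsub>R\<^esub>"
      using dependence_in_group_algebra[OF fin _ lt ec] by auto
    obtain j where j: "j < k" "c j \<noteq> \<zero>\<^bsub>F\<^esub>" using c(2) by auto
    have ej: "e j \<in> carrier R" "e j \<otimes>\<^bsub>R\<^esub> e j = e j" "e j \<noteq> \<zero>\<^bsub>R\<^esub>" using o j by (auto simp: orth_def)
    have d: "c j \<in> Units F" using j c F.field_Units by auto
    let ?m = "\<lambda>i. mon (c i) \<one>\<^bsub>G\<^esub>" and ?d = "mon (inv\<^bsub>F\<^esub> c j) \<one>\<^bsub>G\<^esub>"
    have m: "?m i \<in> carrier R" if "i < k" for i using c that by auto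
    have ei: "e i \<in> carrier R" if "i < k" for i using ec that by auto
    have "\<zero>\<^bsub>R\<^esub> = (\<Oplus>\<^bsub>R\<^esub>i\<in>{..<k}. ?m i \<otimes>\<^bsub>R\<^esub> e i) \<otimes>\<^bsub>R\<^esub> e j" using c(3) ej by simp
    also have "\<dots> = (\<Oplus>\<^bsub>R\<^esub>i\<in>{..<k}. ?m i \<otimes>\<^bsub>R\<^esub> e i \<otimes>\<^bsub>R\<^esub> e j)"
      by (rule finsum_ldistr) (use m ei ej in auto)
    also have "\<dots> = (\<Oplus>\<^bsub>R\<^esub>i\<in>{..<k}. if j = i then ?m i \<otimes>\<^bsub>R\<^esub> e i else \<zero>\<^bsub>R\<^esub>)"
      by (rule finsum_cong') (use o m ei j in \<open>auto simp: orth_def m_assoc\<close>)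
    also have "\<dots> = ?m j \<otimes>\<^bsub>R\<^esub> e j"
      using add.finprod_singleton[of j "{..<k}" "\<lambda>i. ?m i \<otimes>\<^bsub>R\<^esub> e i"] j m ei by auto
    finally have z: "?m j \<otimes>\<^bsub>R\<^esub> e j = \<zero>\<^bsub>R\<^esub>" by simp
    have dc: "?d \<in> carrier R" using d by auto
    have dm: "?d \<otimes>\<^bsub>R\<^esub> ?m j = \<one>\<^bsub>R\<^esub>" using d F.Units_closed[OF d] by (simp add: mult_mon_mon one_eq)
    have "e j = ?d \<otimes>\<^bsub>R\<^esub> ?m j \<otimes>\<^bsub>R\<^esub> e j" using dm ej by simp
    also have "\<dots> = ?d \<otimes>\<^bsub>R\<^esub> (?m j \<otimes>\<^bsub>R\<^esub> e j)" using dc m[OF j(1)] ej by (simp add: m_assoc)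
    also have "\<dots> = \<zero>\<^bsub>R\<^esub>" using z dc by simp
    finally show False using ej by simp
  qed
  have "orth 0 (\<lambda>_. \<zero>\<^bsub>R\<^esub>)" by (simp add: orth_def)
  then obtain k where k: "\<exists>e. orth k e" "\<And>k'. \<exists>e. orth k' e \<Longrightarrow> k' \<le> k"
    using Greatest_le_nat[of "\<lambda>k. \<exists>e. orth k e" _ "card (carrier G)"]
      GreatestI_nat[of "\<lambda>k. \<exists>e. orth k e" 0 "card (carrier G)"] bound by blast
  then obtain e where o: "orth k e" by blast
  have E: "\<And>i. i < k \<Longrightarrow> e i \<in> carrier R" "\<And>i. i < k \<Longrightarrow> e i \<noteq> \<zero>\<^bsub>R\<^esub>" "\<And>i. i < k \<Longrightarrow> e i \<otimes>\<^bsub>R\<^esub> e i = e i"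
    "\<And>i j. i < k \<Longrightarrow> j < k \<Longrightarrow> i \<noteq> j \<Longrightarrow> e i \<otimes>\<^bsub>R\<^esub> e j = \<zero>\<^bsub>R\<^esub>"
    using o unfolding orth_def by auto
  have no_ext: False if "orth (Suc k) f" for f using k(2)[of "Suc k"] that by auto
  \<comment> \<open>The element \<open>x y\<close> is an idempotent that generates the ideal of
    \<open>x\<close>.\<close>
  have idem: "\<exists>y\<in>carrier R. let f = x \<otimes>\<^bsub>R\<^esub> y in f \<otimes>\<^bsub>R\<^esub> f = f \<and> x \<otimes>\<^bsub>R\<^esub> f = x" if x: "x \<in> carrier R" for x
  proof -
    obtain y where y: "y \<in> carrier R" "x = x \<otimes>\<^bsub>R\<^esub> x \<otimes>\<^bsub>R\<^esub> y"
      using von_neumann_regular[OF comm fin nop x] by blast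
    have "(x \<otimes>\<^bsub>R\<^esub> y) \<otimes>\<^bsub>R\<^esub> (x \<otimes>\<^bsub>R\<^esub> y) = (x \<otimes>\<^bsub>R\<^esub> x \<otimes>\<^bsub>R\<^esub> y) \<otimes>\<^bsub>R\<^esub> y"
      using x y(1) by (simp add: m_assoc CR.m_lcomm)
    then have "(x \<otimes>\<^bsub>R\<^esub> y) \<otimes>\<^bsub>R\<^esub> (x \<otimes>\<^bsub>R\<^esub> y) = x \<otimes>\<^bsub>R\<^esub> y" using y(2) by simp
    moreover have "x \<otimes>\<^bsub>R\<^esub> (x \<otimes>\<^bsub>R\<^esub> y) = x" using x y by (simp add: m_assoc)
    ultimately show ?thesis using y(1) by (auto simp: Let_def)
  qed
  have detect: "x = \<zero>\<^bsub>R\<^esub>" if x: "x \<in> carrier R" "\<And>i. i < k \<Longrightarrow> x \<otimes>\<^bsub>R\<^esub> e i = \<zero>\<^bsub>R\<^esub>" for x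
  proof (rule ccontr)
    assume nz: "x \<noteq> \<zero>\<^bsub>R\<^esub>"
    obtain y where y: "y \<in> carrier R" "(x \<otimes>\<^bsub>R\<^esub> y) \<otimes>\<^bsub>R\<^esub> (x \<otimes>\<^bsub>R\<^esub> y) = x \<otimes>\<^bsub>R\<^esub> y" "x \<otimes>\<^bsub>R\<^esub> (x \<otimes>\<^bsub>R\<^esub> y) = x"
      using idem[OF x(1)] by (auto simp: Let_def)
    let ?f = "x \<otimes>\<^bsub>R\<^esub> y"
    have f: "?f \<in> carrier R" using x y by simp
    have "?f \<noteq> \<zero>\<^bsub>R\<^esub>" using y(3) nz x(1) by auto
    moreover have "?f \<otimes>\<^bsub>R\<^esub> e i = \<zero>\<^bsub>R\<^esub>" if "i < k" for i
    proof -
      have "?f \<otimes>\<^bsub>R\<^esub> e i = y \<otimes>\<^bsub>R\<^esub> (x \<otimes>\<^bsub>R\<^esub> e i)" using x y E(1)[OF that] by (simp add: CR.m_comm CR.m_lcomm m_assoc)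
      then show ?thesis using x(2)[OF that] y by simp
    qed
    moreover from this have "e i \<otimes>\<^bsub>R\<^esub> ?f = \<zero>\<^bsub>R\<^esub>" if "i < k" for i
      using that E(1)[OF that] f CR.m_comm by metis
    ultimately have "orth (Suc k) (e(k := ?f))"
      using E y(2) f unfolding orth_def by (auto simp: less_Suc_eq)
    then show False by (rule no_ext)
  qed
  have fld: "\<exists>d\<in>carrier R. c \<otimes>\<^bsub>R\<^esub> d \<otimes>\<^bsub>R\<^esub> e i = e i"
    if c: "i < k" "c \<in> carrier R" "c \<otimes>\<^bsub>R\<^esub> e i \<noteq> \<zero>\<^bsub>R\<^esub>" for i c
  proof -
    let ?z = "c \<otimes>\<^bsub>R\<^esub> e i"
    note ei = E(1)[OF c(1)]
    have z: "?z \<in> carrier R" "?z \<otimes>\<^bsub>R\<^esub> e i = ?z" using c ei E(3)[OF c(1)] by (simp_all add: m_assoc)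
    obtain y where y: "y \<in> carrier R" "(?z \<otimes>\<^bsub>R\<^esub> y) \<otimes>\<^bsub>R\<^esub> (?z \<otimes>\<^bsub>R\<^esub> y) = ?z \<otimes>\<^bsub>R\<^esub> y" "?z \<otimes>\<^bsub>R\<^esub> (?z \<otimes>\<^bsub>R\<^esub> y) = ?z"
      using idem[OF z(1)] by (auto simp: Let_def)
    define f where "f = ?z \<otimes>\<^bsub>R\<^esub> y"
    have f: "f \<in> carrier R" "f \<otimes>\<^bsub>R\<^esub> f = f" "f \<noteq> \<zero>\<^bsub>R\<^esub>" using z y c(3) by (auto simp: f_def)
    have fe: "f \<otimes>\<^bsub>R\<^esub> e i = f"
    proof -
      have "f \<otimes>\<^bsub>R\<^esub> e i = (?z \<otimes>\<^bsub>R\<^esub> e i) \<otimes>\<^bsub>R\<^esub> y"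
        using z(1) y(1) ei unfolding f_def by (simp only: m_assoc CR.m_comm CR.m_lcomm m_closed)
      then show ?thesis using z(2) by (simp add: f_def)
    qed
    have ef: "e i \<otimes>\<^bsub>R\<^esub> f = f" using fe f ei CR.m_comm by metis
    have "f = e i"
    proof (rule ccontr)
      assume ne: "f \<noteq> e i"
      let ?g = "e i \<ominus>\<^bsub>R\<^esub> f"
      have g: "?g \<in> carrier R" "?g \<noteq> \<zero>\<^bsub>R\<^esub>" using f ei ne by (auto simp: r_right_minus_eq)
      have gg: "?g \<otimes>\<^bsub>R\<^esub> ?g = ?g"
        using f ei E(3)[OF c(1)] fe ef by (simp add: a_minus_def l_distr r_distr l_minus r_minus minus_minus a_ac r_neg)
      have fg: "f \<otimes>\<^bsub>R\<^esub> ?g = \<zero>\<^bsub>R\<^esub>" "?g \<otimes>\<^bsub>R\<^esub> f = \<zero>\<^bsub>R\<^esub>"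
        using f ei fe ef by (simp_all add: a_minus_def l_distr r_distr l_minus r_minus r_neg)
      have fj: "f \<otimes>\<^bsub>R\<^esub> e j = \<zero>\<^bsub>R\<^esub>" "e j \<otimes>\<^bsub>R\<^esub> f = \<zero>\<^bsub>R\<^esub>" "?g \<otimes>\<^bsub>R\<^esub> e j = \<zero>\<^bsub>R\<^esub>" "e j \<otimes>\<^bsub>R\<^esub> ?g = \<zero>\<^bsub>R\<^esub>"
        if j: "j < k" "j \<noteq> i" for j
      proof -
        have "f \<otimes>\<^bsub>R\<^esub> e j = f \<otimes>\<^bsub>R\<^esub> (e i \<otimes>\<^bsub>R\<^esub> e j)" using fe f ei E(1)[OF j(1)] by (simp flip: m_assoc)
        then show 1: "f \<otimes>\<^bsub>R\<^esub> e j = \<zero>\<^bsub>R\<^esub>" using E(4)[OF c(1) j(1)] j f by simp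
        then show 2: "e j \<otimes>\<^bsub>R\<^esub> f = \<zero>\<^bsub>R\<^esub>" using f E(1)[OF j(1)] CR.m_comm by metis
        show "?g \<otimes>\<^bsub>R\<^esub> e j = \<zero>\<^bsub>R\<^esub>" "e j \<otimes>\<^bsub>R\<^esub> ?g = \<zero>\<^bsub>R\<^esub>"
          using 1 2 E(4)[OF c(1) j(1)] E(4)[OF j(1) c(1)] j f ei E(1)[OF j(1)]
          by (simp_all add: a_minus_def l_distr r_distr l_minus r_minus)
      qed
      have "orth (Suc k) (e(i := f, k := ?g))"
        unfolding orth_def
        using E f g gg fg fj c(1) by (auto simp: less_Suc_eq)
      then show False by (rule no_ext)
    qed
    then have "c \<otimes>\<^bsub>R\<^esub> (e i \<otimes>\<^bsub>R\<^esub> y) \<otimes>\<^bsub>R\<^esub> e i = e i"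
      using fe c(2) ei y(1) unfolding f_def by (simp add: m_assoc)
    then show ?thesis using ei y(1) by blast
  qed
  have "field_idempotents R k e"
    unfolding field_idempotents_def
  proof (intro conjI allI impI ballI)
    fix x assume x: "x \<in> carrier R" "\<forall>i<k. x \<otimes>\<^bsub>R\<^esub> e i = \<zero>\<^bsub>R\<^esub>"
    show "x = \<zero>\<^bsub>R\<^esub>" by (rule detect) (use x in auto)
  qed (use E fld in blast)+
  then show ?thesis by blast
qed

end

section \<open>A finite torsion subgroup splits off\<close>

context comm_group
begin

lemma int_pow_nat_pow:
  "x \<in> carrier G \<Longrightarrow> (x [^] (i::int)) [^] (n::nat) = x [^] (i * int n)"
  "x \<in> carrier G \<Longrightarrow> (x [^] n) [^] i = x [^] (int n * i)"
  using int_pow_pow[of x i "int n"] int_pow_pow[of x "int n" i] by (simp_all add: int_pow_int)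

lemma subgroup_adjoin:
  assumes K: "subgroup K G" and x: "x \<in> carrier G"
  shows "subgroup {y. \<exists>k\<in>K. \<exists>i::int. y = k \<otimes> x [^] i} G"
proof (rule subgroupI)
  note KG = subgroup.mem_carrier[OF K]
  show "{y. \<exists>k\<in>K. \<exists>i::int. y = k \<otimes> x [^] i} \<subseteq> carrier G" using KG x by auto
  show "{y. \<exists>k\<in>K. \<exists>i::int. y = k \<otimes> x [^] i} \<noteq> {}" using subgroup.one_closed[OF K] by blast
  fix y assume "y \<in> {y. \<exists>k\<in>K. \<exists>i::int. y = k \<otimes> x [^] i}"
  then obtain k and i :: int where y: "k \<in> K" "y = k \<otimes> x [^] i" by blast
  have "inv y = inv k \<otimes> x [^] (- i)" using y KG x by (simp add: inv_mult int_pow_neg)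
  then show "inv y \<in> {y. \<exists>k\<in>K. \<exists>i::int. y = k \<otimes> x [^] i}" using subgroup.m_inv_closed[OF K y(1)] by blast
  fix z assume "z \<in> {y. \<exists>k\<in>K. \<exists>i::int. y = k \<otimes> x [^] i}"
  then obtain l and j :: int where z: "l \<in> K" "z = l \<otimes> x [^] j" by blast
  have "y \<otimes> z = (k \<otimes> l) \<otimes> x [^] (i + j)" using y z KG x by (simp add: int_pow_mult m_ac)
  then show "y \<otimes> z \<in> {y. \<exists>k\<in>K. \<exists>i::int. y = k \<otimes> x [^] i}" using subgroup.m_closed[OF K y(1) z(1)] by blast
qed

text \<open>A cyclic subgroup of maximal \<open>q\<close>-power order is a direct factor. The
  complement \<open>K\<close> is a maximal subgroup that contains all \<open>q\<^sup>k\<close>-th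
  powers and meets \<open>\<langle>d\<rangle>\<close> trivially. If an element is not in \<open>K
  \<langle>d\<rangle>\<close>, some \<open>q\<close>-power \<open>b\<^sub>0\<close> of it is
  outside as well and satisfies \<open>b\<^sub>0\<^sup>q = \<kappa> d\<^sup>j\<close> with
  \<open>\<kappa> \<in> K\<close>. As \<open>b\<^sub>0\<close> to the \<open>q\<^sup>k\<close> is
  in \<open>K\<close>, the prime \<open>q\<close> divides \<open>j\<close>, and dividing
  \<open>b\<^sub>0\<close> by a power of \<open>d\<close> gives an element that could be adjoined
  to \<open>K\<close>.\<close>

lemma cyclic_p_summand:
  assumes q: "Factorial_Ring.prime (q::nat)" and H: "subgroup H G" and d: "d \<in> H" "ord d = q ^ k" "k > 0"
    and max: "\<And>y n. y \<in> H \<Longrightarrow> y [^] (q ^ n :: nat) = \<one> \<Longrightarrow> y [^] (q ^ k) = \<one>"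
  shows "\<exists>K. subgroup K G \<and> K \<subseteq> H \<and> d \<notin> K \<and> H \<subseteq> {y. \<exists>k\<in>K. \<exists>i::int. y = k \<otimes> d [^] i}"
proof -
  let ?m = "q ^ k"
  have HG: "x \<in> carrier G" if "x \<in> H" for x using that subgroup.mem_carrier[OF H] by blast
  have dG: "d \<in> carrier G" using d HG by blast
  have q0: "q > 1" using q prime_gt_1_nat by blast
  have m: "?m = q * q ^ (k - 1)" using d(3) by (cases k) auto
  have Hpow: "x [^] (i::int) \<in> H" if "x \<in> H" for x i using subgroup_int_pow_closed[OF H that] .
  have Hnpow: "x [^] (n::nat) \<in> H" if "x \<in> H" for x n
    using Hpow[OF that, of "int n"] by (simp only: int_pow_int)
  define A where "A = {K. subgroup K G \<and> K \<subseteq> H \<and> (\<forall>h\<in>H. h [^] ?m \<in> K) \<and> (\<forall>i::int. d [^] i \<in> K \<longrightarrow> d [^] i = \<one>)}"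
  have K0: "(\<lambda>h. h [^] ?m) ` H \<in> A"
  proof -
    have sub: "subgroup ((\<lambda>h. h [^] ?m) ` H) G"
    proof (rule subgroupI)
      show "(\<lambda>h. h [^] ?m) ` H \<subseteq> carrier G" using HG by auto
      show "(\<lambda>h. h [^] ?m) ` H \<noteq> {}" using d by blast
      fix y assume "y \<in> (\<lambda>h. h [^] ?m) ` H"
      then obtain h where h: "h \<in> H" "y = h [^] ?m" by blast
      have "inv y = inv h [^] ?m" using h HG by (simp add: nat_pow_inv)
      then show "inv y \<in> (\<lambda>h. h [^] ?m) ` H" using subgroup.m_inv_closed[OF H h(1)] by blast
      fix z assume "z \<in> (\<lambda>h. h [^] ?m) ` H"
      then obtain l where l: "l \<in> H" "z = l [^] ?m" by blast
      have "y \<otimes> z = (h \<otimes> l) [^] ?m" using h l HG by (simp add: nat_pow_distrib)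
      then show "y \<otimes> z \<in> (\<lambda>h. h [^] ?m) ` H" using subgroup.m_closed[OF H h(1) l(1)] by blast
    qed
    have "d [^] i = \<one>" if i: "d [^] i \<in> (\<lambda>h. h [^] ?m) ` H" for i :: int
    proof -
      obtain h where h: "h \<in> H" "d [^] i = h [^] ?m" using i by blast
      have "h [^] (q ^ (k + k)) = (h [^] ?m) [^] ?m" using h HG by (simp add: nat_pow_pow power_add)
      also have "\<dots> = (d [^] i) [^] ?m" using h by simp
      also have "\<dots> = (d [^] ?m) [^] i"
        using dG by (simp only: int_pow_nat_pow mult.commute)
      also have "\<dots> = \<one>" using d(2) dG by (metis int_pow_one pow_ord_eq_1)
      finally show ?thesis using max[OF h(1)] h(2) by simp
    qed
    moreover have "(\<lambda>h. h [^] ?m) ` H \<subseteq> H"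
      using Hnpow by auto
    ultimately show ?thesis unfolding A_def using sub by blast
  qed
  have "\<exists>M\<in>A. \<forall>T\<in>A. M \<subseteq> T \<longrightarrow> T = M"
  proof (rule subset_Zorn_nonempty)
    show "A \<noteq> {}" using K0 by blast
    fix C assume C: "C \<noteq> {}" "subset.chain A C"
    have CA: "\<And>S. S \<in> C \<Longrightarrow> S \<in> A" and ch: "\<And>S T. S \<in> C \<Longrightarrow> T \<in> C \<Longrightarrow> S \<subseteq> T \<or> T \<subseteq> S"
      using C(2) by (auto simp: subset.chain_def)
    obtain S0 where S0: "S0 \<in> C" using C(1) by blast
    have sb: "subgroup S G" if "S \<in> C" for S using CA[OF that] by (simp add: A_def)
    have "subgroup (\<Union>C) G"
    proof (rule subgroupI)
      show "\<Union>C \<subseteq> carrier G" using sb subgroup.subset by blast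
      show "\<Union>C \<noteq> {}" using S0 sb[OF S0] subgroup.one_closed by blast
      fix a assume "a \<in> \<Union>C"
      then obtain S where S: "S \<in> C" "a \<in> S" by blast
      then show "inv a \<in> \<Union>C" using subgroup.m_inv_closed[OF sb[OF S(1)] S(2)] by blast
      fix b assume "b \<in> \<Union>C"
      then obtain T where T: "T \<in> C" "b \<in> T" by blast
      then obtain U where U: "U \<in> C" "a \<in> U" "b \<in> U" using ch[OF S(1) T(1)] S T by blast
      then show "a \<otimes> b \<in> \<Union>C" using subgroup.m_closed[OF sb[OF U(1)] U(2,3)] by blast
    qed
    moreover have "\<Union>C \<subseteq> H" using CA unfolding A_def by blast
    moreover have "\<forall>h\<in>H. h [^] ?m \<in> \<Union>C" using CA[OF S0] S0 unfolding A_def by blast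
    moreover have "\<forall>i::int. d [^] i \<in> \<Union>C \<longrightarrow> d [^] i = \<one>" using CA unfolding A_def by blast
    ultimately show "\<Union>C \<in> A" by (simp only: A_def mem_Collect_eq simp_thms)
  qed
  then obtain K where KA: "K \<in> A" and Kmax: "\<And>T. T \<in> A \<Longrightarrow> K \<subseteq> T \<Longrightarrow> T = K" by (elim bexE) simp
  have K: "subgroup K G" "K \<subseteq> H" "\<And>h. h \<in> H \<Longrightarrow> h [^] ?m \<in> K"
    "\<And>i::int. d [^] i \<in> K \<Longrightarrow> d [^] i = \<one>" using KA by (simp_all add: A_def)
  have KG: "x \<in> carrier G" if "x \<in> K" for x using that K(2) HG by blast
  have Kpow: "x [^] (i::int) \<in> K" if "x \<in> K" for x i using subgroup_int_pow_closed[OF K(1) that] .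
  define KD where "KD = {y. \<exists>k\<in>K. \<exists>i::int. y = k \<otimes> d [^] i}"
  have KD: "subgroup KD G" unfolding KD_def by (rule subgroup_adjoin[OF K(1) dG])
  have KDpow: "x [^] (i::int) \<in> KD" if "x \<in> KD" for x i using subgroup_int_pow_closed[OF KD that] .
  have Knpow: "x [^] (n::nat) \<in> K" if "x \<in> K" for x n
    using Kpow[OF that, of "int n"] by (simp only: int_pow_int)
  have KKD: "x \<in> KD" if "x \<in> K" for x
  proof -
    have "x = x \<otimes> d [^] (0::int)" using KG[OF that] by simp
    then show ?thesis using that unfolding KD_def by blast
  qed
  have dKD: "d [^] (i::int) \<in> KD" for i
  proof -
    have "d [^] i = \<one> \<otimes> d [^] i" using dG by simp
    then show ?thesis using subgroup.one_closed[OF K(1)] unfolding KD_def by blast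
  qed
  have "H \<subseteq> KD"
  proof (rule ccontr)
    assume "\<not> H \<subseteq> KD"
    then obtain a where a: "a \<in> H" "a \<notin> KD" by blast
    have aG: "a \<in> carrier G" using a HG by blast
    have ex: "a [^] (q ^ k) \<in> KD" using K(3)[OF a(1)] KKD by blast
    define i where "i = (LEAST i. a [^] (q ^ i) \<in> KD)"
    have i: "a [^] (q ^ i) \<in> KD" unfolding i_def by (rule LeastI[of _ k]) (rule ex)
    have "i \<noteq> 0" using i a(2) aG by (metis nat_pow_eone power_0)
    then obtain i' where i': "i = Suc i'" by (cases i) auto
    have i'n: "a [^] (q ^ i') \<notin> KD" using not_less_Least[of i' "\<lambda>i. a [^] (q ^ i) \<in> KD"] i' unfolding i_def by simp
    define b0 where "b0 = a [^] (q ^ i')"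
    have b0: "b0 \<in> H" "b0 \<in> carrier G" "b0 \<notin> KD"
      using Hnpow[OF a(1)] aG i'n by (auto simp: b0_def)
    have "b0 [^] q \<in> KD" using i i' aG by (simp add: b0_def nat_pow_pow mult.commute)
    then obtain \<kappa> and j :: int where \<kappa>: "\<kappa> \<in> K" "b0 [^] q = \<kappa> \<otimes> d [^] j" unfolding KD_def by blast
    have "b0 [^] ?m = (b0 [^] q) [^] (q ^ (k - 1))" using b0 m by (simp add: nat_pow_pow)
    also have "\<dots> = \<kappa> [^] (q ^ (k - 1)) \<otimes> d [^] (j * int (q ^ (k - 1)))"
      unfolding \<kappa>(2) using KG[OF \<kappa>(1)] dG by (simp add: nat_pow_distrib int_pow_nat_pow)
    finally have e: "b0 [^] ?m = \<kappa> [^] (q ^ (k - 1)) \<otimes> d [^] (j * int (q ^ (k - 1)))" .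
    have "d [^] (j * int (q ^ (k - 1))) = inv (\<kappa> [^] (q ^ (k - 1))) \<otimes> b0 [^] ?m"
      unfolding e using KG[OF \<kappa>(1)] dG by (simp add: mult_cancels)
    also have "\<dots> \<in> K"
      using K(1) K(3)[OF b0(1)] Knpow[OF \<kappa>(1)]
      by (simp add: subgroup.m_closed subgroup.m_inv_closed)
    finally have "d [^] (j * int (q ^ (k - 1))) = \<one>" by (rule K(4))
    then have "int ?m dvd j * int (q ^ (k - 1))" using int_pow_eq_id[OF dG] d(2) by simp
    then have "int q dvd j" using q0 m by simp
    then obtain j' where j': "j = int q * j'" by (elim dvdE)
    \<comment> \<open>Now \<open>b\<^sup>q = \<kappa>\<close> is in \<open>K\<close>, but
      \<open>b\<close> is not in \<open>K \<langle>d\<rangle>\<close>.\<close>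
    define b where "b = b0 \<otimes> inv (d [^] j')"
    have b: "b \<in> H" "b \<in> carrier G"
      using b0 Hpow[OF d(1), of j'] H dG by (auto simp: b_def subgroup.m_closed subgroup.m_inv_closed)
    have b0b: "b0 = b \<otimes> d [^] j'" using b0 dG by (simp add: b_def m_assoc)
    have bKD: "b \<notin> KD" using b0(3) b0b subgroup.m_closed[OF KD _ dKD[of j']] by auto
    have "b [^] q = b0 [^] q \<otimes> inv (d [^] j)"
      using b0 dG by (simp add: b_def nat_pow_distrib nat_pow_inv j' int_pow_nat_pow mult.commute)
    also have "\<dots> = \<kappa>" unfolding \<kappa>(2) using KG[OF \<kappa>(1)] dG by (simp add: m_assoc)
    finally have bq: "b [^] q \<in> K" using \<kappa>(1) by simp
    define K' where "K' = {y. \<exists>k\<in>K. \<exists>i::int. y = k \<otimes> b [^] i}"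
    have subK': "subgroup K' G" unfolding K'_def by (rule subgroup_adjoin[OF K(1) b(2)])
    have KK': "K \<subseteq> K'"
    proof
      fix x assume x: "x \<in> K"
      then have "x = x \<otimes> b [^] (0::int)" using KG by simp
      then show "x \<in> K'" using x unfolding K'_def by blast
    qed
    have "b = \<one> \<otimes> b [^] (1::int)" using b by simp
    then have bK': "b \<in> K'" using subgroup.one_closed[OF K(1)] unfolding K'_def by blast
    have "K' \<in> A"
    proof -
      have "K' \<subseteq> H" unfolding K'_def using Hpow[OF b(1)] K(2) subgroup.m_closed[OF H] by blast
      moreover have "d [^] s = \<one>" if s: "d [^] s \<in> K'" for s :: int
      proof -
        obtain x and l :: int where x: "x \<in> K" "d [^] s = x \<otimes> b [^] l" using s unfolding K'_def by blast
        have bl: "b [^] l = inv x \<otimes> d [^] s" unfolding x(2) using KG[OF x(1)] b by (simp add: mult_cancels)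
        show ?thesis
        proof (cases "int q dvd l")
          case True
          then obtain l' where l': "l = int q * l'" by (elim dvdE)
          have "b [^] l = (b [^] q) [^] l'" using b l' by (simp add: int_pow_nat_pow)
          then have "b [^] l \<in> K" using Kpow[OF bq] by simp
          then have "d [^] s \<in> K" using x K(1) by (simp add: subgroup.m_closed)
          then show ?thesis by (rule K(4))
        next
          case False
          have "coprime (int q) l" using False q by (simp add: prime_imp_coprime)
          then obtain u v where uv: "u * int q + v * l = 1"
            using bezout_int[of "int q" l] by auto
          have "b [^] l \<in> KD"
            unfolding bl using KKD[OF subgroup.m_inv_closed[OF K(1) x(1)]] dKD subgroup.m_closed[OF KD] by blast
          then have 1: "(b [^] l) [^] v \<in> KD" by (rule KDpow)
          have 2: "(b [^] q) [^] u \<in> KD" by (rule KDpow[OF KKD[OF bq]])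
          have "b = b [^] (u * int q + v * l)" using uv b by simp
          also have "\<dots> = (b [^] q) [^] u \<otimes> (b [^] l) [^] v"
            using b by (simp add: int_pow_mult int_pow_nat_pow int_pow_pow mult.commute)
          finally have "b \<in> KD" using subgroup.m_closed[OF KD 2 1] by simp
          then show ?thesis using bKD by simp
        qed
      qed
      ultimately show ?thesis unfolding A_def using subK' KK' K(3) by blast
    qed
    then have "K' = K" using Kmax KK' by blast
    then show False using bK' bKD KKD by blast
  qed
  moreover have "d \<notin> K"
  proof
    assume "d \<in> K"
    then have "d [^] (1::int) = \<one>" using dG by (intro K(4)) simp
    then have "ord d = 1" using dG by (simp add: ord_eq_1)
    moreover have "1 < q ^ k" using q0 d(3) by (rule one_less_power)
    ultimately show False using d(2) by linarith
  qed
  ultimately show ?thesis using K(1,2) unfolding KD_def by blast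
qed

text \<open>Induction on the number of torsion elements: a cyclic direct factor of prime power
  order is split off in each step.\<close>

lemma finite_torsion_splits:
  assumes "subgroup H G" "finite {x \<in> H. ord x \<noteq> 0}"
  shows "\<exists>L. subgroup L G \<and> L \<subseteq> H \<and> (\<forall>x\<in>L. ord x \<noteq> 0 \<longrightarrow> x = \<one>) \<and>
     (\<forall>x\<in>H. \<exists>t\<in>H. \<exists>l\<in>L. ord t \<noteq> 0 \<and> x = t \<otimes> l)"
  using assms
proof (induction "card {x \<in> H. ord x \<noteq> 0}" arbitrary: H rule: less_induct)
  case less
  note H = less.prems(1)
  have HG: "x \<in> carrier G" if "x \<in> H" for x using that subgroup.mem_carrier[OF H] by blast
  show ?case
  proof (cases "\<forall>x\<in>H. ord x \<noteq> 0 \<longrightarrow> x = \<one>")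
    case True
    have "\<exists>t\<in>H. \<exists>l\<in>H. ord t \<noteq> 0 \<and> x = t \<otimes> l" if "x \<in> H" for x
      using that subgroup.one_closed[OF H] HG[OF that] by (intro bexI[of _ \<one>] bexI[of _ x]) auto
    then show ?thesis using True H by (intro exI[of _ H]) simp
  next
    case False
    then obtain x where x: "x \<in> H" "ord x \<noteq> 0" "x \<noteq> \<one>" by blast
    have xG: "x \<in> carrier G" using x HG by blast
    have "ord x \<noteq> 1" using ord_eq_1[OF xG] x by simp
    then obtain q where q: "Factorial_Ring.prime q" "q dvd ord x" using prime_factor_nat by blast
    let ?Q = "{y \<in> H. \<exists>n::nat. y [^] (q ^ n) = \<one>}"
    have Qsub: "?Q \<subseteq> {x \<in> H. ord x \<noteq> 0}"
    proof
      fix y assume "y \<in> ?Q"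
      then obtain n :: nat where y: "y \<in> H" "y [^] (q ^ n) = \<one>" by blast
      then have "ord y dvd q ^ n" using pow_eq_id[OF HG[OF y(1)], of "q ^ n"] by simp
      then have "ord y \<noteq> 0" using q(1) prime_gt_0_nat[of q] by (intro notI) simp
      then show "y \<in> {x \<in> H. ord x \<noteq> 0}" using y(1) by simp
    qed
    have finQ: "finite ?Q" using Qsub less.prems(2) finite_subset by blast
    have neQ: "?Q \<noteq> {}" using subgroup.one_closed[OF H] by force
    obtain z where z: "z \<in> ?Q" "z \<noteq> \<one>"
    proof -
      obtain r where r: "ord x = q * r" using q(2) by (elim dvdE)
      have r0: "r \<noteq> 0" using r x(2) by auto
      have "x [^] r \<in> H" using subgroup_int_pow_closed[OF H x(1), of "int r"] by (simp add: int_pow_int)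
      moreover have "(x [^] r) [^] (q ^ 1) = \<one>" using r xG pow_ord_eq_1[OF xG] by (simp add: nat_pow_pow mult.commute)
      moreover have "x [^] r \<noteq> \<one>"
      proof
        assume "x [^] r = \<one>"
        then have "q * r dvd r" using pow_eq_id[OF xG] r by simp
        then have "q dvd 1" using r0 by simp
        then show False using q(1) by auto
      qed
      ultimately show thesis using that[of "x [^] r"] by blast
    qed
    have "Max (ord ` ?Q) \<in> ord ` ?Q" using finQ neQ by (intro Max_in) blast+
    then obtain d where d: "d \<in> ?Q" "ord d = Max (ord ` ?Q)" by (elim imageE) simp
    have dmax: "ord y \<le> ord d" if "y \<in> ?Q" for y
      unfolding d(2) by (rule Max_ge) (use finQ that in blast)+
    have oq: "\<exists>k. ord y = q ^ k" if "y \<in> ?Q" for y using that HG ord_prime_power_iff[OF q(1)] by blast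
    obtain k where k: "ord d = q ^ k" using oq[OF d(1)] by blast
    have q1: "q > 1" using q(1) prime_gt_1_nat by blast
    have "k \<noteq> 0"
    proof
      assume "k = 0"
      then have "ord z \<le> 1" using dmax[OF z(1)] k by simp
      moreover have "ord z \<noteq> 0" using z(1) Qsub by blast
      ultimately have "z = \<one>" using ord_eq_1 z(1) HG by force
      then show False using z by simp
    qed
    moreover have "y [^] (q ^ k) = \<one>" if y: "y \<in> H" "y [^] (q ^ n) = \<one>" for y and n :: nat
    proof -
      have yQ: "y \<in> ?Q" using y by blast
      obtain j where j: "ord y = q ^ j" using oq[OF yQ] by blast
      have "q ^ j \<le> q ^ k" using dmax[OF yQ] j k by simp
      then have "j \<le> k" using q1 by simp
      then have "ord y dvd q ^ k" using j by (simp add: le_imp_power_dvd)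
      then show ?thesis using pow_eq_id[OF HG[OF y(1)]] by blast
    qed
    ultimately obtain K where K: "subgroup K G" "K \<subseteq> H" "d \<notin> K" "H \<subseteq> {y. \<exists>k\<in>K. \<exists>i::int. y = k \<otimes> d [^] i}"
      using cyclic_p_summand[OF q(1) H _ k] d(1) by blast
    have dH: "d \<in> H" "ord d \<noteq> 0" using d(1) Qsub by blast+
    have dG: "d \<in> carrier G" using dH HG by blast
    have lt: "{x \<in> K. ord x \<noteq> 0} \<subset> {x \<in> H. ord x \<noteq> 0}" using K(2,3) dH by blast
    obtain L where L: "subgroup L G" "L \<subseteq> K" "\<forall>x\<in>L. ord x \<noteq> 0 \<longrightarrow> x = \<one>"
      "\<forall>x\<in>K. \<exists>t\<in>K. \<exists>l\<in>L. ord t \<noteq> 0 \<and> x = t \<otimes> l"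
      using less.hyps[OF psubset_card_mono[OF less.prems(2) lt] K(1)] finite_subset[OF _ less.prems(2)] lt by auto
    have "\<exists>t\<in>H. \<exists>l\<in>L. ord t \<noteq> 0 \<and> x = t \<otimes> l" if x: "x \<in> H" for x
    proof -
      obtain \<kappa> and i :: int where \<kappa>: "\<kappa> \<in> K" "x = \<kappa> \<otimes> d [^] i" using x K(4) by blast
      obtain t l where tl: "t \<in> K" "l \<in> L" "ord t \<noteq> 0" "\<kappa> = t \<otimes> l" using L(4) \<kappa>(1) by blast
      have G: "t \<in> carrier G" "l \<in> carrier G" "d [^] i \<in> carrier G" using tl L(2) K(2) HG dG by blast+
      have di: "d [^] i \<in> H" using subgroup_int_pow_closed[OF H dH(1)] .
      have "t \<otimes> d [^] i \<in> H" using tl(1) K(2) di subgroup.m_closed[OF H] by blast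
      moreover have "x = (t \<otimes> d [^] i) \<otimes> l" using \<kappa>(2) tl(4) G by (simp add: m_ac)
      moreover have "ord (t \<otimes> d [^] i) \<noteq> 0"
      proof -
        have dd: "(d [^] i) [^] ord d = \<one>" using dG by (metis int_pow_nat_pow int_pow_one mult.commute pow_ord_eq_1)
        have "ord (d [^] i) dvd ord d" using dd pow_eq_id[OF G(3)] by blast
        then have "t [^] (ord t * ord d) = \<one>" "(d [^] i) [^] (ord t * ord d) = \<one>"
          using pow_eq_id[OF G(1)] pow_eq_id[OF G(3)] by auto
        then have "(t \<otimes> d [^] i) [^] (ord t * ord d) = \<one>"
          using G by (simp add: nat_pow_distrib)
        then have "ord (t \<otimes> d [^] i) dvd ord t * ord d" using pow_eq_id G by simp
        then show ?thesis using tl(3) dH(2) by (metis dvd_0_left_iff mult_eq_0_iff)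
      qed
      ultimately show ?thesis using tl(2) by blast
    qed
    then show ?thesis using L(1,2,3) K(2) by (intro exI[of _ L]) blast
  qed
qed

text \<open>A torsion-free complement of the kernel is mapped isomorphically to \<open>L\<close>,
  and the section is the inverse map.\<close>

lemma torsion_quotient_section:
  assumes \<rho>: "group_hom G L \<rho>" and surj: "\<rho> ` carrier G = carrier L"
    and ker: "kernel G L \<rho> = {x \<in> carrier G. ord x \<noteq> 0}" and fin: "finite (kernel G L \<rho>)"
  shows "\<exists>s\<in>hom L G. \<forall>l\<in>carrier L. \<rho> (s l) = l"
proof -
  interpret \<rho>: group_hom G L \<rho> by fact
  obtain C where C: "subgroup C G" "\<forall>x\<in>C. ord x \<noteq> 0 \<longrightarrow> x = \<one>"
    "\<forall>x\<in>carrier G. \<exists>t\<in>carrier G. \<exists>l\<in>C. ord t \<noteq> 0 \<and> x = t \<otimes> l"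
    using finite_torsion_splits[OF subgroup_self] fin unfolding ker by blast
  have CG: "x \<in> carrier G" if "x \<in> C" for x using that subgroup.mem_carrier[OF C(1)] by blast
  have ex: "\<exists>c\<in>C. \<rho> c = l" if l: "l \<in> carrier L" for l
  proof -
    obtain x where x: "x \<in> carrier G" "l = \<rho> x" using l surj by blast
    obtain t c where tc: "t \<in> carrier G" "c \<in> C" "ord t \<noteq> 0" "x = t \<otimes> c" using C(3) x(1) by blast
    have "t \<in> kernel G L \<rho>" using tc ker by blast
    then have "\<rho> c = l" using tc x CG by (simp add: kernel_def)
    then show ?thesis using tc(2) by blast
  qed
  have inj: "c = c'" if c: "c \<in> C" "c' \<in> C" "\<rho> c = \<rho> c'" for c c'
  proof -
    have "\<rho> (c \<otimes> inv c') = \<one>\<^bsub>L\<^esub>" using c CG by simp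
    then have "c \<otimes> inv c' \<in> kernel G L \<rho>" using c CG by (simp add: kernel_def)
    then have "ord (c \<otimes> inv c') \<noteq> 0" using ker by blast
    moreover have "c \<otimes> inv c' \<in> C" using c C(1) by (simp add: subgroup.m_closed subgroup.m_inv_closed)
    ultimately have "c \<otimes> inv c' = \<one>" using C(2) by blast
    then show ?thesis using c CG by (metis inv_equality inv_inv inv_closed)
  qed
  obtain s where s: "\<And>l. l \<in> carrier L \<Longrightarrow> s l \<in> C \<and> \<rho> (s l) = l" using ex by metis
  have "s \<in> hom L G"
  proof (rule homI)
    fix x y assume xy: "x \<in> carrier L" "y \<in> carrier L"
    show "s x \<in> carrier G" using s[OF xy(1)] CG by blast
    have "\<rho> (s (x \<otimes>\<^bsub>L\<^esub> y)) = \<rho> (s x \<otimes> s y)" using s xy CG by simp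
    then show "s (x \<otimes>\<^bsub>L\<^esub> y) = s x \<otimes> s y"
      by (rule inj[rotated 2]) (use s xy subgroup.m_closed[OF C(1)] in auto)
  qed
  then show ?thesis using s by blast
qed

end

section \<open>Normalized units of the group algebra of a subgroup\<close>

lemma group_algebra_sub_ops:
  "monoid.mult (group_algebra F (G\<lparr>carrier := H\<rparr>)) = monoid.mult (group_algebra F G)"
  "\<one>\<^bsub>group_algebra F (G\<lparr>carrier := H\<rparr>)\<^esub> = \<one>\<^bsub>group_algebra F G\<^esub>"
  "\<zero>\<^bsub>group_algebra F (G\<lparr>carrier := H\<rparr>)\<^esub> = \<zero>\<^bsub>group_algebra F G\<^esub>"
  "ring.add (group_algebra F (G\<lparr>carrier := H\<rparr>)) = ring.add (group_algebra F G)"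
  by (simp_all add: group_algebra_def)

context ga
begin

lemma sub_carrier:
  assumes "subgroup H G"
  shows "a \<in> carrier (group_algebra F (G\<lparr>carrier := H\<rparr>)) \<longleftrightarrow> a \<in> carrier R \<and> supp a \<subseteq> H"
  using subgroup.subset[OF assms] unfolding group_algebra_def by auto

lemmas sub_ops = group_algebra_sub_ops[where F = F and G = G]

text \<open>The inverse enters the condition since a unit supported on \<open>H\<close> has to be
  invertible within \<open>FH\<close>.\<close>

lemma sub_V_carrier:
  assumes "subgroup H G"
  shows "u \<in> carrier (normalized_units F (G\<lparr>carrier := H\<rparr>)) \<longleftrightarrow>
    u \<in> carrier V \<and> supp u \<subseteq> H \<and> supp (inv\<^bsub>V\<^esub> u) \<subseteq> H"
proof -
  interpret H: group "G\<lparr>carrier := H\<rparr>" by (rule G.subgroup_imp_group[OF assms])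
  interpret H: ga F "G\<lparr>carrier := H\<rparr>" by unfold_locales
  show ?thesis
  proof
    assume u: "u \<in> carrier H.V"
    have uc: "u \<in> carrier H.R" using u by (rule H.V_R)
    have ui: "inv\<^bsub>H.V\<^esub> u \<in> carrier H.R" using H.V.inv_closed[OF u] by (rule H.V_R)
    have e: "u \<otimes>\<^bsub>R\<^esub> inv\<^bsub>H.V\<^esub> u = \<one>\<^bsub>R\<^esub>" "inv\<^bsub>H.V\<^esub> u \<otimes>\<^bsub>R\<^esub> u = \<one>\<^bsub>R\<^esub>"
      using H.V.r_inv[OF u] H.V.l_inv[OF u] by (simp_all add: sub_ops)
    have a: "augmentation F u = \<one>\<^bsub>F\<^esub>" "augmentation F (inv\<^bsub>H.V\<^esub> u) = \<one>\<^bsub>F\<^esub>"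
      using u H.V.inv_closed[OF u] by (auto simp: H.V_carrier)
    have cc: "u \<in> carrier R" "supp u \<subseteq> H" "inv\<^bsub>H.V\<^esub> u \<in> carrier R" "supp (inv\<^bsub>H.V\<^esub> u) \<subseteq> H"
      using uc ui sub_carrier[OF assms] by auto
    have uV: "u \<in> carrier V" "inv\<^bsub>H.V\<^esub> u \<in> carrier V" using V_I cc e a by auto
    have "inv\<^bsub>V\<^esub> u = inv\<^bsub>H.V\<^esub> u" using V.inv_equality[of "inv\<^bsub>H.V\<^esub> u" u] e uV by simp
    then show "u \<in> carrier V \<and> supp u \<subseteq> H \<and> supp (inv\<^bsub>V\<^esub> u) \<subseteq> H" using uV cc by simp
  next
    assume u: "u \<in> carrier V \<and> supp u \<subseteq> H \<and> supp (inv\<^bsub>V\<^esub> u) \<subseteq> H"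
    then have uV: "u \<in> carrier V" "inv\<^bsub>V\<^esub> u \<in> carrier V" by auto
    have e: "u \<otimes>\<^bsub>R\<^esub> inv\<^bsub>V\<^esub> u = \<one>\<^bsub>R\<^esub>" "inv\<^bsub>V\<^esub> u \<otimes>\<^bsub>R\<^esub> u = \<one>\<^bsub>R\<^esub>"
      using V.r_inv[OF uV(1)] V.l_inv[OF uV(1)] by simp_all
    have "u \<in> carrier H.R" "inv\<^bsub>V\<^esub> u \<in> carrier H.R" using sub_carrier[OF assms] u uV V_R by auto
    moreover have "augmentation F u = \<one>\<^bsub>F\<^esub>" using uV by (simp add: V_carrier)
    ultimately show "u \<in> carrier H.V"
      using e H.V_I[of u "inv\<^bsub>V\<^esub> u"] by (simp add: sub_ops)
  qed
qed

lemma sub_V_subgroup: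
  assumes "subgroup H G"
  shows "subgroup (carrier (normalized_units F (G\<lparr>carrier := H\<rparr>))) V"
proof -
  interpret H: group "G\<lparr>carrier := H\<rparr>" by (rule G.subgroup_imp_group[OF assms])
  interpret H: ga F "G\<lparr>carrier := H\<rparr>" by unfold_locales
  show ?thesis
  proof (rule V.subgroupI)
    show "carrier H.V \<subseteq> carrier V" using sub_V_carrier[OF assms] by blast
    show "carrier H.V \<noteq> {}" using H.V.one_closed by blast
    fix u assume u: "u \<in> carrier H.V"
    then show "inv\<^bsub>V\<^esub> u \<in> carrier H.V" using sub_V_carrier[OF assms] by auto
    fix v assume "v \<in> carrier H.V"
    then show "u \<otimes>\<^bsub>V\<^esub> v \<in> carrier H.V" using H.V.m_closed[OF u] by (simp add: sub_ops)
  qed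
qed

end

section \<open>The unit group of a graded group algebra\<close>

context ga
begin

lemma finsum_sub:
  assumes "subgroup H G" "finite I" "f \<in> I \<rightarrow> carrier (group_algebra F (G\<lparr>carrier := H\<rparr>))"
  shows "finsum (group_algebra F (G\<lparr>carrier := H\<rparr>)) f I = finsum R f I"
  using assms(2,3)
proof (induction I rule: finite_induct)
  interpret H: group "G\<lparr>carrier := H\<rparr>" by (rule G.subgroup_imp_group[OF assms(1)])
  interpret H: ga F "G\<lparr>carrier := H\<rparr>" by unfold_locales
  case empty then show ?case by (simp add: sub_ops)
next
  interpret H: group "G\<lparr>carrier := H\<rparr>" by (rule G.subgroup_imp_group[OF assms(1)])
  interpret H: ga F "G\<lparr>carrier := H\<rparr>" by unfold_locales
  case (insert i I)
  have f: "f \<in> I \<rightarrow> carrier H.R" "f i \<in> carrier H.R" using insert.prems by auto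
  then have "f \<in> I \<rightarrow> carrier R" "f i \<in> carrier R" using sub_carrier[OF assms(1)] by auto
  then show ?case using insert.hyps insert.IH f by (simp add: sub_ops)
qed

lemma aug_finsum:
  assumes "finite I" "f \<in> I \<rightarrow> carrier R"
  shows "augmentation F (finsum R f I) = finsum F (\<lambda>i. augmentation F (f i)) I"
  using assms
proof (induction I rule: finite_induct)
  case empty
  have "augmentation F \<zero>\<^bsub>R\<^esub> = \<zero>\<^bsub>F\<^esub>" using aug_mon[of "\<zero>\<^bsub>F\<^esub>" "\<one>\<^bsub>G\<^esub>"] by (simp add: mon_zero)
  then show ?case by simp
next
  case (insert i I)
  have "f \<in> I \<rightarrow> carrier R" "f i \<in> carrier R" using insert.prems by auto
  moreover from this have "(\<lambda>i. augmentation F (f i)) \<in> I \<rightarrow> carrier F" by auto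
  ultimately show ?case using insert by (simp add: aug_add)
qed

end

context ga_graded
begin

abbreviation RT where "RT \<equiv> group_algebra F (A\<lparr>carrier := T\<rparr>)"
abbreviation VT where "VT \<equiv> normalized_units F (A\<lparr>carrier := T\<rparr>)"

sublocale TG: group "A\<lparr>carrier := T\<rparr>" by (rule G.subgroup_imp_group[OF T_subgroup])
sublocale TA: ga F "A\<lparr>carrier := T\<rparr>" by unfold_locales
sublocale VC: comm_group V by (rule V_comm_group) (rule A.comm_group_axioms)

lemmas RT_carrier = sub_carrier[OF T_subgroup]
lemmas VT_carrier = sub_V_carrier[OF T_subgroup]

lemma VT_normal: "carrier VT \<lhd> V"
  by (rule VC.subgroup_imp_normal[OF sub_V_subgroup[OF T_subgroup]])

text \<open>Both \<open>u\<close> and \<open>u\<^sup>-\<^sup>1\<close> are roots of elements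
  supported on \<open>T\<close>.\<close>

lemma quotient_torsion_free: "torsion_free_group (V Mod carrier VT)"
proof -
  interpret N: normal "carrier VT" V by (rule VT_normal)
  interpret Q: group "V Mod carrier VT" by (rule N.factorgroup_is_group)
  have "C = carrier VT" if C: "C \<in> carrier (V Mod carrier VT)" "Q.ord C \<noteq> 0" for C
  proof -
    obtain u where u: "u \<in> carrier V" "C = carrier VT #>\<^bsub>V\<^esub> u" using C(1) by (auto simp: carrier_FactGroup)
    let ?n = "Q.ord C"
    have "carrier VT #>\<^bsub>V\<^esub> (u [^]\<^bsub>V\<^esub> ?n) = carrier VT"
      using Q.pow_ord_eq_1[OF C(1)] N.FactGroup_pow[OF u(1), of ?n] u(2) by simp
    then have un: "u [^]\<^bsub>V\<^esub> ?n \<in> carrier VT"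
      using V.rcos_self[OF V.nat_pow_closed[OF u(1)] N.subgroup_axioms] by metis
    have "supp (u [^]\<^bsub>R\<^esub> ?n) \<subseteq> T" using un VT_carrier by (simp add: V_pow)
    then have 1: "supp u \<subseteq> T" using root_in_kernel[OF V_R[OF u(1)], of ?n] C(2) by simp
    have iv: "inv\<^bsub>V\<^esub> u \<in> carrier V" using u by simp
    have "supp (inv\<^bsub>V\<^esub> (u [^]\<^bsub>V\<^esub> ?n)) \<subseteq> T" using un VT_carrier by simp
    then have "supp ((inv\<^bsub>V\<^esub> u) [^]\<^bsub>R\<^esub> ?n) \<subseteq> T" using V.nat_pow_inv[OF u(1), of ?n] by (simp add: V_pow)
    then have 2: "supp (inv\<^bsub>V\<^esub> u) \<subseteq> T" using root_in_kernel[OF V_R[OF iv], of ?n] C(2) by simp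
    have "u \<in> carrier VT" using VT_carrier 1 2 u(1) by simp
    then show ?thesis using u(2) V.coset_join2[OF u(1) N.subgroup_axioms] by simp
  qed
  then have "torsion_part (V Mod carrier VT) = {carrier VT}"
    using Q.one_closed Q.ord_id unfolding one_FactGroup torsion_part_def by auto
  then show ?thesis unfolding torsion_free_group_def using Q.is_group by simp
qed

lemma supp_mult_T:
  assumes "a \<in> carrier R" "b \<in> carrier R" "supp a \<subseteq> T" "supp b \<subseteq> T" shows "supp (a \<otimes>\<^bsub>R\<^esub> b) \<subseteq> T"
proof -
  have "a \<otimes>\<^bsub>RT\<^esub> b \<in> carrier RT" using assms RT_carrier by (intro TA.mult_closed) auto
  then show ?thesis using RT_carrier by (simp add: sub_ops)
qed

text \<open>Put \<open>w(f) = \<Sum> e\<^sub>i s(f\<^sub>i)\<close>, which is a unit with inverse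
  \<open>w(f\<^sup>-\<^sup>1)\<close> and has degree \<open>f\<^sub>i\<close> at
  \<open>e\<^sub>i\<close>. If \<open>f\<close> lists the degrees of the components of a unit
  \<open>u\<close>, then \<open>u w(f\<^sup>-\<^sup>1)\<close> and its inverse have all components
  in degree \<open>1\<close>. Injectivity is the uniqueness of the degrees.\<close>

theorem units_iso_direct_product:
  assumes s: "s \<in> hom L A" "\<And>l. l \<in> carrier L \<Longrightarrow> \<rho> (s l) = l"
    and e: "field_idempotents RT n e"
  shows "(\<lambda>(c, f). c \<otimes>\<^bsub>R\<^esub> (\<Oplus>\<^bsub>R\<^esub>i\<in>{..<n}. e i \<otimes>\<^bsub>R\<^esub> mon \<one>\<^bsub>F\<^esub> (s (f i))))
     \<in> iso (VT \<times>\<times> product_group {..<n} (\<lambda>_. L)) V"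
proof -
  interpret s: group_hom L A s by unfold_locales (rule s(1))
  interpret CT: cring RT
    by (rule TA.cring_if_comm, rule TG.group_comm_groupI)
      (use A.m_comm subgroup.mem_carrier[OF T_subgroup] in simp)
  have e1: "e i \<in> carrier R" "supp (e i) \<subseteq> T" "e i \<noteq> \<zero>\<^bsub>R\<^esub>" "e i \<otimes>\<^bsub>R\<^esub> e i = e i" if "i < n" for i
    using e that RT_carrier[of "e i"] unfolding field_idempotents_def by (auto simp: sub_ops)
  have e2: "e i \<otimes>\<^bsub>R\<^esub> e j = \<zero>\<^bsub>R\<^esub>" if "i < n" "j < n" "i \<noteq> j" for i j
    using e that unfolding field_idempotents_def by (simp add: sub_ops)
  have e3: "\<exists>d\<in>carrier R. c \<otimes>\<^bsub>R\<^esub> d \<otimes>\<^bsub>R\<^esub> e i = e i"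
    if "i < n" "c \<in> carrier R" "supp c \<subseteq> T" "c \<otimes>\<^bsub>R\<^esub> e i \<noteq> \<zero>\<^bsub>R\<^esub>" for i c
  proof -
    have "\<exists>d\<in>carrier RT. c \<otimes>\<^bsub>R\<^esub> d \<otimes>\<^bsub>R\<^esub> e i = e i"
      using e that RT_carrier[of c] unfolding field_idempotents_def by (simp add: sub_ops)
    then show ?thesis using RT_carrier by blast
  qed
  have sum1: "finsum R e {..<n} = \<one>\<^bsub>R\<^esub>"
    using CT.field_idempotents_sum[OF e] finsum_sub[OF T_subgroup, of "{..<n}" e] e1 RT_carrier
    by (auto simp: sub_ops)
  have ec: "e \<in> {..<n} \<rightarrow> carrier R" using e1 by auto
  have expand: "x = (\<Oplus>\<^bsub>R\<^esub>i\<in>{..<n}. x \<otimes>\<^bsub>R\<^esub> e i)" if x: "x \<in> carrier R" for x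
  proof -
    have "x = x \<otimes>\<^bsub>R\<^esub> finsum R e {..<n}" using x sum1 by simp
    also have "\<dots> = (\<Oplus>\<^bsub>R\<^esub>i\<in>{..<n}. x \<otimes>\<^bsub>R\<^esub> e i)" by (rule finsum_rdistr) (use x ec in auto)
    finally show ?thesis .
  qed
  have eqI: "x = y" if xy: "x \<in> carrier R" "y \<in> carrier R" "\<And>j. j < n \<Longrightarrow> x \<otimes>\<^bsub>R\<^esub> e j = y \<otimes>\<^bsub>R\<^esub> e j" for x y
  proof -
    have "(\<Oplus>\<^bsub>R\<^esub>i\<in>{..<n}. x \<otimes>\<^bsub>R\<^esub> e i) = (\<Oplus>\<^bsub>R\<^esub>i\<in>{..<n}. y \<otimes>\<^bsub>R\<^esub> e i)"
      by (rule finsum_cong') (use xy e1 in auto)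
    then show ?thesis using expand[OF xy(1)] expand[OF xy(2)] by simp
  qed
  have suppT: "supp x \<subseteq> T" if x: "x \<in> carrier R" "\<And>j. j < n \<Longrightarrow> supp (x \<otimes>\<^bsub>R\<^esub> e j) \<subseteq> T" for x
  proof -
    have f: "(\<lambda>i. x \<otimes>\<^bsub>R\<^esub> e i) \<in> {..<n} \<rightarrow> carrier RT" using x e1 RT_carrier by auto
    have "finsum RT (\<lambda>i. x \<otimes>\<^bsub>R\<^esub> e i) {..<n} \<in> carrier RT" by (rule TA.finsum_closed[OF f])
    then have "x \<in> carrier RT" using finsum_sub[OF T_subgroup _ f] expand[OF x(1)] by simp
    then show ?thesis using RT_carrier by blast
  qed
  let ?m = "\<lambda>l. mon \<one>\<^bsub>F\<^esub> (s l)"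
  have m: "?m l \<in> carrier R" if "l \<in> carrier L" for l using that by auto
  have mm: "?m l \<otimes>\<^bsub>R\<^esub> ?m k = ?m (l \<otimes>\<^bsub>L\<^esub> k)" if "l \<in> carrier L" "k \<in> carrier L" for l k
    using that by (simp add: mult_mon_mon)
  have m1: "?m \<one>\<^bsub>L\<^esub> = \<one>\<^bsub>R\<^esub>" by (simp add: one_eq)
  define w where "w f = (\<Oplus>\<^bsub>R\<^esub>i\<in>{..<n}. e i \<otimes>\<^bsub>R\<^esub> ?m (f i))" for f
  have wc: "w f \<in> carrier R" if "f \<in> {..<n} \<rightarrow> carrier L" for f
    unfolding w_def by (rule finsum_closed) (use that e1(1) in \<open>auto intro!: m_closed m\<close>)
  have we: "w f \<otimes>\<^bsub>R\<^esub> e j = e j \<otimes>\<^bsub>R\<^esub> ?m (f j)" if f: "f \<in> {..<n} \<rightarrow> carrier L" and j: "j < n" for f j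
  proof -
    have fc: "f i \<in> carrier L" if "i < n" for i using f that by auto
    have "w f \<otimes>\<^bsub>R\<^esub> e j = (\<Oplus>\<^bsub>R\<^esub>i\<in>{..<n}. e i \<otimes>\<^bsub>R\<^esub> ?m (f i) \<otimes>\<^bsub>R\<^esub> e j)"
      unfolding w_def by (rule finsum_ldistr) (use e1 m fc j in auto)
    also have "\<dots> = (\<Oplus>\<^bsub>R\<^esub>i\<in>{..<n}. if j = i then e i \<otimes>\<^bsub>R\<^esub> ?m (f i) else \<zero>\<^bsub>R\<^esub>)"
    proof (rule finsum_cong')
      fix i assume "i \<in> {..<n}"
      then have i: "i < n" by simp
      have "e i \<otimes>\<^bsub>R\<^esub> ?m (f i) \<otimes>\<^bsub>R\<^esub> e j = ?m (f i) \<otimes>\<^bsub>R\<^esub> (e i \<otimes>\<^bsub>R\<^esub> e j)"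
        using e1(1)[OF i] e1(1)[OF j] m[OF fc[OF i]] by (simp only: m_assoc CR.m_comm CR.m_lcomm m_closed)
      then show "e i \<otimes>\<^bsub>R\<^esub> ?m (f i) \<otimes>\<^bsub>R\<^esub> e j = (if j = i then e i \<otimes>\<^bsub>R\<^esub> ?m (f i) else \<zero>\<^bsub>R\<^esub>)"
        using e1[OF i] e2[OF i j] m[OF fc[OF i]] CR.m_comm[of "e i" "?m (f i)"] by auto
    qed (use e1 m fc in auto)
    also have "\<dots> = e j \<otimes>\<^bsub>R\<^esub> ?m (f j)"
      using add.finprod_singleton[of j "{..<n}" "\<lambda>i. e i \<otimes>\<^bsub>R\<^esub> ?m (f i)"] j e1 m fc by auto
    finally show ?thesis .
  qed
  have wmult: "w f \<otimes>\<^bsub>R\<^esub> w g = w h"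
    if f: "f \<in> {..<n} \<rightarrow> carrier L" and g: "g \<in> {..<n} \<rightarrow> carrier L" and h: "\<And>i. i < n \<Longrightarrow> h i = f i \<otimes>\<^bsub>L\<^esub> g i" for f g h
  proof (rule eqI)
    have hh: "h \<in> {..<n} \<rightarrow> carrier L" using f g h by (auto intro!: L.m_closed)
    show "w f \<otimes>\<^bsub>R\<^esub> w g \<in> carrier R" "w h \<in> carrier R" using wc f g hh by auto
    fix j assume j: "j < n"
    have fg: "f j \<in> carrier L" "g j \<in> carrier L" using f g j by auto
    have "w f \<otimes>\<^bsub>R\<^esub> w g \<otimes>\<^bsub>R\<^esub> e j = (w f \<otimes>\<^bsub>R\<^esub> e j) \<otimes>\<^bsub>R\<^esub> ?m (g j)"
      using we[OF g j] wc[OF f] wc[OF g] e1(1)[OF j] m[OF fg(2)] by (simp add: m_assoc)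
    also have "\<dots> = e j \<otimes>\<^bsub>R\<^esub> ?m (h j)"
      using we[OF f j] e1(1)[OF j] m fg mm[OF fg] h[OF j] by (simp add: m_assoc)
    also have "\<dots> = w h \<otimes>\<^bsub>R\<^esub> e j" using we[OF hh j] by simp
    finally show "w f \<otimes>\<^bsub>R\<^esub> w g \<otimes>\<^bsub>R\<^esub> e j = w h \<otimes>\<^bsub>R\<^esub> e j" .
  qed
  have w1: "w f = \<one>\<^bsub>R\<^esub>" if f: "\<And>i. i < n \<Longrightarrow> f i = \<one>\<^bsub>L\<^esub>" for f
  proof (rule eqI)
    have ff: "f \<in> {..<n} \<rightarrow> carrier L" using f by auto
    show "w f \<in> carrier R" using wc[OF ff] .
    fix j assume j: "j < n"
    show "w f \<otimes>\<^bsub>R\<^esub> e j = \<one>\<^bsub>R\<^esub> \<otimes>\<^bsub>R\<^esub> e j" using we[OF ff j] f[OF j] m1 e1[OF j] by simp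
  qed simp
  have waug: "augmentation F (w f) = \<one>\<^bsub>F\<^esub>" if f: "f \<in> {..<n} \<rightarrow> carrier L" for f
  proof -
    have "augmentation F (w f) = (\<Oplus>\<^bsub>F\<^esub>i\<in>{..<n}. augmentation F (e i \<otimes>\<^bsub>R\<^esub> ?m (f i)))"
      unfolding w_def by (rule aug_finsum) (use f e1(1) in \<open>auto intro!: m_closed m\<close>)
    also have "\<dots> = (\<Oplus>\<^bsub>F\<^esub>i\<in>{..<n}. augmentation F (e i))"
      by (rule F.finsum_cong') (use e1 m f in \<open>auto simp: aug_mult aug_mon Pi_def\<close>)
    also have "\<dots> = augmentation F (finsum R e {..<n})" by (rule aug_finsum[symmetric]) (use ec in auto)
    finally show ?thesis using sum1 aug_one by simp
  qed
  define iv where "iv f = (\<lambda>i. inv\<^bsub>L\<^esub> (f i))" for f :: "nat \<Rightarrow> 'l"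
  have ivc: "iv f \<in> {..<n} \<rightarrow> carrier L" if "f \<in> {..<n} \<rightarrow> carrier L" for f using that by (auto simp: iv_def)
  have winv: "w f \<otimes>\<^bsub>R\<^esub> w (iv f) = \<one>\<^bsub>R\<^esub>" "w (iv f) \<otimes>\<^bsub>R\<^esub> w f = \<one>\<^bsub>R\<^esub>" if f: "f \<in> {..<n} \<rightarrow> carrier L" for f
  proof -
    have fi: "f i \<in> carrier L" if "i < n" for i using f that by auto
    show "w f \<otimes>\<^bsub>R\<^esub> w (iv f) = \<one>\<^bsub>R\<^esub>"
      using wmult[OF f ivc[OF f], of "\<lambda>_. \<one>\<^bsub>L\<^esub>"] w1 fi by (simp add: iv_def)
    show "w (iv f) \<otimes>\<^bsub>R\<^esub> w f = \<one>\<^bsub>R\<^esub>"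
      using wmult[OF ivc[OF f] f, of "\<lambda>_. \<one>\<^bsub>L\<^esub>"] w1 fi by (simp add: iv_def)
  qed
  have wV: "w f \<in> carrier V" if f: "f \<in> {..<n} \<rightarrow> carrier L" for f
    by (rule V_I[OF wc[OF f] wc[OF ivc[OF f]] winv[OF f] waug[OF f]])
  have winvV: "inv\<^bsub>V\<^esub> (w (iv f)) = w f" if f: "f \<in> {..<n} \<rightarrow> carrier L" for f
    by (rule V.inv_equality) (use winv[OF f] wV[OF f] wV[OF ivc[OF f]] in simp_all)
  let ?G = "VT \<times>\<times> product_group {..<n} (\<lambda>_. L)"
  let ?\<Psi> = "\<lambda>(c, f). c \<otimes>\<^bsub>R\<^esub> w f"
  interpret PG: group "product_group {..<n} (\<lambda>_. L)" by (simp add: L.is_group)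
  have G: "group ?G" by (rule DirProd_group[OF TA.V_group PG.is_group])
  have pc: "f \<in> carrier (product_group {..<n} (\<lambda>_. L)) \<Longrightarrow> f \<in> {..<n} \<rightarrow> carrier L" for f by auto
  have VTV: "c \<in> carrier V" "supp c \<subseteq> T" "c \<in> carrier R" if "c \<in> carrier VT" for c
    using that VT_carrier V_R by auto
  have "?\<Psi> \<in> iso ?G V"
    unfolding iso_kernel_image[OF G V_group]
  proof (intro conjI)
    show "?\<Psi> \<in> hom ?G V"
    proof (rule homI)
      fix x assume "x \<in> carrier ?G"
      then obtain c f where x: "x = (c, f)" "c \<in> carrier VT" "f \<in> carrier (product_group {..<n} (\<lambda>_. L))" by auto
      show "?\<Psi> x \<in> carrier V" using V.m_closed[OF VTV(1)[OF x(2)] wV[OF pc[OF x(3)]]] x(1) by simp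
      fix y assume "y \<in> carrier ?G"
      then obtain d g where y: "y = (d, g)" "d \<in> carrier VT" "g \<in> carrier (product_group {..<n} (\<lambda>_. L))" by auto
      have "w (\<lambda>i\<in>{..<n}. f i \<otimes>\<^bsub>L\<^esub> g i) = w f \<otimes>\<^bsub>R\<^esub> w g"
        by (rule wmult[symmetric]) (use pc x y in auto)
      then have "?\<Psi> (x \<otimes>\<^bsub>?G\<^esub> y) = (c \<otimes>\<^bsub>R\<^esub> d) \<otimes>\<^bsub>R\<^esub> (w f \<otimes>\<^bsub>R\<^esub> w g)"
        using x y by (simp add: sub_ops)
      also have "\<dots> = (c \<otimes>\<^bsub>R\<^esub> w f) \<otimes>\<^bsub>R\<^esub> (d \<otimes>\<^bsub>R\<^esub> w g)"
        using VTV(3)[OF x(2)] VTV(3)[OF y(2)] wc[OF pc[OF x(3)]] wc[OF pc[OF y(3)]]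
        by (simp only: m_assoc CR.m_comm CR.m_lcomm m_closed)
      finally show "?\<Psi> (x \<otimes>\<^bsub>?G\<^esub> y) = ?\<Psi> x \<otimes>\<^bsub>V\<^esub> ?\<Psi> y" using x y by simp
    qed
    have "x = \<one>\<^bsub>?G\<^esub>" if x: "x \<in> carrier ?G" "?\<Psi> x = \<one>\<^bsub>V\<^esub>" for x
    proof -
      obtain c f where cf: "x = (c, f)" "c \<in> carrier VT" "f \<in> carrier (product_group {..<n} (\<lambda>_. L))" using x(1) by auto
      note f = pc[OF cf(3)] and c = VTV[OF cf(2)]
      have eq: "c \<otimes>\<^bsub>R\<^esub> w f = \<one>\<^bsub>R\<^esub>" using x(2) cf(1) by simp
      have f1: "f j = \<one>\<^bsub>L\<^esub>" if j: "j < n" for j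
      proof -
        have fj: "f j \<in> carrier L" using f j by auto
        have "e j = c \<otimes>\<^bsub>R\<^esub> w f \<otimes>\<^bsub>R\<^esub> e j" using eq e1[OF j] by simp
        also have "\<dots> = (c \<otimes>\<^bsub>R\<^esub> e j) \<otimes>\<^bsub>R\<^esub> ?m (f j)"
          using we[OF f j] c(3) wc[OF f] e1(1)[OF j] m[OF fj] by (simp add: m_assoc)
        finally have ej: "e j = (c \<otimes>\<^bsub>R\<^esub> e j) \<otimes>\<^bsub>R\<^esub> ?m (f j)" .
        obtain x where x: "x \<in> supp (e j)" using e1(3)[OF j] supp_empty by blast
        have ce: "c \<otimes>\<^bsub>R\<^esub> e j \<in> carrier R" using c(3) e1(1)[OF j] by simp
        have "x \<in> supp ((c \<otimes>\<^bsub>R\<^esub> e j) \<otimes>\<^bsub>R\<^esub> ?m (f j))" using x ej by simp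
        then obtain y where y: "y \<in> supp (c \<otimes>\<^bsub>R\<^esub> e j)" "x = y \<otimes>\<^bsub>A\<^esub> s (f j)"
          using subsetD[OF supp_mult[OF ce m[OF fj]]] supp_mon[of "\<one>\<^bsub>F\<^esub>" "s (f j)"] by force
        have yT: "y \<in> T" using y(1) supp_mult_T[OF c(3) e1(1)[OF j] c(2) e1(2)[OF j]] by blast
        have xT: "x \<in> T" using x e1(2)[OF j] by blast
        have "\<rho> x = \<rho> y \<otimes>\<^bsub>L\<^esub> f j" using y(2) yT fj s(2)[OF fj] by (simp add: T_def kernel_def)
        then show ?thesis using xT yT fj by (simp add: T_def kernel_def)
      qed
      then have "w f = \<one>\<^bsub>R\<^esub>" by (rule w1)
      then have "c = \<one>\<^bsub>R\<^esub>" using eq c(3) by simp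
      moreover have "f = \<one>\<^bsub>product_group {..<n} (\<lambda>_. L)\<^esub>"
        using cf(3) f1 by (auto simp: PiE_def extensional_def fun_eq_iff)
      ultimately show ?thesis using cf(1) by (simp add: sub_ops)
    qed
    moreover have "?\<Psi> \<one>\<^bsub>?G\<^esub> = \<one>\<^bsub>V\<^esub>" using w1[of "\<lambda>i\<in>{..<n}. \<one>\<^bsub>L\<^esub>"] by (simp add: sub_ops)
    moreover have "\<one>\<^bsub>?G\<^esub> \<in> carrier ?G" using G by (rule group.is_monoid[THEN monoid.one_closed])
    ultimately show "kernel ?G V ?\<Psi> = {\<one>\<^bsub>?G\<^esub>}" unfolding kernel_def by blast
    show "?\<Psi> ` carrier ?G = carrier V"
    proof
      show "?\<Psi> ` carrier ?G \<subseteq> carrier V"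
        using hom_in_carrier[OF \<open>?\<Psi> \<in> hom ?G V\<close>] by blast
      show "carrier V \<subseteq> ?\<Psi> ` carrier ?G"
      proof
        fix u assume u: "u \<in> carrier V"
        let ?v = "inv\<^bsub>V\<^esub> u"
        have v: "?v \<in> carrier V" using u by simp
        have uv: "u \<in> carrier R" "?v \<in> carrier R" "u \<otimes>\<^bsub>R\<^esub> ?v = \<one>\<^bsub>R\<^esub>"
          using u v V_R V.r_inv[OF u] by auto
        have "\<exists>l\<in>carrier L. \<rho> ` supp (u \<otimes>\<^bsub>R\<^esub> e j) \<subseteq> {l} \<and> \<rho> ` supp (?v \<otimes>\<^bsub>R\<^esub> e j) \<subseteq> {inv\<^bsub>L\<^esub> l}"
          if j: "j < n" for j
          by (rule unit_component_homogeneous[OF e1(1)[OF j] e1(2)[OF j] e1(4)[OF j] e1(3)[OF j] e3[OF j] uv])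
        then obtain l where l: "\<And>j. j < n \<Longrightarrow> l j \<in> carrier L \<and> \<rho> ` supp (u \<otimes>\<^bsub>R\<^esub> e j) \<subseteq> {l j} \<and>
          \<rho> ` supp (?v \<otimes>\<^bsub>R\<^esub> e j) \<subseteq> {inv\<^bsub>L\<^esub> (l j)}" by metis
        define f where "f = restrict l {..<n}"
        have fP: "f \<in> carrier (product_group {..<n} (\<lambda>_. L))" using l by (auto simp: f_def)
        note f = pc[OF fP]
        \<comment> \<open>The factor \<open>w g\<close> moves components of degree inverse to
          \<open>g\<close> into degree \<open>1\<close>; this serves \<open>u\<close> and its
          inverse alike.\<close>
        have shift: "supp (x \<otimes>\<^bsub>R\<^esub> w g) \<subseteq> T"
          if x: "x \<in> carrier R" and g: "g \<in> {..<n} \<rightarrow> carrier L"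
            and deg: "\<And>j. j < n \<Longrightarrow> \<rho> ` supp (x \<otimes>\<^bsub>R\<^esub> e j) \<subseteq> {inv\<^bsub>L\<^esub> (g j)}" for x g
        proof (rule suppT)
          show "x \<otimes>\<^bsub>R\<^esub> w g \<in> carrier R" using x wc[OF g] by simp
          fix j assume j: "j < n"
          have gj: "g j \<in> carrier L" using g j by auto
          have xe: "x \<otimes>\<^bsub>R\<^esub> e j \<in> carrier R" using x e1(1)[OF j] by simp
          have eq: "x \<otimes>\<^bsub>R\<^esub> w g \<otimes>\<^bsub>R\<^esub> e j = (x \<otimes>\<^bsub>R\<^esub> e j) \<otimes>\<^bsub>R\<^esub> ?m (g j)"
            using we[OF g j] x wc[OF g] e1(1)[OF j] m[OF gj] by (simp add: m_assoc)
          show "supp (x \<otimes>\<^bsub>R\<^esub> w g \<otimes>\<^bsub>R\<^esub> e j) \<subseteq> T"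
          proof
            fix z assume "z \<in> supp (x \<otimes>\<^bsub>R\<^esub> w g \<otimes>\<^bsub>R\<^esub> e j)"
            then have "z \<in> supp ((x \<otimes>\<^bsub>R\<^esub> e j) \<otimes>\<^bsub>R\<^esub> ?m (g j))" using eq by simp
            then obtain y where y: "y \<in> supp (x \<otimes>\<^bsub>R\<^esub> e j)" "z = y \<otimes>\<^bsub>A\<^esub> s (g j)"
              using subsetD[OF supp_mult[OF xe m[OF gj]]] supp_mon[of "\<one>\<^bsub>F\<^esub>" "s (g j)"] by force
            have yA: "y \<in> carrier A" using y(1) supp_carrier[OF xe] by blast
            have "\<rho> y = inv\<^bsub>L\<^esub> (g j)" using deg[OF j] y(1) by blast
            then show "z \<in> T" using y(2) yA gj s(2)[OF gj] by (simp add: T_def kernel_def)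
          qed
        qed
        define c where "c = u \<otimes>\<^bsub>R\<^esub> w (iv f)"
        have cV: "c \<in> carrier V" using V.m_closed[OF u wV[OF ivc[OF f]]] by (simp add: c_def)
        have ci: "inv\<^bsub>V\<^esub> c = ?v \<otimes>\<^bsub>R\<^esub> w f"
          using VC.inv_mult[OF u wV[OF ivc[OF f]]] winvV[OF f] by (simp add: c_def)
        have "supp c \<subseteq> T" unfolding c_def
          by (rule shift[OF uv(1) ivc[OF f]]) (use l in \<open>auto simp: iv_def f_def\<close>)
        moreover have "supp (inv\<^bsub>V\<^esub> c) \<subseteq> T" unfolding ci
          by (rule shift[OF uv(2) f]) (use l in \<open>auto simp: f_def\<close>)
        ultimately have cVT: "c \<in> carrier VT" using cV VT_carrier by simp
        have "c \<otimes>\<^bsub>R\<^esub> w f = u" unfolding c_def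
          using winv(2)[OF f] uv(1) wc[OF f] wc[OF ivc[OF f]] by (simp add: m_assoc)
        then have "u = ?\<Psi> (c, f)" by simp
        moreover have "(c, f) \<in> carrier ?G" using cVT fP by simp
        ultimately show "u \<in> ?\<Psi> ` carrier ?G" by blast
      qed
    qed
  qed
  then show ?thesis unfolding w_def .
qed

end

section \<open>Isomorphic groups have isomorphic group algebras\<close>

context ga_pair
begin

lemma ga_map_inverse:
  assumes \<phi>: "\<phi> \<in> carrier G \<rightarrow> carrier H" and \<psi>: "\<And>g. g \<in> carrier G \<Longrightarrow> \<psi> (\<phi> g) = g"
    and a: "a \<in> carrier R"
  shows "ga_map F \<psi> (ga_map F \<phi> a) = a"
  using a
proof (induction a rule: induct)
  case (mon c g) then show ?case using \<psi> by (simp add: ga_map_mon)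
next
  case (add a b)
  have c: "ga_map F \<phi> a \<in> carrier H.R" "ga_map F \<phi> b \<in> carrier H.R" using add \<phi> by auto
  have "ga_map F \<psi> (ga_map F \<phi> (a \<oplus>\<^bsub>R\<^esub> b)) = ga_map F \<psi> (ga_map F \<phi> a \<oplus>\<^bsub>H.R\<^esub> ga_map F \<phi> b)"
    using ga_map_add'[OF add(1,2), of \<phi>] by simp
  also have "\<dots> = (\<lambda>y. ga_map F \<psi> (ga_map F \<phi> a) y \<oplus>\<^bsub>F\<^esub> ga_map F \<psi> (ga_map F \<phi> b) y)" by (rule H.ga_map_add[OF c])
  also have "\<dots> = a \<oplus>\<^bsub>R\<^esub> b" unfolding add.IH add_eq ..
  finally show ?case .
qed

lemma ga_map_iso:
  assumes \<phi>: "\<phi> \<in> iso G H"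
  shows "ga_map F \<phi> \<in> ring_iso R H.R" and "ga_map F \<phi> \<in> iso V H.V"
proof -
  have hom: "\<phi> \<in> hom G H" and bij: "bij_betw \<phi> (carrier G) (carrier H)" using \<phi> by (auto simp: iso_def)
  have \<phi>': "\<phi> \<in> carrier G \<rightarrow> carrier H" using hom by (simp add: hom_def)
  let ?\<psi> = "inv_into (carrier G) \<phi>"
  have \<psi>: "?\<psi> \<in> hom H G" using G.iso_set_sym[OF \<phi>] by (simp add: iso_def)
  then have \<psi>': "?\<psi> \<in> carrier H \<rightarrow> carrier G" by (simp add: hom_def)
  have l: "?\<psi> (\<phi> g) = g" if "g \<in> carrier G" for g using bij_betw_inv_into_left[OF bij that] .
  have r: "\<phi> (?\<psi> h) = h" if "h \<in> carrier H" for h using bij_betw_inv_into_right[OF bij that] .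
  interpret HG: ga_pair F H G by unfold_locales
  have L: "ga_map F ?\<psi> (ga_map F \<phi> a) = a" if "a \<in> carrier R" for a by (rule ga_map_inverse[OF \<phi>' l that])
  have RR: "ga_map F \<phi> (ga_map F ?\<psi> b) = b" if "b \<in> carrier H.R" for b by (rule HG.ga_map_inverse[OF \<psi>' r that])
  have "bij_betw (ga_map F \<phi>) (carrier R) (carrier H.R)"
    by (rule bij_betw_byWitness[of _ "ga_map F ?\<psi>"]) (use L RR ga_map_closed \<phi>' HG.ga_map_closed \<psi>' in auto)
  then show "ga_map F \<phi> \<in> ring_iso R H.R" using ga_map_hom[OF hom] by (simp add: ring_iso_def)
  have V1: "ga_map F \<phi> ` carrier V \<subseteq> carrier H.V" using hom_in_carrier[OF ga_map_V_hom[OF hom]] by blast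
  have V2: "ga_map F ?\<psi> ` carrier H.V \<subseteq> carrier V" using hom_in_carrier[OF HG.ga_map_V_hom[OF \<psi>]] by blast
  have "bij_betw (ga_map F \<phi>) (carrier V) (carrier H.V)"
    by (rule bij_betw_byWitness[of _ "ga_map F ?\<psi>"]) (use L RR V_R H.V_R V1 V2 in auto)
  then show "ga_map F \<phi> \<in> iso V H.V" using ga_map_V_hom[OF hom] by (simp add: iso_def)
qed

end

section \<open>The torsion structure of the group\<close>

context group
begin

lemma left_comm_in_derived:
  assumes "x \<in> carrier G" "y \<in> carrier G" shows "left_comm G x y \<in> derived G (carrier G)"
proof -
  have "left_comm G x y = inv x \<otimes> inv y \<otimes> inv (inv x) \<otimes> inv (inv y)"
    using assms by (simp add: left_comm_def)
  then have "left_comm G x y \<in> derived_set G (carrier G)" using assms by (metis (no_types, lifting) UN_I inv_closed singletonI)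
  then show ?thesis unfolding derived_def by (rule generate.incl)
qed

lemma quotient_comm_group:
  assumes N: "N \<lhd> G" and d: "derived G (carrier G) \<subseteq> N" shows "comm_group (G Mod N)"
proof -
  interpret N: normal N G by fact
  interpret Q: group "G Mod N" by (rule N.factorgroup_is_group)
  show ?thesis
  proof (rule Q.group_comm_groupI)
    fix C E assume "C \<in> carrier (G Mod N)" "E \<in> carrier (G Mod N)"
    then obtain x y where xy: "x \<in> carrier G" "C = N #> x" "y \<in> carrier G" "E = N #> y"
      by (auto simp: carrier_FactGroup)
    have "(x \<otimes> y) \<otimes> inv (y \<otimes> x) = left_comm G (inv x) (inv y)"
      using xy by (simp add: left_comm_def inv_mult_group m_assoc)
    then have "(x \<otimes> y) \<otimes> inv (y \<otimes> x) \<in> N"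
      using left_comm_in_derived[of "inv x" "inv y"] xy d by auto
    then have "x \<otimes> y \<in> N #> (y \<otimes> x)"
      using xy N.rcos_module_rev[OF is_group, of "y \<otimes> x" "x \<otimes> y"] by simp
    then have "N #> (x \<otimes> y) = N #> (y \<otimes> x)"
      using xy repr_independence[of "x \<otimes> y" N "y \<otimes> x"] N.subgroup_axioms by simp
    then show "C \<otimes>\<^bsub>G Mod N\<^esub> E = E \<otimes>\<^bsub>G Mod N\<^esub> C" using xy by (simp add: N.rcos_sum)
  qed
qed

lemma pow_coprime_decomp:
  assumes x: "x \<in> carrier G" "x [^] (a * b :: nat) = \<one>" and ab: "coprime a b"
  shows "\<exists>y\<in>carrier G. \<exists>z\<in>carrier G. x = y \<otimes> z \<and> y [^] a = \<one> \<and> z [^] b = \<one>"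
proof -
  obtain u v where uv: "u * int a + v * int b = 1" using bezout_int[of "int a" "int b"] ab by auto
  let ?y = "x [^] (v * int b)" and ?z = "x [^] (u * int a)"
  have o: "x [^] (int (a * b) * i) = \<one>" for i
    using x by (simp add: int_pow_pow[symmetric] int_pow_int del: of_nat_mult)
  have "x = x [^] (v * int b + u * int a)" using uv x by (simp add: add.commute)
  then have "x = ?y \<otimes> ?z" using x by (simp only: int_pow_mult)
  moreover have "?y [^] a = \<one>" "?z [^] b = \<one>"
  proof -
    have "?y [^] a = x [^] (int (a * b) * v)"
      using x int_pow_pow[of x "v * int b" "int a"] by (simp add: int_pow_int ac_simps)
    then show "?y [^] a = \<one>" using o by simp
    have "?z [^] b = x [^] (int (a * b) * u)"
      using x int_pow_pow[of x "u * int a" "int b"] by (simp add: int_pow_int ac_simps)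
    then show "?z [^] b = \<one>" using o by simp
  qed
  ultimately show ?thesis using x by blast
qed

text \<open>Central generators of finite order prime to \<open>r\<close> generate a group all of
  whose elements have this property. The conclusion carries centrality along, as it is needed to
  take powers of products.\<close>

lemma generate_central_coprime:
  assumes B: "B \<subseteq> carrier G"
    and c: "\<And>x g. x \<in> B \<Longrightarrow> g \<in> carrier G \<Longrightarrow> x \<otimes> g = g \<otimes> x"
    and o: "\<And>x. x \<in> B \<Longrightarrow> \<exists>m>0. coprime m r \<and> x [^] (m::nat) = \<one>"
    and y: "y \<in> generate G B"
  shows "(\<forall>g\<in>carrier G. y \<otimes> g = g \<otimes> y) \<and> (\<exists>m>0. coprime m r \<and> y [^] (m::nat) = \<one>)"
  using y
proof (induction y rule: generate.induct)
  case one
  show ?case by (auto intro!: exI[of _ "1::nat"])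
next
  case (incl h) then show ?case using c o by blast
next
  case (inv h)
  have hG: "h \<in> carrier G" using inv B by blast
  obtain m :: nat where m: "m > 0" "coprime m r" "h [^] m = \<one>" using o inv by blast
  have "inv h \<otimes> g = g \<otimes> inv h" if "g \<in> carrier G" for g
    using c[OF inv that] hG that by (metis inv_closed inv_solve_left inv_solve_right m_assoc m_closed)
  moreover have "inv h [^] m = \<one>" using m hG by (simp add: nat_pow_inv)
  ultimately show ?case using m by blast
next
  case (eng a b)
  have G: "a \<in> carrier G" "b \<in> carrier G" using eng generate_in_carrier[OF B] by auto
  obtain m n :: nat where m: "m > 0" "coprime m r" "a [^] m = \<one>" and n: "n > 0" "coprime n r" "b [^] n = \<one>"
    using eng.IH by blast
  have ca: "a \<otimes> g = g \<otimes> a" and cb: "b \<otimes> g = g \<otimes> b" if "g \<in> carrier G" for g using eng.IH that by auto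
  have "a \<otimes> b \<otimes> g = g \<otimes> (a \<otimes> b)" if "g \<in> carrier G" for g
    using ca[OF that] cb[OF that] G that by (metis m_assoc)
  moreover have "(a \<otimes> b) [^] (m * n) = \<one>"
  proof -
    have "(a \<otimes> b) [^] (m * n) = a [^] (m * n) \<otimes> b [^] (m * n)" using ca[OF G(2)] G by (rule pow_mult_distrib)
    moreover have "a [^] (m * n) = \<one>" using m(3) G by (simp flip: nat_pow_pow)
    moreover have "b [^] (m * n) = \<one>" using n(3) nat_pow_pow[OF G(2), of n m] by (simp add: mult.commute)
    ultimately show ?thesis by simp
  qed
  moreover have "coprime (m * n) r" "m * n > 0" using m n by auto
  ultimately show ?case by blast
qed

end

text \<open>The situation of the theorem on the side of the group, with the Engel condition
  transferred from the units to \<open>G\<close>.\<close>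

locale engel_setting = group G for G :: "('g, 'b) monoid_scheme" (structure) +
  fixes p :: nat and Syl :: "nat \<Rightarrow> 'g set" and P D :: "'g set"
  assumes prime: "Factorial_Ring.prime p"
    and derived_lf: "locally_finite_group (G\<lparr>carrier := derived G (carrier G)\<rparr>)"
    and derived_p: "primary_group p (G\<lparr>carrier := derived G (carrier G)\<rparr>)"
    and Syl: "\<And>q. Factorial_Ring.prime q \<Longrightarrow> sylow_subgroup q G (Syl q)"
    and P: "P = Syl p" and P_normal: "P \<lhd> G"
    and D: "D = generate G (\<Union>q\<in>{q. Factorial_Ring.prime q \<and> q \<noteq> p}. Syl q)"
    and engel: "engel_group G"
begin

sublocale P: normal P G by (rule P_normal)

lemma P_eq: "P = {x \<in> carrier G. \<exists>n::nat. x [^] (p ^ n) = \<one>}"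
  using normal_sylow_eq[OF prime] Syl[OF prime] P P_normal by simp

lemma derived_sub: "subgroup (derived G (carrier G)) G"
  by (rule derived_is_subgroup) simp

lemma derived_subset_P: "derived G (carrier G) \<subseteq> P"
proof
  fix x assume x: "x \<in> derived G (carrier G)"
  then have "\<exists>n::nat. x [^] (p ^ n) = \<one>"
    using derived_p primary_subgroup_iff[OF prime derived_sub] by blast
  then show "x \<in> P" using x subgroup.mem_carrier[OF derived_sub] unfolding P_eq by blast
qed

lemma coprime_central:
  assumes "h \<in> carrier G" "h [^] (m::nat) = \<one>" "coprime m p" "g \<in> carrier G"
  shows "g \<otimes> h = h \<otimes> g"
proof (rule engel_coprime_central[OF engel _ assms])
  fix a b assume ab: "a \<in> carrier G" "b \<in> carrier G"
  then have "left_comm G a b \<in> P" using left_comm_in_derived derived_subset_P by blast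
  then show "\<exists>n::nat. left_comm G a b [^] (p ^ n) = \<one>" unfolding P_eq by blast
qed

lemma Syl_subgroup: "Factorial_Ring.prime q \<Longrightarrow> subgroup (Syl q) G"
  using Syl by (simp add: sylow_subgroup_def)

lemma Syl_elem:
  assumes "Factorial_Ring.prime q" "x \<in> Syl q" shows "x \<in> carrier G" "\<exists>n::nat. x [^] (q ^ n) = \<one>"
  using assms Syl[OF assms(1)] primary_subgroup_iff[OF assms(1) Syl_subgroup[OF assms(1)]]
    subgroup.mem_carrier[OF Syl_subgroup[OF assms(1)]] by (auto simp: sylow_subgroup_def)

lemma Syl_commutes:
  assumes "Factorial_Ring.prime q" "q \<noteq> p" "x \<in> Syl q" "g \<in> carrier G" shows "x \<otimes> g = g \<otimes> x"
proof -
  obtain n :: nat where "x [^] (q ^ n) = \<one>" using Syl_elem[OF assms(1,3)] by blast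
  moreover have "coprime (q ^ n) p" using assms(1,2) prime by (simp add: primes_coprime)
  ultimately show ?thesis using coprime_central Syl_elem(1)[OF assms(1,3)] assms(4) by metis
qed

lemma Syl_normal: "Factorial_Ring.prime q \<Longrightarrow> q \<noteq> p \<Longrightarrow> Syl q \<lhd> G"
proof (rule normal_invI[OF Syl_subgroup])
  fix x h assume q: "Factorial_Ring.prime q" "q \<noteq> p" and xh: "x \<in> carrier G" "h \<in> Syl q"
  have "x \<otimes> h \<otimes> inv x = h \<otimes> x \<otimes> inv x" using Syl_commutes[OF q xh(2,1)] by simp
  then show "x \<otimes> h \<otimes> inv x \<in> Syl q" using xh Syl_elem[OF q(1) xh(2)] by (simp add: m_assoc)
qed

lemma Syl_eq:
  assumes "Factorial_Ring.prime q" "q \<noteq> p"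
  shows "Syl q = {x \<in> carrier G. \<exists>n::nat. x [^] (q ^ n) = \<one>}"
  by (rule normal_sylow_eq[OF assms(1) Syl[OF assms(1)] Syl_normal[OF assms]])

lemma Syl_central: "Factorial_Ring.prime q \<Longrightarrow> q \<noteq> p \<Longrightarrow> central_subgroup (Syl q) G"
  unfolding central_subgroup_def using Syl_subgroup Syl_commutes by blast

abbreviation Qs where "Qs \<equiv> {q. Factorial_Ring.prime q \<and> q \<noteq> p}"

lemma Union_Syl_carrier: "(\<Union>q\<in>I. Syl q) \<subseteq> carrier G" if "I \<subseteq> Qs" for I
  using that Syl_elem(1) by blast

text \<open>The parameter \<open>r\<close> is \<open>p\<close> when all primes of \<open>D\<close>
  are involved, and it is one of these primes when independence of the Sylow subgroups is
  concerned.\<close>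

lemma generate_Syl:
  assumes I: "I \<subseteq> Qs" and r: "\<And>q. q \<in> I \<Longrightarrow> coprime q r" and y: "y \<in> generate G (\<Union>q\<in>I. Syl q)"
  shows "(\<forall>g\<in>carrier G. y \<otimes> g = g \<otimes> y) \<and> (\<exists>m>0. coprime m r \<and> y [^] (m::nat) = \<one>)"
proof (rule generate_central_coprime[OF Union_Syl_carrier[OF I] _ _ y])
  fix x assume "x \<in> (\<Union>q\<in>I. Syl q)"
  then obtain q where q: "q \<in> I" "x \<in> Syl q" by blast
  then have qp: "Factorial_Ring.prime q" "q \<noteq> p" using I by auto
  show "x \<otimes> g = g \<otimes> x" if "g \<in> carrier G" for g using Syl_commutes[OF qp q(2) that] .
  obtain n :: nat where n: "x [^] (q ^ n) = \<one>" using Syl_elem[OF qp(1) q(2)] by blast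
  moreover have "q ^ n > 0" using qp(1) prime_gt_0_nat by simp
  moreover have "coprime (q ^ n) r" using r[OF q(1)] by simp
  ultimately show "\<exists>m>0. coprime m r \<and> x [^] (m::nat) = \<one>" by blast
qed

text \<open>Split \<open>m\<close> into a power of a prime \<open>q\<close> and a cofactor prime
  to \<open>q\<close>, and \<open>y\<close> accordingly into powers of itself.\<close>

lemma coprime_in_D:
  assumes "y \<in> carrier G" "y [^] (m::nat) = \<one>" "m > 0" "coprime m p" shows "y \<in> D"
  using assms
proof (induction m arbitrary: y rule: less_induct)
  case (less m)
  show ?case
  proof (cases "m = 1")
    case True then show ?thesis using less.prems unfolding D by (simp add: generate.one)
  next
    case False
    then obtain q where q: "Factorial_Ring.prime q" "q dvd m" using prime_factor_nat by blast
    have qp: "q \<noteq> p"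
    proof
      assume "q = p"
      then have "p dvd 1" using q(2) less.prems(4) by (metis coprime_common_divisor dvd_refl)
      then show False using prime by auto
    qed
    obtain k m' where m: "m = q ^ k * m'" "\<not> q dvd m'"
      using multiplicity_decompose'[of m q] less.prems(3) q(1) by (metis not_prime_unit bot_nat_0.not_eq_extremum)
    have cop: "coprime (q ^ k) m'" using q(1) m(2) by (simp add: prime_imp_coprime)
    have k: "k \<noteq> 0" using m q(2) by (metis mult_1 power_0)
    obtain y1 y2 where y: "y1 \<in> carrier G" "y2 \<in> carrier G" "y = y1 \<otimes> y2" "y1 [^] (q ^ k) = \<one>" "y2 [^] m' = \<one>"
      using pow_coprime_decomp[OF less.prems(1) _ cop] less.prems(2) m(1) by auto
    have "y1 \<in> Syl q" using y(1,4) unfolding Syl_eq[OF q(1) qp] by blast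
    then have "y1 \<in> D" unfolding D using q(1) qp by (auto intro!: generate.incl)
    moreover have "y2 \<in> D"
    proof (rule less.IH[of m'])
      have "q ^ k > 1" using q(1) k prime_gt_1_nat by (intro one_less_power) auto
      moreover have "m' > 0" using m(1) less.prems(3) by (cases m') auto
      ultimately show "m' < m" "m' > 0" using m(1) by auto
      show "coprime m' p" using less.prems(4) m(1) by simp
    qed (use y in auto)
    ultimately show ?thesis unfolding D y(3) by (rule generate.eng)
  qed
qed

lemma D_props:
  assumes "y \<in> D" shows "y \<in> carrier G" "\<And>g. g \<in> carrier G \<Longrightarrow> y \<otimes> g = g \<otimes> y"
    "\<exists>m>0. coprime m p \<and> y [^] (m::nat) = \<one>"
proof -
  have r: "\<And>q. q \<in> Qs \<Longrightarrow> coprime q p" using prime by (simp add: primes_coprime)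
  show "y \<in> carrier G" using assms generate_in_carrier[OF Union_Syl_carrier] unfolding D by blast
  show "\<And>g. g \<in> carrier G \<Longrightarrow> y \<otimes> g = g \<otimes> y" "\<exists>m>0. coprime m p \<and> y [^] (m::nat) = \<one>"
    using generate_Syl[of Qs p y] assms r unfolding D by auto
qed

lemma D_subgroup: "subgroup D G"
  unfolding D by (rule generate_is_subgroup) (rule Union_Syl_carrier, simp)

lemma P_D_trivial: "x \<in> P \<Longrightarrow> x \<in> D \<Longrightarrow> x = \<one>"
proof -
  assume x: "x \<in> P" "x \<in> D"
  obtain n :: nat where n: "x [^] (p ^ n) = \<one>" using x(1) unfolding P_eq by blast
  obtain m :: nat where m: "coprime m p" "x [^] m = \<one>" using D_props(3)[OF x(2)] by blast
  have "coprime m (p ^ n)" using m(1) by simp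
  then show "x = \<one>" using pow_coprime_eq_one[OF D_props(1)[OF x(2)] m(2) n] by blast
qed

lemma torsion_iff: "x \<in> torsion_part G \<longleftrightarrow> x \<in> carrier G \<and> (\<exists>n>0. x [^] (n::nat) = \<one>)"
proof -
  have "ord x \<noteq> 0 \<longleftrightarrow> (\<exists>n>0. x [^] (n::nat) = \<one>)" if "x \<in> carrier G"
    using ord_eq_0[OF that] by auto
  then show ?thesis by (auto simp: torsion_part_def)
qed

lemma torsion_decomp: "x \<in> torsion_part G \<longleftrightarrow> (\<exists>y\<in>P. \<exists>d\<in>D. x = y \<otimes> d)"
proof
  assume "x \<in> torsion_part G"
  then obtain n :: nat where n: "x \<in> carrier G" "n > 0" "x [^] n = \<one>" unfolding torsion_iff by blast
  obtain k m where m: "n = p ^ k * m" "\<not> p dvd m"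
    using multiplicity_decompose'[of n p] n(2) prime by (metis not_prime_unit bot_nat_0.not_eq_extremum)
  have "coprime p m" using prime_imp_coprime[OF prime m(2)] .
  then have cop: "coprime (p ^ k) m" "coprime m p" by (simp_all add: coprime_commute)
  obtain y d where y: "y \<in> carrier G" "d \<in> carrier G" "x = y \<otimes> d" "y [^] (p ^ k) = \<one>" "d [^] m = \<one>"
    using pow_coprime_decomp[OF n(1) _ cop(1)] n(3) m(1) by auto
  have "m > 0" using m(1) n(2) by (cases m) auto
  then have "d \<in> D" using coprime_in_D y cop(2) by blast
  moreover have "y \<in> P" unfolding P_eq using y by blast
  ultimately show "\<exists>y\<in>P. \<exists>d\<in>D. x = y \<otimes> d" using y(3) by blast
next
  assume "\<exists>y\<in>P. \<exists>d\<in>D. x = y \<otimes> d"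
  then obtain y d where y: "y \<in> P" "d \<in> D" "x = y \<otimes> d" by blast
  obtain n :: nat where n: "y \<in> carrier G" "y [^] (p ^ n) = \<one>" using y(1) unfolding P_eq by blast
  obtain m :: nat where m: "m > 0" "d [^] m = \<one>" using D_props(3)[OF y(2)] by blast
  note d = D_props(1,2)[OF y(2)]
  have "x [^] (p ^ n * m) = y [^] (p ^ n * m) \<otimes> d [^] (p ^ n * m)"
    unfolding y(3) by (rule pow_mult_distrib) (use d n in auto)
  also have "y [^] (p ^ n * m) = \<one>" using n by (simp flip: nat_pow_pow)
  also have "d [^] (p ^ n * m) = \<one>" using m nat_pow_pow[OF d(1), of m "p ^ n"] by (simp add: mult.commute)
  finally have "x [^] (p ^ n * m) = \<one>" by simp
  moreover have "p ^ n * m > 0" using m prime prime_gt_0_nat by simp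
  ultimately show "x \<in> torsion_part G" unfolding torsion_iff using n d y(3) by blast
qed

lemma PD_hom: "(\<lambda>(x, d). x \<otimes> d) \<in> hom (G\<lparr>carrier := P\<rparr> \<times>\<times> G\<lparr>carrier := D\<rparr>) G"
proof (rule homI)
  fix a assume "a \<in> carrier (G\<lparr>carrier := P\<rparr> \<times>\<times> G\<lparr>carrier := D\<rparr>)"
  then obtain x d where a: "a = (x, d)" "x \<in> P" "d \<in> D" by auto
  have xd: "x \<in> carrier G" "d \<in> carrier G" using a P.mem_carrier D_props(1) by auto
  then show "(case a of (x, d) \<Rightarrow> x \<otimes> d) \<in> carrier G" using a by simp
  fix b assume "b \<in> carrier (G\<lparr>carrier := P\<rparr> \<times>\<times> G\<lparr>carrier := D\<rparr>)"
  then obtain y e where b: "b = (y, e)" "y \<in> P" "e \<in> D" by auto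
  have ye: "y \<in> carrier G" "e \<in> carrier G" using b P.mem_carrier D_props(1) by auto
  have "(x \<otimes> y) \<otimes> (d \<otimes> e) = x \<otimes> (y \<otimes> d) \<otimes> e" using xd ye by (simp add: m_assoc)
  also have "y \<otimes> d = d \<otimes> y" using D_props(2)[OF a(3) ye(1)] by simp
  also have "x \<otimes> (d \<otimes> y) \<otimes> e = (x \<otimes> d) \<otimes> (y \<otimes> e)" using xd ye by (simp add: m_assoc)
  finally show "(case a \<otimes>\<^bsub>G\<lparr>carrier := P\<rparr> \<times>\<times> G\<lparr>carrier := D\<rparr>\<^esub> b of (x, d) \<Rightarrow> x \<otimes> d) =
    (case a of (x, d) \<Rightarrow> x \<otimes> d) \<otimes> (case b of (x, d) \<Rightarrow> x \<otimes> d)" using a b by simp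
qed

lemma PD_group: "group (G\<lparr>carrier := P\<rparr> \<times>\<times> G\<lparr>carrier := D\<rparr>)"
  by (rule DirProd_group) (use subgroup_imp_group P.subgroup_axioms D_subgroup in auto)

lemma torsion_image: "(\<lambda>(x, d). x \<otimes> d) ` carrier (G\<lparr>carrier := P\<rparr> \<times>\<times> G\<lparr>carrier := D\<rparr>) = torsion_part G"
  using torsion_decomp by (force simp: image_iff)

lemma torsion_subgroup: "subgroup (torsion_part G) G"
proof -
  interpret h: group_hom "G\<lparr>carrier := P\<rparr> \<times>\<times> G\<lparr>carrier := D\<rparr>" G "\<lambda>(x, d). x \<otimes> d"
    using PD_group is_group PD_hom by (simp add: group_hom_def group_hom_axioms_def)
  show ?thesis using h.img_is_subgroup unfolding torsion_image .
qed

lemma torsion_iso: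
  "(\<lambda>(x, d). x \<otimes> d) \<in> iso (G\<lparr>carrier := P\<rparr> \<times>\<times> G\<lparr>carrier := D\<rparr>) (G\<lparr>carrier := torsion_part G\<rparr>)"
proof -
  have "inj_on (\<lambda>(x, d). x \<otimes> d) (carrier (G\<lparr>carrier := P\<rparr> \<times>\<times> G\<lparr>carrier := D\<rparr>))"
  proof (rule inj_onI, clarsimp)
    fix x d y e assume h: "x \<in> P" "d \<in> D" "y \<in> P" "e \<in> D" "x \<otimes> d = y \<otimes> e"
    have G: "x \<in> carrier G" "y \<in> carrier G" "d \<in> carrier G" "e \<in> carrier G"
      using h P.mem_carrier D_props(1) by auto
    have "inv y \<otimes> x = inv y \<otimes> (x \<otimes> d) \<otimes> inv d" using G by (simp add: m_assoc)
    also have "\<dots> = e \<otimes> inv d" unfolding h(5) using G by (simp add: m_assoc mult_cancels flip: m_assoc[of e])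
    finally have eq: "inv y \<otimes> x = e \<otimes> inv d" .
    have "inv y \<otimes> x \<in> P" using h by (simp add: P.m_closed P.m_inv_closed)
    moreover have "e \<otimes> inv d \<in> D" using h D_subgroup by (simp add: subgroup.m_closed subgroup.m_inv_closed)
    ultimately have one: "inv y \<otimes> x = \<one>" "e \<otimes> inv d = \<one>" using eq P_D_trivial by auto
    have "x = y \<otimes> (inv y \<otimes> x)" using G by (simp add: mult_cancels)
    then have "x = y" using one G by simp
    moreover have "e = (e \<otimes> inv d) \<otimes> d" using G by (simp add: m_assoc)
    then have "d = e" using one G by simp
    ultimately show "x = y \<and> d = e" by simp
  qed
  moreover have "(\<lambda>(x, d). x \<otimes> d) \<in> hom (G\<lparr>carrier := P\<rparr> \<times>\<times> G\<lparr>carrier := D\<rparr>) (G\<lparr>carrier := torsion_part G\<rparr>)"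
    using PD_hom torsion_image unfolding hom_def by (auto simp: Pi_def image_iff)
  ultimately show ?thesis unfolding iso_def bij_betw_def using torsion_image by simp
qed

lemma torsion_normal: "torsion_part G \<lhd> G"
proof (rule normal_invI[OF torsion_subgroup])
  fix g h assume g: "g \<in> carrier G" and h: "h \<in> torsion_part G"
  obtain n :: nat where n: "n > 0" "h \<in> carrier G" "h [^] n = \<one>" using h torsion_iff by blast
  have "g \<otimes> h \<otimes> inv g = conj_by G (inv g) h" using g by (simp add: conj_by_def)
  then have "(g \<otimes> h \<otimes> inv g) [^] n = conj_by G (inv g) (h [^] n)" using conj_by_pow[of "inv g" h n] g n(2) by simp
  then have "(g \<otimes> h \<otimes> inv g) [^] n = \<one>" using n g by simp
  then show "g \<otimes> h \<otimes> inv g \<in> torsion_part G" unfolding torsion_iff using g n by blast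
qed

lemma P_torsion: "P \<subseteq> torsion_part G"
proof
  fix x assume x: "x \<in> P"
  then have "x = x \<otimes> \<one>" using P.mem_carrier by simp
  then show "x \<in> torsion_part G" unfolding torsion_decomp using x subgroup.one_closed[OF D_subgroup] by blast
qed

lemma D_internal: "internal_direct_product (G\<lparr>carrier := D\<rparr>) Qs Syl"
proof -
  have SD: "Syl q \<subseteq> D" if "q \<in> Qs" for q unfolding D using that by (auto intro!: generate.incl)
  have gen: "generate (G\<lparr>carrier := D\<rparr>) (\<Union>j\<in>I. Syl j) = generate G (\<Union>j\<in>I. Syl j)" if "I \<subseteq> Qs" for I
    by (rule generate_consistent[OF _ D_subgroup]) (use SD that in blast)
  have "Syl q \<lhd> G\<lparr>carrier := D\<rparr>" if q: "q \<in> Qs" for q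
  proof -
    have S: "subgroup (Syl q) (G\<lparr>carrier := D\<rparr>)"
      by (rule subgroup_incl[OF Syl_subgroup D_subgroup]) (use q SD in auto)
    interpret DG: comm_group "G\<lparr>carrier := D\<rparr>"
      by (rule group.group_comm_groupI[OF subgroup_imp_group[OF D_subgroup]]) (use D_props(1,2) in auto)
    show ?thesis using S by (rule DG.subgroup_imp_normal)
  qed
  moreover have "carrier (G\<lparr>carrier := D\<rparr>) = generate (G\<lparr>carrier := D\<rparr>) (\<Union>q\<in>Qs. Syl q)"
    using gen[of Qs] D by simp
  moreover have "Syl i \<inter> generate (G\<lparr>carrier := D\<rparr>) (\<Union>j\<in>Qs - {i}. Syl j) = {\<one>\<^bsub>G\<lparr>carrier := D\<rparr>\<^esub>}" if i: "i \<in> Qs" for i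
  proof -
    have "x = \<one>" if x: "x \<in> Syl i" "x \<in> generate G (\<Union>j\<in>Qs - {i}. Syl j)" for x
    proof -
      obtain n :: nat where n: "x \<in> carrier G" "x [^] (i ^ n) = \<one>" using Syl_elem[of i x] i x by blast
      obtain m :: nat where m: "coprime m i" "x [^] m = \<one>"
        using generate_Syl[of "Qs - {i}" i x] x(2) i by (auto simp: primes_coprime)
      have "coprime m (i ^ n)" using m(1) by simp
      then show ?thesis using pow_coprime_eq_one[OF n(1) m(2) n(2)] by blast
    qed
    moreover have "\<one> \<in> Syl i" using Syl_subgroup[of i] i by (simp add: subgroup.one_closed)
    moreover have "\<one> \<in> generate G (\<Union>j\<in>Qs - {i}. Syl j)" by (rule generate.one)
    ultimately have "Syl i \<inter> generate G (\<Union>j\<in>Qs - {i}. Syl j) = {\<one>}" by blast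
    moreover have "generate (G\<lparr>carrier := D\<rparr>) (\<Union>j\<in>Qs - {i}. Syl j) = generate G (\<Union>j\<in>Qs - {i}. Syl j)"
      by (rule gen) blast
    ultimately show ?thesis by simp
  qed
  ultimately show ?thesis unfolding internal_direct_product_def by blast
qed

subsection \<open>The quotients by \<open>P\<close> and by the torsion part\<close>

sublocale A: comm_group "G Mod P"
  by (rule quotient_comm_group[OF P_normal derived_subset_P])

lemma coset_eq_P: "y \<in> carrier G \<Longrightarrow> P #> y = P \<longleftrightarrow> y \<in> P"
  using coset_join1[OF _ _ P.subgroup_axioms] coset_join2[OF _ P.subgroup_axioms] by blast

lemma coset_pow: "y \<in> carrier G \<Longrightarrow> (P #> y) [^]\<^bsub>G Mod P\<^esub> (n::nat) = \<one>\<^bsub>G Mod P\<^esub> \<longleftrightarrow> y [^] n \<in> P"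
  using P.FactGroup_pow[of y n] coset_eq_P[of "y [^] n"] by simp

lemma A_no_p_torsion: "C \<in> carrier (G Mod P) \<Longrightarrow> C [^]\<^bsub>G Mod P\<^esub> p = \<one>\<^bsub>G Mod P\<^esub> \<Longrightarrow> C = \<one>\<^bsub>G Mod P\<^esub>"
proof -
  assume C: "C \<in> carrier (G Mod P)" "C [^]\<^bsub>G Mod P\<^esub> p = \<one>\<^bsub>G Mod P\<^esub>"
  obtain y where y: "y \<in> carrier G" "C = P #> y" using C(1) by (auto simp: carrier_FactGroup)
  have "y [^] p \<in> P" using coset_pow[OF y(1)] C(2) y(2) by blast
  then obtain n :: nat where "(y [^] p) [^] (p ^ n) = \<one>" unfolding P_eq by blast
  then have "y [^] (p ^ Suc n) = \<one>" using y(1) by (simp add: nat_pow_pow)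
  then have "y \<in> P" unfolding P_eq using y(1) by blast
  then show "C = \<one>\<^bsub>G Mod P\<^esub>" using y coset_eq_P by simp
qed

definition DP where "DP = (\<lambda>d. P #> d) ` D"

lemma DP_torsion: "DP = {C \<in> carrier (G Mod P). group.ord (G Mod P) C \<noteq> 0}"
proof
  have o: "A.ord C \<noteq> 0 \<longleftrightarrow> (\<exists>n>0. C [^]\<^bsub>G Mod P\<^esub> (n::nat) = \<one>\<^bsub>G Mod P\<^esub>)" if "C \<in> carrier (G Mod P)" for C
    using A.ord_eq_0[OF that] by auto
  show "DP \<subseteq> {C \<in> carrier (G Mod P). A.ord C \<noteq> 0}"
  proof
    fix C assume "C \<in> DP"
    then obtain d where d: "d \<in> D" "C = P #> d" unfolding DP_def by blast
    have dG: "d \<in> carrier G" using D_props(1)[OF d(1)] .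
    have C: "C \<in> carrier (G Mod P)" using d dG by (auto simp: carrier_FactGroup)
    obtain m :: nat where m: "m > 0" "d [^] m = \<one>" using D_props(3)[OF d(1)] by blast
    have "C [^]\<^bsub>G Mod P\<^esub> m = \<one>\<^bsub>G Mod P\<^esub>" using coset_pow[OF dG] m(2) d(2) P.one_closed by simp
    then show "C \<in> {C \<in> carrier (G Mod P). A.ord C \<noteq> 0}" using C o m(1) by blast
  qed
  show "{C \<in> carrier (G Mod P). A.ord C \<noteq> 0} \<subseteq> DP"
  proof
    fix C assume "C \<in> {C \<in> carrier (G Mod P). A.ord C \<noteq> 0}"
    then have C: "C \<in> carrier (G Mod P)" "A.ord C \<noteq> 0" by auto
    obtain y where y: "y \<in> carrier G" "C = P #> y" using C(1) by (auto simp: carrier_FactGroup)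
    obtain n :: nat where n: "n > 0" "C [^]\<^bsub>G Mod P\<^esub> n = \<one>\<^bsub>G Mod P\<^esub>" using C o by blast
    have "y [^] n \<in> P" using coset_pow[OF y(1)] n(2) y(2) by blast
    then obtain k :: nat where "(y [^] n) [^] (p ^ k) = \<one>" unfolding P_eq by blast
    then have "y [^] (n * p ^ k) = \<one>" using y(1) by (simp add: nat_pow_pow)
    moreover have "n * p ^ k > 0" using n(1) prime prime_gt_0_nat by simp
    ultimately have "y \<in> torsion_part G" using torsion_iff y(1) by blast
    then obtain z d where zd: "z \<in> P" "d \<in> D" "y = z \<otimes> d" using torsion_decomp by blast
    have "P #> y = P #> z #> d"
      unfolding zd(3) using P.subset P.mem_carrier[OF zd(1)] D_props(1)[OF zd(2)] by (simp add: coset_mult_assoc)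
    also have "P #> z = P" using coset_eq_P[OF P.mem_carrier[OF zd(1)]] zd(1) by simp
    finally have "C = P #> d" using y(2) by simp
    then show "C \<in> DP" unfolding DP_def using zd(2) by blast
  qed
qed

text \<open>An element of \<open>G/P\<close> has either infinite or finite order, and in the
  second case it lies in the image of \<open>D\<close>.\<close>

lemma M_carrier: "generate (G Mod P) (DP \<union> {x \<in> carrier (G Mod P). group.ord (G Mod P) x = 0}) = carrier (G Mod P)"
proof -
  have "DP \<union> {x \<in> carrier (G Mod P). A.ord x = 0} = carrier (G Mod P)" unfolding DP_torsion by auto
  then show ?thesis
    using A.generate_incl[of "carrier (G Mod P)"] generate.incl[of _ "carrier (G Mod P)" "G Mod P"] by auto
qed

lemma D_iso_DP: "(\<lambda>d. P #> d) \<in> iso (G\<lparr>carrier := D\<rparr>) ((G Mod P)\<lparr>carrier := DP\<rparr>)"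
proof -
  have "inj_on (\<lambda>d. P #> d) D"
  proof (rule inj_onI)
    fix d e assume de: "d \<in> D" "e \<in> D" "P #> d = P #> e"
    note G = D_props(1)[OF de(1)] D_props(1)[OF de(2)]
    have "d \<in> P #> e" using de(3) rcos_self[OF G(1) P.subgroup_axioms] by simp
    then have "d \<otimes> inv e \<in> P" using P.rcos_module_imp[OF is_group G(2)] by blast
    moreover have "d \<otimes> inv e \<in> D" using de D_subgroup by (simp add: subgroup.m_closed subgroup.m_inv_closed)
    ultimately have "d \<otimes> inv e = \<one>" by (rule P_D_trivial)
    moreover have "d = (d \<otimes> inv e) \<otimes> e" using G by (simp add: m_assoc)
    ultimately show "d = e" using G by simp
  qed
  moreover have "(\<lambda>d. P #> d) \<in> hom (G\<lparr>carrier := D\<rparr>) ((G Mod P)\<lparr>carrier := DP\<rparr>)"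
    by (rule homI) (use D_props(1) P.rcos_sum in \<open>auto simp: DP_def\<close>)
  ultimately show ?thesis by (simp add: iso_def bij_betw_def DP_def)
qed

lemma DP_subgroup: "subgroup DP (G Mod P)"
proof -
  interpret h: group_hom G "G Mod P" "(#>) P" by unfold_locales (rule P.r_coset_hom_Mod)
  show ?thesis unfolding DP_def by (rule h.subgroup_img_is_subgroup[OF D_subgroup])
qed

lemma DP_central: "central_subgroup DP (G Mod P)"
  unfolding central_subgroup_def using DP_subgroup A.m_comm subgroup.mem_carrier[OF DP_subgroup] by blast

sublocale L: comm_group "G Mod torsion_part G"
  by (rule quotient_comm_group[OF torsion_normal]) (use derived_subset_P P_torsion in blast)

sublocale t: normal "torsion_part G" G by (rule torsion_normal)

lemma coset_eq_t: "y \<in> carrier G \<Longrightarrow> torsion_part G #> y = torsion_part G \<longleftrightarrow> y \<in> torsion_part G"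
  using coset_join1[OF _ _ t.subgroup_axioms] coset_join2[OF _ t.subgroup_axioms] by blast

lemma L_torsion_free:
  assumes C: "C \<in> carrier (G Mod torsion_part G)" "(n::nat) > 0" "C [^]\<^bsub>G Mod torsion_part G\<^esub> n = \<one>\<^bsub>G Mod torsion_part G\<^esub>"
  shows "C = \<one>\<^bsub>G Mod torsion_part G\<^esub>"
proof -
  obtain y where y: "y \<in> carrier G" "C = torsion_part G #> y" using C(1) by (auto simp: carrier_FactGroup)
  have "y [^] n \<in> torsion_part G"
    using C(3) y t.FactGroup_pow[OF y(1), of n] coset_eq_t[of "y [^] n"] by simp
  then obtain m :: nat where m: "m > 0" "(y [^] n) [^] m = \<one>" using torsion_iff by blast
  then have "y [^] (n * m) = \<one>" "n * m > 0" using y(1) C(2) by (simp_all add: nat_pow_pow)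
  then have "y \<in> torsion_part G" using torsion_iff y(1) by blast
  then show ?thesis using y coset_eq_t by simp
qed

lemma L_torsion_free_group: "torsion_free_group (G Mod torsion_part G)"
proof -
  have "C = \<one>\<^bsub>G Mod torsion_part G\<^esub>" if "C \<in> carrier (G Mod torsion_part G)" "L.ord C \<noteq> 0" for C
    using L_torsion_free[OF that(1), of "L.ord C"] that by simp
  then have "torsion_part (G Mod torsion_part G) = {\<one>\<^bsub>G Mod torsion_part G\<^esub>}"
    using L.ord_id L.one_closed unfolding torsion_part_def[of "G Mod torsion_part G"] by auto
  then show ?thesis unfolding torsion_free_group_def using L.is_group by blast
qed

lemma quotient_hom:
  "\<exists>\<rho>\<in>hom (G Mod P) (G Mod torsion_part G). (\<forall>x\<in>carrier G. \<rho> (P #> x) = torsion_part G #> x)"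
proof -
  have "torsion_part G #> x = torsion_part G #> y"
    if xy: "x \<in> carrier G" "y \<in> carrier G" "P #> x = P #> y" for x y
  proof -
    have "x \<in> P #> y" using xy rcos_self[OF xy(1) P.subgroup_axioms] by simp
    then have "x \<in> torsion_part G #> y" using P_torsion by (auto simp: r_coset_def)
    then show ?thesis using repr_independence[OF _ xy(2) t.subgroup_axioms] by simp
  qed
  then show ?thesis using FactGroup_universal[OF t.r_coset_hom_Mod P_normal] by metis
qed

lemma quotient_hom_kernel:
  assumes "\<rho> \<in> hom (G Mod P) (G Mod torsion_part G)" "\<And>x. x \<in> carrier G \<Longrightarrow> \<rho> (P #> x) = torsion_part G #> x"
  shows "kernel (G Mod P) (G Mod torsion_part G) \<rho> = DP" "\<rho> ` carrier (G Mod P) = carrier (G Mod torsion_part G)"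
proof -
  show "\<rho> ` carrier (G Mod P) = carrier (G Mod torsion_part G)"
    using assms(2) by (auto simp: carrier_FactGroup image_iff)
  interpret \<rho>: group_hom "G Mod P" "G Mod torsion_part G" \<rho> by unfold_locales (rule assms(1))
  show "kernel (G Mod P) (G Mod torsion_part G) \<rho> = DP"
  proof
    show "DP \<subseteq> kernel (G Mod P) (G Mod torsion_part G) \<rho>"
    proof
      fix C assume "C \<in> DP"
      then have C: "C \<in> carrier (G Mod P)" "A.ord C \<noteq> 0" unfolding DP_torsion by auto
      have "\<rho> C [^]\<^bsub>G Mod torsion_part G\<^esub> A.ord C = \<rho> (C [^]\<^bsub>G Mod P\<^esub> A.ord C)"
        using \<rho>.hom_nat_pow[OF C(1)] by simp
      also have "\<dots> = \<one>\<^bsub>G Mod torsion_part G\<^esub>" using A.pow_ord_eq_1[OF C(1)] \<rho>.hom_one by simp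
      finally have "\<rho> C = \<one>\<^bsub>G Mod torsion_part G\<^esub>"
        using L_torsion_free[of "\<rho> C" "A.ord C"] C \<rho>.hom_closed by simp
      then show "C \<in> kernel (G Mod P) (G Mod torsion_part G) \<rho>" using C(1) by (simp add: kernel_def)
    qed
    show "kernel (G Mod P) (G Mod torsion_part G) \<rho> \<subseteq> DP"
    proof
      fix C assume C: "C \<in> kernel (G Mod P) (G Mod torsion_part G) \<rho>"
      then obtain x where x: "x \<in> carrier G" "C = P #> x" by (auto simp: kernel_def carrier_FactGroup)
      have "torsion_part G #> x = torsion_part G" using C x assms(2) by (simp add: kernel_def)
      then have "x \<in> torsion_part G" using coset_eq_t x by blast
      then obtain n :: nat where n: "n > 0" "x [^] n = \<one>" using torsion_iff by blast
      have CA: "C \<in> carrier (G Mod P)" using C by (simp add: kernel_def)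
      have "C [^]\<^bsub>G Mod P\<^esub> n = \<one>\<^bsub>G Mod P\<^esub>" using coset_pow[OF x(1)] n(2) x(2) P.one_closed by simp
      then have "A.ord C \<noteq> 0" using A.ord_eq_0[OF CA] n(1) by auto
      then show "C \<in> DP" unfolding DP_torsion using CA by blast
    qed
  qed
qed

lemma finite_invariant:
  assumes "finite S" "S \<subseteq> carrier G" "finite K" "K \<subseteq> P"
  shows "\<exists>N. subgroup N G \<and> finite N \<and> K \<subseteq> N \<and> N \<subseteq> P \<and> (\<forall>s\<in>S. \<forall>n\<in>N. conj_by G s n \<in> N)"
proof (rule engel_finite_invariant_subgroup[OF engel derived_sub left_comm_in_derived _ P.subgroup_axioms derived_subset_P _ assms])
  fix B assume B: "finite B" "B \<subseteq> derived G (carrier G)"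
  then show "finite (generate G B)"
    using derived_lf generate_consistent[OF B(2) derived_sub] unfolding locally_finite_group_def by auto
next
  fix x assume "x \<in> P"
  then obtain n :: nat where "x [^] (p ^ n) = \<one>" unfolding P_eq by blast
  moreover have "p ^ n > 0" using prime prime_gt_0_nat by simp
  ultimately show "\<exists>r>0. x [^] (r::nat) = \<one>" by blast
qed

end

section \<open>Normalized units when the unit group is Engel\<close>

lemma (in group) derived_subset_kernel:
  assumes "group_hom G H h" "comm_group H" shows "derived G (carrier G) \<subseteq> kernel G H h"
proof -
  interpret h: group_hom G H h by fact
  interpret H: comm_group H by fact
  have "derived_set G (carrier G) \<subseteq> kernel G H h"
  proof (clarify)
    fix x y assume xy: "x \<in> carrier G" "y \<in> carrier G"
    have c: "h x \<in> carrier H" "h y \<in> carrier H" using xy by auto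
    have "h (x \<otimes> y \<otimes> inv x \<otimes> inv y) = h x \<otimes>\<^bsub>H\<^esub> h y \<otimes>\<^bsub>H\<^esub> inv\<^bsub>H\<^esub> (h x) \<otimes>\<^bsub>H\<^esub> inv\<^bsub>H\<^esub> (h y)"
      using xy by simp
    also have "\<dots> = h y \<otimes>\<^bsub>H\<^esub> h x \<otimes>\<^bsub>H\<^esub> inv\<^bsub>H\<^esub> (h x) \<otimes>\<^bsub>H\<^esub> inv\<^bsub>H\<^esub> (h y)"
      using H.m_comm[OF c] by simp
    also have "\<dots> = \<one>\<^bsub>H\<^esub>" using c by (simp add: h.H.m_assoc)
    finally show "x \<otimes> y \<otimes> inv x \<otimes> inv y \<in> kernel G H h" using xy by (simp add: kernel_def)
  qed
  then show ?thesis unfolding derived_def by (rule generate_subgroup_incl[OF _ h.subgroup_kernel])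
qed

locale engel_units = ga_char F G p + E: engel_setting G p Syl P D
  for F :: "('f, 'a) ring_scheme" and G :: "('g, 'b) monoid_scheme" and p Syl P D
begin

abbreviation VA where "VA \<equiv> normalized_units F (G Mod P)"
abbreviation VL where "VL \<equiv> G Mod torsion_part G"

lemma derived_normal: "derived G (carrier G) \<lhd> G"
  by (rule G.derived_is_normal[OF G.normal_self])

lemma nil_P: "a \<in> aug_ideal F G P \<Longrightarrow> \<exists>n::nat. a [^]\<^bsub>R\<^esub> n = \<zero>\<^bsub>R\<^esub>"
  by (rule aug_ideal_nil[OF E.P_normal _ E.finite_invariant]) (use E.P_eq in blast)

lemma nil_derived: "a \<in> aug_ideal F G (derived G (carrier G)) \<Longrightarrow> \<exists>n::nat. a [^]\<^bsub>R\<^esub> n = \<zero>\<^bsub>R\<^esub>"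
  using nil_P aug_ideal_mono[OF E.derived_subset_P] by blast

lemma ga_char_quotient: "N \<lhd> G \<Longrightarrow> ga_char F (G Mod N) p"
proof -
  assume "N \<lhd> G"
  then interpret Q: ga_pair F G "G Mod N" by (rule cosets_ga_pair)
  show ?thesis by unfold_locales (rule prime, rule char)
qed

sublocale A: ga_char F "G Mod P" p by (rule ga_char_quotient[OF E.P_normal])

lemma quotient_V_hom: "N \<lhd> G \<Longrightarrow> group_hom V (normalized_units F (G Mod N)) (ga_map F (r_coset G N))"
proof -
  assume N: "N \<lhd> G"
  interpret N: normal N G by fact
  interpret Q: ga_pair F G "G Mod N" by (rule cosets_ga_pair[OF N])
  show ?thesis using Q.ga_map_V_hom[OF N.r_coset_hom_Mod] by unfold_locales
qed

lemma derived_units: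
  "derived V (carrier V) \<subseteq> one_plus R (aug_ideal F G (derived G (carrier G)))"
  "subgroup (one_plus R (aug_ideal F G (derived G (carrier G)))) V"
proof -
  let ?N = "derived G (carrier G)"
  have K: "one_plus R (aug_ideal F G ?N) = kernel V (normalized_units F (G Mod ?N)) (ga_map F (r_coset G ?N))"
    by (rule nil_quotient_units(1)[OF derived_normal nil_derived])
  interpret h: group_hom V "normalized_units F (G Mod ?N)" "ga_map F (r_coset G ?N)"
    by (rule quotient_V_hom[OF derived_normal])
  interpret B: ga_char F "G Mod ?N" p by (rule ga_char_quotient[OF derived_normal])
  have "comm_group (normalized_units F (G Mod ?N))"
    by (rule B.V_comm_group[OF G.quotient_comm_group[OF derived_normal subset_refl]])
  then show "derived V (carrier V) \<subseteq> one_plus R (aug_ideal F G ?N)"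
    unfolding K by (rule V.derived_subset_kernel[OF h.group_hom_axioms])
  show "subgroup (one_plus R (aug_ideal F G ?N)) V" unfolding K by (rule h.subgroup_kernel)
qed

lemma one_plus_P: "one_plus R (aug_ideal F G P) = kernel V VA (ga_map F (r_coset G P))"
  by (rule nil_quotient_units(1)[OF E.P_normal nil_P])

sublocale q: group_hom V VA "ga_map F (r_coset G P)"
  by (rule quotient_V_hom[OF E.P_normal])

text \<open>The image of a \<open>p\<close>-element in \<open>V(F(G/P))\<close> is trivial,
  because \<open>G/P\<close> is abelian without \<open>p\<close>-torsion.\<close>

lemma one_plus_P_eq: "one_plus R (aug_ideal F G P) = {u \<in> carrier V. \<exists>n::nat. u [^]\<^bsub>V\<^esub> (p ^ n) = \<one>\<^bsub>V\<^esub>}"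
proof
  show "one_plus R (aug_ideal F G P) \<subseteq> {u \<in> carrier V. \<exists>n::nat. u [^]\<^bsub>V\<^esub> (p ^ n) = \<one>\<^bsub>V\<^esub>}"
    using nil_quotient_units(3)[OF E.P_normal nil_P] unfolding one_plus_P by (auto simp: kernel_def)
  show "{u \<in> carrier V. \<exists>n::nat. u [^]\<^bsub>V\<^esub> (p ^ n) = \<one>\<^bsub>V\<^esub>} \<subseteq> one_plus R (aug_ideal F G P)"
  proof clarify
    fix u and n :: nat assume u: "u \<in> carrier V" "u [^]\<^bsub>V\<^esub> (p ^ n) = \<one>\<^bsub>V\<^esub>"
    let ?w = "ga_map F (r_coset G P) u"
    have w: "?w \<in> carrier VA" by (rule q.hom_closed[OF u(1)])
    have wn: "?w [^]\<^bsub>VA\<^esub> (p ^ n) = \<one>\<^bsub>VA\<^esub>"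
      using q.hom_nat_pow[OF u(1), of "p ^ n"] q.hom_one unfolding u(2) by simp
    have "?w = \<one>\<^bsub>VA\<^esub>"
      by (rule A.p_unit_trivial[OF E.A.comm_group_axioms _ w wn]) (rule E.A_no_p_torsion)
    then show "u \<in> one_plus R (aug_ideal F G P)" unfolding one_plus_P kernel_def using u(1) by blast
  qed
qed

lemma sylow_units: "sylow_subgroup p V Q \<longleftrightarrow> Q = one_plus R (aug_ideal F G P)"
  by (rule V.sylow_subgroup_iff_eq[OF prime _ one_plus_P_eq]) (unfold one_plus_P, rule q.subgroup_kernel)

lemma quotient_units:
  "one_plus R (aug_ideal F G P) \<lhd> V" "V Mod one_plus R (aug_ideal F G P) \<cong> VA"
  unfolding one_plus_P
  by (rule q.normal_kernel, rule q.FactGroup_iso, rule nil_quotient_units(2)[OF E.P_normal nil_P])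

lemma graded:
  "\<exists>\<rho>. ga_graded F (G Mod P) p VL \<rho> \<and> kernel (G Mod P) VL \<rho> = E.DP \<and> \<rho> ` carrier (G Mod P) = carrier VL"
proof -
  obtain \<rho> where \<rho>: "\<rho> \<in> hom (G Mod P) VL" "\<And>x. x \<in> carrier G \<Longrightarrow> \<rho> (P #>\<^bsub>G\<^esub> x) = torsion_part G #>\<^bsub>G\<^esub> x"
    using E.quotient_hom by blast
  have "ga_graded F (G Mod P) p VL \<rho>"
    by unfold_locales (rule \<rho>(1), erule (2) E.L_torsion_free, erule (1) E.A_no_p_torsion)
  then show ?thesis using E.quotient_hom_kernel[OF \<rho>] by blast
qed

lemma DP_units:
  "carrier (normalized_units F ((G Mod P)\<lparr>carrier := E.DP\<rparr>)) \<lhd> VA"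
  "torsion_free_group (VA Mod carrier (normalized_units F ((G Mod P)\<lparr>carrier := E.DP\<rparr>)))"
proof -
  obtain \<rho> where \<rho>: "ga_graded F (G Mod P) p VL \<rho>" "kernel (G Mod P) VL \<rho> = E.DP" using graded by blast
  interpret g: ga_graded F "G Mod P" p VL \<rho> by (rule \<rho>(1))
  have T: "g.T = E.DP" unfolding g.T_def by (rule \<rho>(2))
  show "carrier (normalized_units F ((G Mod P)\<lparr>carrier := E.DP\<rparr>)) \<lhd> VA" using g.VT_normal unfolding T .
  show "torsion_free_group (VA Mod carrier (normalized_units F ((G Mod P)\<lparr>carrier := E.DP\<rparr>)))"
    using g.quotient_torsion_free unfolding T .
qed

abbreviation GD where "GD \<equiv> G\<lparr>carrier := D\<rparr>"
abbreviation AD where "AD \<equiv> (G Mod P)\<lparr>carrier := E.DP\<rparr>"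

lemma GD_comm: "comm_group GD"
  by (rule group.group_comm_groupI[OF G.subgroup_imp_group[OF E.D_subgroup]]) (use E.D_props(1,2) in auto)

sublocale GD: ga_pair F GD AD
proof -
  interpret GD: comm_group GD by (rule GD_comm)
  interpret AD: group AD by (rule E.A.subgroup_imp_group[OF E.DP_subgroup])
  show "ga_pair F GD AD" by unfold_locales
qed

sublocale GDc: ga_char F GD p by unfold_locales (rule prime, rule char)

text \<open>The group \<open>D\<close> has no \<open>p\<close>-torsion, as it meets
  \<open>P\<close> trivially.\<close>

lemma D_algebra_semisimple: "finite D \<Longrightarrow> \<exists>n. direct_sum_of_fields (group_algebra F GD) n"
proof -
  assume fin: "finite D"
  have "x = \<one>\<^bsub>GD\<^esub>" if x: "x \<in> carrier GD" "x [^]\<^bsub>GD\<^esub> p = \<one>\<^bsub>GD\<^esub>" for x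
  proof -
    have "x [^]\<^bsub>G\<^esub> (p ^ 1) = \<one>\<^bsub>G\<^esub>" using x(2) by (simp add: nat_pow_def)
    moreover have xD: "x \<in> D" using x(1) by simp
    ultimately have "x \<in> P" unfolding E.P_eq using E.D_props(1) by blast
    then show ?thesis using E.P_D_trivial xD by simp
  qed
  then obtain n e where e: "field_idempotents (group_algebra F GD) n e"
    using GDc.field_idempotents_exist[OF GD_comm] fin by auto
  interpret CD: cring "group_algebra F GD" by (rule GD.cring_if_comm[OF GD_comm])
  show ?thesis using CD.idempotents_imp_direct_sum_of_fields[OF e] by blast
qed

text \<open>The number \<open>n\<close> is an arbitrary one for which \<open>FD\<close> is a sum
  of \<open>n\<close> fields. The idempotents of the given decomposition are carried over to the
  image of \<open>D\<close> in \<open>G/P\<close>, so that the factor count matches.\<close>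

lemma units_decomposition:
  assumes fin: "finite D" and n: "direct_sum_of_fields (group_algebra F GD) n"
  shows "VA \<cong> normalized_units F GD \<times>\<times> product_group {..<n} (\<lambda>_. VL)"
proof -
  obtain \<rho> where \<rho>: "ga_graded F (G Mod P) p VL \<rho>" "kernel (G Mod P) VL \<rho> = E.DP"
    "\<rho> ` carrier (G Mod P) = carrier VL" using graded by blast
  interpret g: ga_graded F "G Mod P" p VL \<rho> by (rule \<rho>(1))
  have T: "g.T = E.DP" unfolding g.T_def by (rule \<rho>(2))
  note D_iso = E.D_iso_DP
  let ?\<psi> = "inv_into (carrier GD) (\<lambda>d. P #>\<^bsub>G\<^esub> d)"
  have \<psi>: "?\<psi> \<in> iso AD GD" by (rule GD.G.iso_set_sym[OF D_iso])
  interpret DG: ga_pair F AD GD by unfold_locales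
  obtain e where e: "field_idempotents (group_algebra F GD) n e"
    using direct_sum_of_fields_imp_idempotents[OF GD.ring_R n] by blast
  let ?f = "\<lambda>i. ga_map F (\<lambda>d. P #>\<^bsub>G\<^esub> d) (e i)"
  have cosets: "(\<lambda>d. P #>\<^bsub>G\<^esub> d) \<in> carrier GD \<rightarrow> carrier AD" using D_iso by (simp add: iso_def hom_def)
  have inv: "?\<psi> (P #>\<^bsub>G\<^esub> d) = d" if "d \<in> carrier GD" for d
    using bij_betw_inv_into_left[OF _ that] D_iso by (auto simp: iso_def)
  have "field_idempotents (group_algebra F AD) n ?f"
  proof (rule field_idempotents_transfer[OF GD.ring_R GD.H.ring_R DG.ga_map_iso(1)[OF \<psi>] e])
    fix i assume "i < n"
    then have ei: "e i \<in> carrier (group_algebra F GD)" using e unfolding field_idempotents_def by blast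
    show "?f i \<in> carrier (group_algebra F AD) \<and> ga_map F ?\<psi> (?f i) = e i"
      using GD.ga_map_closed[OF ei cosets] GD.ga_map_inverse[OF cosets inv ei] by blast
  qed
  then have fT: "field_idempotents g.RT n ?f" unfolding T .
  have "E.DP = {C \<in> carrier (G Mod P). group.ord (G Mod P) C \<noteq> 0}" by (rule E.DP_torsion)
  moreover have "finite E.DP" unfolding E.DP_def using fin by simp
  ultimately obtain s where s: "s \<in> hom VL (G Mod P)" "\<And>l. l \<in> carrier VL \<Longrightarrow> \<rho> (s l) = l"
    using E.A.torsion_quotient_section[OF g.\<rho>.group_hom_axioms \<rho>(3)] \<rho>(2) by auto
  have "normalized_units F AD \<times>\<times> product_group {..<n} (\<lambda>_. VL) \<cong> VA"
    using g.units_iso_direct_product[OF s fT] unfolding T by (rule is_isoI)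
  moreover have "normalized_units F GD \<cong> normalized_units F AD"
    by (rule is_isoI[OF GD.ga_map_iso(2)[OF D_iso]])
  then have "normalized_units F GD \<times>\<times> product_group {..<n} (\<lambda>_. VL)
      \<cong> normalized_units F AD \<times>\<times> product_group {..<n} (\<lambda>_. VL)"
    by (rule GD.V.DirProd_iso_trans[OF _ iso_refl])
  ultimately have "normalized_units F GD \<times>\<times> product_group {..<n} (\<lambda>_. VL) \<cong> VA" by (rule iso_trans[rotated])
  moreover have "group (normalized_units F GD \<times>\<times> product_group {..<n} (\<lambda>_. VL))"
    by (rule DirProd_group[OF GD.V.is_group product_group]) (rule E.L.is_group)
  ultimately show ?thesis by (metis group.iso_sym)
qed

end

theorem theorem2:
  fixes F :: "('f, 'a) ring_scheme"
    and G :: "('g, 'b) monoid_scheme"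
    and p :: nat
    and Syl :: "nat \<Rightarrow> 'g set"
    and P D :: "'g set"
    and DP M :: "'g set set"
    and V :: "('g \<Rightarrow> 'f) monoid"
  assumes p: "Factorial_Ring.prime p"
    and F: "field F" "ring_char F = p"
    and G: "group G"
    and G': "locally_finite_group (G\<lparr>carrier := derived G (carrier G)\<rparr>)"
            "primary_group p (G\<lparr>carrier := derived G (carrier G)\<rparr>)"
    and Syl: "\<And>q. Factorial_Ring.prime q \<Longrightarrow> sylow_subgroup q G (Syl q)"
    and P: "P = Syl p" "P \<lhd> G"
    and D: "D = generate G (\<Union>q\<in>{q. Factorial_Ring.prime q \<and> q \<noteq> p}. Syl q)"
    and DP: "DP = (\<lambda>d. P #>\<^bsub>G\<^esub> d) ` D"
    and M: "M = generate (G Mod P)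
                  (DP \<union> {x \<in> carrier (G Mod P). group.ord (G Mod P) x = 0})"
    and V: "V = normalized_units F G"
    and engel: "engel_group V"
  shows
    "(derived V (carrier V) \<subseteq> one_plus (group_algebra F G) (aug_ideal F G (derived G (carrier G)))
      \<and> subgroup (one_plus (group_algebra F G) (aug_ideal F G (derived G (carrier G)))) V
      \<and> (\<forall>Q. sylow_subgroup p V Q \<longleftrightarrow> Q = one_plus (group_algebra F G) (aug_ideal F G P)))
   \<and> (\<forall>q. Factorial_Ring.prime q \<and> q \<noteq> p \<longrightarrow> central_subgroup (Syl q) G)
   \<and> (subgroup (torsion_part G) G
      \<and> subgroup D G
      \<and> internal_direct_product (G\<lparr>carrier := D\<rparr>) {q. Factorial_Ring.prime q \<and> q \<noteq> p} Syl
      \<and> (\<lambda>(x, d). x \<otimes>\<^bsub>G\<^esub> d)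
          \<in> iso (G\<lparr>carrier := P\<rparr> \<times>\<times> G\<lparr>carrier := D\<rparr>) (G\<lparr>carrier := torsion_part G\<rparr>))
   \<and> (central_subgroup DP (G Mod P)
      \<and> (\<lambda>d. P #>\<^bsub>G\<^esub> d) \<in> iso (G\<lparr>carrier := D\<rparr>) ((G Mod P)\<lparr>carrier := DP\<rparr>)
      \<and> one_plus (group_algebra F G) (aug_ideal F G P) \<lhd> V
      \<and> V Mod one_plus (group_algebra F G) (aug_ideal F G P)
          \<cong> normalized_units F ((G Mod P)\<lparr>carrier := M\<rparr>)
      \<and> carrier (normalized_units F ((G Mod P)\<lparr>carrier := DP\<rparr>))
          \<lhd> normalized_units F ((G Mod P)\<lparr>carrier := M\<rparr>)
      \<and> torsion_free_group
          (normalized_units F ((G Mod P)\<lparr>carrier := M\<rparr>)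
             Mod carrier (normalized_units F ((G Mod P)\<lparr>carrier := DP\<rparr>))))
   \<and> (torsion_part G \<lhd> G
      \<and> comm_group (G Mod torsion_part G)
      \<and> torsion_free_group (G Mod torsion_part G)
      \<and> (finite D \<longrightarrow>
          (\<exists>n. direct_sum_of_fields (group_algebra F (G\<lparr>carrier := D\<rparr>)) n)
          \<and> (\<forall>n. direct_sum_of_fields (group_algebra F (G\<lparr>carrier := D\<rparr>)) n \<longrightarrow>
               normalized_units F ((G Mod P)\<lparr>carrier := M\<rparr>)
                 \<cong> normalized_units F (G\<lparr>carrier := D\<rparr>)
                     \<times>\<times> product_group {..<n} (\<lambda>_. G Mod torsion_part G))))"
proof -
  interpret F: field F by (rule F(1))
  interpret ga F G by (intro ga.intro F.cring_axioms G)
  have engel_G: "engel_group G"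
    using engel_units_imp_engel engel F.zero_not_one unfolding V by metis
  interpret engel_units F G p Syl P D
    by (intro engel_units.intro ga_char.intro ga_char_axioms.intro engel_setting.intro engel_setting_axioms.intro
        ga_axioms F G p G' Syl P D engel_G)
  have DP': "DP = E.DP" unfolding DP E.DP_def ..
  have "M = carrier (G Mod P)" unfolding M DP' by (rule E.M_carrier)
  then have M': "(G Mod P)\<lparr>carrier := M\<rparr> = G Mod P" by simp
  show ?thesis
    unfolding M' V DP'
  proof (intro conjI)
    show "\<forall>Q. sylow_subgroup p (normalized_units F G) Q \<longleftrightarrow> Q = one_plus R (aug_ideal F G P)"
      by (rule allI) (rule sylow_units)
    show "\<forall>q. Factorial_Ring.prime q \<and> q \<noteq> p \<longrightarrow> central_subgroup (Syl q) G"
      using E.Syl_central by blast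
    show "finite D \<longrightarrow> (\<exists>n. direct_sum_of_fields (group_algebra F GD) n)
        \<and> (\<forall>n. direct_sum_of_fields (group_algebra F GD) n \<longrightarrow>
              VA \<cong> normalized_units F GD \<times>\<times> product_group {..<n} (\<lambda>_. VL))"
      using D_algebra_semisimple units_decomposition by blast
  qed (rule derived_units E.torsion_subgroup E.D_subgroup E.D_internal E.torsion_iso E.DP_central
      E.D_iso_DP quotient_units DP_units E.torsion_normal E.L.comm_group_axioms E.L_torsion_free_group)+
qed

end
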